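(* Let $\omega$ be a real number. (i) If for every $\eta>0$ one can multiply $n$-by-$n$ matrices in $O(n^{\omega+\eta})$ arithmetic operations, then for every $\eta>0$ one can invert $n$-by-$n$ matrices stably in $O(n^{\omega+\eta})$ bit operations. (ii) Conversely, if for every $\eta>0$ one can invert $n$-by-$n$ matrices stably in $O(n^{\omega+\eta})$ bit operations, then for every $\eta>0$ one can multiply $n$-by-$n$ matrices stably in $O(n^{\omega+\eta})$ bit operations. (iii) Likewise, if for every $\eta>0$ one can invert $n$-by-$n$ matrices exactly in $O(n^{\omega+\eta})$ arithmetic operations, then for every $\eta>0$ one can multiply $n$-by-$n$ matrices exactly in $O(n^{\omega+\eta})$ arithmetic operations.
   Context: Floating point arithmetic with machine epsilon $\varepsilon$ (a bound on the roundoff error, $b=\log_2(1/\varepsilon)$ bits of precision) is used; one arithmetic operation at $b$ bits costs at most $O(b^2)$ bit operations. Factors depending on the number of bits that a conventional backward stable algorithm would need for the same target relative error are not counted in the exponent of $n$; only the growth with $n$ is. Stable multiplication: an algorithm for $C=A\cdot B$ is stable if its computed result satisfies $\|C_{comp}-C\|\le \mu(n)\,\varepsilon\,\|A\|\,\|B\|+O(\varepsilon^2)$, where $\mu(n)=O(n^c)$ for a constant $c$. Stable inversion: the computed inverse achieves the same normwise forward error bound as a backward stable algorithm would at the target precision $\varepsilon$, i.e. $\|X_{comp}-A^{-1}\|/\|A^{-1}\| = O(\varepsilon)\kappa(A)+O(\varepsilon^2)$ with $\kappa(A)=\|A\|\,\|A^{-1}\|$, where $O(\cdot)$ may hide a factor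 polynomial in $n$. The algorithm may internally use more bits of precision than the target, and the cost of this extra precision is included in the count of bit operations. *)

theory Defs
  imports "Jordan_Normal_Form.Matrix" "HOL-Library.Landau_Symbols"
begin

section \<open>Exact algorithms: algebraic computation trees\<close>

text \<open>
  An algorithm for matrices of a given order is an algebraic computation tree over the reals.
  The memory is the list of the inputs followed by the results computed so far; \<open>Cell i\<close> is its
  \<open>i\<close>-th entry.  A run that reads a non-existing cell or divides by zero has no result.
\<close>

datatype operand = Cell nat | Const real

datatype arith_op = Plus | Minus | Times | Divide

datatype arith_alg =
    Return "operand list"
  | Compute arith_op operand operand arith_alg
  | If_le operand operand arith_alg arith_alg

fun read :: "real list \<Rightarrow> operand \<Rightarrow> real option" where
  "read m (Cell i) = (if i < length m then Some (m ! i) else None)"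
| "read m (Const r) = Some r"

fun apply_op :: "arith_op \<Rightarrow> real \<Rightarrow> real \<Rightarrow> real option" where
  "apply_op Plus x y = Some (x + y)"
| "apply_op Minus x y = Some (x - y)"
| "apply_op Times x y = Some (x * y)"
| "apply_op Divide x y = (if y = 0 then None else Some (x / y))"

fun run_arith :: "arith_alg \<Rightarrow> real list \<Rightarrow> real list option" where
  "run_arith (Return us) m = those (map (read m) us)"
| "run_arith (Compute f u v T) m =
     (case (read m u, read m v) of
        (Some x, Some y) \<Rightarrow>
          (case apply_op f x y of Some z \<Rightarrow> run_arith T (m @ [z]) | None \<Rightarrow> None)
      | _ \<Rightarrow> None)"
| "run_arith (If_le u v T1 T2) m =
     (case (read m u, read m v) of
        (Some x, Some y) \<Rightarrow> if x \<le> y then run_arith T1 m else run_arith T2 m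
      | _ \<Rightarrow> None)"

text \<open>Worst-case number of operations along a run; a comparison counts as one operation.\<close>

fun arith_ops :: "arith_alg \<Rightarrow> nat" where
  "arith_ops (Return us) = 0"
| "arith_ops (Compute f u v T) = Suc (arith_ops T)"
| "arith_ops (If_le u v T1 T2) = Suc (max (arith_ops T1) (arith_ops T2))"

definition entries :: "real mat \<Rightarrow> real list" where
  "entries A = concat (mat_to_list A)"

definition multiplies_exactly :: "nat \<Rightarrow> arith_alg \<Rightarrow> bool" where
  "multiplies_exactly n T \<longleftrightarrow>
     (\<forall>A \<in> carrier_mat n n. \<forall>B \<in> carrier_mat n n.
        run_arith T (entries A @ entries B) = Some (entries (A * B)))"

definition is_inverse :: "real mat \<Rightarrow> real mat \<Rightarrow> bool" where
  "is_inverse A X \<longleftrightarrow> inverts_mat A X \<and> inverts_mat X A"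

definition inverts_exactly :: "nat \<Rightarrow> arith_alg \<Rightarrow> bool" where
  "inverts_exactly n T \<longleftrightarrow>
     (\<forall>A \<in> carrier_mat n n. \<forall>X \<in> carrier_mat n n.
        is_inverse A X \<longrightarrow> run_arith T (entries A) = Some (entries X))"

definition exact_multiplication_in :: "real \<Rightarrow> bool" where
  "exact_multiplication_in \<tau> \<longleftrightarrow>
     (\<exists>T. (\<forall>n\<ge>1. multiplies_exactly n (T n)) \<and>
          (\<lambda>n. real (arith_ops (T n))) \<in> O(\<lambda>n. real n powr \<tau>))"

definition exact_inversion_in :: "real \<Rightarrow> bool" where
  "exact_inversion_in \<tau> \<longleftrightarrow>
     (\<exists>T. (\<forall>n\<ge>1. inverts_exactly n (T n)) \<and>
          (\<lambda>n. real (arith_ops (T n))) \<in> O(\<lambda>n. real n powr \<tau>))"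


section \<open>Floating point data\<close>

text \<open>
  A floating point number with a \<open>b\<close>-bit significand \<open>M\<close> and a \<open>w\<close>-bit exponent field \<open>E\<close>
  is stored as the sign bit, the bits of \<open>M\<close> and the bits of \<open>E\<close> (least significant bits first),
  and has the value \<open>\<plusminus> M \<cdot> 2\<close> to the power \<open>E - 2 ^ (w - 1)\<close>.  Significands need not be normalized, so
  that every bit string of length \<open>1 + b + w\<close> denotes a number.  Rounding to a \<open>b\<close>-bit
  significand has relative error at most \<open>roundoff b\<close>, barring over- and underflow.
\<close>

definition roundoff :: "nat \<Rightarrow> real" where
  "roundoff b = (1 / 2) ^ b"

definition bits_value :: "bool list \<Rightarrow> nat" where
  "bits_value bs = horner_sum of_bool 2 bs"

definition float_value :: "nat \<Rightarrow> nat \<Rightarrow> bool list \<Rightarrow> real" where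
  "float_value b w bs =
     (if bs ! 0 then - 1 else 1) * real (bits_value (take b (drop 1 bs)))
       * 2 powi (int (bits_value (take w (drop (1 + b) bs))) - 2 ^ (w - 1))"

definition float_mat_length :: "nat \<Rightarrow> nat \<Rightarrow> nat \<Rightarrow> nat" where
  "float_mat_length n b w = n * n * (1 + b + w)"

text \<open>The entries are stored row by row; bits behind those of the last entry are ignored.\<close>

definition float_mat :: "nat \<Rightarrow> nat \<Rightarrow> nat \<Rightarrow> bool list \<Rightarrow> real mat" where
  "float_mat n b w bs =
     mat n n (\<lambda>(i, j). float_value b w (drop ((i * n + j) * (1 + b + w)) bs))"


section \<open>Bit operations: Boolean circuits\<close>

text \<open>
  Bit operations are the gates of a Boolean circuit over the full binary basis, a gate
  being given by its function and the numbers of its two argument wires.  Unlike the depth of a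
  computation tree, which on \<open>N\<close> input bits never needs to exceed \<open>N\<close>, the number of gates is a
  meaningful cost measure on bits.
  The input bits are the first wires, and each gate adds a wire; non-existing wires read as
  \<open>False\<close>.  An algorithm may use any internal precision, and it chooses the format
  (\<open>out_prec\<close>, \<open>out_exp\<close>) of the floating point numbers that it outputs; writing an output bit also
  costs one bit operation.
\<close>

datatype gate = Gate "bool \<Rightarrow> bool \<Rightarrow> bool" nat nat

datatype bit_alg =
  Bit_Alg (gates: "gate list") (out_wires: "nat list") (out_prec: nat) (out_exp: nat)

definition wire :: "bool list \<Rightarrow> nat \<Rightarrow> bool" where
  "wire ws i \<longleftrightarrow> i < length ws \<and> ws ! i"

fun add_wire :: "gate \<Rightarrow> bool list \<Rightarrow> bool list" where
  "add_wire (Gate f i j) ws = ws @ [f (wire ws i) (wire ws j)]"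

definition run_bits :: "bit_alg \<Rightarrow> bool list \<Rightarrow> bool list" where
  "run_bits P bs = map (wire (fold add_wire (gates P) bs)) (out_wires P)"

definition bit_ops :: "bit_alg \<Rightarrow> nat" where
  "bit_ops P = length (gates P) + length (out_wires P)"

definition outputs_matrix :: "nat \<Rightarrow> bit_alg \<Rightarrow> bool" where
  "outputs_matrix n P \<longleftrightarrow> length (out_wires P) = float_mat_length n (out_prec P) (out_exp P)"

definition computed_mat :: "nat \<Rightarrow> bit_alg \<Rightarrow> bool list \<Rightarrow> real mat" where
  "computed_mat n P bs = float_mat n (out_prec P) (out_exp P) (run_bits P bs)"


section \<open>Stability\<close>

definition mat_norm :: "real mat \<Rightarrow> real" where
  "mat_norm A =
     Sup {sqrt ((A *\<^sub>v x) \<bullet> (A *\<^sub>v x)) | x. x \<in> carrier_vec (dim_col A) \<and> x \<bullet> x \<le> 1}"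

definition poly_bounded :: "(nat \<Rightarrow> real) \<Rightarrow> bool" where
  "poly_bounded \<mu> \<longleftrightarrow> (\<exists>c::nat. \<mu> \<in> O(\<lambda>n. real n ^ c))"

text \<open>
  An algorithm is a family of circuits, indexed by the order \<open>n\<close>, the number \<open>b\<close> of bits of precision
  and the width \<open>w\<close> of the exponent field of the input.  The constant hidden in the second order
  term \<open>O(\<epsilon>\<^sup>2)\<close> is polynomial in \<open>n\<close> as well; with an arbitrary dependence on \<open>n\<close>, say \<open>4 ^ n\<close>, the zero
  matrix would be an admissible product whenever \<open>b \<le> n\<close>.
\<close>

definition stable_multiplication :: "(nat \<Rightarrow> nat \<Rightarrow> nat \<Rightarrow> bit_alg) \<Rightarrow> bool" where
  "stable_multiplication P \<longleftrightarrow>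
     (\<exists>\<mu> \<nu>. poly_bounded \<mu> \<and> poly_bounded \<nu> \<and>
       (\<forall>n\<ge>1. \<forall>b\<ge>1. \<forall>w\<ge>1.
          outputs_matrix n (P n b w) \<and>
          (\<forall>as bs. length as = float_mat_length n b w \<and> length bs = float_mat_length n b w \<longrightarrow>
             (let A = float_mat n b w as; B = float_mat n b w bs; \<epsilon> = roundoff b
              in mat_norm (computed_mat n (P n b w) (as @ bs) - A * B)
                   \<le> \<mu> n * \<epsilon> * mat_norm A * mat_norm B
                     + \<nu> n * \<epsilon>\<^sup>2 * mat_norm A * mat_norm B))))"

definition stable_inversion :: "(nat \<Rightarrow> nat \<Rightarrow> nat \<Rightarrow> bit_alg) \<Rightarrow> bool" where
  "stable_inversion P \<longleftrightarrow>
     (\<exists>\<mu> \<nu>. poly_bounded \<mu> \<and> poly_bounded \<nu> \<and>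
       (\<forall>n\<ge>1. \<forall>b\<ge>1. \<forall>w\<ge>1.
          outputs_matrix n (P n b w) \<and>
          (\<forall>as. length as = float_mat_length n b w \<longrightarrow>
             (let A = float_mat n b w as; \<epsilon> = roundoff b
              in \<forall>X \<in> carrier_mat n n. is_inverse A X \<longrightarrow>
                   (let \<kappa> = mat_norm A * mat_norm X
                    in mat_norm (computed_mat n (P n b w) as - X) / mat_norm X
                         \<le> \<mu> n * \<epsilon> * \<kappa> + \<nu> n * \<epsilon>\<^sup>2)))))"

text \<open>
  Bit operations \<open>O(n powr \<tau>)\<close>, up to a factor depending on the word length \<open>b + w\<close> of the
  data.  That factor has to be polynomial: stability only constrains the result when \<open>n\<close> is less than some
  fixed exponential in \<open>b\<close>, and in this range a factor exponential in \<open>b\<close> would absorb any power of \<open>n\<close>.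
\<close>

definition bit_complexity :: "(nat \<Rightarrow> nat \<Rightarrow> nat \<Rightarrow> bit_alg) \<Rightarrow> real \<Rightarrow> bool" where
  "bit_complexity P \<tau> \<longleftrightarrow>
     (\<exists>C::real. \<exists>k::nat. \<forall>n\<ge>1. \<forall>b\<ge>1. \<forall>w\<ge>1.
        real (bit_ops (P n b w)) \<le> C * real n powr \<tau> * real (b + w) ^ k)"

definition stable_multiplication_in :: "real \<Rightarrow> bool" where
  "stable_multiplication_in \<tau> \<longleftrightarrow> (\<exists>P. stable_multiplication P \<and> bit_complexity P \<tau>)"

definition stable_inversion_in :: "real \<Rightarrow> bool" where
  "stable_inversion_in \<tau> \<longleftrightarrow> (\<exists>P. stable_inversion P \<and> bit_complexity P \<tau>)"

end

theory Submission
  imports Defs "HOL-Analysis.Function_Topology" "HOL-Analysis.L2_Norm"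
begin

text \<open>
  \<^bold>\<open>Multiplication to inversion.\<close> An exact algorithm, restricted to an open set of inputs on which its branching
  is constant, is a straight-line program; the mixed second-order coefficients of its Taylor expansion at a
  point form a bilinear algorithm of the same rank up to a constant.  Real coefficients are replaced by
  dyadic approximations, which is harmless: the recursive application of the bilinear algorithm to
  integer matrices amplifies errors only by \<open>n\<close> to a constant, so that logarithmically many extra bits and
  a final rounding recover the exact integer product.  An inverse is then computed by
  Newton's iteration in fixed point arithmetic with a multiple of \<open>b\<close> bits, after the input has been scaled by a
  power of two.  If \<open>n\<close> exceeds \<open>2 ^ b\<close>, or the scaled inverse is large, the requested error
  bound is so weak that any bounded output is good enough.

  \<^bold>\<open>Inversion to multiplication.\<close> The inverse of the unit upper triangular block matrix with \<open>A\<close> and \<open>B\<close> above the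
  diagonal has \<open>A B\<close> in its corner.  In the floating point model \<open>A\<close> and \<open>B\<close> are first scaled to
  have norm between \<open>1\<close> and \<open>n 2 ^ b\<close>, so that precision \<open>6 b\<close> compensates for the condition number
  of the block matrix.
\<close>

section \<open>Straight-line Boolean computations\<close>

text \<open>Nothing is known about the given trees beyond their operation count: they may divide,
  branch and contain arbitrary real constants, so evaluating them in finite precision would prove
  nothing. A bilinear algorithm has none of these defects, and for each \<eta> a single one, of a
  fixed size m, is enough: its real coefficients are rounded and hard-wired, which a nonuniform
  family of circuits allows, and the factor 2 lost in its rank is absorbed by choosing m large for
  the exponent \<omega> + \<eta>/2. Circuits compute with integers modulo powers of two. Overflow of
  intermediate values therefore needs no analysis; it is enough that a final value is known to be
  small. Reading, scaling and writing matrices costs n^2 times a polynomial in b + w. This fits into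
  every claimed bound because each exponent that occurs is at least 2. No relation between \<omega>
  and 2 is assumed, so quadratic lower bounds have to be derived from the hypotheses
  themselves.\<close>

text \<open>
  Circuits are handled through the set of Boolean functions of the input that their wires
  carry: \<open>computes S c T\<close> says that with at most \<open>c\<close> gates all functions in \<open>T\<close> can be obtained from
  those in \<open>S\<close>, constants being free.
\<close>

definition consts_bool :: "('x \<Rightarrow> bool) set" where
  "consts_bool = {\<lambda>_. False, \<lambda>_. True}"

inductive computes :: "('x \<Rightarrow> bool) set \<Rightarrow> nat \<Rightarrow> ('x \<Rightarrow> bool) set \<Rightarrow> bool" where
  free: "T \<subseteq> S \<union> consts_bool \<Longrightarrow> computes S c T"
| gate: "f \<in> S \<union> consts_bool \<Longrightarrow> g \<in> S \<union> consts_bool \<Longrightarrow>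
    computes (insert (\<lambda>x. h (f x) (g x)) S) c T \<Longrightarrow> computes S (Suc c) T"

text \<open>Weakening on all sides at once. The target may even grow by anything in the source, so
  that functions already available never have to be recomputed.\<close>

lemma computes_mono:
  assumes "computes S c T" "S \<subseteq> S' \<union> consts_bool" "c \<le> c'" "T' \<subseteq> T \<union> S' \<union> consts_bool"
  shows "computes S' c' T'"
  using assms
proof (induction arbitrary: S' c' T' rule: computes.induct)
  case (free T S c)
  then show ?case by (intro computes.free) blast
next
  case (gate f S g h c T)
  then obtain d where d: "c' = Suc d" "c \<le> d" by (cases c') auto
  let ?k = "\<lambda>x. h (f x) (g x)"
  have "computes (insert ?k S') d T'"
    by (rule gate.IH) (use gate.prems d in auto)
  with gate.hyps gate.prems show ?case
    unfolding d(1) by (intro computes.gate[of f _ g]) auto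
qed

lemma computes_trans:
  assumes "computes S c T" "computes (S \<union> T) d U"
  shows "computes S (c + d) U"
  using assms
proof (induction arbitrary: U rule: computes.induct)
  case (free T S c)
  then show ?case
    by (elim computes_mono) auto
next
  case (gate f S g h c T)
  have "computes (insert (\<lambda>x. h (f x) (g x)) S \<union> T) d U"
    by (rule computes_mono[OF gate.prems]) auto
  from gate.IH[OF this] gate.hyps show ?case
    unfolding add_Suc by (intro computes.gate[of f _ g h])
qed

lemma computes_cong_trans:
  assumes "computes S c T" "computes T d U" "c + d \<le> e"
  shows "computes S e U"
proof (rule computes_mono)
  show "computes S (c + d) U"
    by (rule computes_trans[OF assms(1)], rule computes_mono[OF assms(2)]) auto
qed (use assms(3) in auto)

lemma computes_Un:
  assumes "computes S c T" "computes S d U"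
  shows "computes S (c + d) (T \<union> U)"
proof (rule computes_trans[OF assms(1)])
  show "computes (S \<union> T) d (T \<union> U)"
    by (rule computes_mono[OF assms(2)]) auto
qed

lemma computes_UN:
  assumes "finite I" "\<And>i. i \<in> I \<Longrightarrow> computes S (c i) (T i)"
  shows "computes S (\<Sum>i\<in>I. c i) (\<Union>i\<in>I. T i)"
  using assms
proof (induction rule: finite_induct)
  case empty
  show ?case by (rule computes.free) auto
next
  case (insert i I)
  have "computes S (c i + (\<Sum>i\<in>I. c i)) (T i \<union> (\<Union>i\<in>I. T i))"
    by (rule computes_Un) (use insert in auto)
  with insert show ?case by simp
qed

lemma computes_UN_bound:
  assumes "finite I" "\<And>i. i \<in> I \<Longrightarrow> computes S c (T i)" "card I * c \<le> d"
  shows "computes S d (\<Union>i\<in>I. T i)"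
  using computes_mono[OF computes_UN[of I S "\<lambda>_. c" T], of S d] assms by auto

lemma computes_gate1:
  assumes "f \<in> S \<union> consts_bool" "g \<in> S \<union> consts_bool"
  shows "computes S 1 {\<lambda>x. h (f x) (g x)}"
  using computes.gate[OF assms computes.free[of _ _ 0], of "{\<lambda>x. h (f x) (g x)}"] by auto

text \<open>The rule for loops, with \<open>T k\<close> as the state after k rounds. Ripple-carry
  addition, schoolbook multiplication, the barrel shifter and Newton's iteration are all
  instances.\<close>

lemma computes_sequence:
  assumes "\<And>k. k < N \<Longrightarrow> computes (S \<union> T k) c (T (Suc k))" "T 0 \<subseteq> S \<union> consts_bool"
  shows "computes S (N * c) (T N)"
  using assms(1)
proof (induction N)
  case 0
  show ?case using assms(2) by (intro computes.free) auto
next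
  case (Suc N)
  have "computes S (N * c) (T N)" using Suc by auto
  moreover have "computes (S \<union> T N) c (T (Suc N))" by (rule Suc.prems) auto
  ultimately have "computes S (N * c + c) (T (Suc N))" by (rule computes_trans)
  then show ?case by (simp add: add.commute)
qed

subsection \<open>Circuits\<close>

lemma length_add_wire [simp]: "length (add_wire g ws) = Suc (length ws)"
  by (cases g) auto

lemma length_fold_add_wire [simp]: "length (fold add_wire gs ws) = length ws + length gs"
  by (induction gs arbitrary: ws) auto

text \<open>Wires are numbers, so the gates \<open>gs\<close> emitted so far are carried through the
  induction. The bound on the wire number matters: a gate is appended at position
  \<open>N + length gs\<close> and leaves all lower wires unchanged.\<close>

lemma computes_circuit_aux:
  fixes S :: "(bool list \<Rightarrow> bool) set"
  assumes "computes S c T"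
    and "\<And>f. f \<in> S \<union> consts_bool \<Longrightarrow>
          \<exists>i < N + length gs. \<forall>bs. length bs = N \<longrightarrow> wire (fold add_wire gs bs) i = f bs"
  shows "\<exists>gs'. length gs' \<le> length gs + c \<and>
     (\<forall>f\<in>T. \<exists>i. \<forall>bs. length bs = N \<longrightarrow> wire (fold add_wire gs' bs) i = f bs)"
  using assms
proof (induction arbitrary: gs rule: computes.induct)
  case (free T S c)
  then have "\<exists>i. \<forall>bs. length bs = N \<longrightarrow> wire (fold add_wire gs bs) i = f bs" if "f \<in> T" for f
    using that by blast
  then show ?case by (intro exI[of _ gs]) auto
next
  case (gate f S g h c T)
  from gate.prems[OF gate.hyps(1)] obtain i where i: "i < N + length gs"
    "\<And>bs. length bs = N \<Longrightarrow> wire (fold add_wire gs bs) i = f bs" by auto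
  from gate.prems[OF gate.hyps(2)] obtain j where j: "j < N + length gs"
    "\<And>bs. length bs = N \<Longrightarrow> wire (fold add_wire gs bs) j = g bs" by auto
  let ?gs = "gs @ [Gate h i j]"
  have old: "wire (fold add_wire ?gs bs) k = wire (fold add_wire gs bs) k"
    if "length bs = N" "k < N + length gs" for bs k
    using that by (auto simp: wire_def nth_append)
  have new: "wire (fold add_wire ?gs bs) (N + length gs) = h (f bs) (g bs)"
    if "length bs = N" for bs
    using that i(2)[OF that] j(2)[OF that] by (auto simp: wire_def nth_append)
  have "\<exists>gs'. length gs' \<le> length ?gs + c \<and>
     (\<forall>f\<in>T. \<exists>i. \<forall>bs. length bs = N \<longrightarrow> wire (fold add_wire gs' bs) i = f bs)"
  proof (rule gate.IH)
    fix k assume "k \<in> insert (\<lambda>x. h (f x) (g x)) S \<union> consts_bool"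
    then consider "k = (\<lambda>x. h (f x) (g x))" | "k \<in> S \<union> consts_bool" by blast
    then show "\<exists>i<N + length ?gs. \<forall>bs. length bs = N \<longrightarrow> wire (fold add_wire ?gs bs) i = k bs"
    proof cases
      case 1
      with new show ?thesis by (intro exI[of _ "N + length gs"]) auto
    next
      case 2
      from gate.prems[OF this] obtain l where "l < N + length gs"
        "\<And>bs. length bs = N \<Longrightarrow> wire (fold add_wire gs bs) l = k bs" by blast
      with old show ?thesis by (intro exI[of _ l]) auto
    qed
  qed
  then show ?case by auto
qed

definition input_bits :: "nat \<Rightarrow> (bool list \<Rightarrow> bool) set" where
  "input_bits N = {\<lambda>bs. wire bs i | i. i < N}"

lemma wire_mem_input_bits [intro]: "i < N \<Longrightarrow> (\<lambda>bs. wire bs i) \<in> input_bits N"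
  by (auto simp: input_bits_def)

lemma computes_circuit:
  assumes "computes (input_bits N) c (set outs)"
  shows "\<exists>P. out_prec P = b \<and> out_exp P = w \<and> length (out_wires P) = length outs \<and>
    bit_ops P \<le> c + 2 + length outs \<and>
    (\<forall>bs. length bs = N \<longrightarrow> run_bits P bs = map (\<lambda>f. f bs) outs)"
proof -
  \<comment> \<open>Constants are free in \<open>computes\<close> but not in a circuit. These two
    gates supply them and account for the summand 2 in the cost; they ignore their arguments, so
    wire 0 need not exist.\<close>
  let ?gs = "[Gate (\<lambda>_ _. False) 0 0, Gate (\<lambda>_ _. True) 0 0]"
  have "\<exists>gs'. length gs' \<le> length ?gs + c \<and>
     (\<forall>f\<in>set outs. \<exists>i. \<forall>bs. length bs = N \<longrightarrow> wire (fold add_wire gs' bs) i = f bs)"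
  proof (rule computes_circuit_aux[OF assms])
    fix f :: "bool list \<Rightarrow> bool"
    assume "f \<in> input_bits N \<union> consts_bool"
    then consider i where "i < N" "f = (\<lambda>bs. wire bs i)" | "f = (\<lambda>_. False)" | "f = (\<lambda>_. True)"
      by (auto simp: consts_bool_def input_bits_def)
    then show "\<exists>i<N + length ?gs. \<forall>bs. length bs = N \<longrightarrow> wire (fold add_wire ?gs bs) i = f bs"
    proof cases
      case 1
      then show ?thesis by (intro exI[of _ i]) (auto simp: wire_def nth_append)
    next
      case 2
      then show ?thesis by (intro exI[of _ N]) (auto simp: wire_def nth_append)
    next
      case 3
      then show ?thesis by (intro exI[of _ "Suc N"]) (auto simp: wire_def nth_append)
    qed
  qed
  then obtain gs i where gs: "length gs \<le> 2 + c"
    "\<And>f bs. f \<in> set outs \<Longrightarrow> length bs = N \<Longrightarrow> wire (fold add_wire gs bs) (i f) = f bs"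
    by simp metis
  then show ?thesis
    by (intro exI[of _ "Bit_Alg gs (map i outs) b w"]) (auto simp: run_bits_def bit_ops_def)
qed

text \<open>Substitution into a given circuit: its gates are replayed on functions that are already
  available. Reading a missing wire yields \<open>False\<close>, which is a free constant. This is
  how an unknown inversion circuit is later used as a subroutine.\<close>

lemma computes_feed:
  assumes "set gf \<subseteq> S \<union> consts_bool"
  shows "computes S (length gs) {\<lambda>x. wire (fold add_wire gs (map (\<lambda>g. g x) gf)) i | i. True}"
  using assms
proof (induction gs arbitrary: S gf)
  case Nil
  have "(\<lambda>x. wire (map (\<lambda>g. g x) gf) i) \<in> S \<union> consts_bool" for i
  proof (cases "i < length gf")
    case True
    then have "(\<lambda>x. wire (map (\<lambda>g. g x) gf) i) = gf ! i" by (auto simp: wire_def)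
    with nth_mem[OF True] Nil show ?thesis by auto
  next
    case False
    then show ?thesis by (auto simp: wire_def consts_bool_def)
  qed
  then show ?case by (intro computes.free) auto
next
  case (Cons g gs)
  obtain h i j where g: "g = Gate h i j" by (cases g)
  have *: "(\<lambda>x. wire (map (\<lambda>g. g x) gf) i) \<in> S \<union> consts_bool" for i
  proof (cases "i < length gf")
    case True
    then have "(\<lambda>x. wire (map (\<lambda>g. g x) gf) i) = gf ! i" by (auto simp: wire_def)
    with nth_mem[OF True] Cons.prems show ?thesis by auto
  next
    case False
    then show ?thesis by (auto simp: wire_def consts_bool_def)
  qed
  let ?n = "\<lambda>x. h (wire (map (\<lambda>g. g x) gf) i) (wire (map (\<lambda>g. g x) gf) j)"
  have "computes (insert ?n S) (length gs)
     {\<lambda>x. wire (fold add_wire gs (map (\<lambda>g. g x) (gf @ [?n]))) i | i. True}"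
    by (rule Cons.IH) (use Cons.prems in auto)
  from computes.gate[where h = h, OF *[of i] *[of j] this] show ?case by (simp add: g)
qed

lemma computes_run_bits:
  assumes "set gf \<subseteq> S \<union> consts_bool"
  shows "computes S (length (gates P))
    {\<lambda>x. run_bits P (map (\<lambda>g. g x) gf) ! i | i. i < length (out_wires P)}"
  by (rule computes_mono[OF computes_feed[OF assms, of "gates P"]]) (auto simp: run_bits_def)

section \<open>Integer words\<close>

text \<open>Two's complement: \<open>bit\<close> is defined for negative integers as well, so the
  lowest W bits represent the residue modulo 2^W, and ring operations need neither sign cases nor
  overflow checks.\<close>

definition word_bits :: "nat \<Rightarrow> ('x \<Rightarrow> int) \<Rightarrow> ('x \<Rightarrow> bool) set" where
  "word_bits W \<phi> = (\<lambda>i x. bit (\<phi> x) i) ` {..<W}"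

lemma mem_word_bits: "i < W \<Longrightarrow> (\<lambda>x. bit (\<phi> x) i) \<in> word_bits W \<phi>"
  by (auto simp: word_bits_def)

lemma word_bits_mono: "V \<le> W \<Longrightarrow> word_bits V \<phi> \<subseteq> word_bits W \<phi>"
  by (auto simp: word_bits_def)

lemma word_bits_cong:
  assumes "\<And>x. take_bit W (\<phi> x) = take_bit W (\<psi> x)"
  shows "word_bits W \<phi> = word_bits W \<psi>"
proof -
  have "bit (\<phi> x) i = bit (\<psi> x) i" if "i < W" for x i
    using assms[of x] that by (metis bit_take_bit_iff)
  then show ?thesis by (auto simp: word_bits_def intro!: image_cong)
qed

lemma word_bits_const: "word_bits W (\<lambda>_. k) \<subseteq> consts_bool"
  by (auto simp: word_bits_def consts_bool_def)

text \<open>A shift by a fixed distance is mere rewiring, but W valid bits of the quotient require W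
  + p valid bits of the argument. This loss at the top dictates the initial word lengths of the
  rounding step and of Newton's iteration.\<close>

lemma word_bits_div: "word_bits W (\<lambda>x. \<phi> x div 2 ^ p) \<subseteq> word_bits (W + p) \<phi>"
proof
  fix f assume "f \<in> word_bits W (\<lambda>x. \<phi> x div 2 ^ p)"
  then obtain i where i: "i < W" "f = (\<lambda>x. bit (\<phi> x div 2 ^ p) i)" by (auto simp: word_bits_def)
  have "f = (\<lambda>x. bit (\<phi> x) (p + i))"
    using i(2) by (simp add: bit_drop_bit_eq flip: drop_bit_eq_div)
  then show "f \<in> word_bits (W + p) \<phi>"
    using i(1) by (auto intro: mem_word_bits)
qed

lemma word_bits_mult_exp: "word_bits W (\<lambda>x. \<phi> x * 2 ^ p) \<subseteq> word_bits W \<phi> \<union> consts_bool"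
proof
  fix f assume "f \<in> word_bits W (\<lambda>x. \<phi> x * 2 ^ p)"
  then obtain i where i: "i < W" "f = (\<lambda>x. bit (\<phi> x * 2 ^ p) i)" by (auto simp: word_bits_def)
  have *: "bit (\<phi> x * 2 ^ p) i \<longleftrightarrow> p \<le> i \<and> bit (\<phi> x) (i - p)" for x
    using bit_push_bit_iff[of p "\<phi> x" i] by (simp add: push_bit_eq_mult)
  show "f \<in> word_bits W \<phi> \<union> consts_bool"
    using i(1) by (cases "p \<le> i") (auto simp: i(2) * consts_bool_def intro!: mem_word_bits)
qed

lemma word_bits_bounded:
  assumes "\<And>x. 0 \<le> \<phi> x" "\<And>x. \<phi> x < 2 ^ V"
  shows "word_bits W \<phi> \<subseteq> word_bits V \<phi> \<union> consts_bool"
proof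
  fix f assume "f \<in> word_bits W \<phi>"
  then obtain i where i: "i < W" "f = (\<lambda>x. bit (\<phi> x) i)" by (auto simp: word_bits_def)
  have *: "\<not> bit (\<phi> x) i" if "V \<le> i" for x
  proof -
    have "take_bit V (\<phi> x) = \<phi> x" using assms by (intro take_bit_int_eq_self) auto
    with that show ?thesis by (metis bit_take_bit_iff leD)
  qed
  show "f \<in> word_bits V \<phi> \<union> consts_bool"
    by (cases "V \<le> i") (auto simp: i(2) * consts_bool_def intro!: mem_word_bits)
qed

lemma word_bits_take_bit: "word_bits W (\<lambda>x. take_bit V (\<phi> x)) \<subseteq> word_bits V \<phi> \<union> consts_bool"
proof -
  have "word_bits W (\<lambda>x. take_bit V (\<phi> x)) \<subseteq> word_bits V (\<lambda>x. take_bit V (\<phi> x)) \<union> consts_bool"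
    by (rule word_bits_bounded) (auto simp: take_bit_int_less_exp)
  also have "word_bits V (\<lambda>x. take_bit V (\<phi> x)) = word_bits V \<phi>"
    by (rule word_bits_cong) simp
  finally show ?thesis .
qed

definition carry :: "nat \<Rightarrow> int \<Rightarrow> int \<Rightarrow> bool" where
  "carry i a b \<longleftrightarrow> 2 ^ i \<le> take_bit i a + take_bit i b"

text \<open>Bit i is the parity of the quotient by 2^i, and the two remainders contribute 0 or 1 to
  the quotient of the sum.\<close>

lemma bit_add_carry: "bit (a + b) i \<longleftrightarrow> (bit a i \<noteq> (bit b i \<noteq> carry i a b))" for a b :: int
proof -
  let ?a = "take_bit i a" and ?b = "take_bit i b"
  have "(a + b) div 2 ^ i = a div 2 ^ i + b div 2 ^ i + (?a + ?b) div 2 ^ i"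
    unfolding take_bit_eq_mod by (rule div_add1_eq)
  moreover have "(?a + ?b) div 2 ^ i = of_bool (carry i a b)"
  proof (cases "carry i a b")
    case True
    have "?a + ?b < 2 * 2 ^ i"
      using take_bit_int_less_exp[of i a] take_bit_int_less_exp[of i b] by linarith
    then have "(?a + ?b - 2 ^ i) div 2 ^ i = 0"
      using True by (intro div_pos_pos_trivial) (auto simp: carry_def)
    then show ?thesis using True
      using div_add_self2[of "2 ^ i" "?a + ?b - 2 ^ i"] by simp
  next
    case False
    then show ?thesis by (auto simp: carry_def intro!: div_pos_pos_trivial)
  qed
  ultimately show ?thesis by (auto simp: bit_iff_odd)
qed

lemma carry_Suc: "carry (Suc i) a b \<longleftrightarrow> (bit a i \<and> bit b i) \<or> (carry i a b \<and> (bit a i \<or> bit b i))"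
proof -
  have *: "take_bit (Suc i) a = take_bit i a + of_bool (bit a i) * 2 ^ i" for a :: int
    by (simp add: take_bit_Suc_from_most)
  show ?thesis
    using take_bit_int_less_exp[of i a] take_bit_int_less_exp[of i b]
      take_bit_nonnegative[of i a] take_bit_nonnegative[of i b]
    unfolding carry_def * by (cases "bit a i"; cases "bit b i"; simp; linarith)
qed

lemma computes_step:
  assumes "computes S c T" "f \<in> S \<union> T" "g \<in> S \<union> T" "k = (\<lambda>x. h (f x) (g x))"
  shows "computes S (Suc c) (insert k T)"
proof -
  have "computes S (c + 1) (insert (\<lambda>x. h (f x) (g x)) T)"
    by (rule computes_trans[OF assms(1)])
      (rule computes_mono[OF computes_gate1[of f "S \<union> T" g]], use assms(2,3) in auto)
  with assms(4) show ?thesis by simp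
qed

lemma computes_full_adder:
  assumes "a \<in> S" "b \<in> S" "c \<in> S"
  shows "computes S 6 {\<lambda>x. a x \<noteq> (b x \<noteq> c x), \<lambda>x. (a x \<and> b x) \<or> (c x \<and> (a x \<or> b x))}"
proof -
  define f1 f2 f3 f4 f5 f6 where "f1 = (\<lambda>x. b x \<noteq> c x)" and "f2 = (\<lambda>x. a x \<noteq> f1 x)"
    and "f3 = (\<lambda>x. a x \<and> b x)" and "f4 = (\<lambda>x. a x \<or> b x)" and "f5 = (\<lambda>x. c x \<and> f4 x)"
    and "f6 = (\<lambda>x. f3 x \<or> f5 x)"
  have "computes S 0 {}" by (rule computes.free) simp
  from computes_step[where f = b and g = c and h = "(\<noteq>)", OF this _ _ f1_def] have "computes S (Suc 0) {f1}" using assms by blast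
  from computes_step[where f = a and g = f1 and h = "(\<noteq>)", OF this _ _ f2_def] have "computes S (Suc (Suc 0)) {f2, f1}"
    using assms by blast
  from computes_step[where f = a and g = b and h = "(\<and>)", OF this _ _ f3_def] have "computes S (Suc (Suc (Suc 0))) {f3, f2, f1}"
    using assms by blast
  from computes_step[where f = a and g = b and h = "(\<or>)", OF this _ _ f4_def]
  have "computes S (Suc (Suc (Suc (Suc 0)))) {f4, f3, f2, f1}" using assms by blast
  from computes_step[where f = c and g = f4 and h = "(\<and>)", OF this _ _ f5_def]
  have "computes S (Suc (Suc (Suc (Suc (Suc 0))))) {f5, f4, f3, f2, f1}" using assms by blast
  from computes_step[where f = f3 and g = f5 and h = "(\<or>)", OF this _ _ f6_def]
  have "computes S (Suc (Suc (Suc (Suc (Suc (Suc 0)))))) {f6, f5, f4, f3, f2, f1}" by blast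
  moreover have "(\<lambda>x. a x \<noteq> (b x \<noteq> c x)) = f2" "(\<lambda>x. (a x \<and> b x) \<or> (c x \<and> (a x \<or> b x))) = f6"
    by (auto simp: f1_def f2_def f3_def f4_def f5_def f6_def)
  ultimately show ?thesis by (elim computes_mono) auto
qed

lemma computes_add:
  fixes \<phi> \<psi> :: "'x \<Rightarrow> int"
  shows "computes (word_bits W \<phi> \<union> word_bits W \<psi>) (6 * W) (word_bits W (\<lambda>x. \<phi> x + \<psi> x))"
proof -
  let ?S = "word_bits W \<phi> \<union> word_bits W \<psi>"
  let ?c = "\<lambda>i x. carry i (\<phi> x) (\<psi> x)"
  \<comment> \<open>Loop state: the sum bits below position k together with the carry into position
    k.\<close>
  let ?T = "\<lambda>k. word_bits k (\<lambda>x. \<phi> x + \<psi> x) \<union> {?c k}"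
  have "computes (?S \<union> ?T k) 6 (?T (Suc k))" if "k < W" for k
  proof -
    let ?a = "\<lambda>x. bit (\<phi> x) k" and ?b = "\<lambda>x. bit (\<psi> x) k"
    let ?U = "?S \<union> ?T k"
    let ?f2 = "\<lambda>x. ?a x \<noteq> (?b x \<noteq> ?c k x)"
    let ?f6 = "\<lambda>x. (?a x \<and> ?b x) \<or> (?c k x \<and> (?a x \<or> ?b x))"
    have "?a \<in> ?U" "?b \<in> ?U" "?c k \<in> ?U"
      using that by (auto intro: mem_word_bits)
    then have "computes ?U 6 {?f2, ?f6}"
      by (rule computes_full_adder)
    moreover have "?f2 = (\<lambda>x. bit (\<phi> x + \<psi> x) k)" "?f6 = ?c (Suc k)"
      by (auto simp: bit_add_carry carry_Suc)
    moreover have "word_bits (Suc k) (\<lambda>x. \<phi> x + \<psi> x) =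
        insert (\<lambda>x. bit (\<phi> x + \<psi> x) k) (word_bits k (\<lambda>x. \<phi> x + \<psi> x))"
      by (simp add: word_bits_def lessThan_Suc)
    ultimately show ?thesis
      by (elim computes_mono) auto
  qed
  then have "computes ?S (W * 6) (?T W)"
    by (rule computes_sequence[where T = ?T]) (auto simp: word_bits_def consts_bool_def carry_def)
  then show ?thesis by (rule computes_mono) auto
qed

lemma computes_and:
  fixes \<phi> :: "'x \<Rightarrow> int"
  shows "computes (insert g (word_bits W \<phi>)) W (word_bits W (\<lambda>x. of_bool (g x) * \<phi> x))"
proof -
  have "computes (insert g (word_bits W \<phi>)) 1 {\<lambda>x. g x \<and> bit (\<phi> x) i}" if "i < W" for i
    using that by (intro computes_gate1) (auto intro: mem_word_bits)
  then have "computes (insert g (word_bits W \<phi>)) W (\<Union>i<W. {\<lambda>x. g x \<and> bit (\<phi> x) i})"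
    by (intro computes_UN_bound) auto
  also have "(\<Union>i<W. {\<lambda>x. g x \<and> bit (\<phi> x) i}) = word_bits W (\<lambda>x. of_bool (g x) * \<phi> x)"
    by (auto simp: word_bits_def image_def intro!: exI)
  finally show ?thesis .
qed

text \<open>Schoolbook method: after k rounds the state is the product with the k low bits of
  \<psi>. Modulo 2^W only W rounds are needed, also for negative \<psi>. A cost quadratic in W is
  affordable, since powers of the word length are not counted.\<close>

lemma computes_mult:
  fixes \<phi> \<psi> :: "'x \<Rightarrow> int"
  shows "computes (word_bits W \<phi> \<union> word_bits W \<psi>) (W * (7 * W)) (word_bits W (\<lambda>x. \<phi> x * \<psi> x))"
proof -
  let ?S = "word_bits W \<phi> \<union> word_bits W \<psi>"
  let ?p = "\<lambda>k x. \<phi> x * take_bit k (\<psi> x)"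
  have "computes (?S \<union> word_bits W (?p k)) (7 * W) (word_bits W (?p (Suc k)))" if "k < W" for k
  proof -
    let ?q = "\<lambda>x. of_bool (bit (\<psi> x) k) * (\<phi> x * 2 ^ k)"
    have p: "?p (Suc k) = (\<lambda>x. ?p k x + ?q x)"
      by (auto simp: take_bit_Suc_from_most algebra_simps)
    have "computes ?S W (word_bits W ?q)"
      by (rule computes_mono[OF computes_and[of "\<lambda>x. bit (\<psi> x) k" W "\<lambda>x. \<phi> x * 2 ^ k"]])
        (use that word_bits_mult_exp[of W \<phi> k] in \<open>auto intro: mem_word_bits\<close>)
    then have "computes (?S \<union> word_bits W (?p k)) W (word_bits W ?q)"
      by (rule computes_mono) auto
    then have "computes (?S \<union> word_bits W (?p k)) (W + 6 * W) (word_bits W (\<lambda>x. ?p k x + ?q x))"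
      by (rule computes_trans) (rule computes_mono[OF computes_add[of W "?p k" ?q]], auto)
    then show ?thesis unfolding p by simp
  qed
  from computes_sequence[where T = "\<lambda>k. word_bits W (?p k)", OF this, of W]
  have "computes ?S (W * (7 * W)) (word_bits W (?p W))"
    using word_bits_const[of W 0] by auto
  also have "word_bits W (?p W) = word_bits W (\<lambda>x. \<phi> x * \<psi> x)"
  proof (rule word_bits_cong)
    show "take_bit W (?p W x) = take_bit W (\<phi> x * \<psi> x)" for x
      by (metis mod_mult_right_eq take_bit_eq_mod)
  qed
  finally show ?thesis .
qed

lemma computes_add':
  assumes "computes S c (word_bits W \<phi>)" "computes S d (word_bits W \<psi>)" "c + d + 6 * W \<le> e"
  shows "computes S e (word_bits W (\<lambda>x. \<phi> x + \<psi> x))"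
  by (rule computes_cong_trans[OF computes_Un[OF assms(1,2)] computes_add assms(3)])

lemma computes_mult':
  assumes "computes S c (word_bits W \<phi>)" "computes S d (word_bits W \<psi>)" "c + d + W * (7 * W) \<le> e"
  shows "computes S e (word_bits W (\<lambda>x. \<phi> x * \<psi> x))"
  by (rule computes_cong_trans[OF computes_Un[OF assms(1,2)] computes_mult assms(3)])

lemma computes_cmult:
  assumes "computes S c (word_bits W \<phi>)" "c + W * (7 * W) \<le> e"
  shows "computes S e (word_bits W (\<lambda>x. k * \<phi> x))"
  by (rule computes_mult'[OF computes.free[of _ _ 0] assms(1)])
    (use assms word_bits_const[of W k] in auto)

lemma computes_diff:
  assumes "computes S c (word_bits W \<phi>)" "computes S d (word_bits W \<psi>)"
    "c + d + (W * (7 * W) + 6 * W) \<le> e"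
  shows "computes S e (word_bits W (\<lambda>x. \<phi> x - \<psi> x))"
  using computes_add'[OF assms(1) computes_cmult[OF assms(2) order_refl, of "-1"], of e] assms(3)
  by simp

lemma computes_sum:
  assumes "finite I" "\<And>i. i \<in> I \<Longrightarrow> computes S c (word_bits W (\<phi> i))" "card I * (c + 6 * W) \<le> d"
  shows "computes S d (word_bits W (\<lambda>x. \<Sum>i\<in>I. \<phi> i x))"
proof -
  have "computes S (card I * (c + 6 * W)) (word_bits W (\<lambda>x. \<Sum>i\<in>I. \<phi> i x))"
    using assms(1,2)
  proof (induction rule: finite_induct)
    case empty
    show ?case using word_bits_const[of W 0] by (intro computes.free) auto
  next
    case (insert i I)
    have "computes S (card (insert i I) * (c + 6 * W)) (word_bits W (\<lambda>x. \<phi> i x + (\<Sum>i\<in>I. \<phi> i x)))"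
      by (rule computes_add'[of _ c _ _ "card I * (c + 6 * W)"]) (use insert in auto)
    with insert.hyps show ?case by simp
  qed
  then show ?thesis by (rule computes_mono) (use assms(3) in auto)
qed

text \<open>The selection is computed as g (\<phi> - \<psi>) + \<psi>. The word \<psi> enters both
  the difference and the final sum, hence 2 d in the cost.\<close>

lemma computes_if:
  assumes "g \<in> S \<union> consts_bool" "computes S c (word_bits W \<phi>)" "computes S d (word_bits W \<psi>)"
    "c + 2 * d + W * (7 * W) + 13 * W \<le> e"
  shows "computes S e (word_bits W (\<lambda>x. if g x then \<phi> x else \<psi> x))"
proof -
  let ?c = "c + d + (W * (7 * W) + 6 * W)"
  have "computes S ?c (word_bits W (\<lambda>x. \<phi> x - \<psi> x))"
    by (rule computes_diff[OF assms(2,3)]) simp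
  then have "computes S (?c + W) (word_bits W (\<lambda>x. of_bool (g x) * (\<phi> x - \<psi> x)))"
  proof (rule computes_trans)
    show "computes (S \<union> word_bits W (\<lambda>x. \<phi> x - \<psi> x)) W
        (word_bits W (\<lambda>x. of_bool (g x) * (\<phi> x - \<psi> x)))"
      by (rule computes_mono[OF computes_and[of g W "\<lambda>x. \<phi> x - \<psi> x"]])
        (use assms(1) in blast)+
  qed
  then have "computes S e (word_bits W (\<lambda>x. of_bool (g x) * (\<phi> x - \<psi> x) + \<psi> x))"
  proof (rule computes_add'[OF _ assms(3)])
    show "?c + W + d + 6 * W \<le> e" using assms(4) by simp
  qed
  moreover have "(\<lambda>x. of_bool (g x) * (\<phi> x - \<psi> x) + \<psi> x) = (\<lambda>x. if g x then \<phi> x else \<psi> x)"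
    by (rule ext) simp
  ultimately show ?thesis by (simp only:)
qed

section \<open>Bilinear algorithms from computation trees\<close>

lemma concat_map_upt:
  "concat (map (\<lambda>i. map (f i) [0..<n]) [0..<k]) = map (\<lambda>q. f (q div n) (q mod n)) [0..<k * n]"
proof (induction k)
  case (Suc k)
  have "[0..<Suc k * n] = [0..<k * n] @ map (\<lambda>j. j + k * n) [0..<n]"
    using upt_add_eq_append[of 0 "k * n" n] by (simp add: map_add_upt add.commute)
  then show ?case using Suc.IH by (auto simp: o_def)
qed simp

lemma entries_eq:
  assumes "A \<in> carrier_mat n n"
  shows "entries A = map (\<lambda>q. A $$ (q div n, q mod n)) [0..<n * n]"
  using assms by (simp add: entries_def mat_to_list_def concat_map_upt)

lemma those_eq_Some_iff: "those xs = Some ys \<longleftrightarrow> xs = map Some ys"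
proof (induction xs arbitrary: ys)
  case (Cons x xs)
  then show ?case by (cases x; cases ys) auto
qed auto

subsection \<open>Straight-line arithmetic on an open set of inputs\<close>

type_synonym rfun = "(nat \<Rightarrow> real) \<Rightarrow> real"

definition rconsts :: "rfun set" where
  "rconsts = range (\<lambda>r _. r)"

definition op_on :: "(nat \<Rightarrow> real) set \<Rightarrow> arith_op \<Rightarrow> rfun \<Rightarrow> rfun \<Rightarrow> rfun \<Rightarrow> bool" where
  "op_on V f u v k \<longleftrightarrow> (\<forall>p\<in>V. apply_op f (u p) (v p) = Some (k p))"

text \<open>The analogue of \<open>computes\<close> for real functions, with comparisons gone. A new
  function is tied to its arguments on V only, because a division need make sense only
  there.\<close>

inductive straight_line :: "(nat \<Rightarrow> real) set \<Rightarrow> rfun set \<Rightarrow> nat \<Rightarrow> rfun set \<Rightarrow> bool" for V where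
  finish: "T \<subseteq> S \<Longrightarrow> straight_line V S c T"
| step: "u \<in> S \<Longrightarrow> v \<in> S \<Longrightarrow> op_on V f u v k \<Longrightarrow> straight_line V (insert k S) c T \<Longrightarrow>
    straight_line V S (Suc c) T"

lemma straight_line_mono: "straight_line V S c T \<Longrightarrow> c \<le> d \<Longrightarrow> straight_line V S d T"
proof (induction arbitrary: d rule: straight_line.induct)
  case (finish T S c)
  then show ?case by (intro straight_line.finish)
next
  case (step u S v f k c T)
  then show ?case by (cases d) (auto intro: straight_line.step)
qed

fun operand_fun :: "rfun list \<Rightarrow> operand \<Rightarrow> rfun" where
  "operand_fun m (Cell i) = m ! i"
| "operand_fun m (Const r) = (\<lambda>_. r)"

lemma read_operand_fun:
  assumes "read (map (\<lambda>f. f p) m) u = Some x"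
  shows "operand_fun m u \<in> set m \<union> rconsts"
    and "\<And>q. read (map (\<lambda>f. f q) m) u = Some (operand_fun m u q)"
  using assms by (cases u; auto simp: rconsts_def split: if_splits)+

text \<open>Continuity of the functions in memory is the invariant. At a comparison of u and v the
  set where u > v is then open: if it is nonempty, restrict to it and follow the second branch; if
  it is empty, the first branch is taken on the whole set.\<close>

lemma tree_straight_line:
  assumes "open U" "U \<noteq> {}" "\<And>f. f \<in> set m \<Longrightarrow> continuous_on U f"
    "\<And>p. p \<in> U \<Longrightarrow> run_arith T (map (\<lambda>f. f p) m) = Some (map (\<lambda>f. f p) out)"
  shows "\<exists>V us. open V \<and> V \<noteq> {} \<and> V \<subseteq> U \<and>
    straight_line V (set m \<union> rconsts) (arith_ops T) (set us) \<and> length us = length out \<and> (\<forall>p\<in>V. \<forall>i<length out. (us ! i) p = (out ! i) p)"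
  using assms
proof (induction T arbitrary: m U)
  case (Return ws)
  from Return.prems(2) obtain p0 where "p0 \<in> U" by blast
  define us where "us = map (operand_fun m) ws"
  have rd: "map (read (map (\<lambda>f. f p) m)) ws = map Some (map (\<lambda>f. f p) out)" if "p \<in> U" for p
    using Return.prems(4)[OF that] by (simp only: run_arith.simps those_eq_Some_iff)
  have len: "length ws = length out" using rd[OF \<open>p0 \<in> U\<close>, THEN arg_cong, of length] by simp
  have rdi: "read (map (\<lambda>f. f p) m) (ws ! i) = Some ((out ! i) p)" if "p \<in> U" "i < length out" for p i
    using arg_cong[OF rd[OF that(1)], of "\<lambda>l. l ! i"] that(2) len by simp
  have "us ! i \<in> set m \<union> rconsts" if "i < length us" for i
    using read_operand_fun(1)[OF rdi[OF \<open>p0 \<in> U\<close>]] that len by (simp add: us_def)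
  then have "set us \<subseteq> set m \<union> rconsts"
    by (metis in_set_conv_nth subsetI)
  moreover have "(us ! i) p = (out ! i) p" if "p \<in> U" "i < length out" for p i
    using read_operand_fun(2)[OF rdi[OF that], of p] rdi[OF that] len that(2) by (simp add: us_def)
  ultimately show ?case
    using Return.prems(1,2) len
    by (intro exI[of _ U] exI[of _ us]) (auto simp: us_def intro: straight_line.finish)
next
  case (Compute f u v T)
  let ?m = "\<lambda>p. map (\<lambda>f. f p) m"
  have rd: "\<exists>x y z. read (?m p) u = Some x \<and> read (?m p) v = Some y \<and> apply_op f x y = Some z \<and>
      run_arith T (?m p @ [z]) = Some (map (\<lambda>f. f p) out)" if "p \<in> U" for p
    using Compute.prems(4)[OF that] by (auto split: option.splits)
  from Compute.prems(2) obtain p0 where p0: "p0 \<in> U" by blast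
  define u' v' where "u' = operand_fun m u" and "v' = operand_fun m v"
  have uv: "u' \<in> set m \<union> rconsts" "v' \<in> set m \<union> rconsts"
      "read (?m q) u = Some (u' q)" "read (?m q) v = Some (v' q)" for q
    using rd[OF p0] read_operand_fun[of p0 m u] read_operand_fun[of p0 m v]
    by (auto simp: u'_def v'_def)
  define k where "k p = the (apply_op f (u' p) (v' p))" for p
  have k: "apply_op f (u' p) (v' p) = Some (k p)"
    "run_arith T (?m p @ [k p]) = Some (map (\<lambda>f. f p) out)" if "p \<in> U" for p
    using rd[OF that] uv(3,4)[of p] by (auto simp: k_def)
  have cont: "continuous_on U u'" "continuous_on U v'"
    using uv Compute.prems(3) by (auto simp: rconsts_def)
  have kc: "continuous_on U k"
  proof (cases f)
    case Divide
    \<comment> \<open>The run succeeds at every point of U, so the denominator has no zero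
      there.\<close>
    have nz: "v' p \<noteq> 0" if "p \<in> U" for p using k(1)[OF that] Divide by (auto split: if_splits)
    have "continuous_on U (\<lambda>p. u' p / v' p)"
      using cont nz by (intro continuous_intros) auto
    then show ?thesis
      by (rule continuous_on_eq) (use nz in \<open>auto simp: k_def Divide\<close>)
  qed (use cont in \<open>auto simp: k_def intro!: continuous_intros\<close>)
  have "\<exists>V us. open V \<and> V \<noteq> {} \<and> V \<subseteq> U \<and>
    straight_line V (set (m @ [k]) \<union> rconsts) (arith_ops T) (set us) \<and> length us = length out \<and>
    (\<forall>p\<in>V. \<forall>i<length out. (us ! i) p = (out ! i) p)"
    by (rule Compute.IH) (use Compute.prems kc k in auto)
  then obtain V us where V: "open V" "V \<noteq> {}" "V \<subseteq> U" "length us = length out"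
    "straight_line V (insert k (set m \<union> rconsts)) (arith_ops T) (set us)"
    "\<forall>p\<in>V. \<forall>i<length out. (us ! i) p = (out ! i) p" by auto
  have "straight_line V (set m \<union> rconsts) (Suc (arith_ops T)) (set us)"
    by (rule straight_line.step[OF uv(1,2) _ V(5)]) (use V(3) k in \<open>auto simp: op_on_def\<close>)
  with V show ?case by auto
next
  case (If_le u v T1 T2)
  let ?m = "\<lambda>p. map (\<lambda>f. f p) m"
  have rd: "\<exists>x y. read (?m p) u = Some x \<and> read (?m p) v = Some y \<and>
      run_arith (if x \<le> y then T1 else T2) (?m p) = Some (map (\<lambda>f. f p) out)" if "p \<in> U" for p
    using If_le.prems(4)[OF that] by (auto split: option.splits)
  from If_le.prems(2) obtain p0 where p0: "p0 \<in> U" by blast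
  define u' v' where "u' = operand_fun m u" and "v' = operand_fun m v"
  have uv: "u' \<in> set m \<union> rconsts" "v' \<in> set m \<union> rconsts"
      "read (?m q) u = Some (u' q)" "read (?m q) v = Some (v' q)" for q
    using rd[OF p0] read_operand_fun[of p0 m u] read_operand_fun[of p0 m v]
    by (auto simp: u'_def v'_def)
  have run: "run_arith (if u' p \<le> v' p then T1 else T2) (?m p) = Some (map (\<lambda>f. f p) out)"
    if "p \<in> U" for p
    using rd[OF that] uv(3,4)[of p] by auto
  have cont: "continuous_on U u'" "continuous_on U v'"
    using uv If_le.prems(3) by (auto simp: rconsts_def)
  define U' where "U' = U \<inter> (\<lambda>p. u' p - v' p) -` {0<..}"
  have "open U'"
    unfolding U'_def using cont If_le.prems(1)
    by (intro continuous_open_preimage continuous_intros) auto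
  show ?case
  proof (cases "U' = {}")
    case True
    then have "\<And>p. p \<in> U \<Longrightarrow> u' p \<le> v' p" by (force simp: U'_def)
    then have "\<exists>V us. open V \<and> V \<noteq> {} \<and> V \<subseteq> U \<and> straight_line V (set m \<union> rconsts) (arith_ops T1) (set us) \<and>
      length us = length out \<and> (\<forall>p\<in>V. \<forall>i<length out. (us ! i) p = (out ! i) p)"
      using run by (intro If_le.IH(1)) (use If_le.prems in auto)
    then show ?thesis
      by (elim ex_forward conj_forward) (auto elim: straight_line_mono)
  next
    case False
    have "\<And>p. p \<in> U' \<Longrightarrow> \<not> u' p \<le> v' p" by (auto simp: U'_def)
    moreover have "\<And>p. p \<in> U' \<Longrightarrow> p \<in> U" by (auto simp: U'_def)
    ultimately have "\<And>p. p \<in> U' \<Longrightarrow> run_arith T2 (?m p) = Some (map (\<lambda>f. f p) out)"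
      using run by fastforce
    then have "\<exists>V us. open V \<and> V \<noteq> {} \<and> V \<subseteq> U' \<and> straight_line V (set m \<union> rconsts) (arith_ops T2) (set us) \<and>
      length us = length out \<and> (\<forall>p\<in>V. \<forall>i<length out. (us ! i) p = (out ! i) p)"
      using False \<open>open U'\<close> continuous_on_subset[OF If_le.prems(3), of _ U']
      by (intro If_le.IH(2)) (auto simp: U'_def)
    then show ?thesis
      by (elim ex_forward conj_forward) (auto elim: straight_line_mono simp: U'_def)
  qed
qed

subsection \<open>Jets of order two\<close>

text \<open>
  The jet of \<open>F\<close> at the origin modulo the squares of both variables, i.e.\ the value of \<open>F\<close> at
  \<open>(s, t)\<close> with \<open>s\<^sup>2 = t\<^sup>2 = 0\<close>.  Its \<open>s t\<close>-coefficient is what turns a straight-line program into a bilinear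
  algorithm: for a product or a quotient it depends linearly on the coefficients of the arguments, up to
  two products of first-order coefficients.
\<close>

definition jet :: "(real \<times> real \<Rightarrow> real) \<Rightarrow> real \<Rightarrow> real \<Rightarrow> real \<Rightarrow> real \<Rightarrow> bool" where
  "jet F c a b e \<longleftrightarrow> (\<exists>u v. isCont u 0 \<and> isCont v 0 \<and>
     (\<forall>\<^sub>F z in nhds 0. F z = c + a * fst z + b * snd z + e * (fst z * snd z)
        + (fst z)\<^sup>2 * u z + (snd z)\<^sup>2 * v z))"

lemma jetI:
  assumes "isCont u 0" "isCont v 0"
    "\<forall>\<^sub>F z in nhds 0. F z = c + a * fst z + b * snd z + e * (fst z * snd z)
        + (fst z)\<^sup>2 * u z + (snd z)\<^sup>2 * v z"
  shows "jet F c a b e"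
  using assms by (auto simp: jet_def)

lemma jet_poly: "jet (\<lambda>z. c + a * fst z + b * snd z + e * (fst z * snd z)) c a b e"
  by (rule jetI[of "\<lambda>_. 0" "\<lambda>_. 0"]) auto

lemma jet_cong: "jet F c a b e \<Longrightarrow> \<forall>\<^sub>F z in nhds 0. G z = F z \<Longrightarrow> jet G c a b e"
  unfolding jet_def by (elim exE conjE, intro exI conjI) (assumption | erule (1) eventually_elim2, simp)+

lemma jet_add:
  assumes "jet F c a b e" "jet G c' a' b' e'"
  shows "jet (\<lambda>z. F z + G z) (c + c') (a + a') (b + b') (e + e')"
proof -
  from assms obtain u v u' v' where *: "isCont u 0" "isCont v 0" "isCont u' 0" "isCont v' 0"
    "\<forall>\<^sub>F z in nhds 0. F z = c + a * fst z + b * snd z + e * (fst z * snd z) + (fst z)\<^sup>2 * u z + (snd z)\<^sup>2 * v z"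
    "\<forall>\<^sub>F z in nhds 0. G z = c' + a' * fst z + b' * snd z + e' * (fst z * snd z) + (fst z)\<^sup>2 * u' z + (snd z)\<^sup>2 * v' z"
    by (auto simp: jet_def)
  show ?thesis
  proof (rule jetI)
    show "isCont (\<lambda>z. u z + u' z) 0" "isCont (\<lambda>z. v z + v' z) 0"
      using * by (auto intro: continuous_intros)
  qed (use *(5,6) in eventually_elim, simp add: algebra_simps)
qed

lemma jet_mult:
  assumes "jet F c a b e" "jet G c' a' b' e'"
  shows "jet (\<lambda>z. F z * G z) (c * c') (c * a' + a * c') (c * b' + b * c')
    (c * e' + e * c' + a * b' + b * a')"
proof -
  from assms obtain u v u' v' where *: "isCont u 0" "isCont v 0" "isCont u' 0" "isCont v' 0"
    "\<forall>\<^sub>F z in nhds 0. F z = c + a * fst z + b * snd z + e * (fst z * snd z) + (fst z)\<^sup>2 * u z + (snd z)\<^sup>2 * v z"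
    "\<forall>\<^sub>F z in nhds 0. G z = c' + a' * fst z + b' * snd z + e' * (fst z * snd z) + (fst z)\<^sup>2 * u' z + (snd z)\<^sup>2 * v' z"
    by (auto simp: jet_def)
  let ?P = "\<lambda>z. c + a * fst z + b * snd z + e * (fst z * snd z)"
  let ?P' = "\<lambda>z. c' + a' * fst z + b' * snd z + e' * (fst z * snd z)"
  let ?G = "\<lambda>z. ?P' z + (fst z)\<^sup>2 * u' z + (snd z)\<^sup>2 * v' z"
  show ?thesis
  proof (rule jetI)
    \<comment> \<open>With s = fst z and t = snd z, these are the coefficients of s^2 and t^2 in the
      product: what the polynomial parts leave over, plus the remainders of each factor times the
      other factor. The term e e' s^2 t^2 could go to either side and is put into the first.\<close>
    show "isCont (\<lambda>z. a * a' + (a * e' + e * a') * snd z + e * e' * (snd z)\<^sup>2 + u z * ?G z + u' z * ?P z) 0"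
      "isCont (\<lambda>z. b * b' + (b * e' + e * b') * fst z + v z * ?G z + v' z * ?P z) 0"
      using * by (auto intro!: continuous_intros)
  qed (use *(5,6) in eventually_elim, simp add: algebra_simps power2_eq_square)
qed

lemma jet_const: "jet (\<lambda>_. c) c 0 0 0"
  using jet_poly[of c 0 0 0] by simp

lemma jet_diff:
  assumes "jet F c a b e" "jet G c' a' b' e'"
  shows "jet (\<lambda>z. F z - G z) (c - c') (a - a') (b - b') (e - e')"
  using jet_add[OF assms(1) jet_mult[OF jet_const[of "-1"] assms(2)]] by simp

text \<open>The equations say that the polynomial H with coefficients h0, ..., h3 satisfies H G = F
  up to order two. So F - H G is pure remainder, and dividing it by G, which is bounded away from 0
  near the origin, keeps that form.\<close>

lemma jet_divide:
  assumes "jet F c a b e" "jet G c' a' b' e'" "c' \<noteq> 0"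
    and h: "h0 * c' = c" "h0 * a' + h1 * c' = a" "h0 * b' + h2 * c' = b"
      "h0 * e' + h3 * c' + h1 * b' + h2 * a' = e"
  shows "jet (\<lambda>z. F z / G z) h0 h1 h2 h3"
proof -
  let ?H = "\<lambda>z. h0 + h1 * fst z + h2 * snd z + h3 * (fst z * snd z)"
  have "jet (\<lambda>z. F z - ?H z * G z) 0 0 0 0"
    using jet_diff[OF assms(1) jet_mult[OF jet_poly[of h0 h1 h2 h3] assms(2)]] h by simp
  then obtain u v where uv: "isCont u 0" "isCont v 0"
    "\<forall>\<^sub>F z in nhds 0. F z - ?H z * G z = (fst z)\<^sup>2 * u z + (snd z)\<^sup>2 * v z"
    by (auto simp: jet_def)
  from assms(2) obtain u' v' where uv': "isCont u' 0" "isCont v' 0"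
    "\<forall>\<^sub>F z in nhds 0. G z = c' + a' * fst z + b' * snd z + e' * (fst z * snd z) + (fst z)\<^sup>2 * u' z + (snd z)\<^sup>2 * v' z"
    by (auto simp: jet_def)
  \<comment> \<open>G itself is only known to agree with this expression near the origin; the
    expression is continuous at 0, hence nonzero nearby.\<close>
  define G' where "G' z = c' + a' * fst z + b' * snd z + e' * (fst z * snd z) + (fst z)\<^sup>2 * u' z + (snd z)\<^sup>2 * v' z" for z
  have G': "isCont G' 0" "G' 0 \<noteq> 0"
    unfolding G'_def using uv' assms(3) by (auto intro!: continuous_intros)
  have nz: "\<forall>\<^sub>F z in nhds 0. G' z \<noteq> 0"
    using G' by (intro tendsto_imp_eventually_ne[of G' "G' 0"])
      (auto simp: continuous_at_imp_continuous_at_within isCont_def tendsto_at_iff_tendsto_nhds)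
  show ?thesis
  proof (rule jetI)
    show "isCont (\<lambda>z. u z / G' z) 0" "isCont (\<lambda>z. v z / G' z) 0"
      using uv G' by (auto intro!: continuous_intros)
    show "\<forall>\<^sub>F z in nhds 0. F z / G z = h0 + h1 * fst z + h2 * snd z + h3 * (fst z * snd z)
        + (fst z)\<^sup>2 * (u z / G' z) + (snd z)\<^sup>2 * (v z / G' z)"
      using uv(3) uv'(3) nz
    proof eventually_elim
      case (elim z)
      then have "G z = G' z" by (simp add: G'_def)
      with elim have "F z / G z = (?H z * G z + ((fst z)\<^sup>2 * u z + (snd z)\<^sup>2 * v z)) / G' z"
        by (simp add: algebra_simps)
      also have "\<dots> = ?H z + ((fst z)\<^sup>2 * u z + (snd z)\<^sup>2 * v z) / G' z"
        using \<open>G z = G' z\<close> elim by (simp add: add_divide_distrib)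
      finally show ?case by (simp add: add_divide_distrib)
    qed
  qed
qed

text \<open>The values at (h, h), (h, 0) and (0, h) are combined so that a and b cancel. After
  division by h^2 this expresses e through values of u and v, which cancel in the limit by
  continuity at 0.\<close>

lemma jet_zero_unique:
  assumes "jet (\<lambda>_. 0) c a b e"
  shows "e = 0"
proof -
  from assms obtain u v where uv: "isCont u 0" "isCont v 0"
    and ev: "\<forall>\<^sub>F z in nhds 0. 0 = c + a * fst z + b * snd z + e * (fst z * snd z) + (fst z)\<^sup>2 * u z + (snd z)\<^sup>2 * v z"
    by (auto simp: jet_def)
  define Q where "Q z \<longleftrightarrow> 0 = c + a * fst z + b * snd z + e * (fst z * snd z) + (fst z)\<^sup>2 * u z + (snd z)\<^sup>2 * v z" for z
  have ev: "eventually Q (nhds 0)" using ev unfolding Q_def by simp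
  have lim: "((\<lambda>h. f h) \<longlongrightarrow> 0) (at_right 0)"
    if "f = (\<lambda>h. (h, h)) \<or> f = (\<lambda>h. (h, 0)) \<or> f = (\<lambda>h. (0, h))" for f :: "real \<Rightarrow> real \<times> real"
    using that by (auto simp: zero_prod_def intro!: tendsto_Pair tendsto_ident_at tendsto_const)
  define w where "w h = u (h, 0) + v (0, h) - u (h, h) - v (h, h)" for h
  have "(w \<longlongrightarrow> u 0 + v 0 - u 0 - v 0) (at_right 0)"
    unfolding w_def
    by (intro tendsto_intros isCont_tendsto_compose[OF uv(1)] isCont_tendsto_compose[OF uv(2)] lim) auto
  moreover have "\<forall>\<^sub>F h in at_right 0. w h = e"
  proof -
    have c: "c = 0" using eventually_nhds_x_imp_x[OF ev] by (simp add: Q_def)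
    have "\<forall>\<^sub>F h in at_right 0. Q (h, h)" "\<forall>\<^sub>F h in at_right 0. Q (h, 0)" "\<forall>\<^sub>F h in at_right 0. Q (0, h)"
      by (rule eventually_compose_filterlim[OF ev lim], simp)+
    moreover have "\<forall>\<^sub>F h::real in at_right 0. h \<noteq> 0" by (simp add: eventually_at_filter)
    ultimately show ?thesis
    proof eventually_elim
      case (elim h)
      then have "h\<^sup>2 * w h = h\<^sup>2 * e"
        by (simp add: w_def Q_def c algebra_simps power2_eq_square)
      with elim show ?case by simp
    qed
  qed
  ultimately have "((\<lambda>_. e) \<longlongrightarrow> 0) (at_right (0::real))"
    using tendsto_cong[of w "\<lambda>_. e" "at_right 0" 0] by simp
  then show ?thesis by (simp add: tendsto_const_iff)
qed

lemma jet_unique: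
  assumes "jet F c a b e" "jet F c' a' b' e'"
  shows "e = e'"
  using jet_zero_unique[of "c - c'" "a - a'" "b - b'" "e - e'"] jet_diff[OF assms] by simp

subsection \<open>Extraction of the bilinear part\<close>

definition linear_form :: "nat \<Rightarrow> rfun \<Rightarrow> bool" where
  "linear_form N a \<longleftrightarrow> (\<exists>c. \<forall>x. a x = (\<Sum>i<N. c i * x i))"

lemma linear_form_add: "linear_form N a \<Longrightarrow> linear_form N b \<Longrightarrow> linear_form N (\<lambda>x. a x + b x)"
  unfolding linear_form_def
  by (elim exE, rule_tac x = "\<lambda>i. c i + ca i" in exI) (simp add: sum.distrib algebra_simps)

lemma linear_form_cmult: "linear_form N a \<Longrightarrow> linear_form N (\<lambda>x. r * a x)"
  unfolding linear_form_def
  by (elim exE, rule_tac x = "\<lambda>i. r * c i" in exI) (simp add: sum_distrib_left mult.assoc)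

lemma linear_form_zero: "linear_form N (\<lambda>_. 0)"
  unfolding linear_form_def by (rule exI[of _ "\<lambda>_. 0"]) simp

lemma linear_form_coord: "i < N \<Longrightarrow> linear_form N (\<lambda>x. x i)"
  unfolding linear_form_def by (rule exI[of _ "\<lambda>j. if j = i then 1 else 0"]) (simp add: if_distrib[of "\<lambda>r. r * _"] cong: if_cong)

lemmas linear_form_intros = linear_form_add linear_form_cmult linear_form_zero linear_form_coord

lemma linear_form_diff: "linear_form N a \<Longrightarrow> linear_form N b \<Longrightarrow> linear_form N (\<lambda>x. a x - b x)"
  using linear_form_add[OF _ linear_form_cmult[of N b "-1"]] by simp

text \<open>Bilinear expressions generated by the products in \<open>B\<close>. Linear combinations
  are free; the number of products becomes the rank of the bilinear algorithm.\<close>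

inductive product_span :: "(rfun \<times> rfun) set \<Rightarrow> ((nat \<Rightarrow> real) \<Rightarrow> (nat \<Rightarrow> real) \<Rightarrow> real) \<Rightarrow> bool" for B where
  zero: "product_span B (\<lambda>_ _. 0)"
| prod: "(\<phi>, \<psi>) \<in> B \<Longrightarrow> product_span B (\<lambda>x y. \<phi> x * \<psi> y)"
| add: "product_span B e \<Longrightarrow> product_span B e' \<Longrightarrow> product_span B (\<lambda>x y. e x y + e' x y)"
| cmult: "product_span B e \<Longrightarrow> product_span B (\<lambda>x y. r * e x y)"

lemma product_span_mono: "product_span B e \<Longrightarrow> B \<subseteq> B' \<Longrightarrow> product_span B' e"
  by (induction rule: product_span.induct) (auto intro: product_span.intros)

lemma product_span_sum:
  assumes "product_span B e" "finite B"
  shows "\<exists>\<gamma>. \<forall>x y. e x y = (\<Sum>p\<in>B. \<gamma> p * (fst p x * snd p y))"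
  using assms
proof (induction rule: product_span.induct)
  case zero
  show ?case by (rule exI[of _ "\<lambda>_. 0"]) simp
next
  case (prod \<phi> \<psi>)
  then show ?case
    by (intro exI[of _ "\<lambda>p. if p = (\<phi>, \<psi>) then 1 else 0"]) (simp add: if_distrib[of "\<lambda>r. r * _"] cong: if_cong)
next
  case (add e e')
  then obtain \<gamma> \<gamma>' where "\<forall>x y. e x y = (\<Sum>p\<in>B. \<gamma> p * (fst p x * snd p y))"
    "\<forall>x y. e' x y = (\<Sum>p\<in>B. \<gamma>' p * (fst p x * snd p y))" by blast
  then show ?case
    by (intro exI[of _ "\<lambda>p. \<gamma> p + \<gamma>' p"]) (simp add: sum.distrib algebra_simps)
next
  case (cmult e r)
  then obtain \<gamma> where "\<forall>x y. e x y = (\<Sum>p\<in>B. \<gamma> p * (fst p x * snd p y))" by blast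
  then show ?case
    by (intro exI[of _ "\<lambda>p. r * \<gamma> p"]) (simp add: sum_distrib_left mult.assoc)
qed

text \<open>A two-parameter displacement of p. The directions x and y will later carry the left and
  the right factor of a matrix product, so that the mixed coefficient is bilinear in the two
  factors.\<close>

definition shift_point :: "(nat \<Rightarrow> real) \<Rightarrow> (nat \<Rightarrow> real) \<Rightarrow> (nat \<Rightarrow> real) \<Rightarrow> real \<times> real \<Rightarrow> nat \<Rightarrow> real" where
  "shift_point p x y z = (\<lambda>i. p i + x i * fst z + y i * snd z)"

lemma eventually_shift_point:
  assumes "open V" "p \<in> V"
  shows "\<forall>\<^sub>F z in nhds 0. shift_point p x y z \<in> V"
proof -
  have "continuous_on UNIV (shift_point p x y)"
    unfolding shift_point_def
    by (rule continuous_on_coordinatewise_then_product) (intro continuous_intros)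
  then have "isCont (shift_point p x y) 0"
    by (metis continuous_on_eq_continuous_at open_UNIV UNIV_I)
  moreover have "shift_point p x y 0 = p" by (simp add: shift_point_def)
  ultimately have "(shift_point p x y \<longlongrightarrow> p) (nhds 0)"
    by (metis isCont_def tendsto_at_iff_tendsto_nhds)
  then show ?thesis using assms by (auto dest: topological_tendstoD)
qed

definition has_jets :: "(nat \<Rightarrow> real) \<Rightarrow> nat \<Rightarrow> (rfun \<times> rfun) set \<Rightarrow> rfun \<Rightarrow> bool" where
  "has_jets p N B f \<longleftrightarrow> (\<exists>a b e. linear_form N a \<and> linear_form N b \<and> product_span B e \<and>
     (\<forall>x y. jet (\<lambda>z. f (shift_point p x y z)) (f p) (a x) (b y) (e x y)))"

lemma has_jetsI:
  assumes "linear_form N a" "linear_form N b" "product_span B e"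
    "\<And>x y. jet (\<lambda>z. f (shift_point p x y z)) (f p) (a x) (b y) (e x y)"
  shows "has_jets p N B f"
  using assms by (auto simp: has_jets_def)

lemma has_jets_mono: "has_jets p N B f \<Longrightarrow> B \<subseteq> B' \<Longrightarrow> has_jets p N B' f"
  unfolding has_jets_def by (blast intro: product_span_mono)

lemma has_jets_coord: "i < N \<Longrightarrow> has_jets p N B (\<lambda>q. q i)"
  using jet_poly[of "p i" _ _ 0]
  by (intro has_jetsI[where a = "\<lambda>x. x i" and b = "\<lambda>y. y i" and e = "\<lambda>_ _. 0"])
     (auto intro: linear_form_coord product_span.zero simp: shift_point_def)

lemma has_jets_const: "f \<in> rconsts \<Longrightarrow> has_jets p N B f"
  by (intro has_jetsI[where a = "\<lambda>x. 0" and b = "\<lambda>y. 0" and e = "\<lambda>_ _. 0"])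
     (auto intro: linear_form_zero product_span.zero jet_const simp: rconsts_def)

text \<open>Multiplying by the constant terms of the arguments is free, since p is fixed. Only
  products of first-order coefficients are new, and a multiplication or a division needs two of
  them.\<close>

lemma has_jets_op:
  assumes "has_jets p N B u" "has_jets p N B v" "op_on V f u v k" "open V" "p \<in> V"
  shows "\<exists>\<phi> \<psi> \<phi>' \<psi>'. linear_form N \<phi> \<and> linear_form N \<psi> \<and> linear_form N \<phi>' \<and> linear_form N \<psi>' \<and>
    has_jets p N (B \<union> {(\<phi>, \<psi>), (\<phi>', \<psi>')}) k"
proof -
  from assms(1) obtain a b e where u: "linear_form N a" "linear_form N b" "product_span B e"
    "\<And>x y. jet (\<lambda>z. u (shift_point p x y z)) (u p) (a x) (b y) (e x y)"
    by (auto simp: has_jets_def)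
  from assms(2) obtain a' b' e' where v: "linear_form N a'" "linear_form N b'" "product_span B e'"
    "\<And>x y. jet (\<lambda>z. v (shift_point p x y z)) (v p) (a' x) (b' y) (e' x y)"
    by (auto simp: has_jets_def)
  have ev: "\<forall>\<^sub>F z in nhds 0. apply_op f (u (shift_point p x y z)) (v (shift_point p x y z)) =
      Some (k (shift_point p x y z))" for x y
    using eventually_shift_point[OF assms(4,5), of x y]
    by eventually_elim (use assms(3) in \<open>auto simp: op_on_def\<close>)
  have at: "apply_op f (u p) (v p) = Some (k p)" using assms(3,5) by (auto simp: op_on_def)
  show ?thesis
  proof (cases f)
    case Plus
    \<comment> \<open>Sums and differences need no new product; a harmless pair is inserted to fit
      the uniform statement.\<close>
    have "has_jets p N (B \<union> {(a, b), (a, b)}) k"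
    proof (rule has_jetsI)
      show "jet (\<lambda>z. k (shift_point p x y z)) (k p) (a x + a' x) (b y + b' y) (e x y + e' x y)" for x y
      proof -
        have "jet (\<lambda>z. k (shift_point p x y z)) (u p + v p) (a x + a' x) (b y + b' y) (e x y + e' x y)"
        proof (rule jet_cong[OF jet_add[OF u(4) v(4)]])
          show "\<forall>\<^sub>F z in nhds 0. k (shift_point p x y z) = u (shift_point p x y z) + v (shift_point p x y z)"
            using ev[of x y] by eventually_elim (simp add: Plus)
        qed
        then show ?thesis using at by (simp add: Plus)
      qed
      show "product_span (B \<union> {(a, b), (a, b)}) (\<lambda>x y. e x y + e' x y)"
        using u v by (intro product_span.add) (auto intro: product_span_mono)
    qed (use u v in \<open>auto intro!: linear_form_intros\<close>)
    with u show ?thesis by blast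
  next
    case Minus
    have "has_jets p N (B \<union> {(a, b), (a, b)}) k"
    proof (rule has_jetsI)
      show "jet (\<lambda>z. k (shift_point p x y z)) (k p) (a x - a' x) (b y - b' y) (e x y + (-1) * e' x y)" for x y
      proof -
        have "jet (\<lambda>z. k (shift_point p x y z)) (u p - v p) (a x - a' x) (b y - b' y) (e x y - e' x y)"
        proof (rule jet_cong[OF jet_diff[OF u(4) v(4)]])
          show "\<forall>\<^sub>F z in nhds 0. k (shift_point p x y z) = u (shift_point p x y z) - v (shift_point p x y z)"
            using ev[of x y] by eventually_elim (simp add: Minus)
        qed
        then show ?thesis using at by (simp add: Minus)
      qed
      show "product_span (B \<union> {(a, b), (a, b)}) (\<lambda>x y. e x y + (-1) * e' x y)"
        using u v by (intro product_span.add product_span.cmult) (auto intro: product_span_mono)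
    qed (use u v in \<open>auto intro!: linear_form_diff\<close>)
    with u show ?thesis by blast
  next
    case Times
    let ?B = "B \<union> {(a, b'), (a', b)}"
    have "has_jets p N ?B k"
    proof (rule has_jetsI)
      show "jet (\<lambda>z. k (shift_point p x y z)) (k p) (u p * a' x + v p * a x) (u p * b' y + v p * b y)
          (u p * e' x y + v p * e x y + a x * b' y + a' x * b y)" for x y
      proof -
        have "jet (\<lambda>z. k (shift_point p x y z)) (u p * v p) (u p * a' x + a x * v p) (u p * b' y + b y * v p)
            (u p * e' x y + e x y * v p + a x * b' y + b y * a' x)"
        proof (rule jet_cong[OF jet_mult[OF u(4) v(4)]])
          show "\<forall>\<^sub>F z in nhds 0. k (shift_point p x y z) = u (shift_point p x y z) * v (shift_point p x y z)"
            using ev[of x y] by eventually_elim (simp add: Times)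
        qed
        then show ?thesis using at by (simp add: Times mult.commute)
      qed
      show "product_span ?B (\<lambda>x y. u p * e' x y + v p * e x y + a x * b' y + a' x * b y)"
        using u v by (intro product_span.add product_span.cmult product_span.prod) (auto intro: product_span_mono)
    qed (use u v in \<open>auto intro!: linear_form_intros\<close>)
    with u v show ?thesis by blast
  next
    case Divide
    \<comment> \<open>The product rule for k v = u, solved for the coefficients of the quotient k
      one after the other. The first-order coefficients stay linear, so the two new products again
      have linear factors.\<close>
    define h0 where "h0 = u p / v p"
    define h1 where "h1 = (\<lambda>x. (1 / v p) * (a x - h0 * a' x))"
    define h2 where "h2 = (\<lambda>y. (1 / v p) * (b y - h0 * b' y))"
    define h3 where "h3 = (\<lambda>x y. (1 / v p) * (e x y + (- h0) * e' x y + (- 1) * (h1 x * b' y) + (- 1) * (a' x * h2 y)))"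
    have nz: "v p \<noteq> 0" and kp: "k p = h0" using at Divide by (auto simp: h0_def split: if_splits)
    have lin: "linear_form N h1" "linear_form N h2"
      unfolding h1_def h2_def by (intro linear_form_cmult linear_form_diff u v)+
    let ?B = "B \<union> {(h1, b'), (a', h2)}"
    have "has_jets p N ?B k"
    proof (rule has_jetsI)
      fix x y
      have "jet (\<lambda>z. u (shift_point p x y z) / v (shift_point p x y z)) h0 (h1 x) (h2 y) (h3 x y)"
        by (rule jet_divide[OF u(4) v(4) nz])
          (use nz in \<open>simp_all add: h0_def h1_def h2_def h3_def field_simps\<close>)
      then show "jet (\<lambda>z. k (shift_point p x y z)) (k p) (h1 x) (h2 y) (h3 x y)"
        unfolding kp
      proof (rule jet_cong)
        show "\<forall>\<^sub>F z in nhds 0. k (shift_point p x y z) = u (shift_point p x y z) / v (shift_point p x y z)"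
          using ev[of x y] by eventually_elim (auto simp: Divide split: if_splits)
      qed
    next
      show "product_span ?B h3"
        unfolding h3_def using u v
        by (intro product_span.add product_span.cmult product_span.prod) (auto intro: product_span_mono)
    qed (use lin in auto)
    with lin v show ?thesis by blast
  qed
qed

lemma straight_line_jets:
  assumes "straight_line V S c T" "open V" "p \<in> V" "finite B"
    "\<And>f. f \<in> S \<Longrightarrow> has_jets p N B f"
    "\<And>q. q \<in> B \<Longrightarrow> linear_form N (fst q) \<and> linear_form N (snd q)"
  shows "\<exists>B'. finite B' \<and> card B' \<le> card B + 2 * c \<and> (\<forall>f\<in>T. has_jets p N B' f) \<and>
    (\<forall>q\<in>B'. linear_form N (fst q) \<and> linear_form N (snd q))"
  using assms
proof (induction arbitrary: B rule: straight_line.induct)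
  case (finish T S c)
  then show ?case by (intro exI[of _ B]) auto
next
  case (step u S v f k c T)
  from has_jets_op[OF step.prems(4)[OF step.hyps(1)] step.prems(4)[OF step.hyps(2)] step.hyps(3) step.prems(1,2)]
  obtain \<phi> \<psi> \<phi>' \<psi>' where lin: "linear_form N \<phi>" "linear_form N \<psi>" "linear_form N \<phi>'" "linear_form N \<psi>'"
    and k: "has_jets p N (B \<union> {(\<phi>, \<psi>), (\<phi>', \<psi>')}) k" by blast
  let ?B = "B \<union> {(\<phi>, \<psi>), (\<phi>', \<psi>')}"
  have "\<exists>B'. finite B' \<and> card B' \<le> card ?B + 2 * c \<and> (\<forall>f\<in>T. has_jets p N B' f) \<and>
    (\<forall>q\<in>B'. linear_form N (fst q) \<and> linear_form N (snd q))"
  proof (rule step.IH)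
    show "has_jets p N ?B f" if "f \<in> insert k S" for f
      using that k has_jets_mono[OF step.prems(4)[of f], of ?B] by auto
  qed (use step.prems lin in auto)
  moreover have "card ?B \<le> card B + 2"
    using card_Un_le[of B "{(\<phi>, \<psi>), (\<phi>', \<psi>')}"] card_insert_le_m1[of 2 "{(\<phi>', \<psi>')}" "(\<phi>, \<psi>)"]
    by simp
  ultimately show ?case by (elim exE, rule_tac x = B' in exI) auto
qed

definition bilinear_algorithm :: "nat \<Rightarrow> nat \<Rightarrow> (nat \<Rightarrow> nat \<Rightarrow> nat \<Rightarrow> real) \<Rightarrow> (nat \<Rightarrow> nat \<Rightarrow> nat \<Rightarrow> real) \<Rightarrow>
    (nat \<Rightarrow> nat \<Rightarrow> nat \<Rightarrow> real) \<Rightarrow> bool" where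
  "bilinear_algorithm n R \<alpha> \<beta> \<gamma> \<longleftrightarrow> (\<forall>A B. \<forall>i<n. \<forall>j<n.
     (\<Sum>l<n. A i l * B l j) = (\<Sum>r<R. \<gamma> r i j * ((\<Sum>a<n. \<Sum>b<n. \<alpha> r a b * A a b) * (\<Sum>a<n. \<Sum>b<n. \<beta> r a b * B a b))))"

lemma row_major_less: "a < n \<Longrightarrow> b < n \<Longrightarrow> a * n + b < n * n" for a b n :: nat
  using mult_le_mono1[of "Suc a" n n] by simp

lemma sum_div_mod: "(\<Sum>a<n. \<Sum>b<n. g a b) = (\<Sum>q<n * n. g (q div n) (q mod n))" for g :: "nat \<Rightarrow> nat \<Rightarrow> real"
proof (cases "n = 0")
  case False
  have "(\<Sum>q<n * n. g (q div n) (q mod n)) = (\<Sum>(a, b)\<in>{..<n} \<times> {..<n}. g a b)"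
    by (rule sum.reindex_bij_witness[where i = "\<lambda>(a, b). a * n + b" and j = "\<lambda>q. (q div n, q mod n)"])
      (use False in \<open>auto simp: less_mult_imp_div_less intro: row_major_less\<close>)
  then show ?thesis by (simp add: sum.cartesian_product)
qed simp

text \<open>The mixed coefficient of a straight-line program lies in the span of at most two
  products per operation. For an entry of A B, viewed as a quadratic polynomial in all 2 n^2 inputs,
  the same coefficient is the polarized sum, whatever the base point p. Uniqueness of the
  coefficient identifies the two.\<close>

theorem bilinear_algorithm_from_tree:
  assumes "multiplies_exactly n T" "n \<ge> 1"
  shows "\<exists>R \<alpha> \<beta> \<gamma>. R \<le> 2 * arith_ops T \<and> bilinear_algorithm n R \<alpha> \<beta> \<gamma>"
proof -
  let ?N = "2 * n * n"
  define m where "m = map (\<lambda>i (q::nat\<Rightarrow>real). q i) [0..<?N]"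
  define out :: "rfun list" where "out = map (\<lambda>k q. \<Sum>l<n. q (k div n * n + l) * q (n * n + (l * n + k mod n))) [0..<n * n]"
  have run: "run_arith T (map (\<lambda>f. f q) m) = Some (map (\<lambda>f. f q) out)" for q
  proof -
    define A where "A = mat n n (\<lambda>(i, j). q (i * n + j))"
    define B where "B = mat n n (\<lambda>(i, j). q (n * n + (i * n + j)))"
    have AB: "A \<in> carrier_mat n n" "B \<in> carrier_mat n n" by (auto simp: A_def B_def)
    have lt: "k div n < n" "k mod n < n" if "k < n * n" for k
      using that assms(2) by (auto simp: less_mult_imp_div_less)
    have "entries A = map q [0..<n * n]"
      unfolding entries_eq[OF AB(1)] by (rule map_cong) (use lt in \<open>auto simp: A_def\<close>)
    moreover have "entries B = map (\<lambda>k. q (k + n * n)) [0..<n * n]"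
      unfolding entries_eq[OF AB(2)] by (rule map_cong) (use lt in \<open>auto simp: B_def add.commute\<close>)
    moreover have "map (\<lambda>k. q (k + n * n)) [0..<n * n] = map q (map (\<lambda>k. k + n * n) [0..<n * n])"
      unfolding map_map by (rule map_cong) simp_all
    moreover have "map (\<lambda>k. k + n * n) [0..<n * n] = [n * n..<n * n + n * n]"
      by (rule map_add_upt)
    moreover have "[0..<?N] = [0..<n * n] @ [n * n..<n * n + n * n]"
      using upt_add_eq_append[of 0 "n * n" "n * n"] by (simp add: mult_2 add_mult_distrib)
    moreover have "map (\<lambda>f. f q) m = map q [0..<?N]"
      unfolding m_def map_map by (rule map_cong) simp_all
    ultimately have "entries A @ entries B = map (\<lambda>f. f q) m"
      by (simp only: map_append)
    moreover have "entries (A * B) = map (\<lambda>f. f q) out"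
      unfolding entries_eq[OF mult_carrier_mat[OF AB]] out_def map_map
    proof (rule map_cong[OF refl])
      fix k assume "k \<in> set [0..<n * n]"
      then have k: "k div n < n" "k mod n < n" using lt by auto
      have "(A * B) $$ (k div n, k mod n) = (\<Sum>l<n. A $$ (k div n, l) * B $$ (l, k mod n))"
        using AB k by (simp add: scalar_prod_def lessThan_atLeast0)
      also have "\<dots> = (\<Sum>l<n. q (k div n * n + l) * q (n * n + (l * n + k mod n)))"
        by (rule sum.cong) (use k in \<open>auto simp: A_def B_def\<close>)
      finally show "(A * B) $$ (k div n, k mod n) = ((\<lambda>f. f q) \<circ>
          (\<lambda>k q. \<Sum>l<n. q (k div n * n + l) * q (n * n + (l * n + k mod n)))) k"
        by simp
    qed
    moreover have "run_arith T (entries A @ entries B) = Some (entries (A * B))"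
      using assms(1) AB by (simp add: multiplies_exactly_def)
    ultimately show ?thesis by simp
  qed
  have "\<exists>V us. open V \<and> V \<noteq> {} \<and> V \<subseteq> UNIV \<and>
    straight_line V (set m \<union> rconsts) (arith_ops T) (set us) \<and> length us = length out \<and>
    (\<forall>p\<in>V. \<forall>i<length out. (us ! i) p = (out ! i) p)"
    by (rule tree_straight_line) (use run in \<open>auto simp: m_def intro!: continuous_on_product_coordinates\<close>)
  then obtain V us where V: "open V" "V \<noteq> {}" "straight_line V (set m \<union> rconsts) (arith_ops T) (set us)"
    "length us = length out" "\<And>p i. p \<in> V \<Longrightarrow> i < length out \<Longrightarrow> (us ! i) p = (out ! i) p" by blast
  from V(2) obtain p where p: "p \<in> V" by blast
  have "\<exists>B'. finite B' \<and> card B' \<le> card ({} :: (rfun \<times> rfun) set) + 2 * arith_ops T \<and> (\<forall>f\<in>set us. has_jets p ?N B' f) \<and>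
    (\<forall>q\<in>B'. linear_form ?N (fst q) \<and> linear_form ?N (snd q))"
    by (rule straight_line_jets[OF V(3,1) p]) (auto simp: m_def intro: has_jets_coord has_jets_const)
  then obtain B where B: "finite B" "card B \<le> 2 * arith_ops T" "\<And>f. f \<in> set us \<Longrightarrow> has_jets p ?N B f"
    "\<And>q. q \<in> B \<Longrightarrow> linear_form ?N (fst q) \<and> linear_form ?N (snd q)" by auto
  have "\<exists>\<gamma>. \<forall>x y. (\<Sum>l<n. x (k div n * n + l) * y (n * n + (l * n + k mod n)) +
        y (k div n * n + l) * x (n * n + (l * n + k mod n))) = (\<Sum>q\<in>B. \<gamma> q * (fst q x * snd q y))"
    if k: "k < n * n" for k
  proof -
    have kl: "k < length out" "us ! k \<in> set us" using k V(4) by (auto simp: out_def)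
    from B(3)[OF kl(2)] obtain a b e where e: "product_span B e"
      "\<And>x y. jet (\<lambda>z. (us ! k) (shift_point p x y z)) ((us ! k) p) (a x) (b y) (e x y)"
      by (auto simp: has_jets_def)
    \<comment> \<open>Here the jet of the computed function is compared with that of the explicit
      polynomial, with which it agrees near p.\<close>
    have "e x y = (\<Sum>l<n. x (k div n * n + l) * y (n * n + (l * n + k mod n)) +
        y (k div n * n + l) * x (n * n + (l * n + k mod n)))" for x y
    proof -
      have coord: "jet (\<lambda>z. shift_point p x y z i) (p i) (x i) (y i) 0" for i
        using jet_poly[of "p i" "x i" "y i" 0] by (simp add: shift_point_def)
      have "\<exists>c a b. jet (\<lambda>z. \<Sum>l<L. shift_point p x y z (i l) * shift_point p x y z (j l)) c a b
        (\<Sum>l<L. x (i l) * y (j l) + y (i l) * x (j l))" for L :: nat and i j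
      proof (induction L)
        case 0
        show ?case using jet_const[of 0] by auto
      next
        case (Suc L)
        then obtain c a b where "jet (\<lambda>z. \<Sum>l<L. shift_point p x y z (i l) * shift_point p x y z (j l)) c a b
          (\<Sum>l<L. x (i l) * y (j l) + y (i l) * x (j l))" by blast
        from jet_add[OF this jet_mult[OF coord[of "i L"] coord[of "j L"]]] show ?case
          by (simp add: add.assoc) blast
      qed
      from this[where L = n and i = "\<lambda>l. k div n * n + l" and j = "\<lambda>l. n * n + (l * n + k mod n)"]
      obtain c a' b' where jo: "jet (\<lambda>z. (out ! k) (shift_point p x y z)) c a' b'
        (\<Sum>l<n. x (k div n * n + l) * y (n * n + (l * n + k mod n)) +
          y (k div n * n + l) * x (n * n + (l * n + k mod n)))"
        using k by (auto simp: out_def)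
      have "\<forall>\<^sub>F z in nhds 0. (us ! k) (shift_point p x y z) = (out ! k) (shift_point p x y z)"
        using eventually_shift_point[OF V(1) p] by eventually_elim (use V(5) kl in auto)
      from jet_unique[OF e(2) jet_cong[OF jo this]] show ?thesis .
    qed
    with product_span_sum[OF e(1) B(1)] show ?thesis by simp
  qed
  then have "\<forall>k\<in>{..<n * n}. \<exists>\<gamma>. \<forall>x y. (\<Sum>l<n. x (k div n * n + l) * y (n * n + (l * n + k mod n)) +
        y (k div n * n + l) * x (n * n + (l * n + k mod n))) = (\<Sum>q\<in>B. \<gamma> q * (fst q x * snd q y))"
    by simp
  from bchoice[OF this] obtain \<gamma> where \<gamma>: "\<And>k x y. k < n * n \<Longrightarrow> (\<Sum>l<n. x (k div n * n + l) * y (n * n + (l * n + k mod n)) +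
        y (k div n * n + l) * x (n * n + (l * n + k mod n))) = (\<Sum>q\<in>B. \<gamma> k q * (fst q x * snd q y))" by auto
  from ex_bij_betw_nat_finite[OF B(1)] obtain h where h: "bij_betw h {0..<card B} B" by blast
  have "\<exists>c. \<forall>x. fst q x = (\<Sum>i<?N. c i * x i)" "\<exists>d. \<forall>x. snd q x = (\<Sum>i<?N. d i * x i)" if "q \<in> B" for q
    using B(4)[OF that] by (simp_all add: linear_form_def)
  then have "\<forall>q\<in>B. \<exists>c. \<forall>x. fst q x = (\<Sum>i<?N. c i * x i)" "\<forall>q\<in>B. \<exists>d. \<forall>x. snd q x = (\<Sum>i<?N. d i * x i)"
    by blast+
  from bchoice[OF this(1)] bchoice[OF this(2)] obtain c d where cd: "\<And>q x. q \<in> B \<Longrightarrow> fst q x = (\<Sum>i<?N. c q i * x i)"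
    "\<And>q x. q \<in> B \<Longrightarrow> snd q x = (\<Sum>i<?N. d q i * x i)" by blast
  have "bilinear_algorithm n (card B) (\<lambda>r a b. c (h r) (a * n + b)) (\<lambda>r a b. d (h r) (n * n + (a * n + b)))
    (\<lambda>r i j. \<gamma> (i * n + j) (h r))"
    unfolding bilinear_algorithm_def
  proof (intro allI impI)
    fix A B' :: "nat \<Rightarrow> nat \<Rightarrow> real" and i j assume ij: "i < n" "j < n"
    \<comment> \<open>The direction x perturbs only the left factor and y only the right one, so
      half of the polarized sum vanishes and A B' remains.\<close>
    define x where "x q = (if q < n * n then A (q div n) (q mod n) else 0)" for q
    define y where "y q = (if q < n * n then 0 else B' ((q - n * n) div n) ((q - n * n) mod n))" for q
    have lt: "a * n + b < n * n" if "a < n" "b < n" for a b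
      using that by (rule row_major_less)
    have "(\<Sum>l<n. A i l * B' l j) = (\<Sum>l<n. x (i * n + l) * y (n * n + (l * n + j)) +
        y (i * n + l) * x (n * n + (l * n + j)))"
      using ij lt by (intro sum.cong) (auto simp: x_def y_def)
    also have "\<dots> = (\<Sum>q\<in>B. \<gamma> (i * n + j) q * (fst q x * snd q y))"
      using \<gamma>[of "i * n + j" x y] ij lt[of i j] by simp
    also have "\<dots> = (\<Sum>r<card B. \<gamma> (i * n + j) (h r) * (fst (h r) x * snd (h r) y))"
      using sum.reindex_bij_betw[OF h, of "\<lambda>q. \<gamma> (i * n + j) q * (fst q x * snd q y)"]
      by (simp add: lessThan_atLeast0)
    also have "\<dots> = (\<Sum>r<card B. \<gamma> (i * n + j) (h r) *
        ((\<Sum>a<n. \<Sum>b<n. c (h r) (a * n + b) * A a b) * (\<Sum>a<n. \<Sum>b<n. d (h r) (n * n + (a * n + b)) * B' a b)))"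
    proof (rule sum.cong[OF refl])
      fix r assume "r \<in> {..<card B}"
      then have hr: "h r \<in> B" using h by (auto simp: bij_betw_def)
      have "fst (h r) x = (\<Sum>q<n * n. c (h r) q * A (q div n) (q mod n))"
        unfolding cd(1)[OF hr] by (rule sum.mono_neutral_cong_right) (auto simp: x_def)
      moreover have "snd (h r) y = (\<Sum>q<n * n. d (h r) (n * n + q) * B' (q div n) (q mod n))"
      proof -
        have "snd (h r) y = (\<Sum>q\<in>{n * n..<?N}. d (h r) q * B' ((q - n * n) div n) ((q - n * n) mod n))"
          unfolding cd(2)[OF hr] by (rule sum.mono_neutral_cong_right) (auto simp: y_def)
        also have "\<dots> = (\<Sum>q<n * n. d (h r) (n * n + q) * B' (q div n) (q mod n))"
          by (rule sum.reindex_bij_witness[where i = "\<lambda>q. n * n + q" and j = "\<lambda>q. q - n * n"]) auto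
        finally show ?thesis .
      qed
      ultimately show "\<gamma> (i * n + j) (h r) * (fst (h r) x * snd (h r) y) = \<gamma> (i * n + j) (h r) *
        ((\<Sum>a<n. \<Sum>b<n. c (h r) (a * n + b) * A a b) * (\<Sum>a<n. \<Sum>b<n. d (h r) (n * n + (a * n + b)) * B' a b))"
        by (simp add: sum_div_mod)
    qed
    finally show "(\<Sum>l<n. A i l * B' l j) = (\<Sum>r<card B. \<gamma> (i * n + j) (h r) *
        ((\<Sum>a<n. \<Sum>b<n. c (h r) (a * n + b) * A a b) * (\<Sum>a<n. \<Sum>b<n. d (h r) (n * n + (a * n + b)) * B' a b)))" .
  qed
  with B(2) show ?thesis by blast
qed

section \<open>Quadratic lower bounds\<close>

fun operand_consts :: "operand \<Rightarrow> real set" where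
  "operand_consts (Cell i) = {}"
| "operand_consts (Const r) = {r}"

fun tree_consts :: "arith_alg \<Rightarrow> real set" where
  "tree_consts (Return us) = (\<Union>u\<in>set us. operand_consts u)"
| "tree_consts (Compute f u v T) = tree_consts T"
| "tree_consts (If_le u v T1 T2) = tree_consts T1 \<union> tree_consts T2"

lemma finite_tree_consts: "finite (tree_consts T)"
proof -
  have "finite (operand_consts u)" for u by (cases u) auto
  then show ?thesis by (induction T) auto
qed

text \<open>Basis of the counting argument: output values that are neither inputs nor constants of
  the tree must have been computed, one operation each.\<close>

lemma run_arith_memory:
  assumes "run_arith T m = Some r"
  shows "\<exists>zs. length zs \<le> arith_ops T \<and> set r \<subseteq> set m \<union> set zs \<union> tree_consts T"
  using assms
proof (induction T arbitrary: m)
  case (Return us)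
  then have eq: "map (read m) us = map Some r" by (simp add: those_eq_Some_iff)
  have "x \<in> set m \<union> tree_consts (Return us)" if "x \<in> set r" for x
  proof -
    have "Some x \<in> set (map (read m) us)" using that unfolding eq by auto
    then obtain u where u: "u \<in> set us" "read m u = Some x" by auto
    from u(2) have "x \<in> set m \<union> operand_consts u" by (cases u) (auto split: if_splits)
    with u(1) show ?thesis by auto
  qed
  then show ?case by (intro exI[of _ "[]"]) auto
next
  case (Compute f u v T)
  then obtain z where "run_arith T (m @ [z]) = Some r" by (auto split: option.splits)
  from Compute.IH[OF this] obtain zs where "length zs \<le> arith_ops T"
    "set r \<subseteq> set (m @ [z]) \<union> set zs \<union> tree_consts T" by blast
  then show ?case by (intro exI[of _ "z # zs"]) auto
next
  case (If_le u v T1 T2)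
  then have "run_arith T1 m = Some r \<or> run_arith T2 m = Some r"
    by (auto split: option.splits if_splits)
  then show ?case
  proof
    assume "run_arith T1 m = Some r"
    from If_le.IH(1)[OF this] show ?thesis by (elim exE, rule_tac x = zs in exI) auto
  next
    assume "run_arith T2 m = Some r"
    from If_le.IH(2)[OF this] show ?thesis by (elim exE, rule_tac x = zs in exI) auto
  qed
qed

lemma div_less_of_less_square: "k < n * n \<Longrightarrow> k div n < n" "k < n * n \<Longrightarrow> k mod n < n" for k n :: nat
  by (cases "n = 0"; simp add: less_mult_imp_div_less)+

lemma length_entries: "A \<in> carrier_mat n n \<Longrightarrow> length (entries A) = n * n"
  by (simp add: entries_eq)

lemma nth_entries: "A \<in> carrier_mat n n \<Longrightarrow> k < n * n \<Longrightarrow> entries A ! k = A $$ (k div n, k mod n)"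
  by (simp add: entries_eq)

text \<open>For \<open>A = t I\<close> with \<open>t\<close> large, no entry of \<open>A B\<close> is an input or a constant of the tree.\<close>

lemma multiplies_exactly_lower_bound:
  assumes "multiplies_exactly n T" "n \<ge> 1"
  shows "n * n \<le> arith_ops T"
proof -
  \<comment> \<open>The additional element makes t exceed the entries of B as well.\<close>
  define C where "C = tree_consts T \<union> {real (n * n + 2)}"
  define t where "t = Max C + 1"
  have fin: "finite C" by (simp add: C_def finite_tree_consts)
  have t: "c < t" if "c \<in> C" for c using Max_ge[OF fin that] by (simp add: t_def)
  have t0: "t > real (n * n + 2)" by (rule t) (simp add: C_def)
  define A where "A = t \<cdot>\<^sub>m (1\<^sub>m n :: real mat)"
  have tpos: "t > 2" by (rule le_less_trans[OF _ t0]) simp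
  \<comment> \<open>With the offset 2 every product t f(q) is larger than t, hence different from
    the entries of A; an offset of 1 would reproduce t itself.\<close>
  define f :: "nat \<Rightarrow> real" where "f q = real (q + 2)" for q
  define B where "B = mat n n (\<lambda>(i, j). f (i * n + j))"
  have AB: "A \<in> carrier_mat n n" "B \<in> carrier_mat n n" by (auto simp: A_def B_def)
  have prod: "A * B = t \<cdot>\<^sub>m B"
    unfolding A_def using AB by (simp add: mult_smult_assoc_mat[of _ n n])
  have ent: "entries (A * B) ! k = t * f k" if "k < n * n" for k
  proof -
    have "k div n < n" "k mod n < n" using div_less_of_less_square[OF that] by auto
    then show ?thesis
      using nth_entries[OF mult_carrier_mat[OF AB] that] AB(2) unfolding prod by (simp add: B_def)
  qed
  have len: "length (entries (A * B)) = n * n"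
    by (rule length_entries[OF mult_carrier_mat[OF AB]])
  have "run_arith T (entries A @ entries B) = Some (entries (A * B))"
    using assms(1) AB by (simp add: multiplies_exactly_def)
  from run_arith_memory[OF this] obtain zs where zs: "length zs \<le> arith_ops T"
    "set (entries (A * B)) \<subseteq> set (entries A @ entries B) \<union> set zs \<union> tree_consts T" by blast
  have "entries (A * B) ! k \<in> set zs" if k: "k < n * n" for k
  proof -
    have big: "t * f k > t" using tpos by (simp add: f_def)
    have "x < t \<or> x = t" if "x \<in> set (entries A @ entries B)" for x
    proof -
      from that consider q where "q < n * n" "x = entries A ! q" | q where "q < n * n" "x = entries B ! q"
        using length_entries[OF AB(1)] length_entries[OF AB(2)] by (auto simp: in_set_conv_nth)
      then show ?thesis
      proof cases
        case 1
        then have "q div n < n" "q mod n < n" by (auto dest: div_less_of_less_square)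
        then show ?thesis using nth_entries[OF AB(1) 1(1)] 1 tpos by (auto simp: A_def)
      next
        case 2
        then have "q div n < n" "q mod n < n" by (auto dest: div_less_of_less_square)
        then have "x = f q" using nth_entries[OF AB(2) 2(1)] 2 by (simp add: B_def)
        moreover have "f q < real (n * n + 2)" using 2(1) unfolding f_def by (simp only: of_nat_less_iff)
        ultimately show ?thesis using t0 by simp
      qed
    qed
    moreover have "x < t" if "x \<in> tree_consts T" for x using t that by (simp add: C_def)
    moreover have "entries (A * B) ! k \<in> set (entries (A * B))" using k len by simp
    ultimately show ?thesis using zs(2) big ent[OF k] by fastforce
  qed
  then have "(\<lambda>k. t * f k) ` {..<n * n} \<subseteq> set zs" using ent by force
  then have "card ((\<lambda>k. t * f k) ` {..<n * n}) \<le> card (set zs)"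
    by (intro card_mono) auto
  moreover have "inj_on (\<lambda>k. t * f k) {..<n * n}"
    using tpos by (auto simp: inj_on_def f_def)
  ultimately have "n * n \<le> card (set zs)" by (simp only: card_image card_lessThan)
  also have "\<dots> \<le> length zs" by (rule card_length)
  finally show ?thesis using zs(1) by simp
qed

text \<open>Applied once to computation trees and once to circuits, to exclude exponents below
  2.\<close>

lemma quadratic_exponent:
  assumes "\<forall>\<^sub>F n::nat in at_top. real n ^ 2 \<le> C * real n powr \<tau>"
  shows "2 \<le> \<tau>"
proof (rule ccontr)
  assume "\<not> 2 \<le> \<tau>"
  then have "(\<lambda>n::nat. real n powr (\<tau> - 2)) \<longlonglongrightarrow> 0"
    by (intro tendsto_neg_powr filterlim_real_sequentially) auto
  then have "(\<lambda>n::nat. C * real n powr (\<tau> - 2)) \<longlonglongrightarrow> 0"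
    by (rule tendsto_mult_right_zero)
  then have "\<forall>\<^sub>F n::nat in at_top. C * real n powr (\<tau> - 2) < 1"
    by (rule order_tendstoD) simp
  with assms eventually_gt_at_top[of 0] have "\<forall>\<^sub>F n::nat in at_top. False"
  proof eventually_elim
    case (elim n)
    then have "real n ^ 2 \<le> C * real n powr (\<tau> - 2) * real n ^ 2"
      by (simp add: powr_diff powr_numeral)
    with elim show ?case by (simp add: mult_le_cancel_right1)
  qed
  then show False by simp
qed

lemma exact_multiplication_exponent:
  assumes "exact_multiplication_in \<tau>"
  shows "2 \<le> \<tau>"
proof -
  from assms obtain T where T: "\<And>n. n \<ge> 1 \<Longrightarrow> multiplies_exactly n (T n)"
    "(\<lambda>n. real (arith_ops (T n))) \<in> O(\<lambda>n. real n powr \<tau>)"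
    by (auto simp: exact_multiplication_in_def)
  from landau_o.bigE[OF T(2)] obtain C
    where C: "\<forall>\<^sub>F n in at_top. norm (real (arith_ops (T n))) \<le> C * norm (real n powr \<tau>)" by blast
  have "\<forall>\<^sub>F n in at_top. real n ^ 2 \<le> C * real n powr \<tau>"
    using C eventually_ge_at_top[of 1]
  proof eventually_elim
    case (elim n)
    have "real (n * n) \<le> real (arith_ops (T n))"
      using multiplies_exactly_lower_bound[OF T(1)[OF elim(2)] elim(2)] by (simp only: of_nat_le_iff)
    with elim show ?case by (simp add: power2_eq_square)
  qed
  then show ?thesis by (rule quadratic_exponent)
qed

section \<open>Multiplication by inversion\<close>

text \<open>A strictly upper triangular 3 by 3 block matrix N with A and B above the diagonal. The
  only block of N^2 is A B, in the corner, and N^3 = 0; hence I + N has the inverse I - N +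
  N^2.\<close>

definition nil_block :: "nat \<Rightarrow> real mat \<Rightarrow> real mat \<Rightarrow> real mat" where
  "nil_block n A B = mat (3 * n) (3 * n) (\<lambda>(i, j).
     if i < n \<and> n \<le> j \<and> j < 2 * n then A $$ (i, j - n)
     else if n \<le> i \<and> i < 2 * n \<and> 2 * n \<le> j then B $$ (i - n, j - 2 * n) else 0)"

definition unit_block :: "nat \<Rightarrow> real mat \<Rightarrow> real mat \<Rightarrow> real mat" where
  "unit_block n A B = 1\<^sub>m (3 * n) + nil_block n A B"

definition unit_block_inv :: "nat \<Rightarrow> real mat \<Rightarrow> real mat \<Rightarrow> real mat" where
  "unit_block_inv n A B = 1\<^sub>m (3 * n) - nil_block n A B + nil_block n A B * nil_block n A B"

lemma block_carrier [simp]: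
  "nil_block n A B \<in> carrier_mat (3 * n) (3 * n)"
  "unit_block n A B \<in> carrier_mat (3 * n) (3 * n)"
  "unit_block_inv n A B \<in> carrier_mat (3 * n) (3 * n)"
  by (auto simp: nil_block_def unit_block_def unit_block_inv_def intro!: add_carrier_mat mult_carrier_mat)

lemma index_mult_mat_sum:
  assumes "A \<in> carrier_mat k m" "B \<in> carrier_mat m l" "i < k" "j < l"
  shows "(A * B) $$ (i, j) = (\<Sum>q<m. A $$ (i, q) * B $$ (q, j))"
  using assms by (simp add: scalar_prod_def lessThan_atLeast0)

lemma nil_block_square:
  assumes "A \<in> carrier_mat n n" "B \<in> carrier_mat n n" "i < 3 * n" "j < 3 * n"
  shows "(nil_block n A B * nil_block n A B) $$ (i, j) =
    (if i < n \<and> 2 * n \<le> j then (A * B) $$ (i, j - 2 * n) else 0)"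
proof -
  let ?N = "nil_block n A B"
  have "(?N * ?N) $$ (i, j) = (\<Sum>q<3 * n. ?N $$ (i, q) * ?N $$ (q, j))"
    by (rule index_mult_mat_sum) (use assms in auto)
  also have "\<dots> = (\<Sum>q\<in>{n..<2 * n}. if i < n \<and> 2 * n \<le> j then A $$ (i, q - n) * B $$ (q - n, j - 2 * n) else 0)"
    by (rule sum.mono_neutral_cong_right) (use assms in \<open>auto simp: nil_block_def\<close>)
  also have "\<dots> = (\<Sum>q<n. if i < n \<and> 2 * n \<le> j then A $$ (i, q) * B $$ (q, j - 2 * n) else 0)"
    by (rule sum.reindex_bij_witness[where i = "\<lambda>q. q + n" and j = "\<lambda>q. q - n"]) auto
  also have "\<dots> = (if i < n \<and> 2 * n \<le> j then (A * B) $$ (i, j - 2 * n) else 0)"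
    using assms by (auto simp: index_mult_mat_sum[of A n n B n] simp del: index_mult_mat)
  finally show ?thesis .
qed

lemma nil_block_cube:
  assumes "A \<in> carrier_mat n n" "B \<in> carrier_mat n n"
  defines "N \<equiv> nil_block n A B"
  shows "N * (N * N) = 0\<^sub>m (3 * n) (3 * n)" "(N * N) * N = 0\<^sub>m (3 * n) (3 * n)"
proof -
  have N: "N \<in> carrier_mat (3 * n) (3 * n)" by (simp add: N_def)
  note NN = mult_carrier_mat[OF N N]
  show "N * (N * N) = 0\<^sub>m (3 * n) (3 * n)"
  proof (rule eq_matI)
    fix i j assume "i < dim_row (0\<^sub>m (3 * n) (3 * n))" "j < dim_col (0\<^sub>m (3 * n) (3 * n))"
    then have ij: "i < 3 * n" "j < 3 * n" by auto
    have "(N * (N * N)) $$ (i, j) = (\<Sum>q<3 * n. N $$ (i, q) * (N * N) $$ (q, j))"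
      by (rule index_mult_mat_sum[OF N NN ij])
    also have "\<dots> = 0"
      by (rule sum.neutral) (use assms ij in \<open>auto simp: N_def nil_block_square\<close>, auto simp: nil_block_def)
    finally show "(N * (N * N)) $$ (i, j) = 0\<^sub>m (3 * n) (3 * n) $$ (i, j)" using ij by simp
  qed (use N in auto)
  then show "(N * N) * N = 0\<^sub>m (3 * n) (3 * n)" by (simp add: assoc_mult_mat[OF N N N])
qed

lemma unit_block_inverse:
  assumes "A \<in> carrier_mat n n" "B \<in> carrier_mat n n"
  shows "is_inverse (unit_block n A B) (unit_block_inv n A B)"
proof -
  define N where "N = nil_block n A B"
  let ?k = "3 * n"
  let ?X = "1\<^sub>m ?k - N + N * N"
  have N: "N \<in> carrier_mat ?k ?k" by (simp add: N_def)
  note NN = mult_carrier_mat[OF N N]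
  note cube = nil_block_cube[OF assms, folded N_def]
  have one: "1\<^sub>m ?k \<in> carrier_mat ?k ?k" by simp
  note car = add_carrier_mat[OF NN, of "1\<^sub>m ?k - N"] minus_carrier_mat[OF N, of "1\<^sub>m ?k"]
  have "(1\<^sub>m ?k + N) * ?X = ?X + N * ?X"
    by (subst add_mult_distrib_mat[OF one N car(1)]) (use N NN in auto)
  also have "N * ?X = N - N * N + N * (N * N)"
    by (subst mult_add_distrib_mat[OF N car(2) NN], subst mult_minus_distrib_mat[OF N one N])
      (use N in auto)
  also have "?X + (N - N * N + N * (N * N)) = 1\<^sub>m ?k"
    unfolding cube by (rule eq_matI) (use N NN in auto)
  finally have 1: "(1\<^sub>m ?k + N) * ?X = 1\<^sub>m ?k" .
  have "?X * (1\<^sub>m ?k + N) = ?X + ?X * N"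
    by (subst mult_add_distrib_mat[OF car(1) one N]) (use N NN in auto)
  also have "?X * N = N - N * N + (N * N) * N"
    by (subst add_mult_distrib_mat[OF car(2) NN N], subst minus_mult_distrib_mat[OF one N N])
      (use N in auto)
  also have "?X + (N - N * N + (N * N) * N) = 1\<^sub>m ?k"
    unfolding cube by (rule eq_matI) (use N NN in auto)
  finally have 2: "?X * (1\<^sub>m ?k + N) = 1\<^sub>m ?k" .
  show ?thesis
    using 1 2 N NN by (simp add: is_inverse_def inverts_mat_def unit_block_def unit_block_inv_def flip: N_def)
qed

lemma unit_block_inv_corner:
  assumes "A \<in> carrier_mat n n" "B \<in> carrier_mat n n" "i < n" "j < n"
  shows "unit_block_inv n A B $$ (i, 2 * n + j) = (A * B) $$ (i, j)"
proof -
  have ij: "i < 3 * n" "2 * n + j < 3 * n" using assms by auto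
  have "nil_block n A B \<in> carrier_mat (3 * n) (3 * n)" by simp
  with ij nil_block_square[OF assms(1,2) ij] assms(3,4)
  show ?thesis by (simp add: unit_block_inv_def del: index_mult_mat) (simp add: nil_block_def)
qed

subsection \<open>Exact arithmetic\<close>

text \<open>The N inputs of the tree are replaced by operands \<sigma> over a new input of length M,
  and computed cells are renumbered accordingly. Constants are operands too, so feeding the block
  matrix to an inversion tree costs no operation.\<close>

fun subst_operand :: "(nat \<Rightarrow> operand) \<Rightarrow> nat \<Rightarrow> nat \<Rightarrow> operand \<Rightarrow> operand" where
  "subst_operand \<sigma> N M (Cell i) = (if i < N then \<sigma> i else Cell (M + (i - N)))"
| "subst_operand \<sigma> N M (Const r) = Const r"

fun subst_tree :: "(nat \<Rightarrow> operand) \<Rightarrow> nat \<Rightarrow> nat \<Rightarrow> nat list \<Rightarrow> arith_alg \<Rightarrow> arith_alg" where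
  "subst_tree \<sigma> N M ks (Return us) = Return (map (\<lambda>k. subst_operand \<sigma> N M (us ! k)) ks)"
| "subst_tree \<sigma> N M ks (Compute f u v T) =
     Compute f (subst_operand \<sigma> N M u) (subst_operand \<sigma> N M v) (subst_tree \<sigma> N M ks T)"
| "subst_tree \<sigma> N M ks (If_le u v T1 T2) =
     If_le (subst_operand \<sigma> N M u) (subst_operand \<sigma> N M v) (subst_tree \<sigma> N M ks T1) (subst_tree \<sigma> N M ks T2)"

lemma arith_ops_subst_tree [simp]: "arith_ops (subst_tree \<sigma> N M ks T) = arith_ops T"
  by (induction T) auto

lemma run_subst_tree:
  assumes m: "length m = N" "length m' = M" "\<And>i zs. i < N \<Longrightarrow> read (m' @ zs) (\<sigma> i) = Some (m ! i)"
    and run: "run_arith T (m @ zs) = Some r" and ks: "\<And>k. k \<in> set ks \<Longrightarrow> k < length r"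
  shows "run_arith (subst_tree \<sigma> N M ks T) (m' @ zs) = Some (map (\<lambda>k. r ! k) ks)"
proof -
  have rd: "read (m' @ zs) (subst_operand \<sigma> N M u) = Some x" if "read (m @ zs) u = Some x" for u x zs
    using that m by (cases u) (auto simp: nth_append split: if_splits)
  show ?thesis
    using run
  proof (induction T arbitrary: zs)
    case (Return us)
    then have eq: "map (read (m @ zs)) us = map Some r" by (simp add: those_eq_Some_iff)
    then have "length us = length r" by (metis length_map)
    then have "read (m @ zs) (us ! k) = Some (r ! k)" if "k < length r" for k
      using that arg_cong[OF eq, of "\<lambda>l. l ! k"] by simp
    then show ?case using ks by (auto simp: those_eq_Some_iff intro: rd)
  next
    case (Compute f u v T)
    then obtain x y z where "read (m @ zs) u = Some x" "read (m @ zs) v = Some y" "apply_op f x y = Some z"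
      "run_arith T (m @ (zs @ [z])) = Some r" by (auto split: option.splits)
    with rd Compute.IH[of "zs @ [z]"] show ?case by simp
  next
    case (If_le u v T1 T2)
    then obtain x y where xy: "read (m @ zs) u = Some x" "read (m @ zs) v = Some y" by (auto split: option.splits)
    with rd If_le show ?case by (auto split: if_splits)
  qed
qed

lemma inversion_tree_multiplies:
  assumes "inverts_exactly (3 * n) T"
  shows "\<exists>T'. multiplies_exactly n T' \<and> arith_ops T' = arith_ops T"
proof -
  let ?N = "3 * n * (3 * n)"
  define \<sigma> where "\<sigma> k = (let i = k div (3 * n); j = k mod (3 * n) in
     if i = j then Const 1
     else if i < n \<and> n \<le> j \<and> j < 2 * n then Cell (i * n + (j - n))
     else if n \<le> i \<and> i < 2 * n \<and> 2 * n \<le> j then Cell (n * n + ((i - n) * n + (j - 2 * n))) else Const 0)" for k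
  \<comment> \<open>Positions of the upper right block in the row-major list of the entries of the
    inverse.\<close>
  define ks where "ks = map (\<lambda>q. q div n * (3 * n) + (2 * n + q mod n)) [0..<n * n]"
  have "run_arith (subst_tree \<sigma> ?N (n * n + n * n) ks T) (entries A @ entries B) = Some (entries (A * B))"
    if AB: "A \<in> carrier_mat n n" "B \<in> carrier_mat n n" for A B
  proof -
    let ?U = "unit_block n A B" and ?X = "unit_block_inv n A B"
    have len: "length (entries ?U) = ?N" "length (entries ?X) = ?N"
      by (rule length_entries[OF block_carrier(2)], rule length_entries[OF block_carrier(3)])
    have kb: "q div n * (3 * n) + (2 * n + q mod n) < ?N" if "q < n * n" for q
      using div_less_of_less_square[OF that] row_major_less[of "q div n" "3 * n" "2 * n + q mod n"] by simp
    have "run_arith T (entries ?U @ []) = Some (entries ?X)"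
      using assms unit_block_inverse[OF AB] by (simp add: inverts_exactly_def)
    then have "run_arith (subst_tree \<sigma> ?N (n * n + n * n) ks T) ((entries A @ entries B) @ []) =
        Some (map (\<lambda>k. entries ?X ! k) ks)"
    proof (rule run_subst_tree[rotated 3])
      show "k < length (entries ?X)" if "k \<in> set ks" for k
        using that kb by (auto simp: len ks_def)
      fix k zs assume k: "k < ?N"
      define i j where "i = k div (3 * n)" and "j = k mod (3 * n)"
      have ij: "i < 3 * n" "j < 3 * n" using div_less_of_less_square[OF k] by (auto simp: i_def j_def)
      have "entries ?U ! k = ?U $$ (i, j)"
        using nth_entries[OF block_carrier(2) k] by (simp add: i_def j_def)
      also have "\<dots> = (if i = j then 1 else 0) + nil_block n A B $$ (i, j)"
        using ij carrier_matD[OF block_carrier(1)[of n A B]] by (simp add: unit_block_def)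
      finally have U: "entries ?U ! k = (if i = j then 1 else 0) + nil_block n A B $$ (i, j)" .
      have eA: "entries A ! (a * n + b) = A $$ (a, b)" "entries B ! (a * n + b) = B $$ (a, b)"
        if "a < n" "b < n" for a b
        using that row_major_less[OF that] by (auto simp: nth_entries[OF AB(1)] nth_entries[OF AB(2)])
      have rA: "read ((entries A @ entries B) @ zs) (Cell (a * n + b)) = Some (A $$ (a, b))"
        "read ((entries A @ entries B) @ zs) (Cell (n * n + (a * n + b))) = Some (B $$ (a, b))"
        if "a < n" "b < n" for a b
        using row_major_less[OF that] eA[OF that] length_entries[OF AB(1)] length_entries[OF AB(2)]
        by (auto simp: nth_append)
      consider "i = j" | "i \<noteq> j" "i < n" "n \<le> j" "j < 2 * n" | "i \<noteq> j" "n \<le> i" "i < 2 * n" "2 * n \<le> j"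
        | "i \<noteq> j" "\<not> (i < n \<and> n \<le> j \<and> j < 2 * n)" "\<not> (n \<le> i \<and> i < 2 * n \<and> 2 * n \<le> j)" by blast
      then show "read ((entries A @ entries B) @ zs) (\<sigma> k) = Some (entries ?U ! k)"
      proof cases
        case 1
        then show ?thesis using ij U by (simp add: \<sigma>_def nil_block_def flip: i_def j_def)
      next
        case 2
        then have "\<sigma> k = Cell (i * n + (j - n))" by (simp add: \<sigma>_def flip: i_def j_def)
        moreover have "entries ?U ! k = A $$ (i, j - n)" using U ij 2 by (simp add: nil_block_def)
        ultimately show ?thesis using rA(1)[of i "j - n"] 2 by simp
      next
        case 3
        then have "\<sigma> k = Cell (n * n + ((i - n) * n + (j - 2 * n)))" by (simp add: \<sigma>_def flip: i_def j_def)
        moreover have "entries ?U ! k = B $$ (i - n, j - 2 * n)" using U ij 3 by (simp add: nil_block_def)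
        ultimately show ?thesis using rA(2)[of "i - n" "j - 2 * n"] 3 ij by simp
      next
        case 4
        then have "\<sigma> k = Const 0" unfolding \<sigma>_def Let_def i_def[symmetric] j_def[symmetric] by simp
        moreover have "entries ?U ! k = 0" using U ij 4 by (simp add: nil_block_def)
        ultimately show ?thesis by simp
      qed
    qed (use AB in \<open>auto simp: len length_entries\<close>)
    moreover have "map (\<lambda>k. entries ?X ! k) ks = entries (A * B)"
      unfolding entries_eq[OF mult_carrier_mat[OF AB]] ks_def map_map
    proof (rule map_cong[OF refl])
      fix q assume "q \<in> set [0..<n * n]"
      then have q: "q < n * n" by simp
      note qn = div_less_of_less_square[OF q]
      have "((!) (entries ?X) \<circ> (\<lambda>q. q div n * (3 * n) + (2 * n + q mod n))) q = ?X $$ (q div n, 2 * n + q mod n)"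
        using nth_entries[OF block_carrier(3) kb[OF q]] qn by simp
      also have "\<dots> = (A * B) $$ (q div n, q mod n)"
        by (rule unit_block_inv_corner[OF AB qn])
      finally show "((!) (entries ?X) \<circ> (\<lambda>q. q div n * (3 * n) + (2 * n + q mod n))) q = (A * B) $$ (q div n, q mod n)" .
    qed
    ultimately show ?thesis by simp
  qed
  then show ?thesis
    by (intro exI[of _ "subst_tree \<sigma> ?N (n * n + n * n) ks T"]) (simp add: multiplies_exactly_def)
qed

theorem exact_inversion_multiplication:
  assumes "exact_inversion_in \<tau>"
  shows "exact_multiplication_in \<tau>"
proof -
  from assms obtain T where T: "\<And>n. n \<ge> 1 \<Longrightarrow> inverts_exactly n (T n)"
    "(\<lambda>n. real (arith_ops (T n))) \<in> O(\<lambda>n. real n powr \<tau>)" by (auto simp: exact_inversion_in_def)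
  have "\<forall>n\<in>{1..}. \<exists>T'. multiplies_exactly n T' \<and> arith_ops T' = arith_ops (T (3 * n))"
    using T(1) by (intro ballI inversion_tree_multiplies) auto
  from bchoice[OF this] obtain T' where T': "\<And>n. n \<ge> 1 \<Longrightarrow> multiplies_exactly n (T' n)"
    "\<And>n. n \<ge> 1 \<Longrightarrow> arith_ops (T' n) = arith_ops (T (3 * n))" by auto
  have lim: "filterlim (\<lambda>n::nat. 3 * n) at_top at_top"
    by (rule filterlim_at_top_mono[OF filterlim_ident]) auto
  have "(\<lambda>n. real (arith_ops (T' n))) \<in> \<Theta>(\<lambda>n. real (arith_ops (T (3 * n))))"
    by (intro bigthetaI_cong eventually_mono[OF eventually_ge_at_top[of 1]]) (simp add: T'(2))
  also have "(\<lambda>n. real (arith_ops (T (3 * n)))) \<in> O(\<lambda>n. real (3 * n) powr \<tau>)"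
    by (rule landau_o.big.compose[OF T(2) lim])
  also have "(\<lambda>n. real (3 * n) powr \<tau>) = (\<lambda>n. 3 powr \<tau> * real n powr \<tau>)"
    by (simp add: powr_mult)
  also have "O(\<lambda>n. 3 powr \<tau> * real n powr \<tau>) = O(\<lambda>n. real n powr \<tau>)"
    by simp
  finally show ?thesis using T'(1) by (auto simp: exact_multiplication_in_def)
qed

section \<open>Fast multiplication of integer matrices by circuits\<close>

text \<open>A bilinear algorithm for order m, applied recursively to m by m matrices of blocks of
  order m^k. It is generic in the ring: over the reals for the error analysis, over the integers for
  the circuits.\<close>

fun fast_prod :: "nat \<Rightarrow> nat \<Rightarrow> (nat \<Rightarrow> nat \<times> nat \<Rightarrow> 'a) \<Rightarrow> (nat \<Rightarrow> nat \<times> nat \<Rightarrow> 'a) \<Rightarrow> (nat \<Rightarrow> nat \<times> nat \<Rightarrow> 'a) \<Rightarrow>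
    nat \<Rightarrow> (nat \<Rightarrow> nat \<Rightarrow> 'a) \<Rightarrow> (nat \<Rightarrow> nat \<Rightarrow> 'a) \<Rightarrow> nat \<Rightarrow> nat \<Rightarrow> 'a :: comm_ring_1" where
  "fast_prod m R \<alpha> \<beta> \<gamma> 0 A B i j = A 0 0 * B 0 0"
| "fast_prod m R \<alpha> \<beta> \<gamma> (Suc k) A B i j = (\<Sum>r<R. \<gamma> r (i div m ^ k, j div m ^ k) *
     fast_prod m R \<alpha> \<beta> \<gamma> k
       (\<lambda>i j. \<Sum>p\<in>{..<m} \<times> {..<m}. \<alpha> r p * A (fst p * m ^ k + i) (snd p * m ^ k + j))
       (\<lambda>i j. \<Sum>p\<in>{..<m} \<times> {..<m}. \<beta> r p * B (fst p * m ^ k + i) (snd p * m ^ k + j))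
       (i mod m ^ k) (j mod m ^ k))"

text \<open>Bilinearity holds for arbitrary coefficients, whether or not they represent matrix
  multiplication. The effect of inexact coefficients can therefore be analysed on the tensor
  alone.\<close>

lemma fast_prod_sum_left:
  "fast_prod m R \<alpha> \<beta> \<gamma> k (\<lambda>i j. \<Sum>s\<in>S. c s * A s i j) B i j = (\<Sum>s\<in>S. c s * fast_prod m R \<alpha> \<beta> \<gamma> k (A s) B i j)"
proof (induction k arbitrary: A B i j)
  case 0
  show ?case by (simp add: sum_distrib_right mult.assoc)
next
  case (Suc k)
  let ?P = "{..<m} \<times> {..<m}"
  have "(\<Sum>p\<in>?P. \<alpha> r p * (\<Sum>s\<in>S. c s * A s (fst p * m ^ k + i) (snd p * m ^ k + j))) =
      (\<Sum>s\<in>S. c s * (\<Sum>p\<in>?P. \<alpha> r p * A s (fst p * m ^ k + i) (snd p * m ^ k + j)))" for r i j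
    unfolding sum_distrib_left by (subst sum.swap) (simp add: mult.left_commute)
  then have "fast_prod m R \<alpha> \<beta> \<gamma> (Suc k) (\<lambda>i j. \<Sum>s\<in>S. c s * A s i j) B i j =
    (\<Sum>r<R. \<gamma> r (i div m ^ k, j div m ^ k) * (\<Sum>s\<in>S. c s * fast_prod m R \<alpha> \<beta> \<gamma> k
       (\<lambda>i j. \<Sum>p\<in>?P. \<alpha> r p * A s (fst p * m ^ k + i) (snd p * m ^ k + j))
       (\<lambda>i j. \<Sum>p\<in>?P. \<beta> r p * B (fst p * m ^ k + i) (snd p * m ^ k + j))
       (i mod m ^ k) (j mod m ^ k)))"
    by (simp only: fast_prod.simps Suc.IH)
  also have "\<dots> = (\<Sum>s\<in>S. c s * fast_prod m R \<alpha> \<beta> \<gamma> (Suc k) (A s) B i j)"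
    unfolding sum_distrib_left fast_prod.simps by (subst sum.swap) (simp only: mult.left_commute)
  finally show ?case .
qed

lemma fast_prod_sum_right:
  "fast_prod m R \<alpha> \<beta> \<gamma> k A (\<lambda>i j. \<Sum>s\<in>S. c s * B s i j) i j = (\<Sum>s\<in>S. c s * fast_prod m R \<alpha> \<beta> \<gamma> k A (B s) i j)"
proof (induction k arbitrary: A B i j)
  case 0
  show ?case by (simp add: sum_distrib_left mult.left_commute)
next
  case (Suc k)
  let ?P = "{..<m} \<times> {..<m}"
  have "(\<Sum>p\<in>?P. \<beta> r p * (\<Sum>s\<in>S. c s * B s (fst p * m ^ k + i) (snd p * m ^ k + j))) =
      (\<Sum>s\<in>S. c s * (\<Sum>p\<in>?P. \<beta> r p * B s (fst p * m ^ k + i) (snd p * m ^ k + j)))" for r i j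
    unfolding sum_distrib_left by (subst sum.swap) (simp add: mult.left_commute)
  then have "fast_prod m R \<alpha> \<beta> \<gamma> (Suc k) A (\<lambda>i j. \<Sum>s\<in>S. c s * B s i j) i j =
    (\<Sum>r<R. \<gamma> r (i div m ^ k, j div m ^ k) * (\<Sum>s\<in>S. c s * fast_prod m R \<alpha> \<beta> \<gamma> k
       (\<lambda>i j. \<Sum>p\<in>?P. \<alpha> r p * A (fst p * m ^ k + i) (snd p * m ^ k + j))
       (\<lambda>i j. \<Sum>p\<in>?P. \<beta> r p * B s (fst p * m ^ k + i) (snd p * m ^ k + j))
       (i mod m ^ k) (j mod m ^ k)))"
    by (simp only: fast_prod.simps Suc.IH)
  also have "\<dots> = (\<Sum>s\<in>S. c s * fast_prod m R \<alpha> \<beta> \<gamma> (Suc k) A (B s) i j)"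
    unfolding sum_distrib_left fast_prod.simps by (subst sum.swap) (simp only: mult.left_commute)
  finally show ?case .
qed

lemma fast_prod_scale_args:
  "fast_prod m R \<alpha> \<beta> \<gamma> k (\<lambda>i j. c * A i j) (\<lambda>i j. d * B i j) i j = c * d * fast_prod m R \<alpha> \<beta> \<gamma> k A B i j"
  using fast_prod_sum_left[of m R \<alpha> \<beta> \<gamma> k "\<lambda>_. c" "\<lambda>_. A" "{()}"]
    fast_prod_sum_right[of m R \<alpha> \<beta> \<gamma> k _ "\<lambda>_. d" "\<lambda>_. B" "{()}"]
  by (simp add: mult.assoc)

text \<open>Every level uses one coefficient each of \<alpha>, \<beta> and \<gamma> as a factor,
  hence t^3 per level. With t = 2^p this passes from dyadic rationals to their integer
  numerators.\<close>

lemma fast_prod_scale_coeffs: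
  "fast_prod m R (\<lambda>r p. t * \<alpha> r p) (\<lambda>r p. t * \<beta> r p) (\<lambda>r p. t * \<gamma> r p) k A B i j =
    t ^ (3 * k) * fast_prod m R \<alpha> \<beta> \<gamma> k A B i j"
proof (induction k arbitrary: A B i j)
  case (Suc k)
  let ?P = "{..<m} \<times> {..<m}"
  have *: "(\<Sum>p\<in>?P. t * \<alpha> r p * A (fst p * m ^ k + i) (snd p * m ^ k + j)) =
      t * (\<Sum>p\<in>?P. \<alpha> r p * A (fst p * m ^ k + i) (snd p * m ^ k + j))" for r i j and \<alpha> :: "nat \<Rightarrow> nat \<times> nat \<Rightarrow> 'a" and A
    by (simp add: sum_distrib_left mult.assoc)
  have t: "t ^ (3 * Suc k) = t * t * t * t ^ (3 * k)"
    by (simp add: power_add power3_eq_cube mult.assoc)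
  show ?case
    by (simp only: fast_prod.simps Suc.IH * fast_prod_scale_args t)
      (simp only: sum_distrib_left mult.assoc mult.left_commute)
qed simp

lemma of_int_fast_prod:
  "of_int (fast_prod m R \<alpha> \<beta> \<gamma> k A B i j) = fast_prod m R (\<lambda>r p. of_int (\<alpha> r p)) (\<lambda>r p. of_int (\<beta> r p))
    (\<lambda>r p. of_int (\<gamma> r p)) k (\<lambda>i j. of_int (A i j)) (\<lambda>i j. of_int (B i j)) i j"
  by (induction k arbitrary: A B i j) simp_all

lemma sum_shift_lessThan: "(\<Sum>l\<in>{c..<c + q}. f l) = (\<Sum>l<q. f (c + l))" for f :: "nat \<Rightarrow> 'a :: comm_monoid_add"
  by (rule sum.reindex_bij_witness[where i = "\<lambda>l. c + l" and j = "\<lambda>l. l - c"]) auto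

lemma sum_block: "(\<Sum>l<m * q. f l) = (\<Sum>b<m. \<Sum>l<q. f (b * q + l))" for f :: "nat \<Rightarrow> 'a :: comm_monoid_add"
  unfolding sum.nat_group[symmetric] by (simp only: sum_shift_lessThan)

text \<open>
  If \<open>\<alpha>, \<beta>, \<gamma>\<close> represent the matrix multiplication tensor up to \<open>\<delta>\<close>, the error of the recursive
  algorithm satisfies \<open>e (k + 1) \<le> (m + m\<^sup>4 \<delta>) e k + m\<^sup>4 \<delta> m ^ k\<close>.
\<close>

lemma fast_prod_error:
  fixes \<alpha> \<beta> \<gamma> :: "nat \<Rightarrow> nat \<times> nat \<Rightarrow> real"
  assumes tensor: "\<And>i j a b c d. i < m \<Longrightarrow> j < m \<Longrightarrow> a < m \<Longrightarrow> b < m \<Longrightarrow> c < m \<Longrightarrow> d < m \<Longrightarrow>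
      \<bar>(\<Sum>r<R. \<gamma> r (i, j) * \<alpha> r (a, b) * \<beta> r (c, d)) - of_bool (a = i \<and> b = c \<and> d = j)\<bar> \<le> \<delta>"
    and \<delta>: "0 \<le> \<delta>" "real m ^ 3 * \<delta> \<le> 1" and m: "m \<ge> 1"
    and A: "\<And>i j. i < m ^ k \<Longrightarrow> j < m ^ k \<Longrightarrow> \<bar>A i j\<bar> \<le> x"
    and B: "\<And>i j. i < m ^ k \<Longrightarrow> j < m ^ k \<Longrightarrow> \<bar>B i j\<bar> \<le> y"
    and ij: "i < m ^ k" "j < m ^ k"
  shows "\<bar>fast_prod m R \<alpha> \<beta> \<gamma> k A B i j - (\<Sum>l<m ^ k. A i l * B l j)\<bar> \<le>
    real m ^ 3 * \<delta> * ((2 * real m) ^ k - real m ^ k) * (x * y)"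
  using A B ij
proof (induction k arbitrary: A B i j)
  case 0
  then show ?case by simp
next
  case (Suc k)
  let ?P = "{..<m} \<times> {..<m}"
  let ?q = "m ^ k"
  define bl where "bl M p = (\<lambda>i j. M (fst p * ?q + i) (snd p * ?q + j))" for M :: "nat \<Rightarrow> nat \<Rightarrow> real" and p :: "nat \<times> nat"
  define F where "F p p' = fast_prod m R \<alpha> \<beta> \<gamma> k (bl A p) (bl B p') (i mod ?q) (j mod ?q)" for p p'
  define G where "G p p' = (\<Sum>l<?q. bl A p (i mod ?q) l * bl B p' l (j mod ?q))" for p p'
  define e where "e = real m ^ 3 * \<delta> * ((2 * real m) ^ k - real m ^ k) * (x * y)"
  define I J where "I = i div ?q" and "J = j div ?q"
  have q: "?q > 0" using m by simp
  have IJ: "I < m" "J < m" using Suc.prems(3,4) by (auto simp: I_def J_def less_mult_imp_div_less)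
  have blk: "a * ?q + l < m ^ Suc k" if "a < m" "l < ?q" for a l
    using that mult_le_mono1[of "Suc a" m ?q] by simp
  have xy: "0 \<le> x" "0 \<le> y" using Suc.prems(1,2)[OF Suc.prems(3,4)] by linarith+
  have "e \<ge> 0"
    using \<delta> xy m by (auto simp: e_def intro!: mult_nonneg_nonneg power_mono)
  have err: "\<bar>F p p' - G p p'\<bar> \<le> e" if "p \<in> ?P" "p' \<in> ?P" for p p'
    unfolding F_def G_def e_def
    by (rule Suc.IH) (use that blk q Suc.prems(1,2) in \<open>auto simp: bl_def\<close>)
  have Gb: "\<bar>G p p'\<bar> \<le> real ?q * (x * y)" if "p \<in> ?P" "p' \<in> ?P" for p p'
  proof -
    have "\<bar>bl A p (i mod ?q) l * bl B p' l (j mod ?q)\<bar> \<le> x * y" if "l < ?q" for l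
      unfolding abs_mult bl_def using that \<open>p \<in> ?P\<close> \<open>p' \<in> ?P\<close> q xy
      by (intro mult_mono Suc.prems(1,2) blk) auto
    then have "\<bar>G p p'\<bar> \<le> (\<Sum>l<?q. x * y)"
      unfolding G_def by (intro order_trans[OF sum_abs] sum_mono) auto
    then show ?thesis by simp
  qed
  define T where "T p p' = (\<Sum>r<R. \<gamma> r (I, J) * \<alpha> r p * \<beta> r p')" for p p'
  define T0 :: "nat \<times> nat \<Rightarrow> nat \<times> nat \<Rightarrow> real" where "T0 p p' = of_bool (fst p = I \<and> snd p = fst p' \<and> snd p' = J)" for p p'
  have T: "\<bar>T p p' - T0 p p'\<bar> \<le> \<delta>" if "p \<in> ?P" "p' \<in> ?P" for p p'
    using that tensor[OF IJ, of "fst p" "snd p" "fst p'" "snd p'"] by (auto simp: T_def T0_def)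
  have "fast_prod m R \<alpha> \<beta> \<gamma> (Suc k) A B i j =
      (\<Sum>r<R. \<gamma> r (I, J) * (\<Sum>p\<in>?P. \<alpha> r p * (\<Sum>p'\<in>?P. \<beta> r p' * F p p')))"
    by (simp only: fast_prod.simps fast_prod_sum_left fast_prod_sum_right I_def J_def F_def bl_def)
  also have "\<dots> = (\<Sum>r<R. \<Sum>p\<in>?P. \<Sum>p'\<in>?P. \<gamma> r (I, J) * \<alpha> r p * \<beta> r p' * F p p')"
    by (simp only: sum_distrib_left mult.assoc)
  also have "\<dots> = (\<Sum>p\<in>?P. \<Sum>p'\<in>?P. \<Sum>r<R. \<gamma> r (I, J) * \<alpha> r p * \<beta> r p' * F p p')"
    by (subst sum.swap, rule sum.cong[OF refl], rule sum.swap)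
  also have "\<dots> = (\<Sum>p\<in>?P. \<Sum>p'\<in>?P. T p p' * F p p')"
    by (simp only: T_def sum_distrib_right)
  finally have 1: "fast_prod m R \<alpha> \<beta> \<gamma> (Suc k) A B i j = (\<Sum>p\<in>?P. \<Sum>p'\<in>?P. T p p' * F p p')" .
  have pick: "(\<Sum>p\<in>?P. \<Sum>p'\<in>?P. T0 p p' * H p p') = (\<Sum>b<m. H (I, b) (b, J))" for H :: "nat \<times> nat \<Rightarrow> nat \<times> nat \<Rightarrow> real"
  proof -
    have "(\<Sum>p\<in>?P. \<Sum>p'\<in>?P. T0 p p' * H p p') = (\<Sum>z\<in>?P \<times> ?P. T0 (fst z) (snd z) * H (fst z) (snd z))"
      by (simp add: sum.cartesian_product split_def)
    also have "\<dots> = (\<Sum>z\<in>(\<lambda>b. ((I, b), (b, J))) ` {..<m}. H (fst z) (snd z))"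
      by (rule sum.mono_neutral_cong_right) (use IJ in \<open>auto simp: T0_def image_iff\<close>)
    also have "\<dots> = (\<Sum>b<m. H (I, b) (b, J))"
      by (subst sum.reindex) (auto simp: inj_on_def)
    finally show ?thesis .
  qed
  have "(\<Sum>l<m ^ Suc k. A i l * B l j) = (\<Sum>b<m. \<Sum>l<?q. A i (b * ?q + l) * B (b * ?q + l) j)"
    by (simp add: sum_block)
  also have "\<dots> = (\<Sum>b<m. G (I, b) (b, J))"
    by (simp add: G_def bl_def I_def J_def div_mult_mod_eq)
  finally have 2: "(\<Sum>l<m ^ Suc k. A i l * B l j) = (\<Sum>b<m. G (I, b) (b, J))" .
  \<comment> \<open>Two sources of error: the error of the tensor, weighted with all m^4 block
    products, and the recursive errors of the m block products that the exact tensor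
    selects.\<close>
  have "fast_prod m R \<alpha> \<beta> \<gamma> (Suc k) A B i j - (\<Sum>l<m ^ Suc k. A i l * B l j) =
     (\<Sum>p\<in>?P. \<Sum>p'\<in>?P. (T p p' - T0 p p') * F p p') + (\<Sum>b<m. F (I, b) (b, J) - G (I, b) (b, J))"
    unfolding 1 2 by (simp add: left_diff_distrib sum_subtractf pick)
  also have "\<bar>\<dots>\<bar> \<le> (\<Sum>p\<in>?P. \<Sum>p'\<in>?P. \<delta> * (e + real ?q * (x * y))) + (\<Sum>b<m. e)"
  proof (intro order_trans[OF abs_triangle_ineq] add_mono order_trans[OF sum_abs] sum_mono)
    fix p p' assume p: "p \<in> ?P" "p' \<in> ?P"
    have "\<bar>F p p'\<bar> \<le> e + real ?q * (x * y)" using err[OF p] Gb[OF p] by linarith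
    then show "\<bar>(T p p' - T0 p p') * F p p'\<bar> \<le> \<delta> * (e + real ?q * (x * y))"
      unfolding abs_mult using T[OF p] by (intro mult_mono) auto
  qed (use err IJ in auto)
  also have "\<dots> = real m ^ 4 * \<delta> * (e + real ?q * (x * y)) + real m * e"
    by (simp add: card_cartesian_product power4_eq_xxxx)
  also have "\<dots> = real m * (real m ^ 3 * \<delta>) * e + real m * e + real m ^ 4 * \<delta> * (real m ^ k * (x * y))"
    by (simp add: algebra_simps power4_eq_xxxx power3_eq_cube)
  \<comment> \<open>The assumption on \<delta> caps the growth at 2 m per level, which leads to the
    closed form with (2 m)^k - m^k.\<close>
  also have "\<dots> \<le> real m * 1 * e + real m * e + real m ^ 4 * \<delta> * (real m ^ k * (x * y))"
    using \<delta> \<open>e \<ge> 0\<close> by (intro add_right_mono mult_right_mono mult_left_mono) auto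
  also have "\<dots> = real m ^ 3 * \<delta> * ((2 * real m) ^ Suc k - real m ^ Suc k) * (x * y)"
    by (simp add: e_def algebra_simps power4_eq_xxxx power3_eq_cube)
  finally show ?case .
qed

lemma sum_sum_delta:
  fixes f :: "nat \<Rightarrow> nat \<Rightarrow> real"
  assumes "a < m" "b < m"
  shows "(\<Sum>s<m. \<Sum>t<m. f s t * (if s = a then if t = b then 1 else 0 else 0)) = f a b"
proof -
  have "(\<Sum>t<m. f s t * (if s = a then if t = b then 1 else 0 else 0)) = (if s = a then f a b else 0)" for s
    using assms by (cases "s = a") (simp_all add: if_distrib[of "(*) _"] cong: if_cong)
  then show ?thesis using assms by simp
qed

text \<open>Evaluation at two elementary matrices, with their ones at (a, b) and (c, d).\<close>

lemma bilinear_algorithm_tensor: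
  assumes "bilinear_algorithm m R \<alpha> \<beta> \<gamma>" "i < m" "j < m" "a < m" "b < m" "c < m" "d < m"
  shows "(\<Sum>r<R. \<gamma> r i j * \<alpha> r a b * \<beta> r c d) = of_bool (a = i \<and> b = c \<and> d = j)"
proof -
  define A B :: "nat \<Rightarrow> nat \<Rightarrow> real" where "A = (\<lambda>s t. if s = a then if t = b then 1 else 0 else 0)"
    and "B = (\<lambda>s t. if s = c then if t = d then 1 else 0 else 0)"
  have A: "(\<Sum>s<m. \<Sum>t<m. f s t * A s t) = f a b" for f
    unfolding A_def by (rule sum_sum_delta) (use assms in auto)
  have B: "(\<Sum>s<m. \<Sum>t<m. f s t * B s t) = f c d" for f
    unfolding B_def by (rule sum_sum_delta) (use assms in auto)
  have "(\<Sum>l<m. A i l * B l j) = (\<Sum>l<m. if l = b then of_bool (a = i \<and> b = c \<and> d = j) else 0)"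
    by (rule sum.cong) (auto simp: A_def B_def)
  also have "\<dots> = of_bool (a = i \<and> b = c \<and> d = j)" using assms by simp
  finally have "of_bool (a = i \<and> b = c \<and> d = j) = (\<Sum>l<m. A i l * B l j)" by simp
  also have "\<dots> = (\<Sum>r<R. \<gamma> r i j * ((\<Sum>s<m. \<Sum>t<m. \<alpha> r s t * A s t) * (\<Sum>s<m. \<Sum>t<m. \<beta> r s t * B s t)))"
    using assms(1-3) by (simp only: bilinear_algorithm_def)
  also have "\<dots> = (\<Sum>r<R. \<gamma> r i j * (\<alpha> r a b * \<beta> r c d))"
    by (simp only: A B)
  finally show ?thesis by (simp add: mult.assoc)
qed

text \<open>Products of weight zero raise the rank to at least m^2, which the cost estimate of the
  recursion relies on.\<close>

lemma bilinear_algorithm_pad: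
  assumes "bilinear_algorithm m R \<alpha> \<beta> \<gamma>" "R \<le> R'"
  shows "bilinear_algorithm m R' \<alpha> \<beta> (\<lambda>r i j. if r < R then \<gamma> r i j else 0)"
  unfolding bilinear_algorithm_def
proof (intro allI impI)
  fix A B :: "nat \<Rightarrow> nat \<Rightarrow> real" and i j assume ij: "i < m" "j < m"
  let ?f = "\<lambda>r. (\<Sum>a<m. \<Sum>b<m. \<alpha> r a b * A a b) * (\<Sum>a<m. \<Sum>b<m. \<beta> r a b * B a b)"
  have "(\<Sum>r<R'. (if r < R then \<gamma> r i j else 0) * ?f r) = (\<Sum>r<R. \<gamma> r i j * ?f r)"
    by (rule sum.mono_neutral_cong_right) (use assms(2) in auto)
  then show "(\<Sum>l<m. A i l * B l j) = (\<Sum>r<R'. (if r < R then \<gamma> r i j else 0) * ?f r)"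
    using assms(1) ij by (simp add: bilinear_algorithm_def)
qed

section \<open>Dyadic approximation of the coefficients and exact rounding of the product\<close>

definition dyadic :: "nat \<Rightarrow> real \<Rightarrow> int" where
  "dyadic p x = \<lfloor>2 ^ p * x\<rfloor>"

lemma dyadic_error: "\<bar>of_int (dyadic p x) / 2 ^ p - x\<bar> \<le> 1 / 2 ^ p"
proof -
  have "\<bar>of_int (dyadic p x) - 2 ^ p * x\<bar> \<le> 1" unfolding dyadic_def by linarith
  then have "\<bar>of_int (dyadic p x) - 2 ^ p * x\<bar> / 2 ^ p \<le> 1 / 2 ^ p" by (rule divide_right_mono) simp
  moreover have "of_int (dyadic p x) / 2 ^ p - x = (of_int (dyadic p x) - 2 ^ p * x) / 2 ^ p"
    by (simp add: diff_divide_distrib)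
  ultimately show ?thesis by (simp add: abs_divide)
qed

lemma product3_error:
  fixes x y z x' y' z' :: real
  assumes "\<bar>x\<bar> \<le> M" "\<bar>y\<bar> \<le> M" "\<bar>z\<bar> \<le> M" "\<bar>x' - x\<bar> \<le> h" "\<bar>y' - y\<bar> \<le> h" "\<bar>z' - z\<bar> \<le> h" "h \<le> 1"
  shows "\<bar>x' * y' * z' - x * y * z\<bar> \<le> 3 * (M + 1)\<^sup>2 * h"
proof -
  have M: "0 \<le> M" "\<bar>x'\<bar> \<le> M + 1" "\<bar>y'\<bar> \<le> M + 1" "0 \<le> h" using assms by linarith+
  have "x' * y' * z' - x * y * z = x' * y' * (z' - z) + x' * z * (y' - y) + y * z * (x' - x)"
    by (simp add: algebra_simps)
  also have "\<bar>\<dots>\<bar> \<le> \<bar>x' * y' * (z' - z)\<bar> + \<bar>x' * z * (y' - y)\<bar> + \<bar>y * z * (x' - x)\<bar>"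
    by (intro order_trans[OF abs_triangle_ineq] add_right_mono abs_triangle_ineq)
  also have "\<dots> \<le> (M + 1) * (M + 1) * h + (M + 1) * (M + 1) * h + (M + 1) * (M + 1) * h"
    unfolding abs_mult using assms M by (intro add_mono mult_mono) simp_all
  also have "\<dots> = 3 * (M + 1)\<^sup>2 * h" by (simp add: power2_eq_square)
  finally show ?thesis .
qed

text \<open>The tensor error with p-bit coefficients decays like 2^-p. The offset D absorbs the
  rank, the size of the coefficients and the factor m^3 from the error recursion; it depends on the
  base algorithm only, not on the matrices.\<close>

definition dyadic_accuracy :: "nat \<Rightarrow> nat \<Rightarrow> (nat \<Rightarrow> nat \<Rightarrow> nat \<Rightarrow> real) \<Rightarrow> (nat \<Rightarrow> nat \<Rightarrow> nat \<Rightarrow> real) \<Rightarrow>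
    (nat \<Rightarrow> nat \<Rightarrow> nat \<Rightarrow> real) \<Rightarrow> nat \<Rightarrow> bool" where
  "dyadic_accuracy m R \<alpha> \<beta> \<gamma> D \<longleftrightarrow> (\<forall>p\<ge>D. \<forall>i<m. \<forall>j<m. \<forall>a<m. \<forall>b<m. \<forall>c<m. \<forall>d<m.
    \<bar>(\<Sum>r<R. (of_int (dyadic p (\<gamma> r i j)) / 2 ^ p) * (of_int (dyadic p (\<alpha> r a b)) / 2 ^ p) *
       (of_int (dyadic p (\<beta> r c d)) / 2 ^ p)) - of_bool (a = i \<and> b = c \<and> d = j)\<bar> * real m ^ 3 \<le> 2 ^ D / 2 ^ p)"

lemma bilinear_algorithm_dyadic:
  assumes "bilinear_algorithm m R \<alpha> \<beta> \<gamma>"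
  shows "\<exists>D. dyadic_accuracy m R \<alpha> \<beta> \<gamma> D"
proof -
  define X where "X = (\<lambda>(r, a, b). \<bar>\<alpha> r a b\<bar> + \<bar>\<beta> r a b\<bar> + \<bar>\<gamma> r a b\<bar>) ` ({..<R} \<times> {..<m} \<times> {..<m})"
  have finX: "finite X" by (simp add: X_def)
  define M where "M = Max (insert 0 X)"
  have M: "\<bar>\<alpha> r a b\<bar> \<le> M" "\<bar>\<beta> r a b\<bar> \<le> M" "\<bar>\<gamma> r a b\<bar> \<le> M" if "r < R" "a < m" "b < m" for r a b
  proof -
    have "\<bar>\<alpha> r a b\<bar> + \<bar>\<beta> r a b\<bar> + \<bar>\<gamma> r a b\<bar> \<le> M"
      unfolding M_def using finX that
      by (intro Max_ge) (auto simp: X_def intro!: rev_image_eqI[of "(r, a, b)"])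
    then show "\<bar>\<alpha> r a b\<bar> \<le> M" "\<bar>\<beta> r a b\<bar> \<le> M" "\<bar>\<gamma> r a b\<bar> \<le> M" by linarith+
  qed
  define K where "K = real R * (3 * (M + 1)\<^sup>2) * real m ^ 3"
  obtain D where D: "K < 2 ^ D" using real_arch_pow[of 2 K] by auto
  show ?thesis
    unfolding dyadic_accuracy_def
  proof (rule exI[of _ D], intro allI impI)
    fix p i j a b c d assume p: "D \<le> p" and lt: "i < m" "j < m" "a < m" "b < m" "c < m" "d < m"
    define h :: real where "h = 1 / 2 ^ p"
    have "h \<le> 1" "0 \<le> h" by (auto simp: h_def)
    let ?s = "\<lambda>r. (of_int (dyadic p (\<gamma> r i j)) / 2 ^ p) * (of_int (dyadic p (\<alpha> r a b)) / 2 ^ p) *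
       (of_int (dyadic p (\<beta> r c d)) / 2 ^ p)"
    let ?t = "\<lambda>r. \<gamma> r i j * \<alpha> r a b * \<beta> r c d"
    let ?E = "(\<Sum>r<R. ?s r) - of_bool (a = i \<and> b = c \<and> d = j)"
    have E: "?E = (\<Sum>r<R. ?s r - ?t r)"
      unfolding bilinear_algorithm_tensor[OF assms lt, symmetric] by (rule sum_subtractf[symmetric])
    have "\<bar>\<Sum>r<R. ?s r - ?t r\<bar> \<le> (\<Sum>r<R. 3 * (M + 1)\<^sup>2 * h)"
    proof (intro order_trans[OF sum_abs] sum_mono)
      fix r assume r: "r \<in> {..<R}"
      show "\<bar>?s r - ?t r\<bar> \<le> 3 * (M + 1)\<^sup>2 * h"
        by (rule product3_error) (use r lt M \<open>h \<le> 1\<close> dyadic_error in \<open>auto simp: h_def\<close>)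
    qed
    then have "\<bar>?E\<bar> \<le> real R * (3 * (M + 1)\<^sup>2) * h" unfolding E by simp
    then have "\<bar>?E\<bar> * real m ^ 3 \<le> real R * (3 * (M + 1)\<^sup>2) * h * real m ^ 3"
      by (rule mult_right_mono) simp
    moreover have "real R * (3 * (M + 1)\<^sup>2) * h * real m ^ 3 = K * h" by (simp add: K_def)
    moreover have "K * h \<le> 2 ^ D * h" using D \<open>0 \<le> h\<close> by (intro mult_right_mono) auto
    moreover have "2 ^ D * h = 2 ^ D / 2 ^ p" by (simp add: h_def)
    ultimately show "\<bar>?E\<bar> * real m ^ 3 \<le> 2 ^ D / 2 ^ p" by linarith
  qed
qed

definition fast_int :: "nat \<Rightarrow> nat \<Rightarrow> (nat \<Rightarrow> nat \<Rightarrow> nat \<Rightarrow> real) \<Rightarrow> (nat \<Rightarrow> nat \<Rightarrow> nat \<Rightarrow> real) \<Rightarrow> (nat \<Rightarrow> nat \<Rightarrow> nat \<Rightarrow> real) \<Rightarrow>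
    nat \<Rightarrow> nat \<Rightarrow> (nat \<Rightarrow> nat \<Rightarrow> int) \<Rightarrow> (nat \<Rightarrow> nat \<Rightarrow> int) \<Rightarrow> nat \<Rightarrow> nat \<Rightarrow> int" where
  "fast_int m R \<alpha> \<beta> \<gamma> p = fast_prod m R (\<lambda>r q. dyadic p (\<alpha> r (fst q) (snd q)))
     (\<lambda>r q. dyadic p (\<beta> r (fst q) (snd q))) (\<lambda>r q. dyadic p (\<gamma> r (fst q) (snd q)))"

text \<open>The summands of p make the error at most 1/4: D bits for the tensor, k m bits for (2
  m)^k \<le> 2^(k m), 2 W bits for the two factors, and 2 for the fraction 1/4. If the computed
  numerator is Z and V = 3 p k, the quotient in the statement is the floor of Z / 2^V + 1/2, that
  is, rounding to the nearest integer.\<close>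

lemma fast_int_exact:
  assumes D: "dyadic_accuracy m R \<alpha> \<beta> \<gamma> D"
    and m: "m \<ge> 2"
    and A: "\<And>i j. i < m ^ k \<Longrightarrow> j < m ^ k \<Longrightarrow> 0 \<le> A i j \<and> A i j < 2 ^ W"
    and B: "\<And>i j. i < m ^ k \<Longrightarrow> j < m ^ k \<Longrightarrow> 0 \<le> B i j \<and> B i j < 2 ^ W"
    and ij: "i < m ^ k" "j < m ^ k" and p: "p = D + k * m + 2 * W + 2"
  shows "(2 * fast_int m R \<alpha> \<beta> \<gamma> p k A B i j + 2 ^ (3 * p * k)) div 2 ^ (3 * p * k + 1) = (\<Sum>l<m ^ k. A i l * B l j)"
proof -
  let ?f = "\<lambda>\<alpha> r q. real_of_int (dyadic p (\<alpha> r (fst q) (snd q))) / 2 ^ p"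
  let ?F = "fast_prod m R (?f \<alpha>) (?f \<beta>) (?f \<gamma>) k (\<lambda>i j. of_int (A i j)) (\<lambda>i j. of_int (B i j)) i j"
  let ?S = "\<Sum>l<m ^ k. A i l * B l j"
  have pD: "D \<le> p" by (simp add: p)
  have abs_bound: "\<bar>real_of_int a\<bar> \<le> 2 ^ W" if "0 \<le> a \<and> a < 2 ^ W" for a
  proof -
    have "a \<le> 2 ^ W" using that by simp
    then have "real_of_int a \<le> real_of_int (2 ^ W)" by (simp only: of_int_le_iff)
    with that show ?thesis by simp
  qed
  define \<delta> where "\<delta> = 2 ^ D / 2 ^ p / real m ^ 3"
  have m3: "real m ^ 3 > 0" using m by simp
  have m\<delta>: "real m ^ 3 * \<delta> = 2 ^ D / 2 ^ p" using m3 by (simp add: \<delta>_def)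
  have "\<bar>?F - (\<Sum>l<m ^ k. of_int (A i l) * of_int (B l j))\<bar> \<le>
    real m ^ 3 * \<delta> * ((2 * real m) ^ k - real m ^ k) * (2 ^ W * 2 ^ W)"
  proof (rule fast_prod_error[OF _ _ _ _ _ _ ij])
    show "\<bar>(\<Sum>r<R. ?f \<gamma> r (i, j) * ?f \<alpha> r (a, b) * ?f \<beta> r (c, d)) - of_bool (a = i \<and> b = c \<and> d = j)\<bar> \<le> \<delta>"
      if "i < m" "j < m" "a < m" "b < m" "c < m" "d < m" for i j a b c d
      using D[unfolded dyadic_accuracy_def, rule_format, OF pD that] unfolding \<delta>_def by (simp only: pos_le_divide_eq[OF m3] fst_conv snd_conv)
    show "0 \<le> \<delta>" by (simp add: \<delta>_def)
    show "real m ^ 3 * \<delta> \<le> 1" unfolding m\<delta> using pD by (simp add: power_increasing)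
    show "\<bar>real_of_int (A i j)\<bar> \<le> 2 ^ W" "\<bar>real_of_int (B i j)\<bar> \<le> 2 ^ W" if "i < m ^ k" "j < m ^ k" for i j
      by (rule abs_bound[OF A[OF that]], rule abs_bound[OF B[OF that]])
  qed (use m in auto)
  also have "\<dots> = 2 ^ D / 2 ^ p * ((2 * real m) ^ k - real m ^ k) * (2 ^ W * 2 ^ W)" by (simp only: m\<delta>)
  also have "\<dots> \<le> 2 ^ D / 2 ^ p * 2 ^ (k * m) * (2 ^ W * 2 ^ W)"
  proof -
    have "2 * real m \<le> 2 ^ m"
    proof -
      have "2 * m \<le> 2 ^ m" using m by (induction m rule: dec_induct) auto
      then show ?thesis by (metis of_nat_le_iff of_nat_mult of_nat_numeral of_nat_power)
    qed
    then have "(2 * real m) ^ k \<le> (2 ^ m) ^ k" by (rule power_mono) simp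
    then have "(2 * real m) ^ k \<le> 2 ^ (k * m)" by (simp only: power_mult[symmetric] mult.commute)
    moreover have "0 \<le> real m ^ k" by simp
    ultimately have "(2 * real m) ^ k - real m ^ k \<le> 2 ^ (k * m)" by linarith
    then show ?thesis by (intro mult_right_mono mult_left_mono) auto
  qed
  also have "\<dots> = 1 / 4"
  proof -
    have "(2 :: real) ^ p = 4 * (2 ^ D * 2 ^ (k * m) * (2 ^ W * 2 ^ W))"
      unfolding p mult_2 power_add by simp
    then show ?thesis by simp
  qed
  finally have err: "\<bar>?F - of_int ?S\<bar> \<le> 1 / 4" by simp
  have "real_of_int (fast_int m R \<alpha> \<beta> \<gamma> p k A B i j) = fast_prod m R (\<lambda>r q. 2 ^ p * ?f \<alpha> r q) (\<lambda>r q. 2 ^ p * ?f \<beta> r q)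
      (\<lambda>r q. 2 ^ p * ?f \<gamma> r q) k (\<lambda>i j. of_int (A i j)) (\<lambda>i j. of_int (B i j)) i j"
    by (simp add: fast_int_def of_int_fast_prod)
  also have "\<dots> = (2 ^ p) ^ (3 * k) * ?F" by (rule fast_prod_scale_coeffs)
  also have "((2 :: real) ^ p) ^ (3 * k) = 2 ^ (3 * p * k)"
    by (simp only: power_mult[symmetric] mult.assoc mult.left_commute)
  finally have F: "real_of_int (fast_int m R \<alpha> \<beta> \<gamma> p k A B i j) = 2 ^ (3 * p * k) * ?F" .
  let ?V = "3 * p * k"
  let ?Z = "fast_int m R \<alpha> \<beta> \<gamma> p k A B i j"
  have "(2 * ?Z + 2 ^ ?V) div 2 ^ (?V + 1) = \<lfloor>real_of_int (2 * ?Z + 2 ^ ?V) / real_of_int (2 ^ (?V + 1))\<rfloor>"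
    by (rule floor_divide_of_int_eq[symmetric])
  also have "real_of_int (2 * ?Z + 2 ^ ?V) / real_of_int (2 ^ (?V + 1)) = ?F + 1 / 2"
    by (simp add: F add_divide_distrib)
  also have "\<lfloor>?F + 1 / 2\<rfloor> = ?S" using err by (intro floor_unique) linarith+
  finally show ?thesis .
qed

section \<open>Gate counts for the recursive product\<close>

lemma word_cost: "V * (7 * V) + 6 * V \<le> 13 * (V * V)" for V :: nat
  using le_square[of V] by (subst mult.left_commute) linarith

text \<open>Because of m^2 \<le> R, the linear combinations of every level are no more expensive
  than order R^k, like the products at the bottom. The price is only the factor k + 1, which is
  logarithmic in the order of the matrices.\<close>

lemma computes_fast_prod:
  fixes A B :: "nat \<Rightarrow> nat \<Rightarrow> 'x \<Rightarrow> int"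
  assumes R: "m * m \<le> R" and m: "m \<ge> 1"
    and "\<And>i j. i < m ^ k \<Longrightarrow> j < m ^ k \<Longrightarrow> word_bits V (A i j) \<subseteq> S \<union> consts_bool"
    and "\<And>i j. i < m ^ k \<Longrightarrow> j < m ^ k \<Longrightarrow> word_bits V (B i j) \<subseteq> S \<union> consts_bool"
  shows "computes S (39 * (V * V) * (m * m) * (k + 1) * R ^ k)
    (\<Union>z\<in>{..<m ^ k} \<times> {..<m ^ k}. word_bits V (\<lambda>x. fast_prod m R \<alpha> \<beta> \<gamma> k (\<lambda>i j. A i j x) (\<lambda>i j. B i j x) (fst z) (snd z)))"
  using assms(3,4)
proof (induction k arbitrary: A B S)
  case 0
  have "computes S (V * (7 * V)) (word_bits V (\<lambda>x. A 0 0 x * B 0 0 x))"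
    by (rule computes_mult'[OF computes.free[of _ _ 0] computes.free[of _ _ 0]]) (use 0 in simp_all)
  then show ?case
  proof (rule computes_mono)
    have "V * (7 * V) \<le> 39 * (V * V) * 1" by simp
    also have "\<dots> \<le> 39 * (V * V) * (m * m)" using m by (intro mult_le_mono2) simp
    finally show "V * (7 * V) \<le> 39 * (V * V) * (m * m) * (0 + 1) * R ^ 0" by simp
  qed auto
next
  case (Suc k)
  let ?P = "{..<m} \<times> {..<m}"
  let ?q = "m ^ k"
  let ?Q = "{..<?q} \<times> {..<?q}"
  define e where "e = m * m * (V * (7 * V) + 6 * V)"
  define c where "c = 39 * (V * V) * (m * m) * (k + 1) * R ^ k"
  define A' B' where "A' = (\<lambda>r i j x. \<Sum>p\<in>?P. \<alpha> r p * A (fst p * ?q + i) (snd p * ?q + j) x)"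
    and "B' = (\<lambda>r i j x. \<Sum>p\<in>?P. \<beta> r p * B (fst p * ?q + i) (snd p * ?q + j) x)"
  define UA UB where "UA r = (\<Union>z\<in>?Q. word_bits V (A' r (fst z) (snd z)))"
    and "UB r = (\<Union>z\<in>?Q. word_bits V (B' r (fst z) (snd z)))" for r
  define F where "F r z x = fast_prod m R \<alpha> \<beta> \<gamma> k (\<lambda>i j. A' r i j x) (\<lambda>i j. B' r i j x) (fst z) (snd z)" for r z x
  have q: "?q > 0" using m by simp
  have blk: "a * ?q + l < m ^ Suc k" if "a < m" "l < ?q" for a l
    using that mult_le_mono1[of "Suc a" m ?q] by simp
  have comb: "computes S e (word_bits V (\<lambda>x. \<Sum>p\<in>?P. \<phi> p * M (fst p * ?q + i) (snd p * ?q + j) x))"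
    if M: "\<And>i j. i < m ^ Suc k \<Longrightarrow> j < m ^ Suc k \<Longrightarrow> word_bits V (M i j) \<subseteq> S \<union> consts_bool" and "i < ?q" "j < ?q"
    for M :: "nat \<Rightarrow> nat \<Rightarrow> 'x \<Rightarrow> int" and \<phi> i j
  proof (rule computes_sum)
    show "computes S (V * (7 * V)) (word_bits V (\<lambda>x. \<phi> p * M (fst p * ?q + i) (snd p * ?q + j) x))" if "p \<in> ?P" for p
      using M[OF blk[of "fst p" i] blk[of "snd p" j]] that \<open>i < ?q\<close> \<open>j < ?q\<close>
      by (intro computes_cmult[OF computes.free[of _ _ 0]]) auto
  qed (simp_all add: e_def card_cartesian_product)
  have cQ: "card ?Q = ?q * ?q" by (simp add: card_cartesian_product)
  have UA: "computes S (?q * ?q * e) (UA r)" for r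
    unfolding UA_def A'_def using Suc.prems(1) by (intro computes_UN_bound[where c = e] comb) (auto simp: cQ)
  have UB: "computes S (?q * ?q * e) (UB r)" for r
    unfolding UB_def B'_def using Suc.prems(2) by (intro computes_UN_bound[where c = e] comb) (auto simp: cQ)
  have UF: "computes S (?q * ?q * e + ?q * ?q * e + c) (\<Union>z\<in>?Q. word_bits V (F r z))" for r
  proof (rule computes_trans[OF computes_Un[OF UA UB]])
    show "computes (S \<union> (UA r \<union> UB r)) c (\<Union>z\<in>?Q. word_bits V (F r z))"
      unfolding F_def c_def by (rule Suc.IH) (force simp: UA_def UB_def)+
  qed
  have 1: "computes S (R * (?q * ?q * e + ?q * ?q * e + c)) (\<Union>r\<in>{..<R}. \<Union>z\<in>?Q. word_bits V (F r z))"
    by (rule computes_UN_bound[OF _ UF]) auto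
  let ?S' = "S \<union> (\<Union>r\<in>{..<R}. \<Union>z\<in>?Q. word_bits V (F r z))"
  let ?O = "\<lambda>z x. \<Sum>r<R. \<gamma> r (fst z div ?q, snd z div ?q) * F r (fst z mod ?q, snd z mod ?q) x"
  have "computes ?S' (R * (V * (7 * V) + 6 * V)) (word_bits V (?O z))" for z
  proof (rule computes_sum)
    show "computes ?S' (V * (7 * V)) (word_bits V (\<lambda>x. \<gamma> r (fst z div ?q, snd z div ?q) * F r (fst z mod ?q, snd z mod ?q) x))"
      if "r \<in> {..<R}" for r
      by (rule computes_cmult[OF computes.free[of _ _ 0]]) (use that q in auto)
  qed auto
  then have 2: "computes ?S' (m ^ Suc k * m ^ Suc k * (R * (V * (7 * V) + 6 * V)))
      (\<Union>z\<in>{..<m ^ Suc k} \<times> {..<m ^ Suc k}. word_bits V (?O z))"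
    by (intro computes_UN_bound) (auto simp: card_cartesian_product)
  have O: "?O z = (\<lambda>x. fast_prod m R \<alpha> \<beta> \<gamma> (Suc k) (\<lambda>i j. A i j x) (\<lambda>i j. B i j x) (fst z) (snd z))" for z
    by (simp add: F_def A'_def B'_def)
  let ?w = "V * (7 * V) + 6 * V"
  note w = word_cost[of V]
  have qR: "?q * ?q \<le> R ^ k"
    unfolding power_mult_distrib[symmetric] by (rule power_mono[OF R]) simp
  \<comment> \<open>Three families of linear combinations per level: on the left factor, on the
    right factor and on the output. With 13 V^2 gates for each term this gives the constant
    39.\<close>
  have "R * (?q * ?q * e + ?q * ?q * e + c) + m ^ Suc k * m ^ Suc k * (R * ?w) = R * c + R * (?q * ?q) * (m * m) * (3 * ?w)"
    by (simp add: e_def algebra_simps)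
  also have "\<dots> \<le> R * c + R * R ^ k * (m * m) * (3 * (13 * (V * V)))"
    by (intro add_left_mono mult_le_mono qR w order_refl)
  also have "\<dots> = 39 * (V * V) * (m * m) * (Suc k + 1) * R ^ Suc k"
    by (simp add: c_def algebra_simps)
  finally have total: "R * (?q * ?q * e + ?q * ?q * e + c) + m ^ Suc k * m ^ Suc k * (R * ?w) \<le>
    39 * (V * V) * (m * m) * (Suc k + 1) * R ^ Suc k" .
  show ?case
    by (rule computes_mono[OF computes_trans[OF 1 2, unfolded O] _ total]) auto
qed

lemma take_bit_sum_cong:
  fixes f g :: "'b \<Rightarrow> int"
  assumes "\<And>l. l \<in> I \<Longrightarrow> take_bit W (f l) = take_bit W (g l)"
  shows "take_bit W (\<Sum>l\<in>I. f l) = take_bit W (\<Sum>l\<in>I. g l)"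
proof -
  have "(\<Sum>l\<in>I. f l) mod 2 ^ W = (\<Sum>l\<in>I. f l mod 2 ^ W) mod 2 ^ W"
    by (rule mod_sum_eq[symmetric])
  also have "(\<Sum>l\<in>I. f l mod 2 ^ W) = (\<Sum>l\<in>I. g l mod 2 ^ W)"
    by (rule sum.cong) (use assms in \<open>auto simp: take_bit_eq_mod\<close>)
  also have "\<dots> mod 2 ^ W = (\<Sum>l\<in>I. g l) mod 2 ^ W"
    by (rule mod_sum_eq)
  finally show ?thesis by (simp add: take_bit_eq_mod)
qed

text \<open>
  Reducing the entries modulo \<open>2 ^ W\<close> makes them bounded, so that rounding the result of the approximate
  algorithm to the nearest integer gives the exact product modulo \<open>2 ^ W\<close>.
\<close>

lemma computes_matrix_product_aux:
  fixes A B :: "nat \<Rightarrow> nat \<Rightarrow> 'x \<Rightarrow> int"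
  assumes D: "dyadic_accuracy m R \<alpha> \<beta> \<gamma> D"
    and m: "m \<ge> 2" and R: "m * m \<le> R" and n: "n \<le> m ^ k" and V: "V = W + 3 * (D + k * m + 2 * W + 2) * k + 1"
    and A: "\<And>i j. i < n \<Longrightarrow> j < n \<Longrightarrow> word_bits W (A i j) \<subseteq> S \<union> consts_bool"
    and B: "\<And>i j. i < n \<Longrightarrow> j < n \<Longrightarrow> word_bits W (B i j) \<subseteq> S \<union> consts_bool"
  shows "computes S (39 * (V * V) * (m * m) * (k + 1) * R ^ k + n * n * (13 * (V * V)))
    (\<Union>z\<in>{..<n} \<times> {..<n}. word_bits W (\<lambda>x. \<Sum>l<n. A (fst z) l x * B l (snd z) x))"
proof -
  define p where "p = D + k * m + 2 * W + 2"
  \<comment> \<open>Besides the reduction modulo 2^W, the matrices are padded with zeros from order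
    n to order m^k.\<close>
  define cut where "cut M i j x = (if i < n \<and> j < n then take_bit W (M i j x) else 0)" for M :: "nat \<Rightarrow> nat \<Rightarrow> 'x \<Rightarrow> int" and i j x
  have cutS: "word_bits V (cut M i j) \<subseteq> S \<union> consts_bool"
    if "\<And>i j. i < n \<Longrightarrow> j < n \<Longrightarrow> word_bits W (M i j) \<subseteq> S \<union> consts_bool" for M i j
  proof (cases "i < n \<and> j < n")
    case True
    then have "cut M i j = (\<lambda>x. take_bit W (M i j x))" by (auto simp: cut_def)
    then show ?thesis
      using word_bits_take_bit[of V W "M i j"] that[of i j] True by auto
  next
    case False
    then have "cut M i j = (\<lambda>_. 0)" by (auto simp: cut_def)
    then show ?thesis using word_bits_const[of V 0] by auto
  qed
  have bnd: "0 \<le> cut M i j x \<and> cut M i j x < 2 ^ W" for M i j x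
    by (auto simp: cut_def take_bit_int_less_exp)
  define Z where "Z z x = fast_int m R \<alpha> \<beta> \<gamma> p k (\<lambda>i j. cut A i j x) (\<lambda>i j. cut B i j x) (fst z) (snd z)" for z x
  have 1: "computes S (39 * (V * V) * (m * m) * (k + 1) * R ^ k) (\<Union>z\<in>{..<m ^ k} \<times> {..<m ^ k}. word_bits V (Z z))"
    unfolding Z_def fast_int_def
    by (rule computes_fast_prod[OF R]) (use m cutS[OF A] cutS[OF B] in auto)
  have 2: "computes (S \<union> (\<Union>z\<in>{..<m ^ k} \<times> {..<m ^ k}. word_bits V (Z z))) (n * n * (13 * (V * V)))
    (\<Union>z\<in>{..<n} \<times> {..<n}. word_bits W (\<lambda>x. \<Sum>l<n. A (fst z) l x * B l (snd z) x))"
  proof (rule computes_UN_bound)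
    fix z assume z: "z \<in> {..<n} \<times> {..<n}"
    let ?S = "S \<union> (\<Union>z\<in>{..<m ^ k} \<times> {..<m ^ k}. word_bits V (Z z))"
    let ?Y = "\<lambda>x. 2 * Z z x + 2 ^ (3 * p * k)"
    have "z \<in> {..<m ^ k} \<times> {..<m ^ k}" using z n by auto
    then have "word_bits V (Z z) \<subseteq> ?S \<union> consts_bool" by blast
    then have "computes ?S (V * (7 * V)) (word_bits V (\<lambda>x. 2 * Z z x))"
      by (intro computes_cmult[OF computes.free[of _ _ 0]]) auto
    moreover have "computes ?S 0 (word_bits V (\<lambda>x::'x. 2 ^ (3 * p * k)))"
      using word_bits_const by (intro computes.free) blast
    moreover have "V * (7 * V) + 0 + 6 * V \<le> 13 * (V * V)" using word_cost[of V] by simp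
    ultimately have "computes ?S (13 * (V * V)) (word_bits V ?Y)"
      by (rule computes_add')
    \<comment> \<open>Rounding discards 3 p k + 1 bits, and V is chosen so that W valid ones are
      left.\<close>
    moreover have "word_bits W (\<lambda>x. ?Y x div 2 ^ (3 * p * k + 1)) \<subseteq> word_bits V ?Y"
      using word_bits_div[of W ?Y "3 * p * k + 1"] by (simp add: V p_def mult.assoc)
    moreover have "word_bits W (\<lambda>x. ?Y x div 2 ^ (3 * p * k + 1)) = word_bits W (\<lambda>x. \<Sum>l<n. A (fst z) l x * B l (snd z) x)"
    proof (rule word_bits_cong)
      fix x
      have "?Y x div 2 ^ (3 * p * k + 1) = (\<Sum>l<m ^ k. cut A (fst z) l x * cut B l (snd z) x)"
        unfolding Z_def by (rule fast_int_exact[OF D m]) (use z n bnd in \<open>auto simp: p_def\<close>)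
      also have "\<dots> = (\<Sum>l<n. take_bit W (A (fst z) l x) * take_bit W (B l (snd z) x))"
        by (rule sum.mono_neutral_cong_right) (use z n in \<open>auto simp: cut_def\<close>)
      also have "take_bit W \<dots> = take_bit W (\<Sum>l<n. A (fst z) l x * B l (snd z) x)"
        by (rule take_bit_sum_cong) (simp only: take_bit_eq_mod mod_mult_eq)
      finally show "take_bit W (?Y x div 2 ^ (3 * p * k + 1)) = take_bit W (\<Sum>l<n. A (fst z) l x * B l (snd z) x)" .
    qed
    ultimately show "computes ?S (13 * (V * V)) (word_bits W (\<lambda>x. \<Sum>l<n. A (fst z) l x * B l (snd z) x))"
      by (elim computes_mono) auto
  qed (auto simp: card_cartesian_product)
  show ?thesis by (rule computes_trans[OF 1 2])
qed

text \<open>The hypothesis is used with \<eta>/2: for some large m the remaining factor m^(\<eta>/2)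
  exceeds both the implied constant and the factor 2 of the rank. An inequality R \<le> m^(\<omega>
  + \<eta>) without a constant is essential, since the recursion raises it to the power k.\<close>

lemma exact_multiplication_bilinear:
  assumes "\<forall>\<eta>>0. exact_multiplication_in (\<omega> + \<eta>)" "\<eta> > 0"
  shows "\<exists>m R \<alpha> \<beta> \<gamma>. m \<ge> 2 \<and> m * m \<le> R \<and> bilinear_algorithm m R \<alpha> \<beta> \<gamma> \<and> real R \<le> real m powr (\<omega> + \<eta>)"
proof -
  have \<tau>: "2 \<le> \<omega> + \<eta>" using assms by (intro exact_multiplication_exponent) auto
  from assms(1)[rule_format, of "\<eta> / 2"] assms(2) obtain T where T: "\<And>n. n \<ge> 1 \<Longrightarrow> multiplies_exactly n (T n)"
    "(\<lambda>n. real (arith_ops (T n))) \<in> O(\<lambda>n. real n powr (\<omega> + \<eta> / 2))"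
    by (auto simp: exact_multiplication_in_def)
  from landau_o.bigE[OF T(2)] obtain C
    where C: "\<forall>\<^sub>F n in at_top. norm (real (arith_ops (T n))) \<le> C * norm (real n powr (\<omega> + \<eta> / 2))" by blast
  have "(\<lambda>n::nat. real n powr (- (\<eta> / 2))) \<longlonglongrightarrow> 0"
    using assms(2) by (intro tendsto_neg_powr filterlim_real_sequentially) auto
  then have "(\<lambda>n::nat. 2 * C * real n powr (- (\<eta> / 2))) \<longlonglongrightarrow> 0"
    by (rule tendsto_mult_right_zero)
  then have "\<forall>\<^sub>F n::nat in at_top. 2 * C * real n powr (- (\<eta> / 2)) < 1"
    by (rule order_tendstoD) simp
  with C eventually_ge_at_top[of 2] have "\<forall>\<^sub>F n in at_top. n \<ge> 2 \<and> real (2 * arith_ops (T n)) \<le> real n powr (\<omega> + \<eta>)"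
  proof eventually_elim
    case (elim n)
    have "real (2 * arith_ops (T n)) \<le> 2 * (C * real n powr (\<omega> + \<eta> / 2))" using elim by simp
    also have "\<omega> + \<eta> / 2 = - (\<eta> / 2) + (\<omega> + \<eta>)" by (simp add: field_simps)
    also have "real n powr (- (\<eta> / 2) + (\<omega> + \<eta>)) = real n powr (- (\<eta> / 2)) * real n powr (\<omega> + \<eta>)"
      by (rule powr_add)
    also have "2 * (C * (real n powr (- (\<eta> / 2)) * real n powr (\<omega> + \<eta>))) =
        (2 * C * real n powr (- (\<eta> / 2))) * real n powr (\<omega> + \<eta>)" by simp
    also have "\<dots> \<le> 1 * real n powr (\<omega> + \<eta>)"
      using elim by (intro mult_right_mono) auto
    finally show ?case using elim by simp
  qed
  then obtain m where m: "m \<ge> 2" "real (2 * arith_ops (T m)) \<le> real m powr (\<omega> + \<eta>)"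
    by (auto simp: eventually_at_top_linorder)
  define R where "R = max (2 * arith_ops (T m)) (m * m)"
  have "real (m * m) \<le> real m powr (\<omega> + \<eta>)"
    using powr_mono[OF \<tau>, of "real m"] m(1) by (simp add: powr_numeral power2_eq_square)
  with m have R: "real R \<le> real m powr (\<omega> + \<eta>)" by (simp add: R_def max_def)
  from bilinear_algorithm_from_tree[OF T(1)] m(1) obtain R0 \<alpha> \<beta> \<gamma>
    where R0: "R0 \<le> 2 * arith_ops (T m)" "bilinear_algorithm m R0 \<alpha> \<beta> \<gamma>" by (metis One_nat_def Suc_1 Suc_leD)
  from bilinear_algorithm_pad[OF R0(2), of R] R0(1)
  have "bilinear_algorithm m R \<alpha> \<beta> (\<lambda>r i j. if r < R0 then \<gamma> r i j else 0)" by (simp add: R_def)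
  moreover have "m * m \<le> R" by (simp add: R_def)
  ultimately show ?thesis using m(1) R by blast
qed

text \<open>The least k with n \<le> m^k satisfies m^k \<le> m n, so R^k is at most (m n)^(\<omega>
  + \<eta>). The condition n \<le> 2^W bounds k by W and thereby turns every logarithmic factor into
  a power of W.\<close>

theorem computes_matrix_product:
  assumes "\<forall>\<eta>>0. exact_multiplication_in (\<omega> + \<eta>)" "\<eta> > 0"
  shows "\<exists>(C::real) d. C \<ge> 0 \<and> (\<forall>(n::nat) W (S :: ('x \<Rightarrow> bool) set) A B. n \<ge> 1 \<longrightarrow> W \<ge> 1 \<longrightarrow> n \<le> 2 ^ W \<longrightarrow>
     (\<forall>i<n. \<forall>j<n. word_bits W (A i j) \<subseteq> S \<union> consts_bool \<and> word_bits W (B i j) \<subseteq> S \<union> consts_bool) \<longrightarrow>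
     (\<exists>c. real c \<le> C * real n powr (\<omega> + \<eta>) * real W ^ d \<and>
        computes S c (\<Union>z\<in>{..<n} \<times> {..<n}. word_bits W (\<lambda>x. \<Sum>l<n. A (fst z) l x * B l (snd z) x))))"
proof -
  have \<tau>: "2 \<le> \<omega> + \<eta>" using assms by (intro exact_multiplication_exponent) auto
  define \<tau> where "\<tau> = \<omega> + \<eta>"
  from exact_multiplication_bilinear[OF assms] obtain m R \<alpha> \<beta> \<gamma>
    where m: "m \<ge> 2" and R: "m * m \<le> R" "real R \<le> real m powr \<tau>" and bil: "bilinear_algorithm m R \<alpha> \<beta> \<gamma>"
    unfolding \<tau>_def by blast
  from bilinear_algorithm_dyadic[OF bil] obtain D where D: "dyadic_accuracy m R \<alpha> \<beta> \<gamma> D" ..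
  define E where "E = 3 * D + 3 * m + 14"
  define C where "C = 78 * (real E)\<^sup>2 * (real m)\<^sup>2 * real m powr \<tau> + 13 * (real E)\<^sup>2"
  show ?thesis
  \<comment> \<open>The word length V is at most quadratic in W; V^2 contributes W^4 and the number
    of levels one more factor W.\<close>
  proof (rule exI[of _ C], rule exI[of _ 5], intro conjI allI impI)
    show "C \<ge> 0" by (simp add: C_def)
    fix n W :: nat and S :: "('x \<Rightarrow> bool) set" and A B
    assume n: "n \<ge> 1" and W: "W \<ge> 1" "n \<le> 2 ^ W" and
      S: "\<forall>i<n. \<forall>j<n. word_bits W (A i j) \<subseteq> S \<union> consts_bool \<and> word_bits W (B i j) \<subseteq> S \<union> consts_bool"
    define k where "k = (LEAST k. n \<le> m ^ k)"
    have nW: "n \<le> m ^ W" using W(2) power_mono[of 2 m W] m by simp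
    have k: "n \<le> m ^ k" unfolding k_def using nW by (rule LeastI)
    have kW: "k \<le> W" unfolding k_def using nW by (rule Least_le)
    have mk: "m ^ k \<le> m * n"
    proof (cases k)
      case 0
      then show ?thesis using m n by simp
    next
      case (Suc l)
      then have "\<not> n \<le> m ^ l" using not_less_Least[of l "\<lambda>k. n \<le> m ^ k"] by (simp add: k_def)
      then show ?thesis using Suc by simp
    qed
    define V where "V = W + 3 * (D + k * m + 2 * W + 2) * k + 1"
    define c where "c = 39 * (V * V) * (m * m) * (k + 1) * R ^ k + n * n * (13 * (V * V))"
    have comp: "computes S c (\<Union>z\<in>{..<n} \<times> {..<n}. word_bits W (\<lambda>x. \<Sum>l<n. A (fst z) l x * B l (snd z) x))"
      unfolding c_def by (rule computes_matrix_product_aux[OF D m R(1) k V_def]) (use S in auto)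
    have "V \<le> E * (W * W)"
    proof -
      have "D \<le> D * W" "k * m \<le> m * W" "2 \<le> 2 * W" using W kW by auto
      moreover have "(D + m + 4) * W = D * W + m * W + 4 * W" by (simp add: algebra_simps)
      ultimately have "D + k * m + 2 * W + 2 \<le> (D + m + 4) * W" by linarith
      then have "3 * (D + k * m + 2 * W + 2) * k \<le> 3 * ((D + m + 4) * W) * W"
        using kW by (intro mult_le_mono) auto
      moreover have "3 * ((D + m + 4) * W) * W = (3 * D + 3 * m + 12) * (W * W)" by (simp add: algebra_simps)
      moreover have "E * (W * W) = (3 * D + 3 * m + 12) * (W * W) + 2 * (W * W)"
        by (simp add: E_def algebra_simps)
      moreover have "W \<le> W * W" "1 \<le> W * W" using W by auto
      ultimately show ?thesis unfolding V_def by linarith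
    qed
    then have "real V \<le> real (E * (W * W))" by (simp only: of_nat_le_iff)
    then have "real V \<le> real E * real W ^ 2" by (simp add: power2_eq_square)
    then have "(real V)\<^sup>2 \<le> (real E * real W ^ 2)\<^sup>2" by (rule power_mono) simp
    then have V2: "real V * real V \<le> (real E)\<^sup>2 * real W ^ 4"
      by (simp add: power_mult_distrib power2_eq_square power4_eq_xxxx mult_ac)
    have Rk: "real R ^ k \<le> real m powr \<tau> * real n powr \<tau>"
    proof -
      have "real R ^ k \<le> (real m powr \<tau>) ^ k" using R(2) by (rule power_mono) simp
      also have "\<dots> = real m powr (\<tau> * real k)" using m by (simp add: powr_power mult.commute)
      also have "\<dots> = (real m powr real k) powr \<tau>" by (simp add: powr_powr mult.commute)
      also have "real m powr real k = real (m ^ k)" using m by (simp add: powr_realpow)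
      also have "real (m ^ k) powr \<tau> \<le> real (m * n) powr \<tau>"
        using mk \<tau> by (intro powr_mono2) (auto simp: \<tau>_def simp del: of_nat_mult of_nat_power)
      finally show ?thesis by (simp add: powr_mult)
    qed
    have n2: "real n * real n \<le> real n powr \<tau>"
      using powr_mono[OF \<tau>, of "real n"] n by (simp add: powr_numeral power2_eq_square \<tau>_def)
    have k1: "real k + 1 \<le> 2 * real W" using kW W by linarith
    have W45: "real W ^ 4 \<le> real W ^ 5" using W by (intro power_increasing) auto
    define v v' r r' where "v = real V * real V" and "v' = (real E)\<^sup>2 * real W ^ 4" and "r = real R ^ k"
      and "r' = real m powr \<tau> * real n powr \<tau>"
    have nonneg: "0 \<le> v" "0 \<le> v'" "0 \<le> r" "0 \<le> r'" by (simp_all add: v_def v'_def r_def r'_def)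
    have vr: "v \<le> v'" "r \<le> r'" using V2 Rk by (simp_all add: v_def v'_def r_def r'_def)
    have "real c = real (39 * (V * V) * (m * m) * (k + 1) * R ^ k) + real (n * n * (13 * (V * V)))"
      unfolding c_def by (rule of_nat_add)
    also have "real (39 * (V * V) * (m * m) * (k + 1) * R ^ k) = v * (r * (39 * (real m)\<^sup>2 * (real k + 1)))"
      by (simp only: v_def r_def of_nat_mult of_nat_power of_nat_add of_nat_1 of_nat_numeral power2_eq_square mult_ac)
    also have "\<dots> \<le> v' * (r' * (39 * (real m)\<^sup>2 * (2 * real W)))"
      by (intro mult_mono vr mult_left_mono k1 mult_nonneg_nonneg nonneg) simp_all
    also have "real (n * n * (13 * (V * V))) = v * (13 * (real n * real n))"
      by (simp only: v_def of_nat_mult of_nat_numeral mult_ac)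
    also have "\<dots> \<le> v' * (13 * real n powr \<tau>)"
      by (intro mult_mono vr nonneg) (use n2 in simp_all)
    also have "v' * (r' * (39 * (real m)\<^sup>2 * (2 * real W))) + v' * (13 * real n powr \<tau>) \<le>
        v' * (r' * (39 * (real m)\<^sup>2 * (2 * real W))) + v' * (13 * real n powr \<tau>) * real W"
    proof -
      have "v' * (13 * real n powr \<tau>) * 1 \<le> v' * (13 * real n powr \<tau>) * real W"
        using nonneg W by (intro mult_left_mono) auto
      then show ?thesis by simp
    qed
    also have "\<dots> = C * real n powr \<tau> * real W ^ 5"
    proof -
      have W5: "real W ^ 5 = real W ^ 4 * real W" using power_add[of "real W" 4 1] by simp
      show ?thesis unfolding C_def v'_def r'_def W5 by (simp add: algebra_simps)
    qed
    finally show "\<exists>c. real c \<le> C * real n powr (\<omega> + \<eta>) * real W ^ 5 \<and>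
        computes S c (\<Union>z\<in>{..<n} \<times> {..<n}. word_bits W (\<lambda>x. \<Sum>l<n. A (fst z) l x * B l (snd z) x))"
      using comp by (auto simp: \<tau>_def)
  qed
qed

section \<open>The operator norm\<close>

definition vnorm :: "real vec \<Rightarrow> real" where
  "vnorm x = sqrt (x \<bullet> x)"

lemma vnorm_L2: "x \<in> carrier_vec n \<Longrightarrow> vnorm x = L2_set (($) x) {..<n}"
  by (simp add: vnorm_def L2_set_def scalar_prod_def lessThan_atLeast0 power2_eq_square)

lemma vnorm_nonneg: "0 \<le> vnorm x"
  by (simp add: vnorm_L2[of x "dim_vec x"] L2_set_nonneg)

lemma vnorm_square: "(vnorm x)\<^sup>2 = x \<bullet> x"
  unfolding vnorm_def by (rule real_sqrt_pow2) (simp add: scalar_prod_def sum_nonneg)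

lemma vnorm_triangle:
  assumes "x \<in> carrier_vec n" "y \<in> carrier_vec n"
  shows "vnorm (x + y) \<le> vnorm x + vnorm y"
proof -
  have "vnorm (x + y) = L2_set (\<lambda>i. x $ i + y $ i) {..<n}"
    using assms by (simp add: vnorm_L2[of _ n] L2_set_def)
  also have "\<dots> \<le> vnorm x + vnorm y"
    using L2_set_triangle_ineq assms by (simp add: vnorm_L2[of _ n])
  finally show ?thesis .
qed

lemma vnorm_smult: "vnorm (c \<cdot>\<^sub>v x) = \<bar>c\<bar> * vnorm x"
proof -
  have "(c \<cdot>\<^sub>v x) \<bullet> (c \<cdot>\<^sub>v x) = c\<^sup>2 * (x \<bullet> x)"
    by (simp add: power2_eq_square)
  then show ?thesis by (simp add: vnorm_def real_sqrt_mult)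
qed

lemma index_le_vnorm:
  assumes "i < dim_vec x"
  shows "\<bar>x $ i\<bar> \<le> vnorm x"
  using member_le_L2_set[of "{..<dim_vec x}" i "\<lambda>i. \<bar>x $ i\<bar>"] assms
  by (simp add: vnorm_L2[of x "dim_vec x"] L2_set_def)

lemma vnorm_le:
  assumes "x \<in> carrier_vec n" "\<And>i. i < n \<Longrightarrow> \<bar>x $ i\<bar> \<le> h" "0 \<le> h"
  shows "vnorm x \<le> sqrt (real n) * h"
proof -
  have "(\<Sum>i<n. (x $ i)\<^sup>2) \<le> (\<Sum>i<n. h\<^sup>2)"
    using assms by (intro sum_mono abs_le_square_iff[THEN iffD1]) auto
  then have "sqrt (\<Sum>i<n. (x $ i)\<^sup>2) \<le> sqrt (real n * h\<^sup>2)" by simp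
  then show ?thesis using assms by (simp add: vnorm_L2[of _ n] L2_set_def real_sqrt_mult)
qed

lemma sum_abs_le_vnorm:
  assumes "x \<in> carrier_vec n"
  shows "(\<Sum>i<n. \<bar>x $ i\<bar>) \<le> sqrt (real n) * vnorm x"
  using L2_set_mult_ineq[of "\<lambda>_. 1" "($) x" "{..<n}"] assms
  by (simp add: vnorm_L2[of _ n] L2_set_def)

lemma vnorm_eq_0:
  assumes "x \<in> carrier_vec n" "vnorm x = 0"
  shows "x = 0\<^sub>v n"
  using index_le_vnorm[of _ x] assms by (intro eq_vecI) auto

text \<open>Upper bounds for the operator norm in homogeneous form, so that norm estimates can be
  proved vector by vector without handling suprema.\<close>

definition op_bound :: "nat \<Rightarrow> real mat \<Rightarrow> real \<Rightarrow> bool" where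
  "op_bound n A r \<longleftrightarrow> (\<forall>x\<in>carrier_vec n. vnorm (A *\<^sub>v x) \<le> r * vnorm x)"

lemma op_boundD: "op_bound n A r \<Longrightarrow> x \<in> carrier_vec n \<Longrightarrow> vnorm (A *\<^sub>v x) \<le> r * vnorm x"
  by (simp add: op_bound_def)

lemma op_bound_entries:
  assumes A: "A \<in> carrier_mat n n" and h: "\<And>i j. i < n \<Longrightarrow> j < n \<Longrightarrow> \<bar>A $$ (i, j)\<bar> \<le> h" "0 \<le> h"
  shows "op_bound n A (real n * h)"
  unfolding op_bound_def
proof
  fix x :: "real vec" assume x: "x \<in> carrier_vec n"
  have "\<bar>(A *\<^sub>v x) $ i\<bar> \<le> h * (sqrt (real n) * vnorm x)" if i: "i < n" for i
  proof -
    have "(A *\<^sub>v x) $ i = (\<Sum>j<n. A $$ (i, j) * x $ j)"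
      using A x i by (simp add: scalar_prod_def lessThan_atLeast0)
    also have "\<bar>\<dots>\<bar> \<le> (\<Sum>j<n. h * \<bar>x $ j\<bar>)"
      using h i by (intro order_trans[OF sum_abs] sum_mono) (simp add: abs_mult mult_right_mono)
    also have "\<dots> = h * (\<Sum>j<n. \<bar>x $ j\<bar>)" by (simp add: sum_distrib_left)
    also have "\<dots> \<le> h * (sqrt (real n) * vnorm x)"
      by (rule mult_left_mono[OF sum_abs_le_vnorm[OF x] h(2)])
    finally show ?thesis .
  qed
  then have "vnorm (A *\<^sub>v x) \<le> sqrt (real n) * (h * (sqrt (real n) * vnorm x))"
    using A x h vnorm_nonneg by (intro vnorm_le) auto
  also have "\<dots> = (sqrt (real n) * sqrt (real n)) * (h * vnorm x)" by (simp only: mult_ac)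
  also have "sqrt (real n) * sqrt (real n) = real n" by simp
  finally show "vnorm (A *\<^sub>v x) \<le> real n * h * vnorm x" by (simp only: mult.assoc)
qed

text \<open>The supremum in \<open>mat_norm\<close> carries information only once the set is known
  to be bounded; a crude bound through the sum of all entries suffices.\<close>

lemma mat_norm_set_bdd:
  assumes "A \<in> carrier_mat n n"
  shows "bdd_above {sqrt ((A *\<^sub>v x) \<bullet> (A *\<^sub>v x)) | x. x \<in> carrier_vec (dim_col A) \<and> x \<bullet> x \<le> 1}"
proof -
  define h where "h = (\<Sum>i<n. \<Sum>j<n. \<bar>A $$ (i, j)\<bar>)"
  have "0 \<le> h" by (auto simp: h_def intro!: sum_nonneg)
  have "\<bar>A $$ (i, j)\<bar> \<le> h" if "i < n" "j < n" for i j
  proof -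
    have "\<bar>A $$ (i, j)\<bar> \<le> (\<Sum>j<n. \<bar>A $$ (i, j)\<bar>)" using that by (intro member_le_sum) auto
    also have "\<dots> \<le> h" unfolding h_def using that by (intro member_le_sum[where f = "\<lambda>i. \<Sum>j<n. \<bar>A $$ (i, j)\<bar>"]) (auto intro: sum_nonneg)
    finally show ?thesis .
  qed
  then have ob: "op_bound n A (real n * h)" using assms \<open>0 \<le> h\<close> by (intro op_bound_entries) auto
  show ?thesis
  proof (rule bdd_aboveI)
    fix r assume "r \<in> {sqrt ((A *\<^sub>v x) \<bullet> (A *\<^sub>v x)) | x. x \<in> carrier_vec (dim_col A) \<and> x \<bullet> x \<le> 1}"
    then obtain x where x: "r = vnorm (A *\<^sub>v x)" "x \<in> carrier_vec n" "vnorm x \<le> 1"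
      using assms by (auto simp: vnorm_def)
    have "r \<le> real n * h * vnorm x" using op_boundD[OF ob x(2)] x(1) by simp
    also have "\<dots> \<le> real n * h * 1" using x(3) \<open>0 \<le> h\<close> by (intro mult_left_mono) auto
    finally show "r \<le> real n * h" by simp
  qed
qed

lemma vnorm_le_mat_norm:
  assumes "A \<in> carrier_mat n n" "x \<in> carrier_vec n" "vnorm x \<le> 1"
  shows "vnorm (A *\<^sub>v x) \<le> mat_norm A"
  unfolding mat_norm_def
  by (rule cSup_upper[OF _ mat_norm_set_bdd[OF assms(1)]]) (use assms in \<open>auto simp: vnorm_def\<close>)

lemma mat_norm_nonneg: "A \<in> carrier_mat n n \<Longrightarrow> 0 \<le> mat_norm A"
  by (rule order_trans[OF vnorm_nonneg vnorm_le_mat_norm[of A n "0\<^sub>v n"]]) (auto simp: vnorm_def)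

lemma op_bound_mat_norm:
  assumes "A \<in> carrier_mat n n"
  shows "op_bound n A (mat_norm A)"
  unfolding op_bound_def
proof
  fix x :: "real vec" assume x: "x \<in> carrier_vec n"
  show "vnorm (A *\<^sub>v x) \<le> mat_norm A * vnorm x"
  proof (cases "vnorm x = 0")
    case True
    then have "A *\<^sub>v x = 0\<^sub>v n"
      using vnorm_eq_0[OF x] assms by (intro eq_vecI) (auto simp: scalar_prod_def)
    then show ?thesis using True by (simp add: vnorm_def)
  next
    case False
    then have pos: "0 < vnorm x" using vnorm_nonneg[of x] by linarith
    have "vnorm (A *\<^sub>v ((1 / vnorm x) \<cdot>\<^sub>v x)) \<le> mat_norm A"
      using assms x pos by (intro vnorm_le_mat_norm[of _ n]) (auto simp: vnorm_smult)
    also have "A *\<^sub>v ((1 / vnorm x) \<cdot>\<^sub>v x) = (1 / vnorm x) \<cdot>\<^sub>v (A *\<^sub>v x)"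
      by (rule mult_mat_vec[OF assms x])
    finally show ?thesis using pos by (simp add: vnorm_smult field_simps)
  qed
qed

lemma mat_norm_le:
  assumes "A \<in> carrier_mat n n" "op_bound n A r" "0 \<le> r"
  shows "mat_norm A \<le> r"
  unfolding mat_norm_def
proof (rule cSup_least)
  show "{sqrt ((A *\<^sub>v x) \<bullet> (A *\<^sub>v x)) | x. x \<in> carrier_vec (dim_col A) \<and> x \<bullet> x \<le> 1} \<noteq> {}"
    by (auto intro!: exI[of _ "0\<^sub>v (dim_col A)"])
  fix s assume "s \<in> {sqrt ((A *\<^sub>v x) \<bullet> (A *\<^sub>v x)) | x. x \<in> carrier_vec (dim_col A) \<and> x \<bullet> x \<le> 1}"
  then obtain x where x: "s = vnorm (A *\<^sub>v x)" "x \<in> carrier_vec n" "vnorm x \<le> 1"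
    using assms by (auto simp: vnorm_def)
  have "s \<le> r * vnorm x" using op_boundD[OF assms(2) x(2)] x(1) by simp
  also have "\<dots> \<le> r * 1" using x(3) assms(3) by (intro mult_left_mono) auto
  finally show "s \<le> r" by simp
qed

lemma mat_norm_entries:
  assumes "A \<in> carrier_mat n n" "\<And>i j. i < n \<Longrightarrow> j < n \<Longrightarrow> \<bar>A $$ (i, j)\<bar> \<le> h" "0 \<le> h"
  shows "mat_norm A \<le> real n * h"
  using assms by (intro mat_norm_le[of _ n] op_bound_entries) auto

lemma entry_le_mat_norm:
  assumes "A \<in> carrier_mat n n" "i < n" "j < n"
  shows "\<bar>A $$ (i, j)\<bar> \<le> mat_norm A"
proof -
  have "\<bar>A $$ (i, j)\<bar> = \<bar>(A *\<^sub>v unit_vec n j) $ i\<bar>" using assms by simp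
  also have "\<dots> \<le> vnorm (A *\<^sub>v unit_vec n j)" using assms by (intro index_le_vnorm) simp
  also have "\<dots> \<le> mat_norm A" using assms by (intro vnorm_le_mat_norm[of _ n]) (auto simp: vnorm_def)
  finally show ?thesis .
qed

lemma mat_norm_mult:
  assumes A: "A \<in> carrier_mat n n" and B: "B \<in> carrier_mat n n"
  shows "mat_norm (A * B) \<le> mat_norm A * mat_norm B"
proof (rule mat_norm_le)
  show "op_bound n (A * B) (mat_norm A * mat_norm B)"
    unfolding op_bound_def
  proof
    fix x :: "real vec" assume x: "x \<in> carrier_vec n"
    have "vnorm (A * B *\<^sub>v x) = vnorm (A *\<^sub>v (B *\<^sub>v x))"
      by (simp only: assoc_mult_mat_vec[OF A B x])
    also have "\<dots> \<le> mat_norm A * vnorm (B *\<^sub>v x)"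
      by (rule op_boundD[OF op_bound_mat_norm[OF A]]) (use B x in auto)
    also have "\<dots> \<le> mat_norm A * (mat_norm B * vnorm x)"
      by (intro mult_left_mono op_boundD[OF op_bound_mat_norm[OF B] x] mat_norm_nonneg[OF A])
    finally show "vnorm (A * B *\<^sub>v x) \<le> mat_norm A * mat_norm B * vnorm x" by (simp only: mult.assoc)
  qed
qed (use assms mat_norm_nonneg in auto)

lemma mat_norm_triangle:
  assumes A: "A \<in> carrier_mat n n" and B: "B \<in> carrier_mat n n"
  shows "mat_norm (A + B) \<le> mat_norm A + mat_norm B"
proof (rule mat_norm_le)
  show "op_bound n (A + B) (mat_norm A + mat_norm B)"
    unfolding op_bound_def
  proof
    fix x :: "real vec" assume x: "x \<in> carrier_vec n"
    have "vnorm ((A + B) *\<^sub>v x) = vnorm (A *\<^sub>v x + B *\<^sub>v x)"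
      by (simp only: add_mult_distrib_mat_vec[OF A B x])
    also have "\<dots> \<le> vnorm (A *\<^sub>v x) + vnorm (B *\<^sub>v x)"
      by (rule vnorm_triangle[OF mult_mat_vec_carrier[OF A x] mult_mat_vec_carrier[OF B x]])
    also have "\<dots> \<le> mat_norm A * vnorm x + mat_norm B * vnorm x"
      by (intro add_mono op_boundD[OF op_bound_mat_norm[OF A] x] op_boundD[OF op_bound_mat_norm[OF B] x])
    finally show "vnorm ((A + B) *\<^sub>v x) \<le> (mat_norm A + mat_norm B) * vnorm x"
      by (simp only: distrib_right)
  qed
qed (use assms mat_norm_nonneg in \<open>auto intro: add_nonneg_nonneg\<close>)

lemma smult_mat_mult_vec:
  fixes A :: "real mat"
  assumes "A \<in> carrier_mat n n" "x \<in> carrier_vec n"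
  shows "(c \<cdot>\<^sub>m A) *\<^sub>v x = c \<cdot>\<^sub>v (A *\<^sub>v x)"
  using assms by (intro eq_vecI) (auto simp: scalar_prod_def sum_distrib_left mult.assoc)

lemma mat_norm_smult_le:
  assumes A: "A \<in> carrier_mat n n"
  shows "mat_norm (c \<cdot>\<^sub>m A) \<le> \<bar>c\<bar> * mat_norm A"
proof (rule mat_norm_le)
  show "op_bound n (c \<cdot>\<^sub>m A) (\<bar>c\<bar> * mat_norm A)"
    unfolding op_bound_def
  proof
    fix x :: "real vec" assume x: "x \<in> carrier_vec n"
    have "(c \<cdot>\<^sub>m A) *\<^sub>v x = c \<cdot>\<^sub>v (A *\<^sub>v x)"
      by (rule smult_mat_mult_vec[OF A x])
    then show "vnorm ((c \<cdot>\<^sub>m A) *\<^sub>v x) \<le> \<bar>c\<bar> * mat_norm A * vnorm x"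
      using op_boundD[OF op_bound_mat_norm[OF A] x] by (simp add: vnorm_smult mult.assoc mult_left_mono)
  qed
qed (use assms mat_norm_nonneg in auto)

lemma mat_norm_smult:
  assumes A: "A \<in> carrier_mat n n"
  shows "mat_norm (c \<cdot>\<^sub>m A) = \<bar>c\<bar> * mat_norm A"
proof (cases "c = 0")
  case True
  then show ?thesis
    using mat_norm_smult_le[OF A, of c] mat_norm_nonneg[of "c \<cdot>\<^sub>m A" n] A by simp
next
  case False
  have "(1 / c) \<cdot>\<^sub>m (c \<cdot>\<^sub>m A) = A" using False A by (intro eq_matI) auto
  then have "mat_norm A = mat_norm ((1 / c) \<cdot>\<^sub>m (c \<cdot>\<^sub>m A))" by simp
  also have "\<dots> \<le> \<bar>1 / c\<bar> * mat_norm (c \<cdot>\<^sub>m A)" using A by (intro mat_norm_smult_le) auto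
  finally have "\<bar>c\<bar> * mat_norm A \<le> mat_norm (c \<cdot>\<^sub>m A)"
    using False by (simp add: field_simps)
  then show ?thesis using mat_norm_smult_le[OF A, of c] by simp
qed

lemma mat_norm_minus:
  assumes A: "A \<in> carrier_mat n n" and B: "B \<in> carrier_mat n n"
  shows "mat_norm (A - B) \<le> mat_norm A + mat_norm B"
proof -
  have "A - B = A + (- 1) \<cdot>\<^sub>m B" using A B by (intro eq_matI) auto
  then show ?thesis
    using mat_norm_triangle[OF A, of "(- 1) \<cdot>\<^sub>m B"] mat_norm_smult[OF B, of "-1"] B by simp
qed

lemma mat_norm_one_ge: "n \<ge> 1 \<Longrightarrow> 1 \<le> mat_norm (1\<^sub>m n)"
  using entry_le_mat_norm[of "1\<^sub>m n" n 0 0] by simp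

lemma mat_norm_one_le: "mat_norm (1\<^sub>m n) \<le> 1"
  by (rule mat_norm_le[of _ n]) (auto simp: op_bound_def)

section \<open>Newton's iteration\<close>

text \<open>The bound on the Rayleigh quotient bounds the norm of a symmetric positive semidefinite
  matrix, without the spectral theorem: with y = M x, nonnegativity of the form at x - y/\<rho>
  rearranges to |y|^2 \<le> \<rho>^2 |x|^2.\<close>

lemma psd_contraction:
  assumes M: "M \<in> carrier_mat n n" and \<rho>: "0 < \<rho>"
    and sym: "\<And>x y. x \<in> carrier_vec n \<Longrightarrow> y \<in> carrier_vec n \<Longrightarrow> (M *\<^sub>v x) \<bullet> y = x \<bullet> (M *\<^sub>v y)"
    and psd: "\<And>x. x \<in> carrier_vec n \<Longrightarrow> 0 \<le> (M *\<^sub>v x) \<bullet> x"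
    and le: "\<And>x. x \<in> carrier_vec n \<Longrightarrow> (M *\<^sub>v x) \<bullet> x \<le> \<rho> * (x \<bullet> x)"
  shows "mat_norm M \<le> \<rho>"
proof (rule mat_norm_le[OF M])
  show "op_bound n M \<rho>"
    unfolding op_bound_def
  proof
    fix x :: "real vec" assume x: "x \<in> carrier_vec n"
    define y where "y = M *\<^sub>v x"
    define t where "t = - (1 / \<rho>)"
    have y: "y \<in> carrier_vec n" using M x by (simp add: y_def)
    have My: "M *\<^sub>v y \<in> carrier_vec n" using M y by simp
    have ty: "t \<cdot>\<^sub>v y \<in> carrier_vec n" "t \<cdot>\<^sub>v (M *\<^sub>v y) \<in> carrier_vec n" using y My by auto
    have "M *\<^sub>v (x + t \<cdot>\<^sub>v y) = y + t \<cdot>\<^sub>v (M *\<^sub>v y)"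
      using mult_add_distrib_mat_vec[OF M x ty(1)] mult_mat_vec[OF M y] by (simp add: y_def)
    then have "(M *\<^sub>v (x + t \<cdot>\<^sub>v y)) \<bullet> (x + t \<cdot>\<^sub>v y) = (y + t \<cdot>\<^sub>v (M *\<^sub>v y)) \<bullet> (x + t \<cdot>\<^sub>v y)"
      by simp
    also have "\<dots> = y \<bullet> x + t * (y \<bullet> y) + (t * ((M *\<^sub>v y) \<bullet> x) + t * (t * ((M *\<^sub>v y) \<bullet> y)))"
      using x y My ty
      by (simp add: add_scalar_prod_distrib[of _ n] scalar_prod_add_distrib[of _ n])
    also have "(M *\<^sub>v y) \<bullet> x = y \<bullet> y" using sym[OF y x] by (simp add: y_def)
    finally have "0 \<le> y \<bullet> x + t * (y \<bullet> y) + (t * (y \<bullet> y) + t * (t * ((M *\<^sub>v y) \<bullet> y)))"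
      using psd[of "x + t \<cdot>\<^sub>v y"] x ty by simp
    also have "\<dots> \<le> \<rho> * (x \<bullet> x) + t * (y \<bullet> y) + (t * (y \<bullet> y) + t * (t * (\<rho> * (y \<bullet> y))))"
    proof (intro add_mono order_refl)
      show "y \<bullet> x \<le> \<rho> * (x \<bullet> x)" using le[OF x] by (simp only: y_def)
      show "t * (t * ((M *\<^sub>v y) \<bullet> y)) \<le> t * (t * (\<rho> * (y \<bullet> y)))"
        using mult_left_mono[OF le[OF y] zero_le_square[of t]] by (simp only: mult.assoc)
    qed
    also have "t * (t * (\<rho> * (y \<bullet> y))) = - (t * (y \<bullet> y))" using \<rho> by (simp add: t_def)
    finally have "y \<bullet> y / \<rho> \<le> \<rho> * (x \<bullet> x)" by (simp add: t_def)
    then have "y \<bullet> y \<le> \<rho>\<^sup>2 * (x \<bullet> x)" 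
      using \<rho> by (simp only: pos_divide_le_eq power2_eq_square mult_ac)
    then have "(vnorm y)\<^sup>2 \<le> (\<rho> * vnorm x)\<^sup>2" by (simp add: vnorm_square power_mult_distrib)
    then have "vnorm y \<le> \<rho> * vnorm x"
      by (rule power2_le_imp_le) (use \<rho> vnorm_nonneg[of x] in simp)
    then show "vnorm (M *\<^sub>v x) \<le> \<rho> * vnorm x" by (simp only: y_def)
  qed
qed (use \<rho> in simp)

text \<open>The start is the transpose of A divided by c. With B the transpose, the quadratic form
  of the residual is |x|^2 - |B x|^2 / c. It is nonnegative by the choice of c, and x = (transpose
  of X)(B x) gives |x| \<le> s |B x|, which is the upper bound.\<close>

lemma newton_start:
  assumes A: "A \<in> carrier_mat n n" and X: "X \<in> carrier_mat n n" and inv: "is_inverse A X"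
    and c: "(mat_norm A\<^sup>T)\<^sup>2 \<le> c" and s: "mat_norm X\<^sup>T \<le> s" "0 < s" "1 < c * s\<^sup>2"
  shows "mat_norm (1\<^sub>m n - (1 / c) \<cdot>\<^sub>m (A * A\<^sup>T)) \<le> 1 - 1 / (c * s\<^sup>2)"
proof -
  define B where "B = A\<^sup>T"
  have B: "B \<in> carrier_mat n n" using A by (simp add: B_def)
  have cpos: "0 < c"
  proof (rule ccontr)
    assume "\<not> 0 < c"
    then have "c * s\<^sup>2 \<le> 0" by (intro mult_nonpos_nonneg) auto
    with s(3) show False by simp
  qed
  define M where "M = 1\<^sub>m n - (1 / c) \<cdot>\<^sub>m (A * B)"
  have M: "M \<in> carrier_mat n n" using A B by (auto simp: M_def)
  have Mx: "M *\<^sub>v x = x - (1 / c) \<cdot>\<^sub>v (A *\<^sub>v (B *\<^sub>v x))" if x: "x \<in> carrier_vec n" for x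
  proof -
    have "M *\<^sub>v x = 1\<^sub>m n *\<^sub>v x - ((1 / c) \<cdot>\<^sub>m (A * B)) *\<^sub>v x"
      unfolding M_def by (rule minus_mult_distrib_mat_vec) (use A B x in auto)
    also have "((1 / c) \<cdot>\<^sub>m (A * B)) *\<^sub>v x = (1 / c) \<cdot>\<^sub>v ((A * B) *\<^sub>v x)"
      by (rule smult_mat_mult_vec) (use A B x in auto)
    also have "(A * B) *\<^sub>v x = A *\<^sub>v (B *\<^sub>v x)" by (rule assoc_mult_mat_vec[OF A B x])
    finally show ?thesis using x by simp
  qed
  have form: "(M *\<^sub>v x) \<bullet> y = x \<bullet> y - (B *\<^sub>v x) \<bullet> (B *\<^sub>v y) / c" if x: "x \<in> carrier_vec n" and y: "y \<in> carrier_vec n" for x y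
  proof -
    have Bx: "B *\<^sub>v x \<in> carrier_vec n" "B *\<^sub>v y \<in> carrier_vec n" "A *\<^sub>v (B *\<^sub>v x) \<in> carrier_vec n" using A B x y by auto
    have "(M *\<^sub>v x) \<bullet> y = x \<bullet> y - (1 / c) * ((A *\<^sub>v (B *\<^sub>v x)) \<bullet> y)"
      unfolding Mx[OF x] using x y Bx by (simp add: minus_scalar_prod_distrib[of _ n])
    also have "(A *\<^sub>v (B *\<^sub>v x)) \<bullet> y = (B *\<^sub>v x) \<bullet> (B *\<^sub>v y)"
      using transpose_vec_mult_scalar[OF A Bx(1) y] comm_scalar_prod[OF y Bx(3)] comm_scalar_prod[OF Bx(2,1)]
      by (simp only: B_def)
    finally show ?thesis by simp
  qed
  have "mat_norm M \<le> 1 - 1 / (c * s\<^sup>2)"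
  proof (rule psd_contraction[OF M])
    show "0 < 1 - 1 / (c * s\<^sup>2)" using s by simp
    fix x y :: "real vec" assume x: "x \<in> carrier_vec n" and y: "y \<in> carrier_vec n"
    have "x \<bullet> (M *\<^sub>v y) = (M *\<^sub>v y) \<bullet> x" using M x y by (intro comm_scalar_prod[of _ n]) auto
    also have "\<dots> = y \<bullet> x - (B *\<^sub>v y) \<bullet> (B *\<^sub>v x) / c" by (rule form[OF y x])
    also have "y \<bullet> x = x \<bullet> y" by (rule comm_scalar_prod[OF y x])
    also have "(B *\<^sub>v y) \<bullet> (B *\<^sub>v x) = (B *\<^sub>v x) \<bullet> (B *\<^sub>v y)"
      using B x y by (intro comm_scalar_prod[of _ n]) auto
    finally show "(M *\<^sub>v x) \<bullet> y = x \<bullet> (M *\<^sub>v y)" by (simp only: form[OF x y])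
  next
    fix x :: "real vec" assume x: "x \<in> carrier_vec n"
    have Bx: "B *\<^sub>v x \<in> carrier_vec n" using B x by simp
    have "(vnorm (B *\<^sub>v x))\<^sup>2 \<le> (mat_norm B * vnorm x)\<^sup>2"
      by (intro power_mono op_boundD[OF op_bound_mat_norm[OF B] x] vnorm_nonneg)
    also have "\<dots> = (mat_norm B)\<^sup>2 * (x \<bullet> x)" by (simp only: power_mult_distrib vnorm_square)
    also have "\<dots> \<le> c * (x \<bullet> x)"
      using c zero_le_power2[of "vnorm x"] unfolding vnorm_square B_def by (rule mult_right_mono)
    finally have "(B *\<^sub>v x) \<bullet> (B *\<^sub>v x) / c \<le> x \<bullet> x"
      unfolding vnorm_square pos_divide_le_eq[OF cpos] by (simp only: mult.commute)
    then show "0 \<le> (M *\<^sub>v x) \<bullet> x" by (simp add: form[OF x x])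
    have "A * X = 1\<^sub>m n" using inv A by (simp add: is_inverse_def inverts_mat_def)
    then have "X\<^sup>T * B = 1\<^sub>m n" using transpose_mult[OF A X] by (simp add: B_def)
    then have xeq: "X\<^sup>T *\<^sub>v (B *\<^sub>v x) = x"
      using assoc_mult_mat_vec[OF transpose_carrier_mat[THEN iffD2, OF X] B x] x by simp
    have "vnorm (X\<^sup>T *\<^sub>v (B *\<^sub>v x)) \<le> mat_norm X\<^sup>T * vnorm (B *\<^sub>v x)"
      using X by (intro op_boundD[OF op_bound_mat_norm Bx]) simp
    then have "vnorm x \<le> mat_norm X\<^sup>T * vnorm (B *\<^sub>v x)" by (simp only: xeq)
    also have "\<dots> \<le> s * vnorm (B *\<^sub>v x)" by (intro mult_right_mono s vnorm_nonneg)
    finally have "(vnorm x)\<^sup>2 \<le> (s * vnorm (B *\<^sub>v x))\<^sup>2" by (intro power_mono vnorm_nonneg)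
    then have *: "x \<bullet> x \<le> s\<^sup>2 * ((B *\<^sub>v x) \<bullet> (B *\<^sub>v x))" by (simp add: vnorm_square power_mult_distrib)
    have "x \<bullet> x / (c * s\<^sup>2) \<le> s\<^sup>2 * ((B *\<^sub>v x) \<bullet> (B *\<^sub>v x)) / (c * s\<^sup>2)"
      using * by (rule divide_right_mono) (use cpos in simp)
    also have "\<dots> = (B *\<^sub>v x) \<bullet> (B *\<^sub>v x) / c" using s(2) by simp
    finally show "(M *\<^sub>v x) \<bullet> x \<le> (1 - 1 / (c * s\<^sup>2)) * (x \<bullet> x)"
      by (simp add: form[OF x x] left_diff_distrib)
  qed
  then show ?thesis by (simp add: M_def B_def)
qed

text \<open>One step squares the residual, while an error E of the step enters only linearly. This
  holds for an arbitrary Y, which need not commute with A.\<close>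

lemma newton_residual:
  fixes A Y E :: "real mat"
  assumes A: "A \<in> carrier_mat n n" and Y: "Y \<in> carrier_mat n n" and E: "E \<in> carrier_mat n n"
  shows "1\<^sub>m n - A * (Y + Y - Y * (A * Y) + E) = (1\<^sub>m n - A * Y) * (1\<^sub>m n - A * Y) - A * E"
proof -
  define P Q G where "P = A * Y" and "Q = P * P" and "G = A * E"
  have PQG: "P \<in> carrier_mat n n" "Q \<in> carrier_mat n n" "G \<in> carrier_mat n n"
    unfolding P_def Q_def G_def
    by (rule mult_carrier_mat[OF A Y], rule mult_carrier_mat[OF mult_carrier_mat[OF A Y] mult_carrier_mat[OF A Y]],
      rule mult_carrier_mat[OF A E])
  have YP: "Y * P \<in> carrier_mat n n" by (rule mult_carrier_mat[OF Y PQG(1)])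
  have "A * (Y + Y - Y * P + E) = A * (Y + Y - Y * P) + G"
    unfolding G_def by (rule mult_add_distrib_mat[OF A minus_carrier_mat[OF YP] E])
  also have "A * (Y + Y - Y * P) = A * (Y + Y) - A * (Y * P)"
    by (rule mult_minus_distrib_mat[OF A add_carrier_mat[OF Y] YP])
  also have "A * (Y + Y) = P + P" unfolding P_def by (rule mult_add_distrib_mat[OF A Y Y])
  also have "A * (Y * P) = Q" 
    unfolding Q_def using assoc_mult_mat[OF A Y PQG(1)] by (simp only: P_def)
  finally have 1: "A * (Y + Y - Y * P + E) = P + P - Q + G" .
  have "(1\<^sub>m n - P) * (1\<^sub>m n - P) = 1\<^sub>m n * (1\<^sub>m n - P) - P * (1\<^sub>m n - P)"
    by (rule minus_mult_distrib_mat) (use PQG in auto)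
  also have "P * (1\<^sub>m n - P) = P * 1\<^sub>m n - Q"
    unfolding Q_def by (rule mult_minus_distrib_mat) (use PQG in auto)
  finally have 2: "(1\<^sub>m n - P) * (1\<^sub>m n - P) = 1\<^sub>m n * (1\<^sub>m n - P) - (P * 1\<^sub>m n - Q)" .
  have "1\<^sub>m n - (P + P - Q + G) = (1\<^sub>m n - P) - (P - Q) - G"
    by (rule eq_matI) (use PQG in auto)
  moreover have "1\<^sub>m n * (1\<^sub>m n - P) = 1\<^sub>m n - P" by (rule left_mult_one_mat) (use PQG in auto)
  moreover have "P * 1\<^sub>m n = P" by (rule right_mult_one_mat[OF PQG(1)])
  ultimately show ?thesis
    unfolding P_def[symmetric] G_def[symmetric] 1 2 by (simp only:)
qed

text \<open>Write the bound for the residual as t + \<eta> with both at most 1. Then (t + \<eta>)^2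
  + \<delta> \<le> t^2 + 4 \<eta>: the main part is squared and the accumulated error grows by a
  factor 4. The residual stays below 2, so the iterates have norm at most 3 |X|; the error of a step
  has to be controlled only under this condition, which breaks the apparent circularity.\<close>

theorem newton_convergence:
  fixes Y E :: "nat \<Rightarrow> real mat"
  assumes A: "A \<in> carrier_mat n n" and X: "X \<in> carrier_mat n n" and inv: "is_inverse A X"
    and Y: "\<And>k. Y k \<in> carrier_mat n n" and E: "\<And>k. E k \<in> carrier_mat n n"
    and step: "\<And>k. Y (Suc k) = Y k + Y k - Y k * (A * Y k) + E k"
    and err: "\<And>k. mat_norm (Y k) \<le> 3 * mat_norm X \<Longrightarrow> mat_norm A * mat_norm (E k) \<le> \<delta>"
    and start: "mat_norm (1\<^sub>m n - A * Y 0) \<le> \<rho> + \<delta>"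
    and \<rho>: "0 \<le> \<rho>" "\<rho> \<le> 1" and \<delta>: "0 \<le> \<delta>" "4 ^ K * \<delta> \<le> 1"
  shows "mat_norm (Y K - X) \<le> mat_norm X * (\<rho> ^ 2 ^ K + 4 ^ K * \<delta>)"
proof -
  define r where "r k = mat_norm (1\<^sub>m n - A * Y k)" for k
  have R: "1\<^sub>m n - A * Y k \<in> carrier_mat n n" for k using A Y[of k] by auto
  have r0: "0 \<le> r k" for k unfolding r_def by (rule mat_norm_nonneg[OF R])
  have XA: "X * A = 1\<^sub>m n" using inv X by (simp add: is_inverse_def inverts_mat_def)
  have YX: "X * (1\<^sub>m n - A * Y k) = X - Y k" for k
  proof -
    have "X * (1\<^sub>m n - A * Y k) = X * 1\<^sub>m n - X * (A * Y k)"
      by (rule mult_minus_distrib_mat[OF X]) (use A Y[of k] in auto)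
    also have "X * (A * Y k) = Y k"
      using assoc_mult_mat[OF X A Y[of k]] Y[of k] by (simp add: XA)
    finally show ?thesis using X by simp
  qed
  have bound: "r k \<le> \<rho> ^ 2 ^ k + 4 ^ k * \<delta>" if "k \<le> K" for k
    using that
  proof (induction k)
    case 0
    then show ?case using start by (simp add: r_def)
  next
    case (Suc k)
    define \<eta> where "\<eta> = 4 ^ k * \<delta>"
    define t where "t = \<rho> ^ 2 ^ k"
    have \<eta>: "0 \<le> \<eta>" "\<delta> \<le> \<eta>" "\<eta> \<le> 1"
    proof -
      show "0 \<le> \<eta>" using \<delta> by (simp add: \<eta>_def)
      show "\<delta> \<le> \<eta>" using \<delta> by (simp add: \<eta>_def mult_le_cancel_right1)
      have "\<eta> \<le> 4 ^ K * \<delta>" unfolding \<eta>_def using Suc.prems \<delta> by (intro mult_right_mono power_increasing) auto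
      with \<delta> show "\<eta> \<le> 1" by simp
    qed
    have t: "0 \<le> t" "t \<le> 1" using \<rho> by (auto simp: t_def power_le_one)
    have IH: "r k \<le> t + \<eta>" using Suc by (simp add: t_def \<eta>_def)
    have "mat_norm (Y k) \<le> 3 * mat_norm X"
    proof -
      have "Y k = X - X * (1\<^sub>m n - A * Y k)" unfolding YX using X Y[of k] by (intro eq_matI) auto
      then have "mat_norm (Y k) = mat_norm (X - X * (1\<^sub>m n - A * Y k))" by simp
      also have "\<dots> \<le> mat_norm X + mat_norm (X * (1\<^sub>m n - A * Y k))"
        using X R[of k] by (intro mat_norm_minus) auto
      also have "mat_norm (X * (1\<^sub>m n - A * Y k)) \<le> mat_norm X * r k"
        unfolding r_def by (rule mat_norm_mult[OF X R])
      also have "\<dots> \<le> mat_norm X * 2"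
        using IH t \<eta> mat_norm_nonneg[OF X] by (intro mult_left_mono) auto
      finally show ?thesis by simp
    qed
    from err[OF this] have e: "mat_norm A * mat_norm (E k) \<le> \<delta>" .
    have "r (Suc k) = mat_norm ((1\<^sub>m n - A * Y k) * (1\<^sub>m n - A * Y k) - A * E k)"
      unfolding r_def step newton_residual[OF A Y E] ..
    also have "\<dots> \<le> mat_norm ((1\<^sub>m n - A * Y k) * (1\<^sub>m n - A * Y k)) + mat_norm (A * E k)"
      by (rule mat_norm_minus[of _ n]) (use A E[of k] R[of k] in auto)
    also have "\<dots> \<le> r k * r k + \<delta>"
      unfolding r_def using mat_norm_mult[OF R R] order_trans[OF mat_norm_mult[OF A E] e]
      by (rule add_mono)
    also have "\<dots> \<le> (t + \<eta>) * (t + \<eta>) + \<delta>"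
      by (intro add_right_mono mult_mono IH r0) (use t \<eta> in auto)
    also have "\<dots> \<le> t * t + 4 * \<eta>"
    proof -
      have "t * \<eta> \<le> 1 * \<eta>" "\<eta> * \<eta> \<le> 1 * \<eta>" by (rule mult_right_mono; use t \<eta> in simp)+
      then show ?thesis using \<eta>(2) by (simp add: algebra_simps)
    qed
    also have "t * t + 4 * \<eta> = \<rho> ^ 2 ^ Suc k + 4 ^ Suc k * \<delta>"
      by (simp add: t_def \<eta>_def mult_2 flip: power_add)
    finally show ?case .
  qed
  have "Y K - X = (- 1) \<cdot>\<^sub>m (X * (1\<^sub>m n - A * Y K))"
    unfolding YX using X Y[of K] by (intro eq_matI) auto
  then have "mat_norm (Y K - X) = mat_norm (X * (1\<^sub>m n - A * Y K))"
    using mat_norm_smult[of "X * (1\<^sub>m n - A * Y K)" n "- 1"] X R[of K] by simp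
  also have "\<dots> \<le> mat_norm X * r K" unfolding r_def by (rule mat_norm_mult[OF X R])
  also have "\<dots> \<le> mat_norm X * (\<rho> ^ 2 ^ K + 4 ^ K * \<delta>)"
    by (intro mult_left_mono bound mat_norm_nonneg[OF X]) simp
  finally show ?thesis .
qed

section \<open>Floating point numbers as bit strings\<close>

text \<open>Read through \<open>wire\<close>, the field is defined and bounded by 2^l for lists of
  any length.\<close>

definition bit_field :: "nat \<Rightarrow> nat \<Rightarrow> bool list \<Rightarrow> int" where
  "bit_field d l bs = horner_sum of_bool 2 (map (\<lambda>i. wire bs (d + i)) [0..<l])"

lemma bit_bit_field: "bit (bit_field d l bs) i \<longleftrightarrow> i < l \<and> wire bs (d + i)"
  by (auto simp: bit_field_def bit_horner_sum_bit_iff)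

lemma bit_field_bounds: "0 \<le> bit_field d l bs" "bit_field d l bs < 2 ^ l"
proof -
  have *: "take_bit l (bit_field d l bs) = bit_field d l bs"
    by (rule bit_eqI) (auto simp: bit_take_bit_iff bit_bit_field)
  show "0 \<le> bit_field d l bs" "bit_field d l bs < 2 ^ l"
    using take_bit_nonnegative[of l "bit_field d l bs"] take_bit_int_less_exp[of l "bit_field d l bs"]
    unfolding * by auto
qed

lemma bit_field_eq_take_bit:
  assumes "\<And>i. i < l \<Longrightarrow> wire bs (d + i) = bit v i"
  shows "bit_field d l bs = take_bit l v"
  by (rule bit_eqI) (use assms in \<open>auto simp: bit_take_bit_iff bit_bit_field\<close>)

lemma word_bits_bit_field:
  "word_bits W (\<lambda>x. bit_field d l (f x)) \<subseteq> {\<lambda>x. wire (f x) i | i. d \<le> i \<and> i < d + l} \<union> consts_bool"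
proof
  fix g assume "g \<in> word_bits W (\<lambda>x. bit_field d l (f x))"
  then obtain i where i: "g = (\<lambda>x. i < l \<and> wire (f x) (d + i))"
    by (auto simp: word_bits_def bit_bit_field)
  show "g \<in> {\<lambda>x. wire (f x) i | i. d \<le> i \<and> i < d + l} \<union> consts_bool"
  proof (cases "i < l")
    case True
    then have "g = (\<lambda>x. wire (f x) (d + i))" by (simp add: i)
    with True show ?thesis by (intro UnI1 CollectI exI[of _ "d + i"]) auto
  next
    case False
    then have "g = (\<lambda>_. False)" by (simp add: i)
    then show ?thesis by (simp add: consts_bool_def)
  qed
qed

lemma bits_value_take_drop:
  assumes "d + l \<le> length bs"
  shows "int (bits_value (take l (drop d bs))) = bit_field d l bs"
proof -
  have "take l (drop d bs) = map (\<lambda>i. wire bs (d + i)) [0..<l]"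
    using assms by (intro nth_equalityI) (auto simp: wire_def)
  then show ?thesis by (simp add: bits_value_def bit_field_def horner_sum_eq_sum)
qed

lemma float_value_fields:
  assumes "d + (1 + b + w) \<le> length bs"
  shows "float_value b w (drop d bs) = (if wire bs d then - 1 else 1) * of_int (bit_field (d + 1) b bs) *
     2 powi (bit_field (d + 1 + b) w bs - 2 ^ (w - 1))"
proof -
  have s: "drop d bs ! 0 = wire bs d" using assms by (auto simp: wire_def)
  have M: "int (bits_value (take b (drop 1 (drop d bs)))) = bit_field (d + 1) b bs"
    using bits_value_take_drop[of "d + 1" b bs] assms by simp
  have E: "int (bits_value (take w (drop (1 + b) (drop d bs)))) = bit_field (d + 1 + b) w bs"
    using bits_value_take_drop[of "d + 1 + b" w bs] assms by (simp add: add_ac)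
  have "real (bits_value (take b (drop 1 (drop d bs)))) = of_int (bit_field (d + 1) b bs)"
    unfolding M[symmetric] by simp
  then show ?thesis unfolding float_value_def s E by simp
qed

section \<open>Writing floating point matrices from words\<close>

lemma chunk_bound: "e < N \<Longrightarrow> e * L + L \<le> N * L" for e N L :: nat
  using mult_le_mono1[of "Suc e" N L] by simp

text \<open>The Boolean functions that an output matrix consists of. Only the low b bits of M and
  the low w bits of E are written, so the decoded value contains truncations that each application
  has to remove.\<close>

definition encode :: "nat \<Rightarrow> nat \<Rightarrow> nat \<Rightarrow> (nat \<Rightarrow> 'x \<Rightarrow> bool) \<Rightarrow> (nat \<Rightarrow> 'x \<Rightarrow> int) \<Rightarrow> (nat \<Rightarrow> 'x \<Rightarrow> int) \<Rightarrow> ('x \<Rightarrow> bool) list" where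
  "encode N b w s M E = map (\<lambda>q. let e = q div (1 + b + w); r = q mod (1 + b + w) in
     if r = 0 then s e else if r < 1 + b then (\<lambda>x. bit (M e x) (r - 1)) else (\<lambda>x. bit (E e x) (r - 1 - b)))
     [0..<N * (1 + b + w)]"

lemma length_encode: "length (encode N b w s M E) = N * (1 + b + w)"
  by (simp add: encode_def)

lemma set_encode: "set (encode N b w s M E) \<subseteq> (\<Union>e<N. {s e} \<union> word_bits b (M e) \<union> word_bits w (E e))"
proof
  fix f assume "f \<in> set (encode N b w s M E)"
  then obtain q where q: "q < N * (1 + b + w)" and f: "f = (let e = q div (1 + b + w); r = q mod (1 + b + w) in
     if r = 0 then s e else if r < 1 + b then (\<lambda>x. bit (M e x) (r - 1)) else (\<lambda>x. bit (E e x) (r - 1 - b)))"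
    by (auto simp: encode_def)
  define e r where "e = q div (1 + b + w)" and "r = q mod (1 + b + w)"
  have e: "e < N" using q by (simp add: e_def less_mult_imp_div_less)
  have r: "r < 1 + b + w" by (simp add: r_def)
  have "f \<in> {s e} \<union> word_bits b (M e) \<union> word_bits w (E e)"
    using r unfolding f Let_def e_def[symmetric] r_def[symmetric] by (auto intro!: mem_word_bits)
  with e show "f \<in> (\<Union>e<N. {s e} \<union> word_bits b (M e) \<union> word_bits w (E e))" by blast
qed

lemma encode_value:
  assumes "e < N"
  shows "float_value b w (drop (e * (1 + b + w)) (map (\<lambda>f. f x) (encode N b w s M E))) =
    (if s e x then - 1 else 1) * of_int (take_bit b (M e x)) * 2 powi (take_bit w (E e x) - 2 ^ (w - 1))"
proof -
  define L where "L = 1 + b + w"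
  let ?ys = "map (\<lambda>f. f x) (encode N b w s M E)"
  have Lpos: "L > 0" by (simp add: L_def)
  have len: "e * L + L \<le> length ?ys" using chunk_bound[OF assms(1), of L] by (simp add: length_encode L_def)
  have wr: "wire ?ys (e * L + r) = (if r = 0 then s e x else if r < 1 + b then bit (M e x) (r - 1) else bit (E e x) (r - 1 - b))"
    if r: "r < L" for r
  proof -
    have lt: "e * L + r < N * L" using r len by (simp add: length_encode L_def)
    have dm: "(e * L + r) div L = e" "(e * L + r) mod L = r" using r Lpos by auto
    have "wire ?ys (e * L + r) = (encode N b w s M E ! (e * L + r)) x"
      using lt by (simp add: wire_def length_encode L_def)
    also have "encode N b w s M E ! (e * L + r) =
        (if r = 0 then s e else if r < 1 + b then (\<lambda>x. bit (M e x) (r - 1)) else (\<lambda>x. bit (E e x) (r - 1 - b)))"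
    proof -
      have "[0..<N * L] ! (e * L + r) = e * L + r" using nth_upt[of 0 "e * L + r" "N * L"] lt by simp
      moreover have "e * L + r < length [0..<N * L]" using lt by simp
      ultimately show ?thesis
        unfolding encode_def L_def[symmetric] by (simp only: nth_map dm Let_def)
    qed
    finally have "wire ?ys (e * L + r) = (if r = 0 then s e else if r < 1 + b then (\<lambda>x. bit (M e x) (r - 1)) else (\<lambda>x. bit (E e x) (r - 1 - b))) x" .
    then show ?thesis by (simp only: if_distribR)
  qed
  have "bit_field (e * L + 1) b ?ys = take_bit b (M e x)"
    by (rule bit_field_eq_take_bit) (use wr[of "1 + i" for i] in \<open>simp add: L_def\<close>)
  moreover have "bit_field (e * L + 1 + b) w ?ys = take_bit w (E e x)"
  proof (rule bit_field_eq_take_bit)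
    fix i assume "i < w"
    then show "wire ?ys (e * L + 1 + b + i) = bit (E e x) i"
      using wr[of "1 + b + i"] by (simp add: L_def add.assoc)
  qed
  moreover have "wire ?ys (e * L) = s e x" using wr[of 0] Lpos by simp
  ultimately show ?thesis
    using float_value_fields[of "e * L" b w ?ys] len by (simp add: L_def)
qed

lemma encode_circuit:
  assumes "computes (input_bits N) c (\<Union>e<n * n. {s e} \<union> word_bits b (M e) \<union> word_bits w (E e))"
  shows "\<exists>P. out_prec P = b \<and> out_exp P = w \<and> outputs_matrix n P \<and> bit_ops P \<le> c + 2 + n * n * (1 + b + w) \<and>
    (\<forall>bs. length bs = N \<longrightarrow> computed_mat n P bs = mat n n (\<lambda>(i, j). let e = i * n + j in
      (if s e bs then - 1 else 1) * of_int (take_bit b (M e bs)) * 2 powi (take_bit w (E e bs) - 2 ^ (w - 1))))"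
proof -
  have "computes (input_bits N) c (set (encode (n * n) b w s M E))"
    by (rule computes_mono[OF assms]) (use set_encode[of "n * n" b w s M E] in auto)
  from computes_circuit[OF this, of b w] obtain P where P: "out_prec P = b" "out_exp P = w"
    "length (out_wires P) = length (encode (n * n) b w s M E)"
    "bit_ops P \<le> c + 2 + length (encode (n * n) b w s M E)"
    "\<And>bs. length bs = N \<Longrightarrow> run_bits P bs = map (\<lambda>f. f bs) (encode (n * n) b w s M E)" by blast
  have "outputs_matrix n P" using P by (simp add: outputs_matrix_def length_encode float_mat_length_def)
  moreover have "computed_mat n P bs = mat n n (\<lambda>(i, j). let e = i * n + j in
      (if s e bs then - 1 else 1) * of_int (take_bit b (M e bs)) * 2 powi (take_bit w (E e bs) - 2 ^ (w - 1)))"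
    if "length bs = N" for bs
    unfolding computed_mat_def float_mat_def P(1,2) P(5)[OF that]
  proof (rule cong_mat[OF refl refl])
    fix i j assume "i < n" "j < n"
    note ij = encode_value[OF row_major_less[OF this], of b w bs s M E]
    show "(\<lambda>(i, j). float_value b w (drop ((i * n + j) * (1 + b + w)) (map (\<lambda>f. f bs) (encode (n * n) b w s M E)))) (i, j) =
      (\<lambda>(i, j). let e = i * n + j in (if s e bs then - 1 else 1) * of_int (take_bit b (M e bs)) *
         2 powi (take_bit w (E e bs) - 2 ^ (w - 1))) (i, j)"
      by (simp only: prod.case Let_def ij)
  qed
  ultimately show ?thesis using P by (auto simp: length_encode)
qed

section \<open>Comparison, maximum and shift of words\<close>

lemma bit_sign:
  fixes d :: int
  assumes "- (2 ^ k) \<le> d" "d < 2 ^ k"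
  shows "bit d k \<longleftrightarrow> d < 0"
proof (cases "d < 0")
  case True
  have "take_bit k (- d - 1) = - d - 1" using assms True by (intro take_bit_int_eq_self) auto
  then have "\<not> bit (- d - 1) k" by (metis bit_take_bit_iff less_irrefl)
  then have "bit d k" by (simp only: bit_not_int_iff' not_not)
  with True show ?thesis by simp
next
  case False
  have "take_bit k d = d" using assms False by (intro take_bit_int_eq_self) auto
  then have "\<not> bit d k" by (metis bit_take_bit_iff less_irrefl)
  with False show ?thesis by simp
qed

lemma computes_nonzero:
  assumes "\<And>x. 0 \<le> \<phi> x" "\<And>x. \<phi> x < 2 ^ b"
  shows "computes (word_bits b \<phi>) b {\<lambda>x. \<phi> x \<noteq> (0 :: int)}"
proof -
  let ?T = "\<lambda>k. {\<lambda>x. take_bit k (\<phi> x) \<noteq> 0}"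
  have "computes (word_bits b \<phi>) (b * 1) (?T b)"
  proof (rule computes_sequence[where T = ?T])
    fix k assume k: "k < b"
    have "computes (word_bits b \<phi> \<union> ?T k) 1 {\<lambda>x. take_bit k (\<phi> x) \<noteq> 0 \<or> bit (\<phi> x) k}"
      using k by (intro computes_gate1) (auto intro: mem_word_bits)
    moreover have "(\<lambda>x. take_bit k (\<phi> x) \<noteq> 0 \<or> bit (\<phi> x) k) = (\<lambda>x. take_bit (Suc k) (\<phi> x) \<noteq> 0)"
    proof
      fix x
      show "(take_bit k (\<phi> x) \<noteq> 0 \<or> bit (\<phi> x) k) = (take_bit (Suc k) (\<phi> x) \<noteq> 0)"
        using take_bit_nonnegative[of k "\<phi> x"] by (auto simp: take_bit_Suc_from_most add_nonneg_eq_0_iff)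
    qed
    ultimately show "computes (word_bits b \<phi> \<union> ?T k) 1 (?T (Suc k))" by simp
  qed (auto simp: consts_bool_def)
  moreover have "take_bit b (\<phi> x) = \<phi> x" for x using assms by (intro take_bit_int_eq_self) auto
  ultimately show ?thesis by simp
qed

text \<open>One bit more than the operands holds their difference, and its sign bit is the
  comparison.\<close>

lemma computes_less:
  assumes "\<And>x. 0 \<le> \<phi> x" "\<And>x. \<phi> x < 2 ^ w" "\<And>x. 0 \<le> \<psi> x" "\<And>x. \<psi> x < 2 ^ w"
  shows "computes (word_bits w \<phi> \<union> word_bits w \<psi>) (13 * ((w + 1) * (w + 1))) {\<lambda>x. \<phi> x < (\<psi> x :: int)}"
proof -
  let ?S = "word_bits w \<phi> \<union> word_bits w \<psi>" and ?W = "w + 1"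
  have "computes ?S (13 * (?W * ?W)) (word_bits ?W (\<lambda>x. \<phi> x - \<psi> x))"
  proof (rule computes_diff[OF computes.free[of _ _ 0] computes.free[of _ _ 0]])
    show "word_bits ?W \<phi> \<subseteq> ?S \<union> consts_bool" using word_bits_bounded[of \<phi> w ?W] assms by auto
    show "word_bits ?W \<psi> \<subseteq> ?S \<union> consts_bool" using word_bits_bounded[of \<psi> w ?W] assms by auto
    show "0 + 0 + (?W * (7 * ?W) + 6 * ?W) \<le> 13 * (?W * ?W)"
      using word_cost[of ?W] by (simp only: add_0)
  qed
  moreover have "(\<lambda>x. \<phi> x < \<psi> x) = (\<lambda>x. bit (\<phi> x - \<psi> x) w)"
  proof
    fix x
    have "- (2 ^ w) \<le> \<phi> x - \<psi> x" "\<phi> x - \<psi> x < 2 ^ w"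
      using assms(1)[of x] assms(2)[of x] assms(3)[of x] assms(4)[of x] by linarith+
    from bit_sign[OF this] show "(\<phi> x < \<psi> x) = bit (\<phi> x - \<psi> x) w" by simp
  qed
  ultimately show ?thesis
    by (elim computes_mono) (auto intro: mem_word_bits)
qed

text \<open>Entries with significand zero are skipped. Their exponents say nothing about the matrix
  and could exceed the others arbitrarily, which would spoil the scaling.\<close>

fun max_exp :: "(nat \<Rightarrow> 'x \<Rightarrow> int) \<Rightarrow> (nat \<Rightarrow> 'x \<Rightarrow> int) \<Rightarrow> nat \<Rightarrow> 'x \<Rightarrow> int" where
  "max_exp M E 0 x = 0"
| "max_exp M E (Suc k) x = (if M k x \<noteq> 0 \<and> max_exp M E k x < E k x then E k x else max_exp M E k x)"

lemma max_exp_bounds: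
  assumes "\<And>e x. 0 \<le> E e x" "\<And>e x. E e x < 2 ^ w"
  shows "0 \<le> max_exp M E k x" "max_exp M E k x < 2 ^ w"
  using assms by (induction k) auto

lemma max_exp_upper: "e < k \<Longrightarrow> M e x \<noteq> 0 \<Longrightarrow> E e x \<le> max_exp M E k x"
  by (induction k) (auto simp: less_Suc_eq)

text \<open>If the running maximum is still at its start value 0, then any nonzero entry has
  exponent exactly 0, because exponent fields are nonnegative.\<close>

lemma max_exp_attained:
  assumes "\<And>e x. 0 \<le> E e x" "e < k" "M e x \<noteq> 0"
  shows "\<exists>e<k. M e x \<noteq> 0 \<and> E e x = max_exp M E k x"
proof -
  have "max_exp M E k x = 0 \<or> (\<exists>e<k. M e x \<noteq> 0 \<and> E e x = max_exp M E k x)"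
    by (induction k) (auto intro: less_SucI)
  then show ?thesis
  proof
    assume "max_exp M E k x = 0"
    with max_exp_upper[of e k M x E] assms have "E e x = max_exp M E k x"
      using assms(1)[of e x] by simp
    with assms show ?thesis by blast
  qed
qed

lemma computes_max_exp:
  assumes M: "\<And>e x. 0 \<le> M e x" "\<And>e x. M e x < 2 ^ b" and E: "\<And>e x. 0 \<le> E e x" "\<And>e x. E e x < 2 ^ w"
    and S: "\<And>e. e < N \<Longrightarrow> word_bits b (M e) \<subseteq> S \<union> consts_bool" "\<And>e. e < N \<Longrightarrow> word_bits w (E e) \<subseteq> S \<union> consts_bool"
    and L: "b + w + 1 \<le> L"
  shows "computes S (N * (35 * (L * L))) (word_bits w (max_exp M E N))"
proof (rule computes_sequence[where T = "\<lambda>k. word_bits w (max_exp M E k)"])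
  have "max_exp M E 0 = (\<lambda>_. 0)" by (rule ext) simp
  then show "word_bits w (max_exp M E 0) \<subseteq> S \<union> consts_bool"
    using word_bits_const[of w 0] by auto
  fix k assume k: "k < N"
  let ?S = "S \<union> word_bits w (max_exp M E k)"
  note mx = max_exp_bounds[OF E]
  let ?W = "w + 1"
  have "computes ?S b {\<lambda>x. M k x \<noteq> 0}"
    by (rule computes_mono[OF computes_nonzero[of "M k" b]]) (use M S(1)[OF k] in auto)
  moreover have "computes ?S (13 * (?W * ?W)) {\<lambda>x. max_exp M E k x < E k x}"
    by (rule computes_mono[OF computes_less[of "max_exp M E k" w "E k"]]) (use mx E S(2)[OF k] in auto)
  ultimately have "computes ?S (b + 13 * (?W * ?W)) ({\<lambda>x. M k x \<noteq> 0} \<union> {\<lambda>x. max_exp M E k x < E k x})"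
    by (rule computes_Un)
  then have g: "computes ?S (b + 13 * (?W * ?W) + 1) {\<lambda>x. M k x \<noteq> 0 \<and> max_exp M E k x < E k x}"
    by (rule computes_trans) (intro computes_gate1, auto)
  let ?c = "w * (7 * w) + 13 * w"
  have "computes (?S \<union> {\<lambda>x. M k x \<noteq> 0 \<and> max_exp M E k x < E k x}) ?c
      (word_bits w (\<lambda>x. if M k x \<noteq> 0 \<and> max_exp M E k x < E k x then E k x else max_exp M E k x))"
    by (rule computes_if[OF _ computes.free[of _ _ 0] computes.free[of _ _ 0]]) (use S(2)[OF k] in auto)
  moreover have "(\<lambda>x. if M k x \<noteq> 0 \<and> max_exp M E k x < E k x then E k x else max_exp M E k x) = max_exp M E (Suc k)"
    by (rule ext) simp
  ultimately have c: "computes ?S (b + 13 * (?W * ?W) + 1 + ?c) (word_bits w (max_exp M E (Suc k)))"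
    using computes_trans[OF g] by (simp only:)
  have "b + 13 * (?W * ?W) + 1 + ?c \<le> 35 * (L * L)"
  proof -
    have 1: "b + 1 \<le> L * L" using L le_square[of L] by linarith
    have 2: "?W * ?W \<le> L * L" "w * w \<le> L * L" by (rule mult_le_mono; use L in linarith)+
    have 3: "w \<le> L * L" using L le_square[of L] by linarith
    have "w * (7 * w) = 7 * (w * w)" by simp
    with 1 2 3 show ?thesis by linarith
  qed
  then show "computes ?S (35 * (L * L)) (word_bits w (max_exp M E (Suc k)))"
    by (intro computes_mono[OF c]) auto
qed

text \<open>The barrel shifter: one conditional shift for each bit of the distance \<open>d\<close>.\<close>

lemma computes_shift:
  assumes m: "\<And>x. 0 \<le> m x" "\<And>x. m x < 2 ^ V"
  shows "computes (word_bits V m \<union> word_bits w d) (w * (20 * (V * V))) (word_bits V (\<lambda>x. m x div 2 ^ nat (take_bit w (d x))))"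
proof (rule computes_sequence[where T = "\<lambda>k. word_bits V (\<lambda>x. m x div 2 ^ nat (take_bit k (d x)))"])
  fix k assume k: "k < w"
  let ?s = "\<lambda>k x. m x div 2 ^ nat (take_bit k (d x))"
  let ?S = "word_bits V m \<union> word_bits w d \<union> word_bits V (?s k)"
  have s: "0 \<le> ?s k x" "?s k x < 2 ^ V" for x
  proof -
    show "0 \<le> ?s k x" using m(1) by (simp add: pos_imp_zdiv_nonneg_iff)
    have "?s k x \<le> m x" by (rule order_trans[OF zdiv_mono2[of "m x" 1]]) (use m(1) in auto)
    then show "?s k x < 2 ^ V" using m(2)[of x] by linarith
  qed
  have "computes ?S (V * (7 * V) + 13 * V) (word_bits V (\<lambda>x. if bit (d x) k then ?s k x div 2 ^ 2 ^ k else ?s k x))"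
  proof (rule computes_if[OF _ computes.free[of _ _ 0] computes.free[of _ _ 0]])
    show "(\<lambda>x. bit (d x) k) \<in> ?S \<union> consts_bool" using k by (auto intro: mem_word_bits)
    have "word_bits V (\<lambda>x. ?s k x div 2 ^ 2 ^ k) \<subseteq> word_bits (V + 2 ^ k) (?s k)" by (rule word_bits_div)
    also have "\<dots> \<subseteq> word_bits V (?s k) \<union> consts_bool" using s by (rule word_bits_bounded)
    finally show "word_bits V (\<lambda>x. ?s k x div 2 ^ 2 ^ k) \<subseteq> ?S \<union> consts_bool" by auto
  qed auto
  moreover have "(\<lambda>x. if bit (d x) k then ?s k x div 2 ^ 2 ^ k else ?s k x) = ?s (Suc k)"
  proof
    fix x
    have "nat (take_bit (Suc k) (d x)) = nat (take_bit k (d x)) + (if bit (d x) k then 2 ^ k else 0)"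
      by (auto simp: take_bit_Suc_from_most nat_add_distrib nat_power_eq)
    then show "(if bit (d x) k then ?s k x div 2 ^ 2 ^ k else ?s k x) = ?s (Suc k) x"
      by (simp add: power_add zdiv_zmult2_eq)
  qed
  ultimately have c: "computes ?S (V * (7 * V) + 13 * V) (word_bits V (?s (Suc k)))" by simp
  have "V * (7 * V) + 13 * V \<le> 20 * (V * V)" using le_square[of V] by (subst mult.left_commute) linarith
  then show "computes ?S (20 * (V * V)) (word_bits V (?s (Suc k)))" by (intro computes_mono[OF c]) auto
qed auto

section \<open>Newton's iteration in fixed point arithmetic\<close>

text \<open>Numerators over the common denominator 2^P, so that one step is an integer expression
  followed by a division by 2^(2 P). The exchanged indices in the first equation form the transpose,
  divided by c = 2^q.\<close>

fun newton_int :: "nat \<Rightarrow> nat \<Rightarrow> nat \<Rightarrow> (nat \<Rightarrow> nat \<Rightarrow> 'x \<Rightarrow> int) \<Rightarrow> nat \<Rightarrow> nat \<Rightarrow> nat \<Rightarrow> 'x \<Rightarrow> int" where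
  "newton_int n P q \<alpha> 0 i j x = \<alpha> j i x div 2 ^ q"
| "newton_int n P q \<alpha> (Suc k) i j x = (2 ^ (2 * P + 1) * newton_int n P q \<alpha> k i j x -
     (\<Sum>l<n. newton_int n P q \<alpha> k i l x * (\<Sum>m<n. \<alpha> l m x * newton_int n P q \<alpha> k m j x))) div 2 ^ (2 * P)"

lemma floor_div_error: "\<bar>of_int (z div 2 ^ p) - of_int z / 2 ^ p\<bar> \<le> (1 :: real)"
proof -
  have "of_int (z div 2 ^ p) = real_of_int \<lfloor>real_of_int z / real_of_int (2 ^ p)\<rfloor>"
    by (simp only: floor_divide_of_int_eq)
  then show ?thesis by (simp only: of_int_power of_int_numeral) linarith
qed

text \<open>Since (1 - d)(1 + d) \<le> 1, the power is at most the reciprocal of (1 + d)^N, to which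
  Bernoulli's inequality applies.\<close>

lemma power_contraction:
  assumes "0 < d" "d \<le> (1 :: real)" "N > 0"
  shows "(1 - d) ^ N \<le> 1 / (real N * d)"
proof -
  have "(1 - d) ^ N * (1 + d) ^ N = (1 - d * d) ^ N"
    by (simp add: algebra_simps flip: power_mult_distrib)
  also have "\<dots> \<le> 1" using assms by (intro power_le_one) (auto simp: mult_le_one)
  finally have 1: "(1 - d) ^ N * (1 + d) ^ N \<le> 1" .
  have "real N * d \<le> (1 + d) ^ N"
    using Bernoulli_inequality[of d N] assms by simp
  then have "(1 - d) ^ N * (real N * d) \<le> (1 - d) ^ N * (1 + d) ^ N"
    using assms by (intro mult_left_mono) auto
  with 1 have "(1 - d) ^ N * (real N * d) \<le> 1" by linarith
  then show ?thesis using assms by (simp add: pos_le_divide_eq)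
qed

lemma minus_mat_index:
  fixes A B :: "real mat"
  shows "A \<in> carrier_mat n n \<Longrightarrow> B \<in> carrier_mat n n \<Longrightarrow> i < n \<Longrightarrow> j < n \<Longrightarrow> (A - B) $$ (i, j) = A $$ (i, j) - B $$ (i, j)"
  by simp

lemma newton_entry_identity:
  fixes u z \<sigma> :: real
  assumes "u \<noteq> 0"
  shows "2 * (z / u) - \<sigma> / (u * (u * u)) = (2 * (u * u) * z - \<sigma>) / (u * u) / u"
  using assms by (simp add: diff_divide_distrib)

lemma power_quotient: "B \<noteq> 0 \<Longrightarrow> B ^ k / B ^ (k + 2) = 1 / B ^ 2" for B :: real
  unfolding power_add by (rule nonzero_divide_mult_cancel_left) simp

lemma newton_entry_error:
  fixes e y y' yy p r t f :: real
  shows "e = y' - (yy - p) \<Longrightarrow> yy = 2 * y \<Longrightarrow> f = e + r \<Longrightarrow> p + r = t \<Longrightarrow> f = y' - (2 * y - t)"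
  by simp

text \<open>Origin of the constants, in powers of B = 2^b. As n and the entries are at most B, the
  norm of a is at most B^2, and c = B^4 = 2^(4 b) starts the iteration. With |X| \<le> B^4 and s =
  B^5 the contraction is 1 - 1/B^14. After 16 b steps it has been raised to the power B^16, which
  leaves at most B^-2. Meanwhile errors have grown by 4^(16 b) = B^32. An error per step of at most
  B^15 / 2^P, with 2^P = B^49, contributes B^-2 again, and 2 B^-2 \<le> 1/B.\<close>

theorem newton_fixed_point:
  fixes a X :: "real mat"
  assumes n: "n \<ge> 1" and b: "b \<ge> 1" and nb: "n \<le> 2 ^ b"
    and a: "a \<in> carrier_mat n n" and X: "X \<in> carrier_mat n n" and inv: "is_inverse a X"
    and ent: "\<And>i j. i < n \<Longrightarrow> j < n \<Longrightarrow> \<bar>a $$ (i, j)\<bar> \<le> 2 ^ b"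
    and \<alpha>: "\<And>i j. i < n \<Longrightarrow> j < n \<Longrightarrow> \<bar>of_int (\<alpha> i j x) - 2 ^ (49 * b) * a $$ (i, j)\<bar> \<le> 1"
    and small: "mat_norm X \<le> 2 ^ (4 * b)"
  shows "mat_norm (mat n n (\<lambda>(i, j). of_int (newton_int n (49 * b) (4 * b) \<alpha> (16 * b) i j x) / 2 ^ (49 * b)) - X)
    \<le> roundoff b * mat_norm X"
proof -
  define B :: real where "B = 2 ^ b"
  define P where "P = 49 * b"
  define h :: real where "h = 1 / 2 ^ P"
  have B: "B \<ge> 2" using power_increasing[OF b, of "2 :: real"] by (simp add: B_def)
  have pw: "(2 :: real) ^ (k * b) = B ^ k" for k by (simp add: B_def power_mult mult.commute[of k])
  have h: "h = 1 / B ^ 49" by (simp only: h_def P_def pw)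
  have hpos: "0 < h" by (simp add: h_def)
  have nB: "real n \<le> B" using nb unfolding B_def by (metis of_nat_le_iff of_nat_numeral of_nat_power)
  define Z where "Z k i j = newton_int n P (4 * b) \<alpha> k i j x" for k i j
  define Y where "Y k = mat n n (\<lambda>(i, j). of_int (Z k i j) / 2 ^ P :: real)" for k
  define D where "D = mat n n (\<lambda>(i, j). of_int (\<alpha> i j x) / 2 ^ P - a $$ (i, j) :: real)"
  have Y: "Y k \<in> carrier_mat n n" for k by (simp add: Y_def)
  have D: "D \<in> carrier_mat n n" by (simp add: D_def)
  \<comment> \<open>The integers iterate with the rounded matrix. Its deviation D from a is moved
    into the error of the step, so that the convergence theorem can be applied to a itself.\<close>
  define E where "E k = Y (Suc k) - (Y k + Y k - Y k * (a * Y k))" for k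
  have aY: "a * Y k \<in> carrier_mat n n" for k by (rule mult_carrier_mat[OF a Y])
  have YaY: "Y k * (a * Y k) \<in> carrier_mat n n" for k by (rule mult_carrier_mat[OF Y aY])
  have base: "Y k + Y k - Y k * (a * Y k) \<in> carrier_mat n n" for k by (rule minus_carrier_mat[OF YaY])
  have E: "E k \<in> carrier_mat n n" for k unfolding E_def by (rule minus_carrier_mat[OF base])
  have step: "Y (Suc k) = Y k + Y k - Y k * (a * Y k) + E k" for k
    unfolding E_def
  proof (rule eq_matI)
    fix i j
    assume ij: "i < dim_row (Y k + Y k - Y k * (a * Y k) + (Y (Suc k) - (Y k + Y k - Y k * (a * Y k))))"
      "j < dim_col (Y k + Y k - Y k * (a * Y k) + (Y (Suc k) - (Y k + Y k - Y k * (a * Y k))))"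
    then show "Y (Suc k) $$ (i, j) = (Y k + Y k - Y k * (a * Y k) + (Y (Suc k) - (Y k + Y k - Y k * (a * Y k)))) $$ (i, j)"
      using base[of k] by (simp add: Y_def)
  qed (use carrier_matD[OF Y] carrier_matD[OF base] in simp_all)
  have DY: "D * Y k \<in> carrier_mat n n" for k by (rule mult_carrier_mat[OF D Y])
  have YDY: "Y k * (D * Y k) \<in> carrier_mat n n" for k by (rule mult_carrier_mat[OF Y DY])
  \<comment> \<open>The rounding error of the integer step alone: it is what E becomes when a + D
    replaces a in the step.\<close>
  define F where "F k = E k + Y k * (D * Y k)" for k
  have F: "F k \<in> carrier_mat n n" for k unfolding F_def by (rule add_carrier_mat[OF YDY])
  have Dent: "\<bar>D $$ (i, j)\<bar> \<le> h" if "i < n" "j < n" for i j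
  proof -
    have "D $$ (i, j) = (of_int (\<alpha> i j x) - 2 ^ P * a $$ (i, j)) / 2 ^ P"
      using that by (simp add: D_def diff_divide_distrib)
    then show ?thesis using \<alpha>[OF that] by (simp add: h_def P_def abs_divide divide_right_mono)
  qed
  have Fent: "\<bar>F k $$ (i, j)\<bar> \<le> h" if ij: "i < n" "j < n" for k i j
  proof -
    define s where "s = (\<Sum>l<n. Z k i l * (\<Sum>m<n. \<alpha> l m x * Z k m j))"
    have "(Y k * (a * Y k)) $$ (i, j) + (Y k * (D * Y k)) $$ (i, j) =
        (\<Sum>l<n. Y k $$ (i, l) * ((\<Sum>m<n. a $$ (l, m) * Y k $$ (m, j)) + (\<Sum>m<n. D $$ (l, m) * Y k $$ (m, j))))"
      using ij index_mult_mat_sum[OF a Y] index_mult_mat_sum[OF D Y]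
      by (simp add: index_mult_mat_sum[OF Y aY ij] index_mult_mat_sum[OF Y DY ij] sum.distrib distrib_left del: index_mult_mat)
    also have "\<dots> = (\<Sum>l<n. Y k $$ (i, l) * (\<Sum>m<n. of_int (\<alpha> l m x) / 2 ^ P * Y k $$ (m, j)))"
      by (rule sum.cong[OF refl]) (simp add: D_def left_diff_distrib flip: sum.distrib)
    also have "\<dots> = (\<Sum>l<n. of_int (Z k i l) / 2 ^ P * (\<Sum>m<n. of_int (\<alpha> l m x) / 2 ^ P * (of_int (Z k m j) / 2 ^ P)))"
      using ij by (intro sum.cong refl arg_cong2[where f = "(*)"]) (auto simp: Y_def)
    also have "\<dots> = of_int s / (2 ^ P * (2 ^ P * 2 ^ P))"
      by (simp add: s_def sum_divide_distrib sum_distrib_left)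
    finally have q: "(Y k * (a * Y k)) $$ (i, j) + (Y k * (D * Y k)) $$ (i, j) = of_int s / (2 ^ P * (2 ^ P * 2 ^ P))" .
    have YY: "Y k + Y k \<in> carrier_mat n n" using Y by simp
    have "E k $$ (i, j) = Y (Suc k) $$ (i, j) - ((Y k + Y k) $$ (i, j) - (Y k * (a * Y k)) $$ (i, j))"
      unfolding E_def by (simp only: minus_mat_index[OF Y base ij] minus_mat_index[OF YY YaY ij])
    moreover have "(Y k + Y k) $$ (i, j) = 2 * Y k $$ (i, j)" using ij by (simp add: Y_def)
    moreover have "F k $$ (i, j) = E k $$ (i, j) + (Y k * (D * Y k)) $$ (i, j)"
      unfolding F_def using carrier_matD[OF YDY[of k]] ij by (intro index_add_mat) simp_all
    ultimately have "F k $$ (i, j) = Y (Suc k) $$ (i, j) - (2 * Y k $$ (i, j) - of_int s / (2 ^ P * (2 ^ P * 2 ^ P)))"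
      by (rule newton_entry_error[OF _ _ _ q])
    also have "2 * Y k $$ (i, j) - of_int s / (2 ^ P * (2 ^ P * 2 ^ P)) = of_int (2 ^ (2 * P + 1) * Z k i j - s) / 2 ^ (2 * P) / 2 ^ P"
    proof -
      have p2: "(2 :: real) ^ (2 * P + 1) = 2 * (2 ^ P * 2 ^ P)" "(2 :: real) ^ (2 * P) = 2 ^ P * 2 ^ P"
        unfolding mult_2[of P] power_add by simp_all
      have "Y k $$ (i, j) = of_int (Z k i j) / 2 ^ P" using ij by (simp add: Y_def)
      then have "2 * Y k $$ (i, j) - of_int s / (2 ^ P * (2 ^ P * 2 ^ P)) =
          2 * (of_int (Z k i j) / 2 ^ P) - of_int s / (2 ^ P * (2 ^ P * 2 ^ P))" by (simp only:)
      also have "\<dots> = (2 * (2 ^ P * 2 ^ P) * of_int (Z k i j) - of_int s) / (2 ^ P * 2 ^ P) / 2 ^ P"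
        by (rule newton_entry_identity) simp
      also have "\<dots> = of_int (2 ^ (2 * P + 1) * Z k i j - s) / 2 ^ (2 * P) / 2 ^ P"
        by (simp only: p2 of_int_diff of_int_mult of_int_power of_int_numeral)
      finally show ?thesis .
    qed
    also have "Y (Suc k) $$ (i, j) = of_int ((2 ^ (2 * P + 1) * Z k i j - s) div 2 ^ (2 * P)) / 2 ^ P"
      using ij by (simp add: Y_def Z_def s_def)
    also have "of_int ((2 ^ (2 * P + 1) * Z k i j - s) div 2 ^ (2 * P)) / 2 ^ P - of_int (2 ^ (2 * P + 1) * Z k i j - s) / 2 ^ (2 * P) / 2 ^ P =
        (of_int ((2 ^ (2 * P + 1) * Z k i j - s) div 2 ^ (2 * P)) - of_int (2 ^ (2 * P + 1) * Z k i j - s) / 2 ^ (2 * P)) / (2 ^ P :: real)"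
      by (simp only: diff_divide_distrib)
    finally show ?thesis
      using floor_div_error[of "2 ^ (2 * P + 1) * Z k i j - s" "2 * P"] by (simp add: h_def abs_divide divide_right_mono)
  qed
  define S where "S = mat_norm X"
  have S0: "0 \<le> S" unfolding S_def by (rule mat_norm_nonneg[OF X])
  have SB: "S \<le> B ^ 4" using small by (simp only: S_def pw)
  have aN: "mat_norm a \<le> B ^ 2"
  proof -
    have "mat_norm a \<le> real n * B" using ent B by (intro mat_norm_entries[OF a]) (auto simp: B_def)
    also have "\<dots> \<le> B * B" using nB B by (intro mult_right_mono) auto
    finally show ?thesis by (simp add: power2_eq_square)
  qed
  have a0: "0 \<le> mat_norm a" by (rule mat_norm_nonneg[OF a])
  define \<delta> where "\<delta> = B ^ 2 * (B * h * (2 + 9 * S\<^sup>2))"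
  have nh: "real n * h \<le> B * h" using nB hpos by (intro mult_right_mono) auto
  have err: "mat_norm a * mat_norm (E k) \<le> \<delta>" if y: "mat_norm (Y k) \<le> 3 * mat_norm X" for k
  proof -
    have "E k = F k - Y k * (D * Y k)"
      unfolding F_def using carrier_matD[OF E[of k]] carrier_matD[OF YDY[of k]]
      by (intro eq_matI) (simp_all del: index_mult_mat(1))
    then have "mat_norm (E k) = mat_norm (F k - Y k * (D * Y k))" by simp
    also have "\<dots> \<le> mat_norm (F k) + mat_norm (Y k * (D * Y k))" by (rule mat_norm_minus[OF F YDY])
    also have "mat_norm (F k) \<le> B * h"
      by (rule order_trans[OF mat_norm_entries[OF F Fent] nh]) (use hpos in simp_all)
    also have "mat_norm (Y k * (D * Y k)) \<le> (3 * S) * ((B * h) * (3 * S))"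
    proof -
      have "mat_norm D \<le> B * h"
        by (rule order_trans[OF mat_norm_entries[OF D Dent] nh]) (use hpos in simp_all)
      then have "mat_norm (D * Y k) \<le> (B * h) * (3 * S)"
        using y S0 B hpos mat_norm_nonneg[OF Y[of k]] unfolding S_def
        by (intro order_trans[OF mat_norm_mult[OF D Y]] mult_mono) auto
      then show ?thesis
        using y S0 B hpos mat_norm_nonneg[OF DY[of k]] unfolding S_def
        by (intro order_trans[OF mat_norm_mult[OF Y DY]] mult_mono) auto
    qed
    finally have "mat_norm (E k) \<le> B * h + (3 * S) * ((B * h) * (3 * S))" by simp
    also have "\<dots> = B * h * (1 + 9 * S\<^sup>2)" by (simp add: algebra_simps power2_eq_square)
    also have "\<dots> \<le> B * h * (2 + 9 * S\<^sup>2)" using B hpos by (intro mult_left_mono) auto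
    finally show ?thesis
      unfolding \<delta>_def using aN a0 mat_norm_nonneg[OF E[of k]] by (intro mult_mono) auto
  qed
  define c :: real where "c = B ^ 4"
  define \<rho> where "\<rho> = 1 - 1 / B ^ 14"
  have BT: "1 < B ^ 14" using B by (intro one_less_power) auto
  have \<rho>: "0 \<le> \<rho>" "\<rho> \<le> 1" using BT by (auto simp: \<rho>_def divide_le_eq_1)
  have start: "mat_norm (1\<^sub>m n - a * Y 0) \<le> \<rho> + \<delta>"
  proof -
    define T where "T = (1 / c) \<cdot>\<^sub>m a\<^sup>T"
    have T: "T \<in> carrier_mat n n" using a by (simp add: T_def)
    define E0 where "E0 = Y 0 - T"
    have E0: "E0 \<in> carrier_mat n n" unfolding E0_def by (rule minus_carrier_mat[OF T])
    have cq: "c = 2 ^ (4 * b)" by (simp only: c_def pw)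
    have cpos: "1 \<le> c" unfolding cq by simp
    have "\<bar>E0 $$ (i, j)\<bar> \<le> 2 * h" if ij: "i < n" "j < n" for i j
    proof -
      have "E0 $$ (i, j) = of_int (\<alpha> j i x div 2 ^ (4 * b)) / 2 ^ P - a $$ (j, i) / c"
        using ij a by (simp add: E0_def T_def Y_def Z_def)
      also have "\<dots> = (of_int (\<alpha> j i x div 2 ^ (4 * b)) - of_int (\<alpha> j i x) / 2 ^ (4 * b)) / 2 ^ P + (of_int (\<alpha> j i x) - 2 ^ P * a $$ (j, i)) / 2 ^ P / c"
        by (simp add: cq diff_divide_distrib)
      also have "\<bar>\<dots>\<bar> \<le> \<bar>(of_int (\<alpha> j i x div 2 ^ (4 * b)) - of_int (\<alpha> j i x) / 2 ^ (4 * b)) / 2 ^ P\<bar> + \<bar>(of_int (\<alpha> j i x) - 2 ^ P * a $$ (j, i)) / 2 ^ P / c\<bar>"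
        by (rule abs_triangle_ineq)
      also have "\<dots> \<le> h + h"
      proof (rule add_mono)
        show "\<bar>(of_int (\<alpha> j i x div 2 ^ (4 * b)) - of_int (\<alpha> j i x) / 2 ^ (4 * b)) / 2 ^ P\<bar> \<le> h"
          using floor_div_error[of "\<alpha> j i x" "4 * b"] by (simp add: h_def abs_divide divide_right_mono)
        have "\<bar>(of_int (\<alpha> j i x) - 2 ^ P * a $$ (j, i)) / 2 ^ P\<bar> \<le> h"
          using \<alpha>[OF ij(2,1)] by (simp add: h_def P_def abs_divide divide_right_mono)
        then have "\<bar>(of_int (\<alpha> j i x) - 2 ^ P * a $$ (j, i)) / 2 ^ P\<bar> / c \<le> h / 1"
          using cpos hpos by (intro frac_le) auto
        then show "\<bar>(of_int (\<alpha> j i x) - 2 ^ P * a $$ (j, i)) / 2 ^ P / c\<bar> \<le> h"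
          using cpos by (simp add: abs_divide)
      qed
      finally show ?thesis by simp
    qed
    then have "mat_norm E0 \<le> real n * (2 * h)"
      by (rule mat_norm_entries[OF E0]) (use hpos in simp_all)
    also have "real n * (2 * h) = 2 * (real n * h)" by simp
    also have "\<dots> \<le> 2 * (B * h)" using nh by (rule mult_left_mono) simp
    finally have e0: "mat_norm E0 \<le> 2 * (B * h)" .
    have aT: "a * T \<in> carrier_mat n n" by (rule mult_carrier_mat[OF a T])
    have aE0: "a * E0 \<in> carrier_mat n n" by (rule mult_carrier_mat[OF a E0])
    have "Y 0 = T + E0"
      unfolding E0_def using carrier_matD[OF T] carrier_matD[OF Y[of 0]] by (intro eq_matI) simp_all
    then have "a * Y 0 = a * T + a * E0" using mult_add_distrib_mat[OF a T E0] by simp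
    then have "1\<^sub>m n - a * Y 0 = (1\<^sub>m n - a * T) - a * E0"
      using carrier_matD[OF aT] carrier_matD[OF aE0] by (intro eq_matI) (simp_all del: index_mult_mat(1))
    then have "mat_norm (1\<^sub>m n - a * Y 0) \<le> mat_norm (1\<^sub>m n - a * T) + mat_norm (a * E0)"
      using mat_norm_minus[OF minus_carrier_mat[OF aT] aE0] by simp
    also have "a * T = (1 / c) \<cdot>\<^sub>m (a * a\<^sup>T)"
      unfolding T_def by (rule mult_smult_distrib[OF a]) (use a in simp)
    also have "mat_norm (1\<^sub>m n - (1 / c) \<cdot>\<^sub>m (a * a\<^sup>T)) \<le> 1 - 1 / (c * (B ^ 5)\<^sup>2)"
    proof (rule newton_start[OF a X inv])
      have "mat_norm a\<^sup>T \<le> real n * B" using a ent B by (intro mat_norm_entries) (auto simp: B_def)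
      also have "\<dots> \<le> B * B" using nB B by (intro mult_right_mono) auto
      finally have "(mat_norm a\<^sup>T)\<^sup>2 \<le> (B * B)\<^sup>2" using a by (intro power_mono mat_norm_nonneg[of _ n]) auto
      then show "(mat_norm a\<^sup>T)\<^sup>2 \<le> c" by (simp add: c_def power2_eq_square power4_eq_xxxx)
      \<comment> \<open>The transpose is estimated through its entries, which costs a factor n \<le>
        B and explains B^5 in place of B^4.\<close>
      have "mat_norm X\<^sup>T \<le> real n * S"
        using X S0 entry_le_mat_norm[OF X] by (intro mat_norm_entries) (auto simp: S_def)
      also have "\<dots> \<le> B * B ^ 4" using nB SB S0 B by (intro mult_mono) auto
      finally show "mat_norm X\<^sup>T \<le> B ^ 5" by (simp add: eval_nat_numeral)
      show "0 < B ^ 5" using B by simp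
      show "1 < c * (B ^ 5)\<^sup>2" using BT unfolding c_def by (simp flip: power_mult power_add)
    qed
    also have "1 - 1 / (c * (B ^ 5)\<^sup>2) = \<rho>" unfolding c_def \<rho>_def by (simp flip: power_mult power_add)
    also have "mat_norm (a * E0) \<le> B ^ 2 * (2 * (B * h))"
      using aN a0 e0 mat_norm_nonneg[OF E0] B by (intro order_trans[OF mat_norm_mult[OF a E0]] mult_mono) auto
    also have "B ^ 2 * (2 * (B * h)) \<le> \<delta>"
      unfolding \<delta>_def using B hpos by (intro mult_left_mono) (auto simp: algebra_simps)
    finally show ?thesis by simp
  qed
  have K4: "(4 :: real) ^ (16 * b) = B ^ 32"
    using power_mult[of "2 :: real" 2 "16 * b"] pw[of 32] by simp
  have \<delta>0: "0 \<le> \<delta>" unfolding \<delta>_def using B hpos by (intro mult_nonneg_nonneg) auto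
  have \<delta>B: "B ^ 32 * \<delta> \<le> 1 / B ^ 2"
  proof -
    have B4: "16 \<le> B ^ 4" using power_mono[OF B, of 4] by simp
    have B8: "1 \<le> B ^ 8" using B by (intro one_le_power) auto
    have "S\<^sup>2 \<le> (B ^ 4)\<^sup>2" using SB S0 by (intro power_mono)
    then have "2 + 9 * S\<^sup>2 \<le> 16 * B ^ 8" using B8 by (simp flip: power_mult)
    also have "\<dots> \<le> B ^ 4 * B ^ 8" using B4 B8 by (intro mult_right_mono) auto
    finally have "2 + 9 * S\<^sup>2 \<le> B ^ 12" by (simp flip: power_add)
    then have "\<delta> \<le> B ^ 2 * (B * h * B ^ 12)"
      unfolding \<delta>_def using B hpos by (intro mult_left_mono) auto
    then have "B ^ 32 * \<delta> \<le> B ^ 32 * (B ^ 2 * (B * h * B ^ 12))" using B by (intro mult_left_mono) auto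
    also have "\<dots> = B ^ 47 / B ^ 49" by (simp add: h flip: power_add power_Suc)
    also have "\<dots> = 1 / B ^ 2"
    proof -
      have "B \<noteq> 0" using B by simp
      from power_quotient[OF this, of 47] show ?thesis by simp
    qed
    finally show ?thesis .
  qed
  have B2: "1 / B ^ 2 \<le> 1" using B by (simp add: divide_le_eq_1 one_le_power)
  have "mat_norm (Y (16 * b) - X) \<le> mat_norm X * (\<rho> ^ 2 ^ (16 * b) + 4 ^ (16 * b) * \<delta>)"
    by (rule newton_convergence[OF a X inv Y E step err start \<rho> \<delta>0]) (use \<delta>B B2 in \<open>simp_all add: K4\<close>)
  also have "\<dots> \<le> mat_norm X * (1 / B)"
  proof (rule mult_left_mono)
    have "\<rho> ^ 2 ^ (16 * b) \<le> 1 / (real (2 ^ (16 * b)) * (1 / B ^ 14))"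
      unfolding \<rho>_def using B BT by (intro power_contraction) auto
    also have "\<dots> = B ^ 14 / B ^ 16" by (simp add: pw)
    also have "\<dots> = 1 / B ^ 2"
    proof -
      have "B \<noteq> 0" using B by simp
      from power_quotient[OF this, of 14] show ?thesis by simp
    qed
    finally have "\<rho> ^ 2 ^ (16 * b) + 4 ^ (16 * b) * \<delta> \<le> 2 / B ^ 2" using \<delta>B by (simp add: K4)
    also have "\<dots> \<le> B / B ^ 2" using B by (intro divide_right_mono) auto
    also have "\<dots> = 1 / B" using B by (simp add: power2_eq_square)
    finally show "\<rho> ^ 2 ^ (16 * b) + 4 ^ (16 * b) * \<delta> \<le> 1 / B" .
  qed (rule mat_norm_nonneg[OF X])
  also have "mat_norm X * (1 / B) = roundoff b * mat_norm X" by (simp add: roundoff_def B_def power_one_over)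
  finally show ?thesis by (simp only: Y_def Z_def P_def)
qed

subsection \<open>Circuits for the iteration\<close>

lemma computes_signed:
  assumes "g \<in> S \<union> consts_bool" "word_bits W \<phi> \<subseteq> S \<union> consts_bool"
  shows "computes S (27 * (W * W)) (word_bits W (\<lambda>x. if g x then - \<phi> x else \<phi> x))"
proof -
  have "computes S (W * (7 * W)) (word_bits W (\<lambda>x. - 1 * \<phi> x))"
    by (rule computes_cmult[OF computes.free[OF assms(2), of 0]]) simp
  then have "computes S (W * (7 * W)) (word_bits W (\<lambda>x. - \<phi> x))" by simp
  then show ?thesis
  proof (rule computes_if[OF assms(1) _ computes.free[OF assms(2), of 0]])
    have "W * (7 * W) = 7 * (W * W)" by simp
    then show "W * (7 * W) + 2 * 0 + W * (7 * W) + 13 * W \<le> 27 * (W * W)"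
      using le_square[of W] by linarith
  qed
qed

text \<open>The real bound rounded down to a natural number, so that gate counts can treat it as one
  opaque quantity.\<close>

definition matmul_cost :: "real \<Rightarrow> nat \<Rightarrow> real \<Rightarrow> nat \<Rightarrow> nat \<Rightarrow> nat" where
  "matmul_cost C d \<tau> n W = nat \<lfloor>C * real n powr \<tau> * real W ^ d\<rfloor>"

text \<open>The circuits compute the product modulo \<open>2 ^ W\<close>.\<close>

definition matmul_circuits :: "'x itself \<Rightarrow> real \<Rightarrow> nat \<Rightarrow> real \<Rightarrow> bool" where
  "matmul_circuits _ C d \<tau> \<longleftrightarrow> C \<ge> 0 \<and> (\<forall>(n::nat) W (S :: ('x \<Rightarrow> bool) set) A B. n \<ge> 1 \<longrightarrow> W \<ge> 1 \<longrightarrow> n \<le> 2 ^ W \<longrightarrow>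
     (\<forall>i<n. \<forall>j<n. word_bits W (A i j) \<subseteq> S \<union> consts_bool \<and> word_bits W (B i j) \<subseteq> S \<union> consts_bool) \<longrightarrow>
     computes S (matmul_cost C d \<tau> n W) (\<Union>z\<in>{..<n} \<times> {..<n}. word_bits W (\<lambda>x. \<Sum>l<n. A (fst z) l x * B l (snd z) x)))"

lemma matmul_circuits_exist:
  assumes "\<forall>\<eta>>0. exact_multiplication_in (\<omega> + \<eta>)" "\<eta> > 0"
  shows "\<exists>C d. matmul_circuits TYPE('x) C d (\<omega> + \<eta>)"
proof -
  from computes_matrix_product[OF assms] obtain C d where C: "C \<ge> 0" and
    *: "\<forall>(n::nat) W (S :: ('x \<Rightarrow> bool) set) A B. n \<ge> 1 \<longrightarrow> W \<ge> 1 \<longrightarrow> n \<le> 2 ^ W \<longrightarrow>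
     (\<forall>i<n. \<forall>j<n. word_bits W (A i j) \<subseteq> S \<union> consts_bool \<and> word_bits W (B i j) \<subseteq> S \<union> consts_bool) \<longrightarrow>
     (\<exists>c. real c \<le> C * real n powr (\<omega> + \<eta>) * real W ^ d \<and>
        computes S c (\<Union>z\<in>{..<n} \<times> {..<n}. word_bits W (\<lambda>x. \<Sum>l<n. A (fst z) l x * B l (snd z) x)))"
    by (elim exE conjE)
  have "matmul_circuits TYPE('x) C d (\<omega> + \<eta>)"
    unfolding matmul_circuits_def
  proof (intro conjI C allI impI)
    fix n W :: nat and S :: "('x \<Rightarrow> bool) set" and A B
    assume a: "n \<ge> 1" "W \<ge> 1" "n \<le> 2 ^ W"
      "\<forall>i<n. \<forall>j<n. word_bits W (A i j) \<subseteq> S \<union> consts_bool \<and> word_bits W (B i j) \<subseteq> S \<union> consts_bool"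
    from *[THEN spec[of _ n], THEN spec[of _ W], THEN spec[of _ S], THEN spec[of _ A], THEN spec[of _ B],
        THEN mp, OF a(1), THEN mp, OF a(2), THEN mp, OF a(3), THEN mp, OF a(4)]
    obtain c where c: "real c \<le> C * real n powr (\<omega> + \<eta>) * real W ^ d"
      "computes S c (\<Union>z\<in>{..<n} \<times> {..<n}. word_bits W (\<lambda>x. \<Sum>l<n. A (fst z) l x * B l (snd z) x))"
      by (elim exE conjE)
    have "c \<le> matmul_cost C d (\<omega> + \<eta>) n W" using c(1) by (simp add: matmul_cost_def le_nat_iff le_floor_iff)
    with c(2) show "computes S (matmul_cost C d (\<omega> + \<eta>) n W) (\<Union>z\<in>{..<n} \<times> {..<n}. word_bits W (\<lambda>x. \<Sum>l<n. A (fst z) l x * B l (snd z) x))"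
      by (elim computes_mono) auto
  qed
  then show ?thesis by blast
qed

lemma matmul_cost_mono: "C \<ge> 0 \<Longrightarrow> U \<le> W \<Longrightarrow> matmul_cost C d \<tau> n U \<le> matmul_cost C d \<tau> n W"
  unfolding matmul_cost_def by (intro nat_mono floor_mono mult_left_mono power_mono) auto

lemma subset_Un_enlarge: "A \<subseteq> S \<union> D \<Longrightarrow> B \<subseteq> T \<Longrightarrow> A \<subseteq> (S \<union> T) \<union> D \<and> B \<subseteq> (S \<union> T) \<union> D"
  by blast

lemma subset_Un_aux2: "A \<subseteq> T \<Longrightarrow> B \<subseteq> U \<Longrightarrow> A \<subseteq> ((S \<union> T) \<union> U) \<union> D \<and> B \<subseteq> ((S \<union> T) \<union> U) \<union> D"
  by blast

text \<open>Every step loses 2 P bits at the top and the initial shift loses q, so W is chosen to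
  leave V correct low bits after K steps. The computation is exact modulo powers of two, and the
  iterates need not be bounded here.\<close>

lemma computes_newton:
  fixes \<alpha> :: "nat \<Rightarrow> nat \<Rightarrow> 'x \<Rightarrow> int"
  assumes mm: "matmul_circuits TYPE('x) C d \<tau>" and n: "n \<ge> 1" "n \<le> 2 ^ V" and V: "V \<ge> 1"
    and W: "W = V + 2 * P * K + q"
    and \<alpha>: "\<And>i j. i < n \<Longrightarrow> j < n \<Longrightarrow> word_bits W (\<alpha> i j) \<subseteq> S \<union> consts_bool"
  shows "computes S (K * (2 * matmul_cost C d \<tau> n W + n * n * (20 * (W * W))))
    (\<Union>z\<in>{..<n} \<times> {..<n}. word_bits V (newton_int n P q \<alpha> K (fst z) (snd z)))"
proof -
  define Y where "Y = newton_int n P q \<alpha>"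
  \<comment> \<open>The number of bits of the iterate that are still valid before step k.\<close>
  define U where "U k = V + 2 * P * (K - k)" for k
  let ?I = "{..<n} \<times> {..<n}"
  let ?T = "\<lambda>k. \<Union>z\<in>?I. word_bits (U k) (Y k (fst z) (snd z))"
  from mm have C: "C \<ge> 0" by (simp add: matmul_circuits_def)
  have "computes S (K * (2 * matmul_cost C d \<tau> n W + n * n * (20 * (W * W)))) (?T K)"
  proof (rule computes_sequence[where T = ?T])
    have init: "word_bits (U 0) (Y 0 i j) \<subseteq> S \<union> consts_bool" if "i < n" "j < n" for i j
    proof -
      have "Y 0 i j = (\<lambda>x. \<alpha> j i x div 2 ^ q)" by (rule ext) (simp add: Y_def)
      then have "word_bits (U 0) (Y 0 i j) \<subseteq> word_bits (U 0 + q) (\<alpha> j i)" using word_bits_div[of "U 0" "\<alpha> j i" q] by simp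
      also have "U 0 + q = W" by (simp add: U_def W)
      finally show ?thesis using \<alpha>[OF that(2,1)] by blast
    qed
    show "?T 0 \<subseteq> S \<union> consts_bool" by (rule UN_least, rule init) auto
    fix k assume k: "k < K"
    have Uk: "U k = U (Suc k) + 2 * P"
    proof -
      have "K - k = Suc (K - Suc k)" using k by simp
      then show ?thesis by (simp add: U_def)
    qed
    have UW: "U k \<le> W" unfolding U_def W by (simp add: mult_le_mono2 trans_le_add1)
    have "(2 :: nat) ^ V \<le> 2 ^ U k" by (intro power_increasing) (auto simp: U_def)
    with n(2) have nU: "n \<le> 2 ^ U k" by (rule order_trans)
    have U1: "1 \<le> U k" using V by (simp add: U_def)
    let ?S = "S \<union> ?T k"
    define Z where "Z = (\<lambda>l j x. \<Sum>m<n. \<alpha> l m x * Y k m j x)"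
    define Q where "Q = (\<lambda>i j x. \<Sum>l<n. Y k i l x * Z l j x)"
    let ?c = "matmul_cost C d \<tau> n W"
    have \<alpha>U: "word_bits (U k) (\<alpha> i j) \<subseteq> S \<union> consts_bool" if "i < n" "j < n" for i j
      using \<alpha>[OF that] word_bits_mono[OF UW] by blast
    have YU: "word_bits (U k) (Y k i j) \<subseteq> ?T k" if "i < n" "j < n" for i j
      using that by force
    have "computes ?S (matmul_cost C d \<tau> n (U k)) (\<Union>z\<in>?I. word_bits (U k) (Z (fst z) (snd z)))"
      unfolding Z_def
      by (rule mm[unfolded matmul_circuits_def, THEN conjunct2, rule_format, OF n(1) U1 nU]) (rule subset_Un_enlarge[OF \<alpha>U YU])
    then have 1: "computes ?S ?c (\<Union>z\<in>?I. word_bits (U k) (Z (fst z) (snd z)))"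
      using matmul_cost_mono[OF C UW] by (elim computes_mono) auto
    have ZU: "word_bits (U k) (Z i j) \<subseteq> (\<Union>z\<in>?I. word_bits (U k) (Z (fst z) (snd z)))" if "i < n" "j < n" for i j
      using that by force
    let ?S1 = "?S \<union> (\<Union>z\<in>?I. word_bits (U k) (Z (fst z) (snd z)))"
    have "computes ?S1 (matmul_cost C d \<tau> n (U k)) (\<Union>z\<in>?I. word_bits (U k) (Q (fst z) (snd z)))"
      unfolding Q_def
      by (rule mm[unfolded matmul_circuits_def, THEN conjunct2, rule_format, OF n(1) U1 nU]) (rule subset_Un_aux2[OF YU ZU])
    then have 2: "computes ?S1 ?c (\<Union>z\<in>?I. word_bits (U k) (Q (fst z) (snd z)))"
      using matmul_cost_mono[OF C UW] by (elim computes_mono) auto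
    let ?S2 = "?S \<union> (\<Union>z\<in>?I. word_bits (U k) (Q (fst z) (snd z)))"
    from computes_trans[OF 1 2] have 12: "computes ?S (?c + ?c) (\<Union>z\<in>?I. word_bits (U k) (Q (fst z) (snd z)))" .
    have 3: "computes ?S2 (n * n * (20 * (W * W))) (?T (Suc k))"
    proof (rule computes_UN_bound)
      fix z assume z: "z \<in> ?I"
      let ?i = "fst z" and ?j = "snd z"
      have "computes ?S2 (U k * (7 * U k)) (word_bits (U k) (\<lambda>x. 2 ^ (2 * P + 1) * Y k ?i ?j x))"
        by (rule computes_cmult[OF computes.free[of _ _ 0]]) (use YU[of ?i ?j] z in auto)
      moreover have "computes ?S2 0 (word_bits (U k) (Q ?i ?j))" using z by (intro computes.free) auto
      moreover have "U k * (7 * U k) + 0 + (U k * (7 * U k) + 6 * U k) \<le> 20 * (W * W)"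
      proof -
        have "U k * (7 * U k) = 7 * (U k * U k)" by simp
        moreover have "U k * U k \<le> W * W" by (rule mult_le_mono[OF UW UW])
        ultimately show ?thesis using word_cost[of "U k"] by linarith
      qed
      ultimately have "computes ?S2 (20 * (W * W)) (word_bits (U k) (\<lambda>x. 2 ^ (2 * P + 1) * Y k ?i ?j x - Q ?i ?j x))"
        by (rule computes_diff)
      moreover have "word_bits (U (Suc k)) (Y (Suc k) ?i ?j) \<subseteq> word_bits (U k) (\<lambda>x. 2 ^ (2 * P + 1) * Y k ?i ?j x - Q ?i ?j x)"
      proof -
        have "Y (Suc k) ?i ?j = (\<lambda>x. (2 ^ (2 * P + 1) * Y k ?i ?j x - Q ?i ?j x) div 2 ^ (2 * P))"
          by (rule ext) (simp only: Y_def Q_def Z_def newton_int.simps)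
        then show ?thesis
          using word_bits_div[of "U (Suc k)" "\<lambda>x. 2 ^ (2 * P + 1) * Y k ?i ?j x - Q ?i ?j x" "2 * P"] by (simp only: Uk)
      qed
      ultimately show "computes ?S2 (20 * (W * W)) (word_bits (U (Suc k)) (Y (Suc k) ?i ?j))"
        by (elim computes_mono) auto
    qed (simp_all add: card_cartesian_product)
    from computes_trans[OF 12 3]
    show "computes ?S (2 * ?c + n * n * (20 * (W * W))) (?T (Suc k))" by (simp only: mult_2)
  qed
  then show ?thesis by (simp add: U_def Y_def)
qed

section \<open>Scaling a floating point matrix\<close>

text \<open>The offset \<open>off\<close> is the bit at which a matrix starts, so that both factors
  of a product can be addressed in one input.\<close>

definition sign_in :: "nat \<Rightarrow> nat \<Rightarrow> nat \<Rightarrow> nat \<Rightarrow> bool list \<Rightarrow> bool" where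
  "sign_in off b w e bs = wire bs (off + e * (1 + b + w))"

definition mant_in :: "nat \<Rightarrow> nat \<Rightarrow> nat \<Rightarrow> nat \<Rightarrow> bool list \<Rightarrow> int" where
  "mant_in off b w e bs = bit_field (off + e * (1 + b + w) + 1) b bs"

definition exp_in :: "nat \<Rightarrow> nat \<Rightarrow> nat \<Rightarrow> nat \<Rightarrow> bool list \<Rightarrow> int" where
  "exp_in off b w e bs = bit_field (off + e * (1 + b + w) + 1 + b) w bs"

definition top_exp :: "nat \<Rightarrow> nat \<Rightarrow> nat \<Rightarrow> nat \<Rightarrow> bool list \<Rightarrow> int" where
  "top_exp off n b w = max_exp (mant_in off b w) (exp_in off b w) (n * n)"

text \<open>The input matrix with its largest relevant exponent divided out. Its entries are at most
  2^b in absolute value, and its norm is at least 1 unless it vanishes, since then an entry of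
  maximal exponent has an integer significand at least 1.\<close>

definition scaled_in :: "nat \<Rightarrow> nat \<Rightarrow> nat \<Rightarrow> nat \<Rightarrow> bool list \<Rightarrow> real mat" where
  "scaled_in off n b w bs = mat n n (\<lambda>(i, j). (if sign_in off b w (i * n + j) bs then - 1 else 1) *
     of_int (mant_in off b w (i * n + j) bs) * 2 powi (exp_in off b w (i * n + j) bs - top_exp off n b w bs))"

lemma mant_in_bounds: "0 \<le> mant_in off b w e bs" "mant_in off b w e bs < 2 ^ b"
  by (simp_all add: mant_in_def bit_field_bounds)

lemma exp_in_bounds: "0 \<le> exp_in off b w e bs" "exp_in off b w e bs < 2 ^ w"
  by (simp_all add: exp_in_def bit_field_bounds)

lemma top_exp_bounds: "0 \<le> top_exp off n b w bs" "top_exp off n b w bs < 2 ^ w"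
  unfolding top_exp_def by (rule max_exp_bounds; rule exp_in_bounds)+

lemma exp_le_top: "e < n * n \<Longrightarrow> mant_in off b w e bs \<noteq> 0 \<Longrightarrow> exp_in off b w e bs \<le> top_exp off n b w bs"
  unfolding top_exp_def by (rule max_exp_upper)

lemma scaled_in_carrier [simp]: "scaled_in off n b w bs \<in> carrier_mat n n"
  by (simp add: scaled_in_def)

lemma scaled_in_le:
  assumes "i < n" "j < n"
  shows "\<bar>scaled_in off n b w bs $$ (i, j)\<bar> \<le> 2 ^ b"
proof (cases "mant_in off b w (i * n + j) bs = 0")
  case True
  then show ?thesis using assms by (simp add: scaled_in_def)
next
  case False
  let ?e = "i * n + j"
  have "exp_in off b w ?e bs - top_exp off n b w bs \<le> 0"
    using exp_le_top[OF row_major_less[OF assms] False] by simp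
  then have "(2 :: real) powi (exp_in off b w ?e bs - top_exp off n b w bs) \<le> 2 powi 0"
    by (intro power_int_increasing) auto
  moreover have "of_int (mant_in off b w ?e bs) \<le> (of_int (2 ^ b) :: real)"
    using mant_in_bounds(2)[of off b w ?e bs] by (simp only: of_int_le_iff)
  ultimately have "of_int (mant_in off b w ?e bs) * (2 :: real) powi (exp_in off b w ?e bs - top_exp off n b w bs) \<le> 2 ^ b * 1"
    using mant_in_bounds(1)[of off b w ?e bs] by (intro mult_mono) auto
  then show ?thesis using assms mant_in_bounds(1)[of off b w ?e bs] by (simp add: scaled_in_def abs_mult)
qed

lemma scaled_in_norm_ge:
  assumes "e < n * n" "mant_in off b w e bs \<noteq> 0"
  shows "1 \<le> mat_norm (scaled_in off n b w bs)"
proof -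
  have "\<exists>e<n * n. mant_in off b w e bs \<noteq> 0 \<and> exp_in off b w e bs = top_exp off n b w bs"
    unfolding top_exp_def by (rule max_exp_attained[where M = "mant_in off b w" and x = bs, OF _ assms]) (rule exp_in_bounds)
  then obtain e where e: "e < n * n" "mant_in off b w e bs \<noteq> 0" "exp_in off b w e bs = top_exp off n b w bs" by blast
  note ij = div_less_of_less_square[OF e(1)]
  have "1 \<le> mant_in off b w e bs" using e(2) mant_in_bounds(1)[of off b w e bs] by linarith
  then have "1 \<le> \<bar>scaled_in off n b w bs $$ (e div n, e mod n)\<bar>"
    using ij e by (simp add: scaled_in_def abs_mult)
  also have "\<dots> \<le> mat_norm (scaled_in off n b w bs)" by (rule entry_le_mat_norm[OF scaled_in_carrier ij])
  finally show ?thesis .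
qed

lemma scaled_in_zero:
  assumes "\<And>e. e < n * n \<Longrightarrow> mant_in off b w e bs = 0"
  shows "scaled_in off n b w bs = 0\<^sub>m n n"
  by (rule eq_matI) (use assms row_major_less in \<open>auto simp: scaled_in_def\<close>)

lemma float_matrix_scaled:
  assumes "off + n * n * (1 + b + w) \<le> length bs"
  shows "mat n n (\<lambda>(i, j). float_value b w (drop (off + (i * n + j) * (1 + b + w)) bs)) =
    2 powi (top_exp off n b w bs - 2 ^ (w - 1)) \<cdot>\<^sub>m scaled_in off n b w bs"
proof (rule eq_matI)
  fix i j assume "i < dim_row (2 powi (top_exp off n b w bs - 2 ^ (w - 1)) \<cdot>\<^sub>m scaled_in off n b w bs)"
    "j < dim_col (2 powi (top_exp off n b w bs - 2 ^ (w - 1)) \<cdot>\<^sub>m scaled_in off n b w bs)"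
  then have ij: "i < n" "j < n" by (simp_all add: scaled_in_def)
  let ?e = "i * n + j"
  have "off + ?e * (1 + b + w) + (1 + b + w) \<le> length bs"
    using chunk_bound[OF row_major_less[OF ij], of "1 + b + w"] assms by linarith
  from float_value_fields[OF this]
  have fv: "float_value b w (drop (off + ?e * (1 + b + w)) bs) =
      (if sign_in off b w ?e bs then - 1 else 1) * of_int (mant_in off b w ?e bs) * 2 powi (exp_in off b w ?e bs - 2 ^ (w - 1))"
    by (simp only: sign_in_def mant_in_def exp_in_def)
  have "(2 :: real) powi (exp_in off b w ?e bs - 2 ^ (w - 1)) =
      2 powi (top_exp off n b w bs - 2 ^ (w - 1)) * 2 powi (exp_in off b w ?e bs - top_exp off n b w bs)"
    by (subst power_int_add[symmetric]) simp_all
  then show "mat n n (\<lambda>(i, j). float_value b w (drop (off + (i * n + j) * (1 + b + w)) bs)) $$ (i, j) =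
      (2 powi (top_exp off n b w bs - 2 ^ (w - 1)) \<cdot>\<^sub>m scaled_in off n b w bs) $$ (i, j)"
    using ij fv by (simp add: scaled_in_def)
qed (simp_all add: scaled_in_def)

lemma input_bits_in:
  assumes "e < n * n" "off + n * n * (1 + b + w) \<le> N"
  shows "sign_in off b w e \<in> input_bits N"
    and "word_bits W (mant_in off b w e) \<subseteq> input_bits N \<union> consts_bool"
    and "word_bits W (exp_in off b w e) \<subseteq> input_bits N \<union> consts_bool"
proof -
  have le: "off + e * (1 + b + w) + (1 + b + w) \<le> N"
    using chunk_bound[OF assms(1), of "1 + b + w"] assms(2) by linarith
  have "sign_in off b w e = (\<lambda>bs. wire bs (off + e * (1 + b + w)))" by (rule ext) (simp add: sign_in_def)
  then show "sign_in off b w e \<in> input_bits N" using le by (auto intro!: wire_mem_input_bits)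
  have *: "word_bits W (\<lambda>bs. bit_field d l bs) \<subseteq> input_bits N \<union> consts_bool" if "d + l \<le> N" for d l
    using word_bits_bit_field[of W d l "\<lambda>bs. bs"] that by (force simp: input_bits_def)
  have "mant_in off b w e = (\<lambda>bs. bit_field (off + e * (1 + b + w) + 1) b bs)" by (rule ext) (simp add: mant_in_def)
  then show "word_bits W (mant_in off b w e) \<subseteq> input_bits N \<union> consts_bool" using * le by simp
  have "exp_in off b w e = (\<lambda>bs. bit_field (off + e * (1 + b + w) + 1 + b) w bs)" by (rule ext) (simp add: exp_in_def)
  then show "word_bits W (exp_in off b w e) \<subseteq> input_bits N \<union> consts_bool" using * le by simp
qed

lemma computes_top_exp:
  assumes "off + n * n * (1 + b + w) \<le> N"
  shows "computes (input_bits N) (n * n * (35 * ((b + w + 1) * (b + w + 1)))) (word_bits w (top_exp off n b w))"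
  unfolding top_exp_def
proof (rule computes_max_exp)
  show "0 \<le> mant_in off b w e x" "mant_in off b w e x < 2 ^ b" "0 \<le> exp_in off b w e x" "exp_in off b w e x < 2 ^ w" for e x
    by (rule mant_in_bounds exp_in_bounds)+
  show "word_bits b (mant_in off b w e) \<subseteq> input_bits N \<union> consts_bool"
    "word_bits w (exp_in off b w e) \<subseteq> input_bits N \<union> consts_bool" if "e < n * n" for e
    using input_bits_in(2,3)[OF that assms] by simp_all
qed simp

section \<open>Stable inversion\<close>

text \<open>A scaled entry times 2^P, rounded toward zero: the magnitude is shifted first and the
  sign applied afterwards. The shift distance can be negative only where the significand is zero,
  and there its reduction modulo 2^w does no harm.\<close>

definition fixed_in :: "nat \<Rightarrow> nat \<Rightarrow> nat \<Rightarrow> nat \<Rightarrow> nat \<Rightarrow> nat \<Rightarrow> bool list \<Rightarrow> int" where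
  "fixed_in n b w P i j bs = (let e = i * n + j;
     m = (mant_in 0 b w e bs * 2 ^ P) div 2 ^ nat (take_bit w (top_exp 0 n b w bs - exp_in 0 b w e bs))
     in if sign_in 0 b w e bs then - m else m)"

lemma fixed_in_error:
  assumes "i < n" "j < n"
  shows "\<bar>of_int (fixed_in n b w P i j bs) - 2 ^ P * scaled_in 0 n b w bs $$ (i, j)\<bar> \<le> 1"
proof (cases "mant_in 0 b w (i * n + j) bs = 0")
  case True
  then show ?thesis using assms by (simp add: scaled_in_def fixed_in_def)
next
  case False
  let ?e = "i * n + j"
  define M where "M = mant_in 0 b w ?e bs"
  define D where "D = top_exp 0 n b w bs - exp_in 0 b w ?e bs"
  have D0: "0 \<le> D" using exp_le_top[OF row_major_less[OF assms] False] by (simp add: D_def)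
  have "D < 2 ^ w" using top_exp_bounds(2)[of 0 n b w bs] exp_in_bounds(1)[of 0 b w ?e bs] unfolding D_def by linarith
  then have tb: "take_bit w D = D" using D0 by (intro take_bit_int_eq_self)
  define m where "m = (M * 2 ^ P) div 2 ^ nat D"
  have fx: "fixed_in n b w P i j bs = (if sign_in 0 b w ?e bs then - m else m)"
  proof -
    have "fixed_in n b w P i j bs = (if sign_in 0 b w ?e bs then - ((M * 2 ^ P) div 2 ^ nat (take_bit w D))
        else (M * 2 ^ P) div 2 ^ nat (take_bit w D))"
      by (simp only: fixed_in_def Let_def M_def D_def)
    then show ?thesis by (simp only: tb m_def)
  qed
  have "exp_in 0 b w ?e bs - top_exp 0 n b w bs = - int (nat D)" using D0 by (simp add: D_def)
  then have p: "(2 :: real) powi (exp_in 0 b w ?e bs - top_exp 0 n b w bs) = 1 / 2 ^ nat D"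
    by (simp only: power_int_minus power_int_of_nat inverse_eq_divide)
  have "2 ^ P * scaled_in 0 n b w bs $$ (i, j) = (if sign_in 0 b w ?e bs then - 1 else 1) * (of_int (M * 2 ^ P) / 2 ^ nat D)"
    using assms by (simp add: scaled_in_def p M_def)
  then show ?thesis
    using floor_div_error[of "M * 2 ^ P" "nat D"] unfolding fx m_def by (cases "sign_in 0 b w ?e bs") auto
qed

lemma computes_fixed_in:
  assumes w: "w \<ge> 1" and P: "P \<ge> 1" and i: "i < n" "j < n" and N: "n * n * (1 + b + w) \<le> N" and T: "b + P \<le> T" "w \<le> T" "W \<le> T"
  shows "computes (input_bits N \<union> word_bits w (top_exp 0 n b w)) (13 * (T * T) + T * (20 * (T * T)) + 27 * (T * T)) (word_bits W (fixed_in n b w P i j))"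
proof -
  define e where "e = i * n + j"
  have e: "e < n * n" unfolding e_def by (rule row_major_less[OF i])
  let ?S = "input_bits N \<union> word_bits w (top_exp 0 n b w)"
  have N': "0 + n * n * (1 + b + w) \<le> N" using N by simp
  note inb = input_bits_in[OF e N']
  have TT: "x * y \<le> T * T" if "x \<le> T" "y \<le> T" for x y using that by (rule mult_le_mono)
  let ?d = "\<lambda>bs. top_exp 0 n b w bs - exp_in 0 b w e bs"
  let ?m = "\<lambda>bs. mant_in 0 b w e bs * 2 ^ P"
  have 1: "computes ?S (13 * (T * T)) (word_bits w ?d)"
  proof (rule computes_diff[OF computes.free[of _ _ 0] computes.free[of _ _ 0]])
    show "word_bits w (exp_in 0 b w e) \<subseteq> ?S \<union> consts_bool" using inb(3) by blast
    show "0 + 0 + (w * (7 * w) + 6 * w) \<le> 13 * (T * T)" using word_cost[of w] TT[OF T(2) T(2)] by linarith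
  qed blast
  have mb: "0 \<le> ?m bs" "?m bs < 2 ^ (b + P)" for bs
    using mant_in_bounds[of 0 b w e bs] by (simp_all add: power_add)
  let ?h = "\<lambda>bs. ?m bs div 2 ^ nat (take_bit w (?d bs))"
  have hb: "0 \<le> ?h bs" "?h bs < 2 ^ (b + P)" for bs
  proof -
    show "0 \<le> ?h bs" using mb(1)[of bs] by (simp add: pos_imp_zdiv_nonneg_iff)
    have "?h bs \<le> ?m bs" by (rule order_trans[OF zdiv_mono2[of "?m bs" 1]]) (use mb(1)[of bs] in auto)
    then show "?h bs < 2 ^ (b + P)" using mb(2)[of bs] by linarith
  qed
  have "computes (?S \<union> word_bits w ?d) (T * (20 * (T * T))) (word_bits (b + P) ?h)"
  proof (rule computes_mono[OF computes_shift[of ?m "b + P" w ?d]])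
    show "word_bits (b + P) ?m \<union> word_bits w ?d \<subseteq> (?S \<union> word_bits w ?d) \<union> consts_bool"
      using word_bits_mult_exp[of "b + P" "mant_in 0 b w e" P] inb(2)[of "b + P"] by blast
    show "w * (20 * ((b + P) * (b + P))) \<le> T * (20 * (T * T))"
      by (rule mult_le_mono[OF T(2)]) (use TT[OF T(1) T(1)] in simp)
  qed (use mb in auto)
  from computes_trans[OF 1 this] have 2: "computes ?S (13 * (T * T) + T * (20 * (T * T))) (word_bits (b + P) ?h)" .
  have "computes (?S \<union> word_bits (b + P) ?h) (27 * (W * W)) (word_bits W (\<lambda>bs. if sign_in 0 b w e bs then - ?h bs else ?h bs))"
  proof (rule computes_signed)
    show "word_bits W ?h \<subseteq> (?S \<union> word_bits (b + P) ?h) \<union> consts_bool"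
      using word_bits_bounded[of ?h "b + P" W, OF hb] by blast
    show "sign_in 0 b w e \<in> (?S \<union> word_bits (b + P) ?h) \<union> consts_bool" using inb(1) by blast
  qed
  from computes_trans[OF 2 this]
  have "computes ?S (13 * (T * T) + T * (20 * (T * T)) + 27 * (W * W)) (word_bits W (\<lambda>bs. if sign_in 0 b w e bs then - ?h bs else ?h bs))" .
  moreover have "(\<lambda>bs. if sign_in 0 b w e bs then - ?h bs else ?h bs) = fixed_in n b w P i j"
    by (rule ext) (simp add: fixed_in_def Let_def e_def)
  ultimately have c: "computes ?S (13 * (T * T) + T * (20 * (T * T)) + 27 * (W * W)) (word_bits W (fixed_in n b w P i j))"
    by (simp only:)
  show ?thesis
    by (rule computes_mono[OF c]) (use TT[OF T(3) T(3)] in auto)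
qed

section \<open>From the digits of Newton's iteration to a floating point inverse\<close>

definition inv_digits :: "nat \<Rightarrow> nat \<Rightarrow> nat \<Rightarrow> nat \<Rightarrow> nat \<Rightarrow> bool list \<Rightarrow> int" where
  "inv_digits n b w i j = newton_int n (49 * b) (4 * b) (fixed_in n b w (49 * b)) (16 * b) i j"

text \<open>Sign and magnitude of \<open>y\<close> in \<open>V\<close> bits: correct when \<open>y\<close> is small, and in any case bounded.\<close>

definition low_digits :: "nat \<Rightarrow> int \<Rightarrow> int" where
  "low_digits V y = (if bit y (V - 1) then - 1 else 1) * take_bit V (if bit y (V - 1) then - y else y)"

lemma low_digits_le: "\<bar>low_digits V y\<bar> \<le> 2 ^ V"
  using take_bit_int_less_exp[of V y, THEN less_imp_le] take_bit_int_less_exp[of V "- y", THEN less_imp_le]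
  by (auto simp: low_digits_def abs_mult)

lemma low_digits_eq:
  assumes "\<bar>y\<bar> < 2 ^ (V - 1)" "V \<ge> 1"
  shows "low_digits V y = y"
proof -
  have "bit y (V - 1) \<longleftrightarrow> y < 0" using assms(1) by (intro bit_sign) linarith+
  moreover have "(2 :: int) ^ (V - 1) \<le> 2 ^ V" by (intro power_increasing) auto
  then have "take_bit V \<bar>y\<bar> = \<bar>y\<bar>" using assms(1) by (intro take_bit_int_eq_self) linarith+
  ultimately show ?thesis by (auto simp: low_digits_def abs_if split: if_splits)
qed

text \<open>Put B = 2^b. If |X| \<le> B^4, the iteration has relative error 1/B, the digits fit into
  56 b bits, and a condition number of at least 1 gives the claim. Otherwise |X|^2 / B is at least
  B^7, which bounds every entry that can be written at all, and also at least |X|; then even a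
  meaningless output is close enough.\<close>

lemma inversion_error:
  assumes n: "n \<ge> 1" and b: "b \<ge> 1" and nb: "n \<le> 2 ^ b"
    and X: "X \<in> carrier_mat n n" and inv: "is_inverse (scaled_in 0 n b w bs) X"
  defines "a \<equiv> scaled_in 0 n b w bs"
  shows "mat_norm (mat n n (\<lambda>(i, j). of_int (low_digits (56 * b) (inv_digits n b w i j bs)) / 2 ^ (49 * b)) - X)
    \<le> (real n + 1) * roundoff b * mat_norm a * (mat_norm X)\<^sup>2"
proof -
  define B :: real where "B = 2 ^ b"
  have B: "B \<ge> 2" using power_increasing[OF b, of "2 :: real"] by (simp add: B_def)
  have pw: "(2 :: real) ^ (k * b) = B ^ k" for k by (simp add: B_def power_mult mult.commute[of k])
  have \<epsilon>: "roundoff b = 1 / B" by (simp add: roundoff_def B_def power_one_over)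
  have a: "a \<in> carrier_mat n n" by (simp add: a_def)
  define S where "S = mat_norm X"
  have S0: "0 \<le> S" unfolding S_def by (rule mat_norm_nonneg[OF X])
  have aX: "a * X = 1\<^sub>m n" using inv carrier_matD[OF a] by (simp add: is_inverse_def inverts_mat_def a_def)
  have \<kappa>: "1 \<le> mat_norm a * S"
    using mat_norm_mult[OF a X] mat_norm_one_ge[OF n] unfolding aX S_def by linarith
  have a1: "1 \<le> mat_norm a"
  proof (rule ccontr)
    assume "\<not> 1 \<le> mat_norm a"
    then have "a = 0\<^sub>m n n" unfolding a_def using scaled_in_norm_ge by (intro scaled_in_zero) blast
    then have "mat_norm a \<le> 0" using mat_norm_entries[OF a, of 0] by simp
    then have "mat_norm a * S \<le> 0" using S0 by (intro mult_nonpos_nonneg)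
    with \<kappa> show False by simp
  qed
  define y where "y = mat n n (\<lambda>(i, j). of_int (low_digits (56 * b) (inv_digits n b w i j bs)) / 2 ^ (49 * b) :: real)"
  have y: "y \<in> carrier_mat n n" by (simp add: y_def)
  have "mat_norm (y - X) \<le> (real n + 1) * (1 / B) * mat_norm a * S\<^sup>2"
  proof (cases "S \<le> B ^ 4")
    case True
    define z where "z = mat n n (\<lambda>(i, j). of_int (inv_digits n b w i j bs) / 2 ^ (49 * b) :: real)"
    have z: "z \<in> carrier_mat n n" by (simp add: z_def)
    have zX: "mat_norm (z - X) \<le> 1 / B * S"
      unfolding z_def inv_digits_def \<epsilon>[symmetric] S_def
    proof (rule newton_fixed_point[OF n b nb a X inv[folded a_def]])
      show "\<bar>a $$ (i, j)\<bar> \<le> 2 ^ b" if "i < n" "j < n" for i j unfolding a_def by (rule scaled_in_le[OF that])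
      show "\<bar>of_int (fixed_in n b w (49 * b) i j bs) - 2 ^ (49 * b) * a $$ (i, j)\<bar> \<le> 1" if "i < n" "j < n" for i j
        unfolding a_def by (rule fixed_in_error[OF that])
      show "mat_norm X \<le> 2 ^ (4 * b)" using True by (simp only: S_def pw)
    qed
    have "low_digits (56 * b) (inv_digits n b w i j bs) = inv_digits n b w i j bs" if ij: "i < n" "j < n" for i j
    proof (rule low_digits_eq)
      have "z = (z - X) + X" using carrier_matD[OF z] carrier_matD[OF X] by (intro eq_matI) simp_all
      then have "mat_norm z = mat_norm ((z - X) + X)" by simp
      also have "\<dots> \<le> mat_norm (z - X) + mat_norm X" by (rule mat_norm_triangle[OF minus_carrier_mat[OF X] X])
      also have "\<dots> \<le> 1 / B * S + S" using zX by (simp add: S_def)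
      also have "1 / B * S \<le> 1 * S" using B S0 by (intro mult_right_mono) auto
      finally have "mat_norm z \<le> 2 * S" by simp
      then have "\<bar>z $$ (i, j)\<bar> \<le> 2 * B ^ 4" using entry_le_mat_norm[OF z ij] True by linarith
      then have "\<bar>real_of_int (inv_digits n b w i j bs)\<bar> / 2 ^ (49 * b) \<le> 2 * B ^ 4"
        using ij by (simp add: z_def abs_divide)
      then have "\<bar>real_of_int (inv_digits n b w i j bs)\<bar> \<le> 2 * B ^ 4 * 2 ^ (49 * b)"
        by (simp only: pos_divide_le_eq zero_less_power zero_less_numeral)
      also have "\<dots> = 2 ^ (4 * b + 49 * b + 1)" by (simp only: pw[symmetric] power_add power_one_right mult_ac)
      also have "\<dots> < 2 ^ (56 * b - 1)" using b by (intro power_strict_increasing) auto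
      finally have "real_of_int \<bar>inv_digits n b w i j bs\<bar> < real_of_int (2 ^ (56 * b - 1))" by simp
      then show "\<bar>inv_digits n b w i j bs\<bar> < 2 ^ (56 * b - 1)" by (simp only: of_int_less_iff)
    qed (use b in simp)
    then have "y = z" unfolding y_def z_def by (intro eq_matI) simp_all
    then have "mat_norm (y - X) \<le> 1 / B * S" using zX by simp
    also have "\<dots> \<le> 1 / B * (S * (mat_norm a * S))" using \<kappa> S0 B by (intro mult_left_mono) (auto intro: mult_le_cancel_left1[THEN iffD2])
    also have "\<dots> \<le> (real n + 1) * (1 / B * (S * (mat_norm a * S)))"
    proof -
      have "0 \<le> 1 / B * (S * (mat_norm a * S))" using a1 S0 B by (intro mult_nonneg_nonneg) auto
      then have "1 * (1 / B * (S * (mat_norm a * S))) \<le> (real n + 1) * (1 / B * (S * (mat_norm a * S)))"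
        by (intro mult_right_mono) auto
      then show ?thesis by (simp only: mult_1_left)
    qed
    also have "\<dots> = (real n + 1) * (1 / B) * mat_norm a * S\<^sup>2" by (simp only: power2_eq_square mult_ac)
    finally show ?thesis .
  next
    case False
    then have SB: "B ^ 4 \<le> S" by simp
    have B7: "B ^ 7 \<le> S\<^sup>2 / B"
    proof -
      have "(B ^ 4)\<^sup>2 \<le> S\<^sup>2" using SB B by (intro power_mono) auto
      then have "B ^ 7 * B \<le> S\<^sup>2" by (simp flip: power_mult power_Suc2)
      then show ?thesis using B by (simp add: pos_le_divide_eq)
    qed
    have S1: "S \<le> S\<^sup>2 / B"
    proof -
      have "B ^ 1 \<le> B ^ 4" using B by (intro power_increasing) auto
      then have "S * B \<le> S * S" using SB S0 by (intro mult_left_mono) auto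
      then show ?thesis using B by (simp add: pos_le_divide_eq power2_eq_square)
    qed
    have "mat_norm (y - X) \<le> mat_norm y + mat_norm X" by (rule mat_norm_minus[OF y X])
    \<comment> \<open>Of the 56 b bits, 49 b are behind the binary point, which leaves entries of at
      most B^7.\<close>
    also have "mat_norm y \<le> real n * B ^ 7"
    proof (rule mat_norm_entries[OF y])
      fix i j assume ij: "i < n" "j < n"
      have "\<bar>y $$ (i, j)\<bar> = real_of_int \<bar>low_digits (56 * b) (inv_digits n b w i j bs)\<bar> / 2 ^ (49 * b)"
        using ij by (simp add: y_def abs_divide)
      also have "\<dots> \<le> real_of_int (2 ^ (56 * b)) / 2 ^ (49 * b)"
        by (intro divide_right_mono of_int_le_iff[THEN iffD2] low_digits_le) simp
      also have "\<dots> = 2 ^ (7 * b)"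
      proof -
        have "(2 :: real) ^ (56 * b) = 2 ^ (7 * b) * 2 ^ (49 * b)" by (simp flip: power_add)
        then show ?thesis by simp
      qed
      finally show "\<bar>y $$ (i, j)\<bar> \<le> B ^ 7" by (simp only: pw)
    qed (use B in simp)
    also have "real n * B ^ 7 + mat_norm X \<le> real n * (S\<^sup>2 / B) + S\<^sup>2 / B"
      using B7 S1 by (intro add_mono mult_left_mono) (auto simp: S_def)
    also have "\<dots> = (real n + 1) * (S\<^sup>2 / B) * 1"
      by (simp only: distrib_right mult_1_left mult_1_right)
    also have "\<dots> \<le> (real n + 1) * (S\<^sup>2 / B) * mat_norm a" using a1 B by (intro mult_left_mono) auto
    finally show ?thesis by (simp add: mult_ac)
  qed
  then show ?thesis by (simp only: y_def \<epsilon> S_def)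
qed


text \<open>T dominates all word lengths at once. The longest word is W, which is quadratic in b
  because 16 b steps lose 98 b bits each; so T is quadratic in b + w.\<close>

lemma inversion_circuit_ops:
  assumes mm: "matmul_circuits TYPE(bool list) C d \<tau>" and n: "n \<ge> 1" "n \<le> 2 ^ b" and b: "b \<ge> 1" and w: "w \<ge> 1"
    and T: "T = 2000 * ((b + w) * (b + w))"
  defines "V \<equiv> 56 * b" and "P \<equiv> 49 * b" and "w' \<equiv> w + 49 * b + 2" and "N \<equiv> n * n * (1 + b + w)"
  shows "\<exists>c. c + 2 + n * n * (1 + V + w') \<le> T * (2 * matmul_cost C d \<tau> n T) + n * n * (200 * (T * (T * T))) \<and>
    computes (input_bits N) c (\<Union>e<n * n. {\<lambda>bs. bit (inv_digits n b w (e div n) (e mod n) bs) (V - 1)} \<union>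
      word_bits V (\<lambda>bs. if bit (inv_digits n b w (e div n) (e mod n) bs) (V - 1) then - inv_digits n b w (e div n) (e mod n) bs
         else inv_digits n b w (e div n) (e mod n) bs) \<union>
      word_bits w' (\<lambda>bs. 2 ^ (w' - 1) + 2 ^ (w - 1) - int P - top_exp 0 n b w bs))"
proof -
  define W where "W = V + 2 * P * (16 * b) + 4 * b"
  let ?I = "{..<n} \<times> {..<n}"
  let ?S0 = "input_bits N"
  let ?S1 = "?S0 \<union> word_bits w (top_exp 0 n b w)"
  let ?A = "\<Union>z\<in>?I. word_bits W (fixed_in n b w P (fst z) (snd z))"
  let ?D = "\<Union>z\<in>?I. word_bits V (inv_digits n b w (fst z) (snd z))"
  let ?E = "\<lambda>bs. 2 ^ (w' - 1) + 2 ^ (w - 1) - int P - top_exp 0 n b w bs"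
  have bb: "b \<le> b * b" "1 \<le> b * b" using b by auto
  have sq: "b * b + w + b + 1 \<le> (b + w) * (b + w)"
  proof -
    have "(b + w) * (b + w) = b * b + 2 * (b * w) + w * w" by (simp add: algebra_simps)
    moreover have "b \<le> b * w" "w \<le> w * w" "1 \<le> b * w" using b w by auto
    ultimately show ?thesis by linarith
  qed
  have W_eq: "W = 60 * b + 1568 * (b * b)" by (simp add: W_def V_def P_def)
  have le: "b + w + 1 \<le> T" "b + P \<le> T" "w \<le> T" "W \<le> T" "V \<le> T" "w' \<le> T" "16 * b \<le> T" "1 + V + w' \<le> T" "1 \<le> T"
    using sq bb b unfolding T W_eq P_def V_def w'_def by linarith+
  have sqT: "x * y \<le> T * T" if "x \<le> T" "y \<le> T" for x y using that by (rule mult_le_mono)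
  have 1: "computes ?S0 (n * n * (35 * (T * T))) (word_bits w (top_exp 0 n b w))"
  proof (rule computes_mono)
    show "computes ?S0 (n * n * (35 * ((b + w + 1) * (b + w + 1)))) (word_bits w (top_exp 0 n b w))"
      by (rule computes_top_exp) (simp add: N_def)
    show "n * n * (35 * ((b + w + 1) * (b + w + 1))) \<le> n * n * (35 * (T * T))"
      using sqT[OF le(1) le(1)] by (intro mult_le_mono2)
  qed blast+
  have 2: "computes ?S1 (n * n * (13 * (T * T) + T * (20 * (T * T)) + 27 * (T * T))) ?A"
  proof (rule computes_UN_bound)
    fix z assume "z \<in> ?I"
    then show "computes ?S1 (13 * (T * T) + T * (20 * (T * T)) + 27 * (T * T)) (word_bits W (fixed_in n b w P (fst z) (snd z)))"
      by (intro computes_fixed_in) (use w b le in \<open>auto simp: N_def P_def\<close>)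
  qed (simp_all add: card_cartesian_product)
  have nV: "n \<le> 2 ^ V"
  proof (rule order_trans[OF n(2)])
    show "(2 :: nat) ^ b \<le> 2 ^ V" by (rule power_increasing) (simp_all add: V_def)
  qed
  have 3: "computes (?S1 \<union> ?A) (16 * b * (2 * matmul_cost C d \<tau> n W + n * n * (20 * (W * W)))) ?D"
  proof -
    have A: "word_bits W (fixed_in n b w P i j) \<subseteq> (?S1 \<union> ?A) \<union> consts_bool" if "i < n" "j < n" for i j
    proof -
      have "(i, j) \<in> ?I" using that by simp
      then have "word_bits W (fixed_in n b w P (fst (i, j)) (snd (i, j))) \<subseteq> ?A" by (rule UN_upper)
      then show ?thesis by (simp only: fst_conv snd_conv) (rule le_supI1, rule le_supI2)
    qed
    have "1 \<le> V" using b by (simp add: V_def)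
    from computes_newton[OF mm n(1) nV this W_def A]
    have "computes (?S1 \<union> ?A) (16 * b * (2 * matmul_cost C d \<tau> n W + n * n * (20 * (W * W))))
      (\<Union>z\<in>?I. word_bits V (newton_int n P (4 * b) (fixed_in n b w P) (16 * b) (fst z) (snd z)))" .
    moreover have "newton_int n P (4 * b) (fixed_in n b w P) (16 * b) i j = inv_digits n b w i j" for i j
      by (rule ext) (simp only: inv_digits_def P_def)
    ultimately show ?thesis by (simp only:)
  qed
  let ?S3 = "(?S1 \<union> ?A) \<union> ?D"
  have 4: "computes ?S3 (13 * (T * T)) (word_bits w' ?E)"
  proof (rule computes_diff[OF computes.free[of _ _ 0] computes.free[of _ _ 0]])
    show "word_bits w' (\<lambda>bs. 2 ^ (w' - 1) + 2 ^ (w - 1) - int P) \<subseteq> ?S3 \<union> consts_bool"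
      using word_bits_const by blast
    show "word_bits w' (top_exp 0 n b w) \<subseteq> ?S3 \<union> consts_bool"
      using word_bits_bounded[of "top_exp 0 n b w" w w', OF top_exp_bounds] by blast
    show "0 + 0 + (w' * (7 * w') + 6 * w') \<le> 13 * (T * T)" using word_cost[of w'] sqT[OF le(6) le(6)] by linarith
  qed
  let ?Y = "\<lambda>e. inv_digits n b w (e div n) (e mod n)"
  have YD: "word_bits V (?Y e) \<subseteq> ?S3 \<union> consts_bool" if "e < n * n" for e
  proof -
    have "(e div n, e mod n) \<in> ?I" using div_less_of_less_square[OF that] by simp
    then have "word_bits V (inv_digits n b w (fst (e div n, e mod n)) (snd (e div n, e mod n))) \<subseteq> ?D" by (rule UN_upper)
    then show ?thesis by (simp only: fst_conv snd_conv) (rule le_supI1, rule le_supI2)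
  qed
  have Ys: "(\<lambda>bs. bit (?Y e bs) (V - 1)) \<in> ?S3 \<union> consts_bool" if "e < n * n" for e
  proof (rule subsetD[OF YD[OF that]])
    have "V - 1 < V" using b by (simp add: V_def)
    then show "(\<lambda>bs. bit (?Y e bs) (V - 1)) \<in> word_bits V (?Y e)" by (rule mem_word_bits)
  qed
  have 5: "computes ?S3 (n * n * (27 * (T * T))) (\<Union>e<n * n. word_bits V (\<lambda>bs. if bit (?Y e bs) (V - 1) then - ?Y e bs else ?Y e bs))"
  proof (rule computes_UN_bound)
    fix e assume "e \<in> {..<n * n}"
    then have e: "e < n * n" by simp
    show "computes ?S3 (27 * (T * T)) (word_bits V (\<lambda>bs. if bit (?Y e bs) (V - 1) then - ?Y e bs else ?Y e bs))"
      by (rule computes_mono[OF computes_signed[OF Ys[OF e] YD[OF e]]]) (use sqT[OF le(5) le(5)] in auto)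
  qed simp_all
  let ?O = "\<Union>e<n * n. {\<lambda>bs. bit (?Y e bs) (V - 1)} \<union>
      word_bits V (\<lambda>bs. if bit (?Y e bs) (V - 1) then - ?Y e bs else ?Y e bs) \<union> word_bits w' ?E"
  define mc where "mc = matmul_cost C d \<tau> n T"
  have C: "C \<ge> 0" using mm by (simp add: matmul_circuits_def)
  define c where "c = n * n * (35 * (T * T)) + (n * n * (13 * (T * T) + T * (20 * (T * T)) + 27 * (T * T)) +
     (16 * b * (2 * matmul_cost C d \<tau> n W + n * n * (20 * (W * W))) + (13 * (T * T) + n * n * (27 * (T * T)))))"
  have 45: "computes ?S3 (13 * (T * T) + n * n * (27 * (T * T))) ?O"
  proof (rule computes_mono[OF computes_Un[OF 4 5]])
    show "?O \<subseteq> (word_bits w' ?E \<union> (\<Union>e<n * n. word_bits V (\<lambda>bs. if bit (?Y e bs) (V - 1) then - ?Y e bs else ?Y e bs))) \<union> ?S3 \<union> consts_bool"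
    proof (rule UN_least)
      fix e assume e: "e \<in> {..<n * n}"
      have "word_bits V (\<lambda>bs. if bit (?Y e bs) (V - 1) then - ?Y e bs else ?Y e bs) \<subseteq> (\<Union>e<n * n. word_bits V (\<lambda>bs. if bit (?Y e bs) (V - 1) then - ?Y e bs else ?Y e bs))"
        using e by (rule UN_upper)
      moreover have "(\<lambda>bs. bit (?Y e bs) (V - 1)) \<in> ?S3 \<union> consts_bool" using Ys e by simp
      ultimately show "{\<lambda>bs. bit (?Y e bs) (V - 1)} \<union> word_bits V (\<lambda>bs. if bit (?Y e bs) (V - 1) then - ?Y e bs else ?Y e bs) \<union> word_bits w' ?E
        \<subseteq> (word_bits w' ?E \<union> (\<Union>e<n * n. word_bits V (\<lambda>bs. if bit (?Y e bs) (V - 1) then - ?Y e bs else ?Y e bs))) \<union> ?S3 \<union> consts_bool"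
        by (simp only: Un_assoc) (intro Un_least; simp add: le_supI1 le_supI2)
    qed
  qed simp_all
  have comp: "computes ?S0 c ?O"
    unfolding c_def by (rule computes_trans[OF 1 computes_trans[OF 2 computes_trans[OF 3 45]]])
  have "c + 2 + n * n * (1 + V + w') \<le> T * (2 * mc) + n * n * (200 * (T * (T * T)))"
  proof -
    define m t where "m = n * n" and "t = T * (T * T)"
    have m1: "1 \<le> m" using n(1) by (simp add: m_def)
    have t: "T * T \<le> t" "T \<le> t" "1 \<le> t"
      using le(9) mult_le_mono[OF le(9) order_refl[of "T * T"]] by (auto simp: t_def)
    have mt: "m * x \<le> m * t" if "x \<le> t" for x using that by (rule mult_le_mono2)
    have tm: "t \<le> m * t" using m1 by simp
    have "16 * b * (2 * matmul_cost C d \<tau> n W + m * (20 * (W * W))) \<le> T * (2 * mc + m * (20 * (T * T)))"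
      unfolding mc_def by (intro mult_le_mono add_mono le matmul_cost_mono[OF C le(4)] order_refl)
    also have "\<dots> = T * (2 * mc) + 20 * (m * t)" by (simp add: t_def algebra_simps)
    finally have k: "16 * b * (2 * matmul_cost C d \<tau> n W + m * (20 * (W * W))) \<le> T * (2 * mc) + 20 * (m * t)" .
    have "c = 35 * (m * (T * T)) + (13 * (m * (T * T)) + 20 * (m * t) + 27 * (m * (T * T)) +
        (16 * b * (2 * matmul_cost C d \<tau> n W + m * (20 * (W * W))) + (13 * (T * T) + 27 * (m * (T * T)))))"
      unfolding c_def m_def[symmetric] by (simp only: t_def distrib_left mult.left_commute)
    moreover have "m * (1 + V + w') \<le> m * t" using mt[of "1 + V + w'"] le(8) t(2) by linarith
    moreover have "2 \<le> 2 * (m * t)" using tm t(3) by linarith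
    moreover have "m * (200 * t) = 200 * (m * t)" by simp
    ultimately show ?thesis
      using k mt[OF t(1)] t(1) tm unfolding m_def[symmetric] t_def[symmetric] by linarith
  qed
  with comp show ?thesis unfolding mc_def by blast
qed

lemma mat_norm_unscale:
  assumes s: "s > 0" and A: "A = s \<cdot>\<^sub>m a" and a: "a \<in> carrier_mat n n" and X: "X \<in> carrier_mat n n" and inv: "is_inverse A X"
  shows "is_inverse a (s \<cdot>\<^sub>m X)"
proof -
  have "A * X = 1\<^sub>m n" "X * A = 1\<^sub>m n" using inv a X by (auto simp: A is_inverse_def inverts_mat_def)
  then have "a * (s \<cdot>\<^sub>m X) = 1\<^sub>m n" "(s \<cdot>\<^sub>m X) * a = 1\<^sub>m n"
    unfolding A using mult_smult_distrib[OF a X] mult_smult_assoc_mat[OF a X] mult_smult_distrib[OF X a] mult_smult_assoc_mat[OF X a]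
    by simp_all
  then show ?thesis using a X by (simp add: is_inverse_def inverts_mat_def)
qed

text \<open>If the input is s a, then s X inverts a, and both sides of the error bound scale like
  1/s. So the scaled problem suffices, and the output exponent undoes the power of two s together
  with the denominator 2^(49 b).\<close>

lemma inversion_circuit:
  assumes mm: "matmul_circuits TYPE(bool list) C d \<tau>" and n: "n \<ge> 1" "n \<le> 2 ^ b" and b: "b \<ge> 1" and w: "w \<ge> 1"
    and T: "T = 2000 * ((b + w) * (b + w))"
  shows "\<exists>Q. outputs_matrix n Q \<and> bit_ops Q \<le> T * (2 * matmul_cost C d \<tau> n T) + n * n * (200 * (T * (T * T))) \<and>
    (\<forall>bs. length bs = float_mat_length n b w \<longrightarrow> (\<forall>X\<in>carrier_mat n n. is_inverse (float_mat n b w bs) X \<longrightarrow>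
       mat_norm (computed_mat n Q bs - X) \<le> (real n + 1) * roundoff b * mat_norm (float_mat n b w bs) * (mat_norm X)\<^sup>2))"
proof -
  define V P w' where "V = 56 * b" and "P = 49 * b" and "w' = w + 49 * b + 2"
  define N where "N = n * n * (1 + b + w)"
  let ?Y = "\<lambda>e. inv_digits n b w (e div n) (e mod n)"
  from inversion_circuit_ops[OF mm n b w T] obtain c where
    c: "c + 2 + n * n * (1 + V + w') \<le> T * (2 * matmul_cost C d \<tau> n T) + n * n * (200 * (T * (T * T)))" and
    comp: "computes (input_bits N) c (\<Union>e<n * n. {\<lambda>bs. bit (?Y e bs) (V - 1)} \<union>
      word_bits V (\<lambda>bs. if bit (?Y e bs) (V - 1) then - ?Y e bs else ?Y e bs) \<union>
      word_bits w' (\<lambda>bs. 2 ^ (w' - 1) + 2 ^ (w - 1) - int P - top_exp 0 n b w bs))"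
    unfolding V_def P_def w'_def N_def by (elim exE conjE)
  from encode_circuit[OF comp] obtain Q where Q: "outputs_matrix n Q" "bit_ops Q \<le> c + 2 + n * n * (1 + V + w')"
    and val: "\<And>bs. length bs = N \<Longrightarrow> computed_mat n Q bs = mat n n (\<lambda>(i, j). let e = i * n + j in
      (if bit (?Y e bs) (V - 1) then - 1 else 1) * of_int (take_bit V (if bit (?Y e bs) (V - 1) then - ?Y e bs else ?Y e bs)) *
      2 powi (take_bit w' (2 ^ (w' - 1) + 2 ^ (w - 1) - int P - top_exp 0 n b w bs) - 2 ^ (w' - 1)))"
    by (elim exE conjE) blast
  have "mat_norm (computed_mat n Q bs - X) \<le> (real n + 1) * roundoff b * mat_norm (float_mat n b w bs) * (mat_norm X)\<^sup>2"
    if len: "length bs = float_mat_length n b w" and X: "X \<in> carrier_mat n n" and inv: "is_inverse (float_mat n b w bs) X" for bs X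
  proof -
    define s :: real where "s = 2 powi (top_exp 0 n b w bs - 2 ^ (w - 1))"
    have s: "s > 0" by (simp add: s_def)
    define a where "a = scaled_in 0 n b w bs"
    have a: "a \<in> carrier_mat n n" by (simp add: a_def)
    have lenN: "length bs = N" using len by (simp add: float_mat_length_def N_def)
    have A: "float_mat n b w bs = s \<cdot>\<^sub>m a"
      using float_matrix_scaled[of 0 n b w bs] lenN by (simp add: float_mat_def s_def a_def N_def)
    define y where "y = mat n n (\<lambda>(i, j). of_int (low_digits (56 * b) (inv_digits n b w i j bs)) / 2 ^ (49 * b) :: real)"
    have y: "y \<in> carrier_mat n n" by (simp add: y_def)
    let ?Xs = "s \<cdot>\<^sub>m X"
    have Xs: "?Xs \<in> carrier_mat n n" using X by simp
    have err: "mat_norm (y - ?Xs) \<le> (real n + 1) * roundoff b * mat_norm a * (mat_norm ?Xs)\<^sup>2"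
      unfolding y_def a_def
      by (rule inversion_error[OF n(1) b n(2) Xs]) (use mat_norm_unscale[OF s A a X inv] in \<open>simp add: a_def\<close>)
    define t where "t = top_exp 0 n b w bs"
    have t: "0 \<le> t" "t < 2 ^ w" using top_exp_bounds[of 0 n b w bs] by (simp_all add: t_def)
    \<comment> \<open>No wrap-around in the exponent field: w' = w + 49 b + 2 bits have room for the
      bias, the offset P < 2^P and the w-bit exponent.\<close>
    have tb: "take_bit w' (2 ^ (w' - 1) + 2 ^ (w - 1) - int P - t) = 2 ^ (w' - 1) + 2 ^ (w - 1) - int P - t"
    proof (rule take_bit_int_eq_self)
      have w'1: "w' - 1 = w + P + 1" by (simp add: w'_def P_def)
      have "int P < 2 ^ P" by (rule of_nat_less_two_power)
      moreover have "(2 :: int) ^ P \<le> 2 ^ (w + P)" "(2 :: int) ^ w \<le> 2 ^ (w + P)" by (intro power_increasing; simp)+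
      moreover have "(2 :: int) ^ (w' - 1) = 2 * 2 ^ (w + P)" unfolding w'1 by simp
      ultimately show "0 \<le> 2 ^ (w' - 1) + 2 ^ (w - 1) - int P - t" using t zero_less_power[of "2 :: int" "w - 1"] by linarith
      have "(2 :: int) ^ (w - 1) \<le> 2 ^ (w' - 1)" by (intro power_increasing) (auto simp: w'_def)
      moreover have "(2 :: int) ^ w' = 2 * 2 ^ (w' - 1)" by (simp add: w'_def)
      moreover have "0 < int P" using b by (simp add: P_def)
      ultimately show "2 ^ (w' - 1) + 2 ^ (w - 1) - int P - t < 2 ^ w'" using t by linarith
    qed
    have pw: "(2 :: real) powi (take_bit w' (2 ^ (w' - 1) + 2 ^ (w - 1) - int P - t) - 2 ^ (w' - 1)) = (1 / s) * (1 / 2 ^ P)"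
    proof -
      have "take_bit w' (2 ^ (w' - 1) + 2 ^ (w - 1) - int P - t) - 2 ^ (w' - 1) = - (t - 2 ^ (w - 1)) + - int P"
        unfolding tb by simp
      then have "(2 :: real) powi (take_bit w' (2 ^ (w' - 1) + 2 ^ (w - 1) - int P - t) - 2 ^ (w' - 1)) = 2 powi (- (t - 2 ^ (w - 1))) * 2 powi (- int P)"
        by (simp only:) (rule power_int_add, simp)
      then show ?thesis by (simp only: power_int_minus power_int_of_nat s_def t_def inverse_eq_divide)
    qed
    have "computed_mat n Q bs = (1 / s) \<cdot>\<^sub>m y"
      unfolding val[OF lenN]
    proof (rule eq_matI)
      fix i j assume "i < dim_row ((1 / s) \<cdot>\<^sub>m y)" "j < dim_col ((1 / s) \<cdot>\<^sub>m y)"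
      then have ij: "i < n" "j < n" by (simp_all add: y_def)
      have dm: "(i * n + j) div n = i" "(i * n + j) mod n = j" using ij by simp_all
      have "of_int (low_digits V (inv_digits n b w i j bs)) = (if bit (inv_digits n b w i j bs) (V - 1) then - 1 else 1) *
          (of_int (take_bit V (if bit (inv_digits n b w i j bs) (V - 1) then - inv_digits n b w i j bs else inv_digits n b w i j bs)) :: real)"
        by (simp add: low_digits_def)
      then show "mat n n (\<lambda>(i, j). let e = i * n + j in
          (if bit (?Y e bs) (V - 1) then - 1 else 1) * of_int (take_bit V (if bit (?Y e bs) (V - 1) then - ?Y e bs else ?Y e bs)) *
          2 powi (take_bit w' (2 ^ (w' - 1) + 2 ^ (w - 1) - int P - top_exp 0 n b w bs) - 2 ^ (w' - 1))) $$ (i, j) = ((1 / s) \<cdot>\<^sub>m y) $$ (i, j)"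
        using ij pw[unfolded t_def] by (simp only: index_mat prod.case Let_def dm index_smult_mat dim_row_mat dim_col_mat y_def V_def[symmetric] P_def[symmetric])
          (simp add: mult.commute)
    qed (simp_all add: y_def)
    moreover have "X = (1 / s) \<cdot>\<^sub>m ?Xs" using s X by (intro eq_matI) auto
    ultimately have "computed_mat n Q bs - X = (1 / s) \<cdot>\<^sub>m (y - ?Xs)"
      using carrier_matD[OF y] carrier_matD[OF X] s by (intro eq_matI) (simp_all add: right_diff_distrib)
    then have "mat_norm (computed_mat n Q bs - X) = (1 / s) * mat_norm (y - ?Xs)"
      using mat_norm_smult[OF minus_carrier_mat[OF Xs], of "1 / s" y] s by simp
    also have "\<dots> \<le> (1 / s) * ((real n + 1) * roundoff b * mat_norm a * (mat_norm ?Xs)\<^sup>2)"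
      using err s by (intro mult_left_mono) auto
    also have "mat_norm ?Xs = s * mat_norm X" using mat_norm_smult[OF X, of s] s by simp
    also have "(1 / s) * ((real n + 1) * roundoff b * mat_norm a * (s * mat_norm X)\<^sup>2) = (real n + 1) * roundoff b * (s * mat_norm a) * (mat_norm X)\<^sup>2"
      using s by (simp add: power2_eq_square)
    also have "s * mat_norm a = mat_norm (float_mat n b w bs)" using mat_norm_smult[OF a, of s] s by (simp add: A)
    finally show ?thesis .
  qed
  with Q c show ?thesis by (intro exI[of _ Q]) auto
qed



lemma mat_norm_inverse_ge:
  assumes "n \<ge> 1" "A \<in> carrier_mat n n" "X \<in> carrier_mat n n" "is_inverse A X"
  shows "1 \<le> mat_norm A * mat_norm X"
proof -
  have "A * X = 1\<^sub>m n" using assms by (auto simp: is_inverse_def inverts_mat_def)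
  then show ?thesis using mat_norm_mult[OF assms(2,3)] mat_norm_one_ge[OF assms(1)] by simp
qed

lemma mat_norm_zero_le: "mat_norm (0\<^sub>m n n) \<le> 0"
  using mat_norm_entries[of "0\<^sub>m n n" n 0] by simp

text \<open>The output format has neither significand nor exponent bits, so each entry is a single
  sign bit with value 0.\<close>

lemma zero_circuit:
  "\<exists>Q. outputs_matrix n Q \<and> bit_ops Q \<le> 2 + n * n \<and> (\<forall>bs. length bs = N \<longrightarrow> computed_mat n Q bs = 0\<^sub>m n n)"
proof -
  have "computes (input_bits N) 0 (\<Union>e<n * n. {\<lambda>bs. False} \<union> word_bits 0 (\<lambda>bs. 0) \<union> word_bits 0 (\<lambda>bs. 0))"
    by (rule computes.free) (auto simp: consts_bool_def word_bits_def)
  from encode_circuit[OF this] obtain Q where Q: "outputs_matrix n Q" "bit_ops Q \<le> 0 + 2 + n * n * (1 + 0 + 0)"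
    and val: "\<And>bs. length bs = N \<Longrightarrow> computed_mat n Q bs = mat n n (\<lambda>(i, j). let e = i * n + j in
      (if False then - 1 else 1) * of_int (take_bit 0 0) * 2 powi (take_bit 0 0 - 2 ^ (0 - 1)))" by (elim exE conjE) blast
  have "computed_mat n Q bs = 0\<^sub>m n n" if "length bs = N" for bs
    unfolding val[OF that] by (rule eq_matI) (simp_all add: Let_def)
  with Q show ?thesis by (intro exI[of _ Q]) simp
qed

text \<open>For n > 2^b the factor n times the roundoff is at least 1. As the condition number is at
  least 1 too, the zero matrix satisfies the bound.\<close>

lemma inversion_circuit_all:
  assumes mm: "matmul_circuits TYPE(bool list) C d \<tau>" and n: "n \<ge> 1" and b: "b \<ge> 1" and w: "w \<ge> 1"
    and T: "T = 2000 * ((b + w) * (b + w))"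
  shows "\<exists>Q. outputs_matrix n Q \<and> bit_ops Q \<le> T * (2 * matmul_cost C d \<tau> n T) + n * n * (200 * (T * (T * T))) \<and>
    (\<forall>bs. length bs = float_mat_length n b w \<longrightarrow> (\<forall>X\<in>carrier_mat n n. is_inverse (float_mat n b w bs) X \<longrightarrow>
       mat_norm (computed_mat n Q bs - X) \<le> (real n + 1) * roundoff b * mat_norm (float_mat n b w bs) * (mat_norm X)\<^sup>2))"
proof (cases "n \<le> 2 ^ b")
  case True
  then show ?thesis by (rule inversion_circuit[OF mm n _ b w T])
next
  case False
  obtain Q where Q: "outputs_matrix n Q" "bit_ops Q \<le> 2 + n * n"
    and val: "\<And>bs. length bs = float_mat_length n b w \<Longrightarrow> computed_mat n Q bs = 0\<^sub>m n n"
    using zero_circuit[of n "float_mat_length n b w"] by blast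
  have T1: "1 \<le> T" using b by (simp add: T)
  have "1 \<le> T * (T * T)" "1 \<le> n * n" using T1 n by auto
  then have "2 + n * n \<le> n * n * (200 * (T * (T * T)))"
  proof -
    have "n * n * 200 \<le> n * n * (200 * (T * (T * T)))" using \<open>1 \<le> T * (T * T)\<close> by (intro mult_le_mono2) simp
    with \<open>1 \<le> n * n\<close> show ?thesis by linarith
  qed
  then have ops: "bit_ops Q \<le> T * (2 * matmul_cost C d \<tau> n T) + n * n * (200 * (T * (T * T)))" using Q(2) by linarith
  have "mat_norm (computed_mat n Q bs - X) \<le> (real n + 1) * roundoff b * mat_norm (float_mat n b w bs) * (mat_norm X)\<^sup>2"
    if len: "length bs = float_mat_length n b w" and X: "X \<in> carrier_mat n n" and inv: "is_inverse (float_mat n b w bs) X" for bs X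
  proof -
    have A: "float_mat n b w bs \<in> carrier_mat n n" by (simp add: float_mat_def)
    let ?\<kappa> = "mat_norm (float_mat n b w bs) * mat_norm X"
    have \<kappa>: "1 \<le> ?\<kappa>" by (rule mat_norm_inverse_ge[OF n A X inv])
    have "real (2 ^ b) \<le> real n" using False by (intro of_nat_mono) simp
    then have "1 \<le> real n * roundoff b" by (simp add: roundoff_def power_one_over field_simps)
    moreover have "0 \<le> roundoff b" by (simp add: roundoff_def)
    ultimately have c: "1 \<le> (real n + 1) * roundoff b" by (simp add: distrib_right)
    have X0: "0 \<le> mat_norm X" by (rule mat_norm_nonneg[OF X])
    have "mat_norm (0\<^sub>m n n - X) \<le> mat_norm (0\<^sub>m n n) + mat_norm X" by (rule mat_norm_minus[OF zero_carrier_mat X])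
    also have "\<dots> \<le> 1 * (1 * mat_norm X)" using mat_norm_zero_le[of n] by simp
    also have "\<dots> \<le> ((real n + 1) * roundoff b) * (?\<kappa> * mat_norm X)"
      using c \<kappa> X0 by (intro mult_mono) auto
    also have "\<dots> = (real n + 1) * roundoff b * mat_norm (float_mat n b w bs) * (mat_norm X)\<^sup>2"
      by (simp only: power2_eq_square mult_ac)
    finally show ?thesis by (simp only: val[OF len])
  qed
  with Q ops show ?thesis by (intro exI[of _ Q]) auto
qed

section \<open>The family of inversion circuits\<close>

lemma poly_bounded_zero: "poly_bounded (\<lambda>n. 0)"
  by (simp add: poly_bounded_def)

theorem exact_multiplication_stable_inversion:
  assumes mult: "\<forall>\<eta>>0. exact_multiplication_in (\<omega> + \<eta>)" and "\<eta> > 0"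
  shows "stable_inversion_in (\<omega> + \<eta>)"
proof -
  define \<tau> where "\<tau> = \<omega> + \<eta>"
  have "2 \<le> \<tau>" unfolding \<tau>_def by (rule exact_multiplication_exponent) (use assms in blast)
  obtain C d where mm: "matmul_circuits TYPE(bool list) C d \<tau>"
    using matmul_circuits_exist[OF assms] unfolding \<tau>_def by blast
  have C: "C \<ge> 0" using mm by (simp add: matmul_circuits_def)
  define T where "T b w = 2000 * ((b + w) * (b + w))" for b w :: nat
  define good where "good n b w Q \<longleftrightarrow> outputs_matrix n Q \<and>
    bit_ops Q \<le> T b w * (2 * matmul_cost C d \<tau> n (T b w)) + n * n * (200 * (T b w * (T b w * T b w))) \<and>
    (\<forall>bs. length bs = float_mat_length n b w \<longrightarrow> (\<forall>X\<in>carrier_mat n n. is_inverse (float_mat n b w bs) X \<longrightarrow>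
       mat_norm (computed_mat n Q bs - X) \<le> (real n + 1) * roundoff b * mat_norm (float_mat n b w bs) * (mat_norm X)\<^sup>2))"
    for n b w Q
  define P where "P n b w = (SOME Q. good n b w Q)" for n b w
  have P: "good n b w (P n b w)" if "n \<ge> 1" "b \<ge> 1" "w \<ge> 1" for n b w
  proof -
    have "\<exists>Q. good n b w Q" unfolding good_def by (rule inversion_circuit_all[OF mm that T_def])
    then show ?thesis unfolding P_def by (rule someI_ex)
  qed
  have "stable_inversion P"
    unfolding stable_inversion_def
  proof (intro exI conjI allI impI)
    have "(\<lambda>n. real n + 1) \<in> O(\<lambda>n. real n ^ 1)"
      by (rule bigoI[of _ 2]) (use eventually_ge_at_top[of "1 :: nat"] in \<open>auto elim!: eventually_mono\<close>)
    then show "poly_bounded (\<lambda>n. real n + 1)" unfolding poly_bounded_def by blast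
    show "poly_bounded (\<lambda>n. 0)" by (rule poly_bounded_zero)
    fix n b w :: nat assume nbw: "1 \<le> n" "1 \<le> b" "1 \<le> w"
    note g = P[OF nbw, unfolded good_def]
    show "outputs_matrix n (P n b w)" using g by blast
    fix as :: "bool list" assume len: "length as = float_mat_length n b w"
    show "let A = float_mat n b w as; \<epsilon> = roundoff b in \<forall>X\<in>carrier_mat n n. is_inverse A X \<longrightarrow>
        (let \<kappa> = mat_norm A * mat_norm X in mat_norm (computed_mat n (P n b w) as - X) / mat_norm X
           \<le> (real n + 1) * \<epsilon> * \<kappa> + 0 * \<epsilon>\<^sup>2)"
      unfolding Let_def
    proof (intro ballI impI)
      fix X assume X: "X \<in> carrier_mat n n" and inv: "is_inverse (float_mat n b w as) X"
      have A: "float_mat n b w as \<in> carrier_mat n n" by (simp add: float_mat_def)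
      have "mat_norm X \<noteq> 0" using mat_norm_inverse_ge[OF nbw(1) A X inv] by auto
      then have X0: "0 < mat_norm X" using mat_norm_nonneg[OF X] by simp
      have "mat_norm (computed_mat n (P n b w) as - X) \<le> (real n + 1) * roundoff b * mat_norm (float_mat n b w as) * (mat_norm X)\<^sup>2"
        using g len X inv by blast
      then show "mat_norm (computed_mat n (P n b w) as - X) / mat_norm X
         \<le> (real n + 1) * roundoff b * (mat_norm (float_mat n b w as) * mat_norm X) + 0 * (roundoff b)\<^sup>2"
        using X0 by (simp add: pos_divide_le_eq power2_eq_square mult_ac)
    qed
  qed
  moreover have "bit_complexity P \<tau>"
    unfolding bit_complexity_def
  proof (intro exI allI impI)
    fix n b w :: nat assume nbw: "1 \<le> n" "1 \<le> b" "1 \<le> w"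
    define t where "t = real (T b w)"
    define p where "p = real n powr \<tau>"
    have "1 \<le> T b w" using nbw by (simp add: T_def)
    then have t: "1 \<le> t" by (simp add: t_def)
    have np: "real (n * n) \<le> p"
    proof -
      have "real n powr 2 \<le> p" unfolding p_def using nbw \<open>2 \<le> \<tau>\<close> by (intro powr_mono) auto
      then show ?thesis using nbw by (simp add: power2_eq_square)
    qed
    have p0: "0 \<le> p" by (simp add: p_def)
    have "real (matmul_cost C d \<tau> n (T b w)) \<le> C * p * t ^ d"
      unfolding matmul_cost_def p_def t_def using C by (intro of_nat_floor) auto
    then have "t * (2 * real (matmul_cost C d \<tau> n (T b w))) \<le> t * (2 * (C * p * t ^ d))"
      using t by (intro mult_left_mono) auto
    also have "\<dots> = 2 * C * p * t ^ (d + 1)" by (simp add: mult_ac)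
    also have "\<dots> \<le> 2 * C * p * t ^ (d + 3)"
      using t C p0 by (intro mult_left_mono power_increasing mult_nonneg_nonneg) auto
    finally have 1: "t * (2 * real (matmul_cost C d \<tau> n (T b w))) \<le> 2 * C * p * t ^ (d + 3)" .
    have "real (n * n) * (200 * (t * (t * t))) \<le> p * (200 * t ^ (d + 3))"
    proof (rule mult_mono[OF np])
      have "t ^ 3 \<le> t ^ (d + 3)" using t by (intro power_increasing) auto
      then show "200 * (t * (t * t)) \<le> 200 * t ^ (d + 3)" by (simp add: power3_eq_cube mult_ac)
    qed (use t p0 in auto)
    moreover have "real (bit_ops (P n b w)) \<le> t * (2 * real (matmul_cost C d \<tau> n (T b w))) + real (n * n) * (200 * (t * (t * t)))"
    proof -
      have "real (bit_ops (P n b w)) \<le> real (T b w * (2 * matmul_cost C d \<tau> n (T b w)) + n * n * (200 * (T b w * (T b w * T b w))))"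
        using P[OF nbw, unfolded good_def] by (simp only: of_nat_le_iff)
      then show ?thesis by (simp add: t_def)
    qed
    ultimately have "real (bit_ops (P n b w)) \<le> 2 * C * p * t ^ (d + 3) + p * (200 * t ^ (d + 3))" using 1 by linarith
    also have "\<dots> = (2 * C + 200) * p * t ^ (d + 3)" by (simp add: algebra_simps)
    also have "t ^ (d + 3) = 2000 ^ (d + 3) * real (b + w) ^ (2 * (d + 3))"
    proof -
      have "t = 2000 * real (b + w) ^ 2" by (simp add: t_def T_def power2_eq_square)
      then show ?thesis by (simp only: power_mult_distrib power_mult)
    qed
    also have "(2 * C + 200) * p * (2000 ^ (d + 3) * real (b + w) ^ (2 * (d + 3))) =
        ((2 * C + 200) * 2000 ^ (d + 3)) * p * real (b + w) ^ (2 * (d + 3))" by (simp only: mult_ac)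
    finally show "real (bit_ops (P n b w)) \<le> ((2 * C + 200) * 2000 ^ (d + 3)) * real n powr \<tau> * real (b + w) ^ (2 * (d + 3))"
      by (simp only: p_def)
  qed
  ultimately show ?thesis unfolding stable_inversion_in_def \<tau>_def by blast
qed

section \<open>Stable multiplication\<close>

lemma float_value_append: "1 + b + w \<le> length ys \<Longrightarrow> float_value b w (ys @ zs) = float_value b w ys"
  by (auto simp: float_value_def nth_append)

lemma float_mat_append_scaled:
  assumes as: "length as = float_mat_length n b w" and bs: "length bs = float_mat_length n b w"
  defines "L \<equiv> n * n * (1 + b + w)"
  shows "float_mat n b w as = 2 powi (top_exp 0 n b w (as @ bs) - 2 ^ (w - 1)) \<cdot>\<^sub>m scaled_in 0 n b w (as @ bs)"
    and "float_mat n b w bs = 2 powi (top_exp L n b w (as @ bs) - 2 ^ (w - 1)) \<cdot>\<^sub>m scaled_in L n b w (as @ bs)"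
proof -
  have len: "length as = L" "length bs = L" using as bs by (simp_all add: float_mat_length_def L_def)
  have "float_mat n b w as = mat n n (\<lambda>(i, j). float_value b w (drop (0 + (i * n + j) * (1 + b + w)) (as @ bs)))"
    unfolding float_mat_def
  proof (rule cong_mat[OF refl refl])
    fix i j assume "i < n" "j < n"
    then have "(i * n + j) * (1 + b + w) + (1 + b + w) \<le> L"
      unfolding L_def by (intro chunk_bound row_major_less)
    then show "(\<lambda>(i, j). float_value b w (drop ((i * n + j) * (1 + b + w)) as)) (i, j) =
        (\<lambda>(i, j). float_value b w (drop (0 + (i * n + j) * (1 + b + w)) (as @ bs))) (i, j)"
      using len float_value_append[of b w "drop ((i * n + j) * (1 + b + w)) as" bs] by simp
  qed
  also have "\<dots> = 2 powi (top_exp 0 n b w (as @ bs) - 2 ^ (w - 1)) \<cdot>\<^sub>m scaled_in 0 n b w (as @ bs)"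
    by (rule float_matrix_scaled) (use len in \<open>simp add: L_def\<close>)
  finally show "float_mat n b w as = 2 powi (top_exp 0 n b w (as @ bs) - 2 ^ (w - 1)) \<cdot>\<^sub>m scaled_in 0 n b w (as @ bs)" .
  have "float_mat n b w bs = mat n n (\<lambda>(i, j). float_value b w (drop (L + (i * n + j) * (1 + b + w)) (as @ bs)))"
    unfolding float_mat_def using len by simp
  also have "\<dots> = 2 powi (top_exp L n b w (as @ bs) - 2 ^ (w - 1)) \<cdot>\<^sub>m scaled_in L n b w (as @ bs)"
    by (rule float_matrix_scaled) (use len in \<open>simp add: L_def\<close>)
  finally show "float_mat n b w bs = 2 powi (top_exp L n b w (as @ bs) - 2 ^ (w - 1)) \<cdot>\<^sub>m scaled_in L n b w (as @ bs)" .
qed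

text \<open>One selection serves signs, significands and exponents of the block matrix alike: f and
  g supply the entries of A and B, and h the constant entries, told apart by being on the diagonal
  or not.\<close>

definition block_select :: "nat \<Rightarrow> (nat \<Rightarrow> 'a) \<Rightarrow> (nat \<Rightarrow> 'a) \<Rightarrow> (bool \<Rightarrow> 'a) \<Rightarrow> nat \<Rightarrow> 'a" where
  "block_select n f g h e = (let i = e div (3 * n); j = e mod (3 * n) in
     if i < n \<and> n \<le> j \<and> j < 2 * n then f (i * n + (j - n))
     else if n \<le> i \<and> i < 2 * n \<and> 2 * n \<le> j then g ((i - n) * n + (j - 2 * n)) else h (i = j))"

lemma block_select_cases:
  assumes n: "n \<ge> 1" and "\<And>e. e < n * n \<Longrightarrow> P (f e)" "\<And>e. e < n * n \<Longrightarrow> P (g e)" "\<And>d. P (h d)"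
  shows "P (block_select n f g h e)"
proof -
  define i j where "i = e div (3 * n)" and "j = e mod (3 * n)"
  have j: "j < 3 * n" using n by (simp add: j_def)
  have "i * n + (j - n) < n * n" if "i < n" "j < 2 * n" "n \<le> j" using that by (intro row_major_less) auto
  moreover have "(i - n) * n + (j - 2 * n) < n * n" if "n \<le> i" "i < 2 * n" "2 * n \<le> j"
    using that j by (intro row_major_less) auto
  ultimately show ?thesis using assms(2-4) by (auto simp: block_select_def Let_def i_def[symmetric] j_def[symmetric])
qed

text \<open>An exponent field of w + 2 bits has bias 2^(w + 1), so this stores the plain difference
  of the two exponents. The difference may be positive at zero significands, but it always lies
  between -2^w and 2^w.\<close>

definition shifted_exp :: "nat \<Rightarrow> nat \<Rightarrow> nat \<Rightarrow> nat \<Rightarrow> nat \<Rightarrow> bool list \<Rightarrow> int" where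
  "shifted_exp off n b w e x = 2 ^ (w + 1) + exp_in off b w e x - top_exp off n b w x"

lemma shifted_exp_bounds: "0 \<le> shifted_exp off n b w e x" "shifted_exp off n b w e x < 2 ^ (w + 2)"
proof -
  have "(2 :: int) ^ (w + 1) = 2 * 2 ^ w" "(2 :: int) ^ (w + 2) = 4 * 2 ^ w" by simp_all
  then show "0 \<le> shifted_exp off n b w e x" "shifted_exp off n b w e x < 2 ^ (w + 2)"
    using exp_in_bounds[of off b w e x] top_exp_bounds[of off n b w x] unfolding shifted_exp_def by linarith+
qed

text \<open>
  The scaled matrices are obtained without arithmetic on the significands: \<open>shifted_exp\<close> only lowers the
  exponents by \<open>top_exp\<close>, the largest exponent of a nonzero entry.
\<close>

definition block_input :: "nat \<Rightarrow> nat \<Rightarrow> nat \<Rightarrow> (bool list \<Rightarrow> bool) list" where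
  "block_input n b w = (let L = n * n * (1 + b + w) in encode (3 * n * (3 * n)) (6 * b) (w + 2)
     (block_select n (sign_in 0 b w) (sign_in L b w) (\<lambda>_ _. False))
     (block_select n (mant_in 0 b w) (mant_in L b w) (\<lambda>d _. if d then 1 else 0))
     (block_select n (shifted_exp 0 n b w) (shifted_exp L n b w) (\<lambda>_ _. 2 ^ (w + 1))))"

lemma length_block_input: "length (block_input n b w) = float_mat_length (3 * n) (6 * b) (w + 2)"
  by (simp add: block_input_def Let_def length_encode float_mat_length_def)

text \<open>For the constant entries the exponent field equals the bias, so their value is the
  significand 1 or 0. Elsewhere nothing is truncated, since the fields of the larger format are wide
  enough.\<close>

lemma block_input_matrix:
  assumes n: "n \<ge> 1" and b: "b \<ge> 1"
  shows "float_mat (3 * n) (6 * b) (w + 2) (map (\<lambda>f. f x) (block_input n b w)) =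
    unit_block n (scaled_in 0 n b w x) (scaled_in (n * n * (1 + b + w)) n b w x)"
proof (rule eq_matI)
  define L where "L = n * n * (1 + b + w)"
  let ?s = "block_select n (sign_in 0 b w) (sign_in L b w) (\<lambda>_ _. False)"
  let ?M = "block_select n (mant_in 0 b w) (mant_in L b w) (\<lambda>d _. if d then 1 else 0)"
  let ?E = "block_select n (shifted_exp 0 n b w) (shifted_exp L n b w) (\<lambda>_ _. 2 ^ (w + 1))"
  fix i j assume "i < dim_row (unit_block n (scaled_in 0 n b w x) (scaled_in (n * n * (1 + b + w)) n b w x))"
    "j < dim_col (unit_block n (scaled_in 0 n b w x) (scaled_in (n * n * (1 + b + w)) n b w x))"
  then have ij: "i < 3 * n" "j < 3 * n" by (simp_all only: carrier_matD[OF block_carrier(2)])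
  define e where "e = i * (3 * n) + j"
  have e: "e < 3 * n * (3 * n)" unfolding e_def by (rule row_major_less[OF ij])
  have de: "e div (3 * n) = i" "e mod (3 * n) = j" using ij by (simp_all add: e_def)
  have M: "take_bit (6 * b) (?M e x) = ?M e x"
  proof (rule block_select_cases[where P = "\<lambda>m. take_bit (6 * b) (m x) = m x", OF n])
    have *: "(2 :: int) ^ b \<le> 2 ^ (6 * b)" by (intro power_increasing) auto
    show "take_bit (6 * b) (mant_in 0 b w e x) = mant_in 0 b w e x" for e
      using mant_in_bounds[of 0 b w e x] * by (intro take_bit_int_eq_self) linarith+
    show "take_bit (6 * b) (mant_in L b w e x) = mant_in L b w e x" for e
      using mant_in_bounds[of L b w e x] * by (intro take_bit_int_eq_self) linarith+
    have "(1 :: int) < 2 ^ (6 * b)" using b by simp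
    then show "take_bit (6 * b) (if d then 1 else 0 :: int) = (if d then 1 else 0)" for d
      by (intro take_bit_int_eq_self) auto
  qed
  have E: "take_bit (w + 2) (?E e x) = ?E e x"
  proof (rule block_select_cases[where P = "\<lambda>m. take_bit (w + 2) (m x) = m x", OF n])
    show "take_bit (w + 2) (shifted_exp 0 n b w e x) = shifted_exp 0 n b w e x" for e
      by (intro take_bit_int_eq_self shifted_exp_bounds)
    show "take_bit (w + 2) (shifted_exp L n b w e x) = shifted_exp L n b w e x" for e
      by (intro take_bit_int_eq_self shifted_exp_bounds)
    show "take_bit (w + 2) (2 ^ (w + 1)) = (2 ^ (w + 1) :: int)" by (intro take_bit_int_eq_self) auto
  qed
  have "float_mat (3 * n) (6 * b) (w + 2) (map (\<lambda>f. f x) (block_input n b w)) $$ (i, j) =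
      float_value (6 * b) (w + 2) (drop (e * (1 + 6 * b + (w + 2))) (map (\<lambda>f. f x) (encode (3 * n * (3 * n)) (6 * b) (w + 2) ?s ?M ?E)))"
    using ij by (simp only: float_mat_def index_mat prod.case e_def block_input_def Let_def L_def)
  also have "\<dots> = (if ?s e x then - 1 else 1) * of_int (?M e x) * 2 powi (?E e x - 2 ^ (w + 1))"
    unfolding encode_value[OF e] M E by simp
  also have "\<dots> = unit_block n (scaled_in 0 n b w x) (scaled_in L n b w x) $$ (i, j)"
  proof -
    consider "i < n \<and> n \<le> j \<and> j < 2 * n" | "n \<le> i \<and> i < 2 * n \<and> 2 * n \<le> j"
      | "\<not> (i < n \<and> n \<le> j \<and> j < 2 * n)" "\<not> (n \<le> i \<and> i < 2 * n \<and> 2 * n \<le> j)" by blast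
    then show ?thesis
    proof cases
      case 1
      then have "j - n < n" by linarith
      with 1 ij show ?thesis
        by (simp add: block_select_def Let_def de unit_block_def nil_block_def scaled_in_def shifted_exp_def)
    next
      case 2
      then have "i - n < n" "j - 2 * n < n" using ij by linarith+
      with 2 ij show ?thesis
        by (simp add: block_select_def Let_def de unit_block_def nil_block_def scaled_in_def shifted_exp_def)
    next
      case 3
      with ij show ?thesis
        by (auto simp: block_select_def Let_def de unit_block_def nil_block_def)
    qed
  qed
  finally show "float_mat (3 * n) (6 * b) (w + 2) (map (\<lambda>f. f x) (block_input n b w)) $$ (i, j) =
      unit_block n (scaled_in 0 n b w x) (scaled_in (n * n * (1 + b + w)) n b w x) $$ (i, j)" by (simp only: L_def)
qed (simp_all only: float_mat_def dim_row_mat dim_col_mat carrier_matD[OF block_carrier(2)])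

lemma block_input_bits:
  fixes n b w :: nat
  assumes n: "n \<ge> 1"
  defines "L \<equiv> n * n * (1 + b + w)"
  shows "set (block_input n b w) \<subseteq> (input_bits (2 * L) \<union> ((\<Union>e<n * n. word_bits (w + 2) (shifted_exp 0 n b w e)) \<union>
    (\<Union>e<n * n. word_bits (w + 2) (shifted_exp L n b w e)))) \<union> consts_bool" (is "_ \<subseteq> ?S")
proof -
  let ?s = "block_select n (sign_in 0 b w) (sign_in L b w) (\<lambda>_ _. False)"
  let ?M = "block_select n (mant_in 0 b w) (mant_in L b w) (\<lambda>d _. if d then 1 else 0)"
  let ?E = "block_select n (shifted_exp 0 n b w) (shifted_exp L n b w) (\<lambda>_ _. 2 ^ (w + 1))"
  have off: "0 + n * n * (1 + b + w) \<le> 2 * L" "L + n * n * (1 + b + w) \<le> 2 * L" by (simp_all add: L_def)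
  have iS: "input_bits (2 * L) \<subseteq> ?S" and cS: "consts_bool \<subseteq> ?S" by blast+
  have inS: "A \<subseteq> input_bits (2 * L) \<union> consts_bool \<Longrightarrow> A \<subseteq> ?S" for A by blast
  have s: "?s e \<in> ?S" for e
  proof (rule block_select_cases[where P = "\<lambda>f. f \<in> ?S", OF n])
    show "sign_in 0 b w e \<in> ?S" if "e < n * n" for e using subsetD[OF iS input_bits_in(1)[OF that off(1)]] .
    show "sign_in L b w e \<in> ?S" if "e < n * n" for e using subsetD[OF iS input_bits_in(1)[OF that off(2)]] .
    show "(\<lambda>_. False) \<in> ?S" by (rule subsetD[OF cS]) (simp add: consts_bool_def)
  qed
  have M: "word_bits (6 * b) (?M e) \<subseteq> ?S" for e
  proof (rule block_select_cases[where P = "\<lambda>m. word_bits (6 * b) m \<subseteq> ?S", OF n])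
    show "word_bits (6 * b) (mant_in 0 b w e) \<subseteq> ?S" if "e < n * n" for e by (rule inS[OF input_bits_in(2)[OF that off(1)]])
    show "word_bits (6 * b) (mant_in L b w e) \<subseteq> ?S" if "e < n * n" for e by (rule inS[OF input_bits_in(2)[OF that off(2)]])
    show "word_bits (6 * b) (\<lambda>_. if d then 1 else 0) \<subseteq> ?S" for d by (rule order_trans[OF word_bits_const cS])
  qed
  have E: "word_bits (w + 2) (?E e) \<subseteq> ?S" for e
  proof (rule block_select_cases[where P = "\<lambda>m. word_bits (w + 2) m \<subseteq> ?S", OF n])
    show "word_bits (w + 2) (shifted_exp 0 n b w e) \<subseteq> ?S" if "e < n * n" for e
    proof -
      have "e \<in> {..<n * n}" using that by simp
      then have "word_bits (w + 2) (shifted_exp 0 n b w e) \<subseteq> (\<Union>e<n * n. word_bits (w + 2) (shifted_exp 0 n b w e))" by (rule UN_upper)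
      then show ?thesis by (intro le_supI1 le_supI2)
    qed
    show "word_bits (w + 2) (shifted_exp L n b w e) \<subseteq> ?S" if "e < n * n" for e
    proof -
      have "e \<in> {..<n * n}" using that by simp
      then have "word_bits (w + 2) (shifted_exp L n b w e) \<subseteq> (\<Union>e<n * n. word_bits (w + 2) (shifted_exp L n b w e))" by (rule UN_upper)
      then show ?thesis by (rule le_supI1[OF le_supI2[OF le_supI2]])
    qed
    show "word_bits (w + 2) (\<lambda>_. 2 ^ (w + 1)) \<subseteq> ?S" by (rule order_trans[OF word_bits_const cS])
  qed
  have "(\<Union>e<3 * n * (3 * n). {?s e} \<union> word_bits (6 * b) (?M e) \<union> word_bits (w + 2) (?E e)) \<subseteq> ?S"
    by (intro UN_least Un_least M E) (use s in simp)
  then show ?thesis unfolding block_input_def Let_def L_def[symmetric] by (rule order_trans[OF set_encode])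
qed

text \<open>A vanishing factor must be detected: its scaled norm has no positive lower bound, so the
  absolute error of the corner could not be turned into a relative one, and the output has to be
  exactly zero.\<close>

definition nonzero_in :: "nat \<Rightarrow> nat \<Rightarrow> nat \<Rightarrow> nat \<Rightarrow> bool list \<Rightarrow> bool" where
  "nonzero_in off n b w x \<longleftrightarrow> (\<exists>e<n * n. mant_in off b w e x \<noteq> 0)"

lemma computes_nonzero_in:
  assumes "off + n * n * (1 + b + w) \<le> N"
  shows "computes (input_bits N) (n * n * (b + 1)) {nonzero_in off n b w}"
proof -
  let ?T = "\<lambda>k. {\<lambda>x. \<exists>e<k. mant_in off b w e x \<noteq> 0}"
  have "computes (input_bits N) (n * n * (b + 1)) (?T (n * n))"
  proof (rule computes_sequence[where T = ?T])
    fix k assume k: "k < n * n"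
    have 1: "computes (input_bits N \<union> ?T k) b {\<lambda>x. mant_in off b w k x \<noteq> 0}"
    proof (rule computes_mono)
      show "computes (word_bits b (mant_in off b w k)) b {\<lambda>x. mant_in off b w k x \<noteq> 0}"
        by (rule computes_nonzero) (rule mant_in_bounds)+
      show "word_bits b (mant_in off b w k) \<subseteq> (input_bits N \<union> ?T k) \<union> consts_bool"
        using input_bits_in(2)[OF k assms, of b] by blast
    qed auto
    have 2: "computes ((input_bits N \<union> ?T k) \<union> {\<lambda>x. mant_in off b w k x \<noteq> 0}) 1
        {\<lambda>x. (\<exists>e<k. mant_in off b w e x \<noteq> 0) \<or> mant_in off b w k x \<noteq> 0}"
      by (rule computes_gate1) auto
    have "(\<lambda>x. (\<exists>e<k. mant_in off b w e x \<noteq> 0) \<or> mant_in off b w k x \<noteq> 0) = (\<lambda>x. \<exists>e<Suc k. mant_in off b w e x \<noteq> 0)"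
      by (auto simp: less_Suc_eq)
    then show "computes (input_bits N \<union> ?T k) (b + 1) (?T (Suc k))"
      using computes_trans[OF 1 2] by (simp only:)
  qed (simp add: consts_bool_def)
  then show ?thesis by (simp add: nonzero_in_def[abs_def])
qed

lemma computes_shifted_exp:
  assumes off: "off + n * n * (1 + b + w) \<le> N" and T: "b + w + 2 \<le> T"
  shows "computes (input_bits N) (n * n * (54 * (T * T))) (word_bits w (top_exp off n b w) \<union> (\<Union>e<n * n. word_bits (w + 2) (shifted_exp off n b w e)))"
proof -
  let ?t = "word_bits w (top_exp off n b w)"
  have sq: "x * y \<le> T * T" if "x \<le> T" "y \<le> T" for x y using that by (rule mult_le_mono)
  have "(b + w + 1) * (b + w + 1) \<le> T * T" using T by (intro sq) auto
  then have "n * n * (35 * ((b + w + 1) * (b + w + 1))) \<le> n * n * (35 * (T * T))" by (intro mult_le_mono2)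
  then have 1: "computes (input_bits N) (n * n * (35 * (T * T))) ?t"
    by (intro computes_mono[OF computes_top_exp[OF off]]) auto
  have 2: "computes (input_bits N \<union> ?t) (n * n * (19 * (T * T))) (\<Union>e<n * n. word_bits (w + 2) (shifted_exp off n b w e))"
  proof (rule computes_UN_bound)
    fix e assume "e \<in> {..<n * n}"
    then have e: "e < n * n" by simp
    have a: "computes (input_bits N \<union> ?t) (6 * (w + 2)) (word_bits (w + 2) (\<lambda>x. 2 ^ (w + 1) + exp_in off b w e x))"
    proof (rule computes_add'[OF computes.free[of _ _ 0] computes.free[of _ _ 0]])
      show "word_bits (w + 2) (\<lambda>x. 2 ^ (w + 1)) \<subseteq> (input_bits N \<union> ?t) \<union> consts_bool" by (rule le_supI2[OF word_bits_const])
      show "word_bits (w + 2) (exp_in off b w e) \<subseteq> (input_bits N \<union> ?t) \<union> consts_bool"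
        using input_bits_in(3)[OF e off, of "w + 2"] by blast
    qed simp
    have "computes (input_bits N \<union> ?t) (19 * (T * T)) (word_bits (w + 2) (\<lambda>x. 2 ^ (w + 1) + exp_in off b w e x - top_exp off n b w x))"
    proof (rule computes_diff[OF a computes.free[of _ _ 0]])
      show "word_bits (w + 2) (top_exp off n b w) \<subseteq> (input_bits N \<union> ?t) \<union> consts_bool"
        using word_bits_bounded[of "top_exp off n b w" w "w + 2", OF top_exp_bounds] by blast
      have "(w + 2) * (w + 2) \<le> T * T" using T by (intro sq) auto
      moreover have "w + 2 \<le> T * T" using T le_square[of T] by linarith
      ultimately show "6 * (w + 2) + 0 + ((w + 2) * (7 * (w + 2)) + 6 * (w + 2)) \<le> 19 * (T * T)"
        using word_cost[of "w + 2"] by linarith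
    qed
    moreover have "(\<lambda>x. 2 ^ (w + 1) + exp_in off b w e x - top_exp off n b w x) = shifted_exp off n b w e"
      by (rule ext) (simp only: shifted_exp_def)
    ultimately show "computes (input_bits N \<union> ?t) (19 * (T * T)) (word_bits (w + 2) (shifted_exp off n b w e))" by (simp only:)
  qed simp_all
  have "computes (input_bits N \<union> ?t) (n * n * (19 * (T * T))) (?t \<union> (\<Union>e<n * n. word_bits (w + 2) (shifted_exp off n b w e)))"
    by (rule computes_mono[OF 2]) auto
  from computes_trans[OF 1 this] show ?thesis by (simp add: algebra_simps)
qed

text \<open>With u = n h the block matrix has norm at most 4 u and its inverse, a quadratic
  polynomial in the nilpotent part, at most 13 u^2. The first-order error therefore carries 4 * 13^2
  = 676 and u^5; the second-order term is dominated by the same quantity.\<close>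

lemma corner_error:
  assumes n: "n \<ge> 1" and A: "A \<in> carrier_mat n n" "\<And>i j. i < n \<Longrightarrow> j < n \<Longrightarrow> \<bar>A $$ (i, j)\<bar> \<le> h"
    and B: "B \<in> carrier_mat n n" "\<And>i j. i < n \<Longrightarrow> j < n \<Longrightarrow> \<bar>B $$ (i, j)\<bar> \<le> h" and h: "1 \<le> h"
    and Y: "Y \<in> carrier_mat (3 * n) (3 * n)" and mvr: "0 \<le> m" "0 \<le> v" "0 \<le> r"
    and err: "mat_norm (Y - unit_block_inv n A B) \<le>
      (m * mat_norm (unit_block n A B) * (mat_norm (unit_block_inv n A B))\<^sup>2 + v * mat_norm (unit_block_inv n A B)) * r"
    and ij: "i < n" "j < n"
  shows "\<bar>Y $$ (i, 2 * n + j) - (A * B) $$ (i, j)\<bar> \<le> 676 * real n ^ 5 * (m + v) * h ^ 5 * r"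
proof -
  define u where "u = real n * h"
  have u: "1 \<le> u" using mult_mono[of 1 "real n" 1 h] n h by (simp add: u_def)
  let ?N = "nil_block n A B"
  let ?X = "unit_block_inv n A B"
  have N: "mat_norm ?N \<le> 3 * u"
  proof -
    have "mat_norm ?N \<le> real (3 * n) * h"
    proof (rule mat_norm_entries)
      fix i j assume "i < 3 * n" "j < 3 * n"
      then show "\<bar>?N $$ (i, j)\<bar> \<le> h" using A B h by (auto simp: nil_block_def)
    qed (use h in auto)
    then show ?thesis by (simp add: u_def)
  qed
  have N0: "0 \<le> mat_norm ?N" by (rule mat_norm_nonneg[of _ "3 * n"]) simp
  have c: "?N \<in> carrier_mat (3 * n) (3 * n)" by simp
  have NN: "?N * ?N \<in> carrier_mat (3 * n) (3 * n)" by (rule mult_carrier_mat[OF c c])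
  have U: "mat_norm (unit_block n A B) \<le> 4 * u"
    using mat_norm_triangle[OF one_carrier_mat c] mat_norm_one_le[of "3 * n"] N u unfolding unit_block_def by linarith
  have "mat_norm ?X \<le> mat_norm (1\<^sub>m (3 * n) - ?N) + mat_norm (?N * ?N)"
    unfolding unit_block_inv_def by (rule mat_norm_triangle[OF minus_carrier_mat[OF c] NN])
  moreover have "mat_norm (1\<^sub>m (3 * n) - ?N) \<le> 1 + 3 * u"
    using mat_norm_minus[OF one_carrier_mat c] mat_norm_one_le[of "3 * n"] N by linarith
  moreover have "mat_norm (?N * ?N) \<le> 9 * u\<^sup>2"
  proof -
    have "mat_norm (?N * ?N) \<le> mat_norm ?N * mat_norm ?N" by (rule mat_norm_mult[OF c c])
    also have "\<dots> \<le> (3 * u) * (3 * u)" using N N0 by (intro mult_mono) auto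
    finally show ?thesis by (simp add: power2_eq_square)
  qed
  moreover have uu: "u \<le> u\<^sup>2" "1 \<le> u\<^sup>2" using u power_increasing[of 1 2 u] one_le_power[of u 2] by simp_all
  ultimately have X: "mat_norm ?X \<le> 13 * u\<^sup>2" by linarith
  have X0: "0 \<le> mat_norm ?X" by (rule mat_norm_nonneg[of _ "3 * n"]) simp
  have U0: "0 \<le> mat_norm (unit_block n A B)" by (rule mat_norm_nonneg[of _ "3 * n"]) simp
  have "m * mat_norm (unit_block n A B) * (mat_norm ?X)\<^sup>2 \<le> m * (4 * u) * (13 * u\<^sup>2)\<^sup>2"
    using U X U0 X0 mvr u by (intro mult_mono power_mono) auto
  also have "\<dots> = 676 * u ^ 5 * m" by (simp add: power_mult_distrib eval_nat_numeral)
  finally have 1: "m * mat_norm (unit_block n A B) * (mat_norm ?X)\<^sup>2 \<le> 676 * u ^ 5 * m" .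
  have "v * mat_norm ?X \<le> v * (676 * u ^ 5)"
  proof (rule mult_left_mono[OF order_trans[OF X] mvr(2)])
    have "u\<^sup>2 \<le> u ^ 5" using u by (intro power_increasing) auto
    then show "13 * u\<^sup>2 \<le> 676 * u ^ 5" using uu(2) by linarith
  qed
  with 1 have "m * mat_norm (unit_block n A B) * (mat_norm ?X)\<^sup>2 + v * mat_norm ?X \<le> 676 * u ^ 5 * (m + v)"
    by (simp add: algebra_simps)
  then have "(m * mat_norm (unit_block n A B) * (mat_norm ?X)\<^sup>2 + v * mat_norm ?X) * r \<le> 676 * u ^ 5 * (m + v) * r"
    using mvr(3) by (rule mult_right_mono)
  with err have E: "mat_norm (Y - ?X) \<le> 676 * u ^ 5 * (m + v) * r" by linarith
  have X': "?X \<in> carrier_mat (3 * n) (3 * n)" by simp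
  have ij': "i < 3 * n" "2 * n + j < 3 * n" using ij by auto
  have "\<bar>(Y - ?X) $$ (i, 2 * n + j)\<bar> \<le> mat_norm (Y - ?X)" by (rule entry_le_mat_norm[OF minus_carrier_mat[OF X'] ij'])
  moreover have "(Y - ?X) $$ (i, 2 * n + j) = Y $$ (i, 2 * n + j) - (A * B) $$ (i, j)"
    using ij' carrier_matD[OF X'] unit_block_inv_corner[OF A(1) B(1) ij] by simp
  ultimately show ?thesis using E by (simp add: u_def power_mult_distrib mult_ac)
qed

text \<open>
  The correction that undoes the scaling is added to the exponents of the output.  Only additions are
  used here, whose cost is linear in the length \<open>v\<close> of the exponents chosen by the inversion algorithm; \<open>v\<close> is not
  bounded in terms of \<open>b + w\<close>, but writing the output costs that algorithm at least \<open>v\<close> operations per entry.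
\<close>

definition product_exp :: "nat \<Rightarrow> nat \<Rightarrow> nat \<Rightarrow> nat \<Rightarrow> bool list \<Rightarrow> int" where
  "product_exp n b w v x = top_exp 0 n b w x + top_exp (n * n * (1 + b + w)) n b w x +
     (2 ^ (v + w + 2) - 2 ^ (v - 1) - 2 * 2 ^ (w - 1))"

text \<open>The inversion circuit is replayed on the block matrix, and the entries of its upper
  right block, numbered \<open>c e\<close>, are rewritten: the sign is kept, the significand is
  masked when a factor vanishes, and the exponent is corrected.\<close>

lemma multiplication_ops:
  fixes n b w :: nat
  assumes n: "n \<ge> 1" and b: "b \<ge> 1" and Q: "outputs_matrix (3 * n) Q" and T: "T = b + w + 2"
  defines "L \<equiv> n * n * (1 + b + w)" and "p \<equiv> out_prec Q" and "v \<equiv> out_exp Q"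
    and "y \<equiv> \<lambda>x. run_bits Q (map (\<lambda>f. f x) (block_input n b w))"
    and "c \<equiv> \<lambda>e. (e div n) * (3 * n) + (2 * n + e mod n)"
  shows "\<exists>d. d + 2 + n * n * (1 + p + (v + w + 3)) \<le> 20 * bit_ops Q + n * n * (200 * (T * T)) \<and>
    computes (input_bits (2 * L)) d (\<Union>e<n * n. {\<lambda>x. sign_in 0 p v (c e) (y x)} \<union>
      word_bits p (\<lambda>x. of_bool (nonzero_in 0 n b w x \<and> nonzero_in L n b w x) * mant_in 0 p v (c e) (y x)) \<union>
      word_bits (v + w + 3) (\<lambda>x. exp_in 0 p v (c e) (y x) + product_exp n b w v x))"
proof -
  define u where "u = v + w + 3"
  define len where "len = length (out_wires Q)"
  have len: "len = 3 * n * (3 * n) * (1 + p + v)"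
    using Q by (simp add: len_def outputs_matrix_def float_mat_length_def p_def v_def)
  have off: "0 + n * n * (1 + b + w) \<le> 2 * L" "L + n * n * (1 + b + w) \<le> 2 * L" by (simp_all add: L_def)
  have T': "b + w + 2 \<le> T" by (simp add: T)
  define S0 tA tB EA EB where "S0 = input_bits (2 * L)" and "tA = word_bits w (top_exp 0 n b w)" and "tB = word_bits w (top_exp L n b w)"
    and "EA = (\<Union>e<n * n. word_bits (w + 2) (shifted_exp 0 n b w e))" and "EB = (\<Union>e<n * n. word_bits (w + 2) (shifted_exp L n b w e))"
  define fA fB f where "fA = nonzero_in 0 n b w" and "fB = nonzero_in L n b w" and "f = (\<lambda>x. fA x \<and> fB x)"
  define F where "F = ((tA \<union> EA) \<union> (tB \<union> EB)) \<union> ({fA} \<union> {fB})"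
  have 1: "computes S0 ((n * n * (54 * (T * T)) + n * n * (54 * (T * T))) + (n * n * (b + 1) + n * n * (b + 1))) F"
    unfolding F_def S0_def
  proof (rule computes_Un[OF computes_Un computes_Un])
    show "computes (input_bits (2 * L)) (n * n * (54 * (T * T))) (tA \<union> EA)"
      unfolding tA_def EA_def by (rule computes_shifted_exp[OF off(1) T'])
    show "computes (input_bits (2 * L)) (n * n * (54 * (T * T))) (tB \<union> EB)"
      unfolding tB_def EB_def by (rule computes_shifted_exp[OF off(2) T'])
    show "computes (input_bits (2 * L)) (n * n * (b + 1)) {fA}"
      unfolding fA_def by (rule computes_nonzero_in[OF off(1)])
    show "computes (input_bits (2 * L)) (n * n * (b + 1)) {fB}"
      unfolding fB_def by (rule computes_nonzero_in[OF off(2)])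
  qed
  define S1 where "S1 = S0 \<union> F"
  have S1: "S0 \<subseteq> S1" "tA \<subseteq> S1" "tB \<subseteq> S1" "EA \<subseteq> S1" "EB \<subseteq> S1" "fA \<in> S1" "fB \<in> S1" by (auto simp: S1_def F_def)
  define R where "R = {\<lambda>x. y x ! i | i. i < len}"
  define G where "G = product_exp n b w v"
  have "set (block_input n b w) \<subseteq> (S0 \<union> (EA \<union> EB)) \<union> consts_bool"
    unfolding S0_def EA_def EB_def L_def by (rule block_input_bits[OF n])
  also have "\<dots> \<subseteq> S1 \<union> consts_bool" using S1 by blast
  finally have R: "computes S1 (length (gates Q)) R"
    unfolding R_def y_def len_def by (rule computes_run_bits)
  have G: "computes S1 (12 * u) (word_bits u G)"
  proof -
    have "computes S1 (6 * u) (word_bits u (\<lambda>x. top_exp 0 n b w x + top_exp L n b w x))"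
    proof (rule computes_add'[OF computes.free[of _ _ 0] computes.free[of _ _ 0]])
      show "word_bits u (top_exp 0 n b w) \<subseteq> S1 \<union> consts_bool"
        using word_bits_bounded[of "top_exp 0 n b w" w u, OF top_exp_bounds] S1(2) unfolding tA_def by blast
      show "word_bits u (top_exp L n b w) \<subseteq> S1 \<union> consts_bool"
        using word_bits_bounded[of "top_exp L n b w" w u, OF top_exp_bounds] S1(3) unfolding tB_def by blast
    qed simp
    then have "computes S1 (12 * u) (word_bits u (\<lambda>x. top_exp 0 n b w x + top_exp L n b w x + (2 ^ (v + w + 2) - 2 ^ (v - 1) - 2 * 2 ^ (w - 1))))"
    proof (rule computes_add'[OF _ computes.free[of _ _ 0]])
      show "word_bits u (\<lambda>_. 2 ^ (v + w + 2) - 2 ^ (v - 1) - 2 * 2 ^ (w - 1)) \<subseteq> S1 \<union> consts_bool"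
        by (rule le_supI2[OF word_bits_const])
    qed simp
    moreover have "G = (\<lambda>x. top_exp 0 n b w x + top_exp L n b w x + (2 ^ (v + w + 2) - 2 ^ (v - 1) - 2 * 2 ^ (w - 1)))"
      by (rule ext) (simp only: G_def product_exp_def L_def)
    ultimately show ?thesis by (simp only:)
  qed
  have f: "computes S1 1 {f}"
    unfolding f_def by (rule computes_gate1[of fA S1 fB "(\<and>)"]) (use S1 in auto)
  define H where "H = R \<union> (word_bits u G \<union> {f})"
  have 2: "computes S1 (length (gates Q) + (12 * u + 1)) H" unfolding H_def by (rule computes_Un[OF R computes_Un[OF G f]])
  define S2 where "S2 = S1 \<union> H"
  have S2: "R \<subseteq> S2" "word_bits u G \<subseteq> S2" "f \<in> S2" by (auto simp: S2_def H_def)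
  let ?M = "\<lambda>e x. mant_in 0 p v (c e) (y x)" and ?E = "\<lambda>e x. exp_in 0 p v (c e) (y x)"
  let ?O = "\<lambda>e. {\<lambda>x. sign_in 0 p v (c e) (y x)} \<union> word_bits p (\<lambda>x. of_bool (f x) * ?M e x) \<union> word_bits u (\<lambda>x. ?E e x + G x)"
  have wR: "(\<lambda>x. wire (y x) i) \<in> R" if "i < len" for i
  proof -
    have "(\<lambda>x. wire (y x) i) = (\<lambda>x. y x ! i)"
      using that by (simp add: wire_def y_def run_bits_def len_def)
    with that show ?thesis unfolding R_def by blast
  qed
  have fR: "word_bits W (\<lambda>x. bit_field d l (y x)) \<subseteq> R \<union> consts_bool" if "d + l \<le> len" for W d l
  proof (rule order_trans[OF word_bits_bit_field Un_mono[OF _ order_refl]])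
    show "{\<lambda>x. wire (y x) i | i. d \<le> i \<and> i < d + l} \<subseteq> R"
    proof
      fix g assume "g \<in> {\<lambda>x. wire (y x) i | i. d \<le> i \<and> i < d + l}"
      then obtain i where "g = (\<lambda>x. wire (y x) i)" "i < d + l" by blast
      with wR[of i] that show "g \<in> R" by simp
    qed
  qed
  have 3: "computes S2 (n * n * (p + 6 * u)) (\<Union>e<n * n. ?O e)"
  proof (rule computes_UN_bound)
    fix e assume "e \<in> {..<n * n}"
    then have "e < n * n" by simp
    from div_less_of_less_square[OF this] have "c e < 3 * n * (3 * n)"
      unfolding c_def by (intro row_major_less) linarith+
    from chunk_bound[OF this, of "1 + p + v"] have ce: "c e * (1 + p + v) + (1 + p + v) \<le> len" by (simp only: len)
    have M: "word_bits W (?M e) \<subseteq> R \<union> consts_bool" for W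
      unfolding mant_in_def by (rule fR) (use ce in linarith)
    have E: "word_bits W (?E e) \<subseteq> R \<union> consts_bool" for W
      unfolding exp_in_def by (rule fR) (use ce in linarith)
    have s: "(\<lambda>x. sign_in 0 p v (c e) (y x)) \<in> R"
      unfolding sign_in_def by (rule wR) (use ce in linarith)
    have 4: "computes S2 p (word_bits p (\<lambda>x. of_bool (f x) * ?M e x))"
    proof (rule computes_mono[OF computes_and])
      show "insert f (word_bits p (?M e)) \<subseteq> S2 \<union> consts_bool" using M[of p] S2 by blast
    qed auto
    have 5: "computes S2 (6 * u) (word_bits u (\<lambda>x. ?E e x + G x))"
    proof (rule computes_add'[OF computes.free[of _ _ 0] computes.free[of _ _ 0]])
      show "word_bits u (?E e) \<subseteq> S2 \<union> consts_bool" using E[of u] S2 by blast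
      show "word_bits u G \<subseteq> S2 \<union> consts_bool" by (rule le_supI1[OF S2(2)])
    qed simp
    show "computes S2 (p + 6 * u) (?O e)"
    proof (rule computes_mono[OF computes_Un[OF 4 5]])
      show "?O e \<subseteq> (word_bits p (\<lambda>x. of_bool (f x) * ?M e x) \<union> word_bits u (\<lambda>x. ?E e x + G x)) \<union> S2 \<union> consts_bool"
        using s S2(1) by auto
    qed simp_all
  qed simp_all
  define d where "d = ((n * n * (54 * (T * T)) + n * n * (54 * (T * T))) + (n * n * (b + 1) + n * n * (b + 1))) +
    ((length (gates Q) + (12 * u + 1)) + n * n * (p + 6 * u))"
  have comp: "computes S0 d (\<Union>e<n * n. ?O e)"
    unfolding d_def by (rule computes_trans[OF 1 computes_trans[OF 2[unfolded S1_def] 3[unfolded S2_def S1_def]]])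
  have "d + 2 + n * n * (1 + p + u) \<le> 20 * bit_ops Q + n * n * (200 * (T * T))"
  proof -
    define m where "m = n * n"
    have m1: "1 \<le> m" using n by (simp add: m_def)
    define t where "t = m * (T * T)"
    have TT: "T \<le> T * T" by (rule le_square)
    have mt: "m * x \<le> t" if "x \<le> T * T" for x unfolding t_def using that by (rule mult_le_mono2)
    have "1 \<le> m * (T * T)" using m1 TT T by simp
    then have t1: "1 \<le> t" by (simp add: t_def)
    \<comment> \<open>The 9 n^2 (1 + p + v) output wires of Q pay for all terms that contain its
      output format p, v.\<close>
    have ops: "bit_ops Q = length (gates Q) + (9 * m + 9 * (m * p) + 9 * (m * v))"
      using len by (simp add: bit_ops_def len_def m_def algebra_simps)
    have u1: "u \<le> m * u" using m1 by simp
    have mu: "m * u = m * v + m * (w + 3)" by (simp add: u_def algebra_simps)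
    have b1: "m * (b + 1) \<le> t" "m * (w + 3) \<le> t" by (rule mt; use TT T b in linarith)+
    have "d = 108 * t + 2 * (m * (b + 1)) + length (gates Q) + 12 * u + 1 + m * p + 6 * (m * u)"
      unfolding d_def m_def[symmetric] t_def by (simp only: distrib_left mult.left_commute)
    moreover have "m * (1 + p + u) = m + m * p + m * u" by (simp add: algebra_simps)
    moreover have "m * (200 * (T * T)) = 200 * t" by (simp add: t_def)
    moreover have "m \<le> t" using mt[of 1] TT T by linarith
    ultimately show ?thesis using ops u1 mu b1 t1 unfolding m_def[symmetric] by linarith
  qed
  with comp show ?thesis unfolding u_def f_def fA_def fB_def G_def S0_def by blast
qed

lemma power_int_add3: "(2 :: real) powi (a + b + c) = 2 powi a * 2 powi b * 2 powi c"
  by (simp add: power_int_add)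

lemma multiplication_circuit:
  fixes n b w :: nat
  assumes n: "n \<ge> 1" and b: "b \<ge> 1" and w: "w \<ge> 1" and Q: "outputs_matrix (3 * n) Q" and T: "T = b + w + 2"
  defines "L \<equiv> n * n * (1 + b + w)"
  shows "\<exists>P. outputs_matrix n P \<and> bit_ops P \<le> 20 * bit_ops Q + n * n * (200 * (T * T)) \<and>
    (\<forall>x. length x = 2 * L \<longrightarrow> computed_mat n P x =
      (if nonzero_in 0 n b w x \<and> nonzero_in L n b w x
       then (2 powi (top_exp 0 n b w x - 2 ^ (w - 1)) * 2 powi (top_exp L n b w x - 2 ^ (w - 1))) \<cdot>\<^sub>m
         mat n n (\<lambda>(i, j). computed_mat (3 * n) Q (map (\<lambda>f. f x) (block_input n b w)) $$ (i, 2 * n + j))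
       else 0\<^sub>m n n))"
proof -
  define p v where "p = out_prec Q" and "v = out_exp Q"
  define y where "y = (\<lambda>x. run_bits Q (map (\<lambda>f. f x) (block_input n b w)))"
  define c where "c = (\<lambda>e. (e div n) * (3 * n) + (2 * n + e mod n))"
  let ?f = "\<lambda>x. nonzero_in 0 n b w x \<and> nonzero_in L n b w x"
  from multiplication_ops[OF n b Q T] obtain d where
    d: "d + 2 + n * n * (1 + p + (v + w + 3)) \<le> 20 * bit_ops Q + n * n * (200 * (T * T))" and
    comp: "computes (input_bits (2 * L)) d (\<Union>e<n * n. {\<lambda>x. sign_in 0 p v (c e) (y x)} \<union>
      word_bits p (\<lambda>x. of_bool (?f x) * mant_in 0 p v (c e) (y x)) \<union>
      word_bits (v + w + 3) (\<lambda>x. exp_in 0 p v (c e) (y x) + product_exp n b w v x))"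
    unfolding L_def p_def v_def y_def c_def by (elim exE conjE)
  from encode_circuit[OF comp] obtain P where P: "outputs_matrix n P" "bit_ops P \<le> d + 2 + n * n * (1 + p + (v + w + 3))"
    and val: "\<And>x. length x = 2 * L \<Longrightarrow> computed_mat n P x = mat n n (\<lambda>(i, j). let e = i * n + j in
      (if sign_in 0 p v (c e) (y x) then - 1 else 1) * of_int (take_bit p (of_bool (?f x) * mant_in 0 p v (c e) (y x))) *
      2 powi (take_bit (v + w + 3) (exp_in 0 p v (c e) (y x) + product_exp n b w v x) - 2 ^ (v + w + 3 - 1)))"
    by (elim exE conjE) blast
  have "computed_mat n P x = (if ?f x
       then (2 powi (top_exp 0 n b w x - 2 ^ (w - 1)) * 2 powi (top_exp L n b w x - 2 ^ (w - 1))) \<cdot>\<^sub>m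
         mat n n (\<lambda>(i, j). computed_mat (3 * n) Q (map (\<lambda>f. f x) (block_input n b w)) $$ (i, 2 * n + j))
       else 0\<^sub>m n n)" (is "_ = ?Z") if len: "length x = 2 * L" for x
    unfolding val[OF len]
  proof (rule eq_matI)
    define tA tB where "tA = top_exp 0 n b w x" and "tB = top_exp L n b w x"
    fix i j assume "i < dim_row ?Z" "j < dim_col ?Z"
    then have ij: "i < n" "j < n" by (simp_all split: if_splits)
    have ce: "c (i * n + j) = i * (3 * n) + (2 * n + j)" using ij by (simp add: c_def)
    define M E where "M = mant_in 0 p v (c (i * n + j)) (y x)" and "E = exp_in 0 p v (c (i * n + j)) (y x)"
    define s where "s \<longleftrightarrow> sign_in 0 p v (c (i * n + j)) (y x)"
    have M: "take_bit p (of_bool (?f x) * M) = of_bool (?f x) * M"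
      unfolding M_def by (rule take_bit_int_eq_self) (use mant_in_bounds[of 0 p v "c (i * n + j)" "y x"] in auto)
    \<comment> \<open>The bias of the inversion output and the biases of the two scaling exponents
      are removed, and the bias of the wider output field is added.\<close>
    have G: "E + product_exp n b w v x = (E - 2 ^ (v - 1)) + (tA - 2 ^ (w - 1)) + (tB - 2 ^ (w - 1)) + 2 ^ (v + w + 2)"
      by (simp add: product_exp_def tA_def tB_def L_def)
    have E: "take_bit (v + w + 3) (E + product_exp n b w v x) = E + product_exp n b w v x"
    proof (rule take_bit_int_eq_self)
      have "(2 :: int) ^ (v - 1) \<le> 2 ^ (v + w)" "(2 :: int) ^ v \<le> 2 ^ (v + w)" "(2 :: int) ^ w \<le> 2 ^ (v + w)"
        "(2 :: int) ^ (w - 1) \<le> 2 ^ (v + w)"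
        by (intro power_increasing; simp)+
      moreover have "(2 :: int) ^ (v + w + 2) = 4 * 2 ^ (v + w)" "(2 :: int) ^ (v + w + 3) = 8 * 2 ^ (v + w)"
        by (simp_all add: power_add)
      moreover have "0 \<le> E" "E < 2 ^ v" "0 \<le> tA" "tA < 2 ^ w" "0 \<le> tB" "tB < 2 ^ w"
        by (simp_all add: E_def tA_def tB_def exp_in_bounds top_exp_bounds)
      moreover have "0 < (2 :: int) ^ (v - 1)" "0 < (2 :: int) ^ (w - 1)" by simp_all
      ultimately show "0 \<le> E + product_exp n b w v x" "E + product_exp n b w v x < 2 ^ (v + w + 3)"
        unfolding G by linarith+
    qed
    have lhs: "mat n n (\<lambda>(i, j). let e = i * n + j in
        (if sign_in 0 p v (c e) (y x) then - 1 else 1) * of_int (take_bit p (of_bool (?f x) * mant_in 0 p v (c e) (y x))) *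
        2 powi (take_bit (v + w + 3) (exp_in 0 p v (c e) (y x) + product_exp n b w v x) - 2 ^ (v + w + 3 - 1))) $$ (i, j) =
      (if s then - 1 else 1) * of_int (of_bool (?f x) * M) * (2 powi (E + product_exp n b w v x - 2 ^ (v + w + 2)) :: real)"
      using ij by (simp only: index_mat prod.case Let_def M_def[symmetric] E_def[symmetric] s_def[symmetric] M E) simp
    have pw: "(2 :: real) powi (E + product_exp n b w v x - 2 ^ (v + w + 2)) =
        2 powi (E - 2 ^ (v - 1)) * 2 powi (tA - 2 ^ (w - 1)) * 2 powi (tB - 2 ^ (w - 1))"
    proof -
      have "E + product_exp n b w v x - 2 ^ (v + w + 2) = (E - 2 ^ (v - 1)) + (tA - 2 ^ (w - 1)) + (tB - 2 ^ (w - 1))"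
        unfolding G by simp
      then show ?thesis by (simp only: power_int_add3)
    qed
    have "computed_mat (3 * n) Q (map (\<lambda>f. f x) (block_input n b w)) $$ (i, 2 * n + j) =
        float_value p v (drop (c (i * n + j) * (1 + p + v)) (y x))"
      using ij by (simp add: computed_mat_def float_mat_def p_def v_def y_def ce)
    also have "\<dots> = (if s then - 1 else 1) * of_int M * 2 powi (E - 2 ^ (v - 1))"
    proof -
      have "c (i * n + j) < 3 * n * (3 * n)" unfolding ce by (rule row_major_less) (use ij in linarith)+
      from chunk_bound[OF this, of "1 + p + v"]
      have "c (i * n + j) * (1 + p + v) + (1 + p + v) \<le> length (y x)"
        using Q by (simp add: y_def run_bits_def outputs_matrix_def float_mat_length_def p_def v_def)
      from float_value_fields[OF this] show ?thesis
        by (simp only: s_def M_def E_def sign_in_def mant_in_def exp_in_def add_0)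
    qed
    finally have rhs: "computed_mat (3 * n) Q (map (\<lambda>f. f x) (block_input n b w)) $$ (i, 2 * n + j) =
        (if s then - 1 else 1) * of_int M * 2 powi (E - 2 ^ (v - 1))" .
    show "mat n n (\<lambda>(i, j). let e = i * n + j in
        (if sign_in 0 p v (c e) (y x) then - 1 else 1) * of_int (take_bit p (of_bool (?f x) * mant_in 0 p v (c e) (y x))) *
        2 powi (take_bit (v + w + 3) (exp_in 0 p v (c e) (y x) + product_exp n b w v x) - 2 ^ (v + w + 3 - 1))) $$ (i, j) = ?Z $$ (i, j)"
      unfolding lhs pw using ij by (simp add: rhs tA_def tB_def)
  qed (auto split: if_splits)
  with P d show ?thesis by (intro exI[of _ P]) auto
qed

text \<open>Scaled entries are at most 2^b, so the corner error contains (2^b)^5, and precision 6 b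
  leaves exactly one roundoff of b bits. Scaled norms of at least 1 turn the absolute into a
  relative bound, and a further factor n passes from entries to the norm.\<close>

lemma stable_product:
  fixes n b w :: nat
  assumes n: "n \<ge> 1" and b: "b \<ge> 1" and w: "w \<ge> 1" and Q: "outputs_matrix (3 * n) Q" and T: "T = b + w + 2"
    and mv: "0 \<le> m" "0 \<le> v"
    and acc: "\<And>as X. length as = float_mat_length (3 * n) (6 * b) (w + 2) \<Longrightarrow> X \<in> carrier_mat (3 * n) (3 * n) \<Longrightarrow>
      is_inverse (float_mat (3 * n) (6 * b) (w + 2) as) X \<Longrightarrow> mat_norm (computed_mat (3 * n) Q as - X) \<le>
      (m * mat_norm (float_mat (3 * n) (6 * b) (w + 2) as) * (mat_norm X)\<^sup>2 + v * mat_norm X) * roundoff (6 * b)"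
  shows "\<exists>P. outputs_matrix n P \<and> bit_ops P \<le> 20 * bit_ops Q + n * n * (200 * (T * T)) \<and>
    (\<forall>as bs. length as = float_mat_length n b w \<and> length bs = float_mat_length n b w \<longrightarrow>
      mat_norm (computed_mat n P (as @ bs) - float_mat n b w as * float_mat n b w bs) \<le>
        676 * real n ^ 6 * (m + v) * roundoff b * mat_norm (float_mat n b w as) * mat_norm (float_mat n b w bs))"
proof -
  define L where "L = n * n * (1 + b + w)"
  from multiplication_circuit[OF n b w Q T] obtain P where
    P: "outputs_matrix n P" "bit_ops P \<le> 20 * bit_ops Q + n * n * (200 * (T * T))" and
    val: "\<And>x. length x = 2 * L \<Longrightarrow> computed_mat n P x =
      (if nonzero_in 0 n b w x \<and> nonzero_in L n b w x
       then (2 powi (top_exp 0 n b w x - 2 ^ (w - 1)) * 2 powi (top_exp L n b w x - 2 ^ (w - 1))) \<cdot>\<^sub>m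
         mat n n (\<lambda>(i, j). computed_mat (3 * n) Q (map (\<lambda>f. f x) (block_input n b w)) $$ (i, 2 * n + j))
       else 0\<^sub>m n n)"
    unfolding L_def[symmetric] by (elim exE conjE) blast
  have "mat_norm (computed_mat n P (as @ bs) - float_mat n b w as * float_mat n b w bs) \<le>
        676 * real n ^ 6 * (m + v) * roundoff b * mat_norm (float_mat n b w as) * mat_norm (float_mat n b w bs)"
    if as: "length as = float_mat_length n b w" and bs: "length bs = float_mat_length n b w" for as bs
  proof -
    define x where "x = as @ bs"
    have len: "length x = 2 * L" using as bs by (simp add: x_def float_mat_length_def L_def)
    define A B where "A = scaled_in 0 n b w x" and "B = scaled_in L n b w x"
    have AB: "A \<in> carrier_mat n n" "B \<in> carrier_mat n n" by (simp_all add: A_def B_def)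
    define sA sB :: real where "sA = 2 powi (top_exp 0 n b w x - 2 ^ (w - 1))" and "sB = 2 powi (top_exp L n b w x - 2 ^ (w - 1))"
    have s: "0 < sA" "0 < sB" by (simp_all add: sA_def sB_def)
    have fm: "float_mat n b w as = sA \<cdot>\<^sub>m A" "float_mat n b w bs = sB \<cdot>\<^sub>m B"
      using float_mat_append_scaled[OF as bs] by (simp_all only: sA_def sB_def A_def B_def x_def L_def)
    have prod: "float_mat n b w as * float_mat n b w bs = (sA * sB) \<cdot>\<^sub>m (A * B)"
    proof -
      have "(sA \<cdot>\<^sub>m A) * (sB \<cdot>\<^sub>m B) = sA \<cdot>\<^sub>m (A * (sB \<cdot>\<^sub>m B))" by (rule mult_smult_assoc_mat[OF AB(1) smult_carrier_mat[OF AB(2)]])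
      also have "\<dots> = sA \<cdot>\<^sub>m (sB \<cdot>\<^sub>m (A * B))" by (simp only: mult_smult_distrib[OF AB])
      also have "\<dots> = (sA * sB) \<cdot>\<^sub>m (A * B)" using AB by (intro eq_matI) simp_all
      finally show ?thesis by (simp only: fm)
    qed
    have nAB: "mat_norm (float_mat n b w as) = sA * mat_norm A" "mat_norm (float_mat n b w bs) = sB * mat_norm B"
      using mat_norm_smult[OF AB(1), of sA] mat_norm_smult[OF AB(2), of sB] s by (simp_all add: fm)
    have N0: "0 \<le> mat_norm A" "0 \<le> mat_norm B" by (rule mat_norm_nonneg[OF AB(1)], rule mat_norm_nonneg[OF AB(2)])
    define K where "K = 676 * real n ^ 5 * (m + v) * roundoff b"
    have K: "0 \<le> K" using mv by (simp add: K_def roundoff_def)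
    have ABc: "A * B \<in> carrier_mat n n" by (rule mult_carrier_mat[OF AB])
    have "mat_norm (computed_mat n P x - (sA * sB) \<cdot>\<^sub>m (A * B)) \<le> (sA * sB) * (real n * K * (mat_norm A * mat_norm B))"
    proof (cases "nonzero_in 0 n b w x \<and> nonzero_in L n b w x")
      case True
      define Y where "Y = computed_mat (3 * n) Q (map (\<lambda>f. f x) (block_input n b w))"
      define Z where "Z = mat n n (\<lambda>(i, j). Y $$ (i, 2 * n + j))"
      have Z: "Z \<in> carrier_mat n n" by (simp add: Z_def)
      have nz: "1 \<le> mat_norm A" "1 \<le> mat_norm B"
        using True scaled_in_norm_ge unfolding nonzero_in_def A_def B_def by blast+
      have Y: "Y \<in> carrier_mat (3 * n) (3 * n)" by (simp add: Y_def computed_mat_def float_mat_def)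
      have U: "float_mat (3 * n) (6 * b) (w + 2) (map (\<lambda>f. f x) (block_input n b w)) = unit_block n A B"
        unfolding A_def B_def L_def by (rule block_input_matrix[OF n b])
      have err: "mat_norm (Y - unit_block_inv n A B) \<le>
          (m * mat_norm (unit_block n A B) * (mat_norm (unit_block_inv n A B))\<^sup>2 + v * mat_norm (unit_block_inv n A B)) * roundoff (6 * b)"
        unfolding Y_def U[symmetric]
      proof (rule acc)
        show "is_inverse (float_mat (3 * n) (6 * b) (w + 2) (map (\<lambda>f. f x) (block_input n b w))) (unit_block_inv n A B)"
          unfolding U by (rule unit_block_inverse[OF AB])
      qed (simp_all add: length_block_input)
      have h: "\<bar>A $$ (i, j)\<bar> \<le> 2 ^ b" "\<bar>B $$ (i, j)\<bar> \<le> 2 ^ b" if "i < n" "j < n" for i j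
        unfolding A_def B_def by (rule scaled_in_le[OF that])+
      have "(1 :: real) \<le> 2 ^ b" by simp
      \<comment> \<open>This identity fixes the multiple 6 of the precision.\<close>
      have r: "(2 ^ b) ^ 5 * roundoff (6 * b) = roundoff b"
        by (simp add: roundoff_def power_one_over power_mult[symmetric] power_add[symmetric] field_simps)
      have "\<bar>(Z - A * B) $$ (i, j)\<bar> \<le> K" if "i < n" "j < n" for i j
      proof -
        have "\<bar>Y $$ (i, 2 * n + j) - (A * B) $$ (i, j)\<bar> \<le> 676 * real n ^ 5 * (m + v) * (2 ^ b) ^ 5 * roundoff (6 * b)"
          by (rule corner_error[OF n AB(1) h(1) AB(2) h(2) \<open>1 \<le> 2 ^ b\<close> Y mv _ err that]) (auto simp: roundoff_def)
        also have "\<dots> = K" unfolding K_def by (simp only: mult.assoc r)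
        also have "Y $$ (i, 2 * n + j) - (A * B) $$ (i, j) = (Z - A * B) $$ (i, j)"
          using that carrier_matD[OF ABc] by (simp only: index_minus_mat Z_def index_mat prod.case)
        finally show ?thesis .
      qed
      then have "mat_norm (Z - A * B) \<le> real n * K" by (intro mat_norm_entries[OF minus_carrier_mat[OF ABc]] K)
      moreover have "real n * K * 1 \<le> real n * K * (mat_norm A * mat_norm B)"
        using mult_mono[OF nz] N0 K by (intro mult_left_mono) auto
      ultimately have "mat_norm (Z - A * B) \<le> real n * K * (mat_norm A * mat_norm B)" by simp
      then have "(sA * sB) * mat_norm (Z - A * B) \<le> (sA * sB) * (real n * K * (mat_norm A * mat_norm B))"
        using s by (intro mult_left_mono) auto
      moreover have "mat_norm ((sA * sB) \<cdot>\<^sub>m (Z - A * B)) = (sA * sB) * mat_norm (Z - A * B)"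
        using mat_norm_smult[OF minus_carrier_mat[OF ABc], of "sA * sB" Z] s by simp
      moreover have "computed_mat n P x - (sA * sB) \<cdot>\<^sub>m (A * B) = (sA * sB) \<cdot>\<^sub>m (Z - A * B)"
      proof -
        have "computed_mat n P x = (sA * sB) \<cdot>\<^sub>m Z"
          unfolding val[OF len] using True by (simp add: Z_def Y_def sA_def sB_def)
        then show ?thesis using carrier_matD[OF ABc] carrier_matD[OF Z] by (intro eq_matI) (simp_all add: right_diff_distrib)
      qed
      ultimately show ?thesis by simp
    next
      case False
      have "A * B = 0\<^sub>m n n"
      proof (cases "nonzero_in 0 n b w x")
        case True
        with False have "B = 0\<^sub>m n n" unfolding B_def nonzero_in_def by (intro scaled_in_zero) blast
        then show ?thesis using AB by simp
      next
        case False
        then have "A = 0\<^sub>m n n" unfolding A_def nonzero_in_def by (intro scaled_in_zero) blast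
        then show ?thesis using AB by simp
      qed
      moreover have "computed_mat n P x = 0\<^sub>m n n"
        unfolding val[OF len] by (rule if_not_P[OF False])
      ultimately have "computed_mat n P x - (sA * sB) \<cdot>\<^sub>m (A * B) = 0\<^sub>m n n" by (intro eq_matI) simp_all
      then have "mat_norm (computed_mat n P x - (sA * sB) \<cdot>\<^sub>m (A * B)) \<le> 0" using mat_norm_zero_le[of n] by simp
      also have "0 \<le> (sA * sB) * (real n * K * (mat_norm A * mat_norm B))"
        using s K N0 by (intro mult_nonneg_nonneg) auto
      finally show ?thesis .
    qed
    also have "(sA * sB) * (real n * K * (mat_norm A * mat_norm B)) =
        676 * real n ^ 6 * (m + v) * roundoff b * (sA * mat_norm A) * (sB * mat_norm B)"
      by (simp add: K_def eval_nat_numeral)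
    finally show ?thesis by (simp only: nAB prod x_def)
  qed
  with P show ?thesis by (intro exI[of _ P]) blast
qed

section \<open>The family of multiplication circuits\<close>

lemma poly_bounded_iff:
  "poly_bounded \<mu> \<longleftrightarrow> (\<exists>c K N. 0 \<le> K \<and> (\<forall>n\<ge>N. \<bar>\<mu> n\<bar> \<le> K * real n ^ c))"
proof
  assume "poly_bounded \<mu>"
  then obtain c where "\<mu> \<in> O(\<lambda>n. real n ^ c)" unfolding poly_bounded_def by blast
  then obtain K where "K > 0" "\<forall>\<^sub>F n in at_top. norm (\<mu> n) \<le> K * norm (real n ^ c)" by (elim landau_o.bigE)
  then obtain N where "\<And>n. n \<ge> N \<Longrightarrow> \<bar>\<mu> n\<bar> \<le> K * real n ^ c" by (auto simp: eventually_at_top_linorder)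
  with \<open>K > 0\<close> show "\<exists>c K N. 0 \<le> K \<and> (\<forall>n\<ge>N. \<bar>\<mu> n\<bar> \<le> K * real n ^ c)" by (intro exI[of _ c] exI[of _ K] exI[of _ N]) auto
next
  assume "\<exists>c K N. 0 \<le> K \<and> (\<forall>n\<ge>N. \<bar>\<mu> n\<bar> \<le> K * real n ^ c)"
  then obtain c K N where "\<And>n. n \<ge> N \<Longrightarrow> \<bar>\<mu> n\<bar> \<le> K * real n ^ c" by blast
  then have "\<forall>\<^sub>F n in at_top. norm (\<mu> n) \<le> K * norm (real n ^ c)"
    unfolding eventually_at_top_linorder by (intro exI[of _ N]) simp
  then have "\<mu> \<in> O(\<lambda>n. real n ^ c)" by (rule bigoI)
  then show "poly_bounded \<mu>" unfolding poly_bounded_def by blast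
qed

theorem stable_inversion_stable_multiplication:
  assumes "stable_inversion_in \<tau>"
  shows "stable_multiplication_in \<tau>"
proof -
  from assms obtain Inv where Inv: "stable_inversion Inv" "bit_complexity Inv \<tau>" unfolding stable_inversion_in_def by blast
  from Inv(1) obtain \<mu> \<nu> where poly: "poly_bounded \<mu>" "poly_bounded \<nu>"
    and main: "\<forall>n\<ge>1. \<forall>b\<ge>1. \<forall>w\<ge>1. outputs_matrix n (Inv n b w) \<and>
      (\<forall>as. length as = float_mat_length n b w \<longrightarrow> (\<forall>X\<in>carrier_mat n n. is_inverse (float_mat n b w as) X \<longrightarrow>
        mat_norm (computed_mat n (Inv n b w) as - X) / mat_norm X \<le>
        \<mu> n * roundoff b * (mat_norm (float_mat n b w as) * mat_norm X) + \<nu> n * (roundoff b)\<^sup>2))"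
    unfolding stable_inversion_def Let_def by (elim exE conjE)
  have out: "outputs_matrix n (Inv n b w)" if "n \<ge> 1" "b \<ge> 1" "w \<ge> 1" for n b w
    using main[rule_format, OF that] by (rule conjunct1)
  have err: "mat_norm (computed_mat n (Inv n b w) as - X) / mat_norm X \<le>
      \<mu> n * roundoff b * (mat_norm (float_mat n b w as) * mat_norm X) + \<nu> n * (roundoff b)\<^sup>2"
    if "n \<ge> 1" "b \<ge> 1" "w \<ge> 1" and len: "length as = float_mat_length n b w" and X: "X \<in> carrier_mat n n"
      and inv: "is_inverse (float_mat n b w as) X" for n b w as X
    using main[rule_format, OF that(1-3), THEN conjunct2, rule_format, OF len X inv] .
  from Inv(2) obtain C0 k where
    ops0: "\<And>n b w. n \<ge> 1 \<Longrightarrow> b \<ge> 1 \<Longrightarrow> w \<ge> 1 \<Longrightarrow> real (bit_ops (Inv n b w)) \<le> C0 * real n powr \<tau> * real (b + w) ^ k"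
    unfolding bit_complexity_def by metis
  \<comment> \<open>The constant in \<open>bit_complexity\<close> carries no sign; monotonicity
    arguments want it nonnegative.\<close>
  define C where "C = \<bar>C0\<bar>"
  have C: "0 \<le> C" by (simp add: C_def)
  have ops: "real (bit_ops (Inv n b w)) \<le> C * real n powr \<tau> * real (b + w) ^ k" if "n \<ge> 1" "b \<ge> 1" "w \<ge> 1" for n b w
    by (rule order_trans[OF ops0[OF that]]) (intro mult_right_mono, auto simp: C_def)
  \<comment> \<open>Even at b = w = 1 an inversion circuit has to write at least one bit for each of
    the n^2 entries.\<close>
  have "2 \<le> \<tau>"
  proof (rule quadratic_exponent)
    show "\<forall>\<^sub>F n::nat in at_top. real n ^ 2 \<le> (C * 2 ^ k) * real n powr \<tau>"
    proof (rule eventually_mono[OF eventually_ge_at_top[of 1]])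
      fix n :: nat assume n: "1 \<le> n"
      have "n * n * 1 \<le> n * n * (1 + out_prec (Inv n 1 1) + out_exp (Inv n 1 1))" by (intro mult_le_mono2) simp
      also have "\<dots> \<le> bit_ops (Inv n 1 1)" using out[OF n, of 1 1] by (simp add: outputs_matrix_def float_mat_length_def bit_ops_def)
      finally have "real (n * n) \<le> real (bit_ops (Inv n 1 1))" by (simp only: of_nat_le_iff mult_1_right)
      also have "\<dots> \<le> C * real n powr \<tau> * real (1 + 1) ^ k" by (rule ops[OF n]) simp_all
      finally show "real n ^ 2 \<le> (C * 2 ^ k) * real n powr \<tau>" by (simp add: power2_eq_square mult_ac)
    qed
  qed
  define T where "T b w = b + w + 2" for b w :: nat
  define good where "good n b w P \<longleftrightarrow> outputs_matrix n P \<and>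
    bit_ops P \<le> 20 * bit_ops (Inv (3 * n) (6 * b) (w + 2)) + n * n * (200 * (T b w * T b w)) \<and>
    (\<forall>as bs. length as = float_mat_length n b w \<and> length bs = float_mat_length n b w \<longrightarrow>
      mat_norm (computed_mat n P (as @ bs) - float_mat n b w as * float_mat n b w bs) \<le>
        676 * real n ^ 6 * (\<bar>\<mu> (3 * n)\<bar> + \<bar>\<nu> (3 * n)\<bar>) * roundoff b * mat_norm (float_mat n b w as) * mat_norm (float_mat n b w bs))"
    for n b w P
  define P where "P n b w = (SOME Q. good n b w Q)" for n b w
  have P: "good n b w (P n b w)" if nbw: "n \<ge> 1" "b \<ge> 1" "w \<ge> 1" for n b w
  proof -
    let ?Q = "Inv (3 * n) (6 * b) (w + 2)"
    have nbw': "3 * n \<ge> 1" "6 * b \<ge> 1" "w + 2 \<ge> 1" using nbw by auto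
    have "\<exists>P. good n b w P"
      unfolding good_def
    proof (rule stable_product[OF nbw out[OF nbw'] T_def])
      fix as X assume len: "length as = float_mat_length (3 * n) (6 * b) (w + 2)" and X: "X \<in> carrier_mat (3 * n) (3 * n)"
        and inv: "is_inverse (float_mat (3 * n) (6 * b) (w + 2) as) X"
      define A where "A = float_mat (3 * n) (6 * b) (w + 2) as"
      have A: "A \<in> carrier_mat (3 * n) (3 * n)" by (simp add: A_def float_mat_def)
      define \<epsilon> where "\<epsilon> = roundoff (6 * b)"
      \<comment> \<open>The second-order term is merged into the first-order one. This keeps the
        result polynomial in n because \<nu> is polynomially bounded.\<close>
      have \<epsilon>: "0 \<le> \<epsilon>" "\<epsilon>\<^sup>2 \<le> \<epsilon>" by (simp_all add: \<epsilon>_def roundoff_def power2_eq_square mult_le_cancel_left1 power_le_one)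
      have "mat_norm X \<noteq> 0" using mat_norm_inverse_ge[OF nbw'(1) A X inv[folded A_def]] by auto
      then have X0: "0 < mat_norm X" using mat_norm_nonneg[OF X] by simp
      have AX: "0 \<le> mat_norm A * mat_norm X" using mat_norm_nonneg[OF A] X0 by simp
      have "mat_norm (computed_mat (3 * n) ?Q as - X) / mat_norm X \<le> \<mu> (3 * n) * \<epsilon> * (mat_norm A * mat_norm X) + \<nu> (3 * n) * \<epsilon>\<^sup>2"
        using err[OF nbw' len X inv] by (simp only: A_def \<epsilon>_def)
      also have "\<dots> \<le> \<bar>\<mu> (3 * n)\<bar> * \<epsilon> * (mat_norm A * mat_norm X) + \<bar>\<nu> (3 * n)\<bar> * \<epsilon>"
      proof (rule add_mono)
        show "\<mu> (3 * n) * \<epsilon> * (mat_norm A * mat_norm X) \<le> \<bar>\<mu> (3 * n)\<bar> * \<epsilon> * (mat_norm A * mat_norm X)"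
          using \<epsilon> AX by (intro mult_right_mono) auto
        have "\<nu> (3 * n) * \<epsilon>\<^sup>2 \<le> \<bar>\<nu> (3 * n)\<bar> * \<epsilon>\<^sup>2" by (intro mult_right_mono) auto
        also have "\<dots> \<le> \<bar>\<nu> (3 * n)\<bar> * \<epsilon>" using \<epsilon> by (intro mult_left_mono) auto
        finally show "\<nu> (3 * n) * \<epsilon>\<^sup>2 \<le> \<bar>\<nu> (3 * n)\<bar> * \<epsilon>" .
      qed
      finally have "mat_norm (computed_mat (3 * n) ?Q as - X) \<le> (\<bar>\<mu> (3 * n)\<bar> * \<epsilon> * (mat_norm A * mat_norm X) + \<bar>\<nu> (3 * n)\<bar> * \<epsilon>) * mat_norm X"
        using X0 by (simp only: pos_divide_le_eq)
      also have "\<dots> = (\<bar>\<mu> (3 * n)\<bar> * mat_norm A * (mat_norm X)\<^sup>2 + \<bar>\<nu> (3 * n)\<bar> * mat_norm X) * \<epsilon>"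
        by (simp add: algebra_simps power2_eq_square)
      finally show "mat_norm (computed_mat (3 * n) ?Q as - X) \<le> (\<bar>\<mu> (3 * n)\<bar> * mat_norm (float_mat (3 * n) (6 * b) (w + 2) as) * (mat_norm X)\<^sup>2 +
          \<bar>\<nu> (3 * n)\<bar> * mat_norm X) * roundoff (6 * b)" by (simp only: A_def \<epsilon>_def)
    qed simp_all
    then show ?thesis unfolding P_def by (rule someI_ex)
  qed
  have "stable_multiplication P"
    unfolding stable_multiplication_def
  proof (intro exI conjI allI impI)
    show "poly_bounded (\<lambda>n. 676 * real n ^ 6 * (\<bar>\<mu> (3 * n)\<bar> + \<bar>\<nu> (3 * n)\<bar>))"
    proof -
      from poly(1) obtain c1 K1 N1 where 1: "0 \<le> K1" "\<And>n. n \<ge> N1 \<Longrightarrow> \<bar>\<mu> n\<bar> \<le> K1 * real n ^ c1" unfolding poly_bounded_iff by blast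
      from poly(2) obtain c2 K2 N2 where 2: "0 \<le> K2" "\<And>n. n \<ge> N2 \<Longrightarrow> \<bar>\<nu> n\<bar> \<le> K2 * real n ^ c2" unfolding poly_bounded_iff by blast
      show ?thesis
        unfolding poly_bounded_iff
      proof (intro exI conjI allI impI)
        show "0 \<le> 676 * (K1 * 3 ^ c1 + K2 * 3 ^ c2)" using 1 2 by simp
        fix n assume n: "N1 + N2 + 1 \<le> n"
        have "\<bar>\<mu> (3 * n)\<bar> \<le> K1 * real (3 * n) ^ c1" using n by (intro 1) simp
        also have "\<dots> = K1 * 3 ^ c1 * real n ^ c1" by (simp add: power_mult_distrib)
        also have "\<dots> \<le> K1 * 3 ^ c1 * real n ^ (c1 + c2)" using n 1(1) by (intro mult_left_mono power_increasing) auto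
        finally have m: "\<bar>\<mu> (3 * n)\<bar> \<le> K1 * 3 ^ c1 * real n ^ (c1 + c2)" .
        have "\<bar>\<nu> (3 * n)\<bar> \<le> K2 * real (3 * n) ^ c2" using n by (intro 2) simp
        also have "\<dots> = K2 * 3 ^ c2 * real n ^ c2" by (simp add: power_mult_distrib)
        also have "\<dots> \<le> K2 * 3 ^ c2 * real n ^ (c1 + c2)" using n 2(1) by (intro mult_left_mono power_increasing) auto
        finally have "\<bar>\<mu> (3 * n)\<bar> + \<bar>\<nu> (3 * n)\<bar> \<le> (K1 * 3 ^ c1 + K2 * 3 ^ c2) * real n ^ (c1 + c2)"
          using m by (simp add: distrib_right)
        then have "676 * real n ^ 6 * (\<bar>\<mu> (3 * n)\<bar> + \<bar>\<nu> (3 * n)\<bar>) \<le> 676 * real n ^ 6 * ((K1 * 3 ^ c1 + K2 * 3 ^ c2) * real n ^ (c1 + c2))"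
          by (intro mult_left_mono) auto
        also have "\<dots> = 676 * (K1 * 3 ^ c1 + K2 * 3 ^ c2) * real n ^ (6 + (c1 + c2))" by (simp only: power_add mult_ac)
        finally show "\<bar>676 * real n ^ 6 * (\<bar>\<mu> (3 * n)\<bar> + \<bar>\<nu> (3 * n)\<bar>)\<bar> \<le> 676 * (K1 * 3 ^ c1 + K2 * 3 ^ c2) * real n ^ (6 + (c1 + c2))"
          by (simp add: abs_mult)
      qed
    qed
    show "poly_bounded (\<lambda>n. 0)" by (rule poly_bounded_zero)
    fix n b w :: nat assume nbw: "1 \<le> n" "1 \<le> b" "1 \<le> w"
    note g = P[OF nbw, unfolded good_def]
    show "outputs_matrix n (P n b w)" using g by blast
    fix as bs :: "bool list" assume "length as = float_mat_length n b w \<and> length bs = float_mat_length n b w"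
    with g show "let A = float_mat n b w as; B = float_mat n b w bs; \<epsilon> = roundoff b
        in mat_norm (computed_mat n (P n b w) (as @ bs) - A * B)
          \<le> 676 * real n ^ 6 * (\<bar>\<mu> (3 * n)\<bar> + \<bar>\<nu> (3 * n)\<bar>) * \<epsilon> * mat_norm A * mat_norm B + 0 * \<epsilon>\<^sup>2 * mat_norm A * mat_norm B"
      by (simp add: Let_def)
  qed
  moreover have "bit_complexity P \<tau>"
    unfolding bit_complexity_def
  proof (intro exI allI impI)
    fix n b w :: nat assume nbw: "1 \<le> n" "1 \<le> b" "1 \<le> w"
    define p where "p = real n powr \<tau>"
    define t where "t = real (b + w)"
    have t: "1 \<le> t" using nbw by (simp add: t_def)
    have p0: "0 \<le> p" by (simp add: p_def)
    have np: "real (n * n) \<le> p"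
    proof -
      have "real n powr 2 \<le> p" unfolding p_def using nbw \<open>2 \<le> \<tau>\<close> by (intro powr_mono) auto
      then show ?thesis using nbw by (simp add: power2_eq_square)
    qed
    have "real (bit_ops (Inv (3 * n) (6 * b) (w + 2))) \<le> C * real (3 * n) powr \<tau> * real (6 * b + (w + 2)) ^ k"
      by (rule ops) (use nbw in auto)
    also have "\<dots> \<le> C * (3 powr \<tau> * p) * (7 * t) ^ k"
    proof (rule mult_mono)
      show "C * real (3 * n) powr \<tau> \<le> C * (3 powr \<tau> * p)" by (simp add: p_def powr_mult)
      show "real (6 * b + (w + 2)) ^ k \<le> (7 * t) ^ k" using nbw by (intro power_mono) (auto simp: t_def)
    qed (use C p0 in auto)
    also have "\<dots> = (C * 3 powr \<tau> * 7 ^ k) * p * t ^ k" by (simp add: power_mult_distrib mult_ac)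
    also have "\<dots> \<le> (C * 3 powr \<tau> * 7 ^ k) * p * t ^ (k + 2)"
      using t C p0 by (intro mult_left_mono power_increasing) auto
    finally have 1: "real (bit_ops (Inv (3 * n) (6 * b) (w + 2))) \<le> (C * 3 powr \<tau> * 7 ^ k) * p * t ^ (k + 2)" .
    have "real (n * n * (200 * (T b w * T b w))) \<le> p * (800 * t ^ (k + 2))"
    proof -
      have "real (T b w) \<le> 2 * t" using nbw by (simp add: T_def t_def)
      then have "real (T b w) * real (T b w) \<le> (2 * t) * (2 * t)" by (intro mult_mono) auto
      also have "\<dots> = 4 * t ^ 2" by (simp add: power2_eq_square)
      also have "\<dots> \<le> 4 * t ^ (k + 2)" using t by (intro mult_left_mono power_increasing) auto
      finally have "200 * (real (T b w) * real (T b w)) \<le> 800 * t ^ (k + 2)" by simp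
      from mult_mono[OF np this] p0 show ?thesis by simp
    qed
    moreover have "real (bit_ops (P n b w)) \<le> 20 * real (bit_ops (Inv (3 * n) (6 * b) (w + 2))) + real (n * n * (200 * (T b w * T b w)))"
    proof -
      have "real (bit_ops (P n b w)) \<le> real (20 * bit_ops (Inv (3 * n) (6 * b) (w + 2)) + n * n * (200 * (T b w * T b w)))"
        using P[OF nbw, unfolded good_def] by (simp only: of_nat_le_iff)
      then show ?thesis by simp
    qed
    ultimately have "real (bit_ops (P n b w)) \<le> 20 * ((C * 3 powr \<tau> * 7 ^ k) * p * t ^ (k + 2)) + p * (800 * t ^ (k + 2))"
      using 1 by linarith
    also have "\<dots> = (20 * (C * 3 powr \<tau> * 7 ^ k) + 800) * p * t ^ (k + 2)" by (simp add: algebra_simps)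
    finally show "real (bit_ops (P n b w)) \<le> (20 * (C * 3 powr \<tau> * 7 ^ k) + 800) * real n powr \<tau> * real (b + w) ^ (k + 2)"
      by (simp only: p_def t_def)
  qed
  ultimately show ?thesis unfolding stable_multiplication_in_def by blast
qed

theorem theorem3p3:
  fixes \<omega> :: real
  shows
    "((\<forall>\<eta>>0. exact_multiplication_in (\<omega> + \<eta>)) \<longrightarrow> (\<forall>\<eta>>0. stable_inversion_in (\<omega> + \<eta>))) \<and>
     ((\<forall>\<eta>>0. stable_inversion_in (\<omega> + \<eta>)) \<longrightarrow> (\<forall>\<eta>>0. stable_multiplication_in (\<omega> + \<eta>))) \<and>
     ((\<forall>\<eta>>0. exact_inversion_in (\<omega> + \<eta>)) \<longrightarrow> (\<forall>\<eta>>0. exact_multiplication_in (\<omega> + \<eta>)))"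
  using exact_multiplication_stable_inversion stable_inversion_stable_multiplication exact_inversion_multiplication
  by blast

end
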